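(* Let $n,p,g\ge 1$ be integers. Let $\mu_0,\mu_1,\dots,\mu_g\in\mathbb{R}^n$, let $\Phi_j,\Psi_{i,j}\in\mathbb{R}^{n\times n}$ ($1\le i\le g$, $1\le j\le p$), and let $\Omega_0,\Omega_1,\dots,\Omega_g\in\mathbb{R}^{n\times n}$ be (symmetric) positive definite matrices. Let $\gamma,c$ be fixed parameters and, for $i=1,\dots,g$, let $u\mapsto G_i(\gamma,c;u)$ be a continuous function from $\mathbb{R}$ to $[0,1]$, with $\sum_{i=1}^g G_i(\gamma,c;u)\le 1$ for all $u$. Let $s_t=s(y_{t-1},\dots,y_{t-p})$ for a fixed Borel measurable function $s:\mathbb{R}^{np}\to\mathbb{R}$. Let $\varepsilon_t$, $t\ge 1$, be i.i.d. random vectors in $\mathbb{R}^n$ with mean $0$ and covariance matrix $I_n$, having a Lebesgue density that is bounded away from zero on compact subsets of $\mathbb{R}^n$. Given initial values $(y_0,\dots,y_{-p+1})$ independent of $\{\varepsilon_t\}_{t\ge1}$, let $y_t$, $t\ge 1$, be defined by $$ y_t=\mu_0+\sum_{j=1}^p\Phi_j y_{t-j}+\sum_{i=1}^g G_i(\gamma,c;s_t)\Big\{\mu_i+\sum_{j=1}^p\Psi_{i,j}y_{t-j}\Big\}+\Big\{\Big(1-\sum_{i=1}^g G_i(\gamma,c;s_t)\Big)\Omega_0+\sum_{i=1}^g G_i(\gamma,c;s_t)\Omega_i\Big\}^{1/2}\varepsilon_t . $$ Define the $np\times np$ matrices, for $i=1,\dots,g$, $$ B_i=\begin{pmatrix}\Phi_1+\Psi_{i,1}&\Phi_2+\Psi_{i,2}&\cdots&\Phi_{p-1}+\Psi_{i,p-1}&\Phi_p+\Psi_{i,p}\\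 I_n&0&\cdots&0&0\\ 0&I_n&\cdots&0&0\\ \vdots&\vdots&\ddots&\vdots&\vdots\\ 0&0&\cdots&I_n&0\end{pmatrix},\qquad B_{g+1}=\begin{pmatrix}\Phi_1&\Phi_2&\cdots&\Phi_{p-1}&\Phi_p\\ I_n&0&\cdots&0&0\\ 0&I_n&\cdots&0&0\\ \vdots&\vdots&\ddots&\vdots&\vdots\\ 0&0&\cdots&I_n&0\end{pmatrix}. $$ Suppose that the joint spectral radius satisfies $\rho(\{B_1,\dots,B_g,B_{g+1}\})<1$. Then the process $Z_t=(y_t',\dots,y_{t-p+1}')'$, $t\ge 0$, is a $(1+\|x\|^2)$-geometrically ergodic Markov chain on $\mathbb{R}^{np}$. Consequently, there exist (random) initial values $y_{-p+1},\dots,y_0$ such that the process $y_t$ defined by $$ y_t=\mu_0+\sum_{j=1}^p\Phi_j y_{t-j}+\sum_{i=1}^g G_i(\gamma,c;s_t)\Big\{\mu_i+\sum_{j=1}^p\Psi_{i,j}y_{t-j}\Big\}+\Big\{\Big(1-\sum_{i=1}^g G_i(\gamma,c;s_t)\Big)\Omega_0+\sum_{i=1}^g G_i(\gamma,c;s_t)\Omega_i\Big\}^{1/2}\varepsilon_t ,\qquad t\ge 1, $$ is (1) strictly stationary, (2) second-order stationary, and (3) $\beta$-mixing with geometrically decaying mixing numbers.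
   Context: Joint spectral radius: for a finite set $\mathcal{A}$ of square matrices of the same size, $$\rho(\mathcal{A})=\limsup_{j\to\infty}\Big(\sup_{A\in\mathcal{A}^j}\rho(A)\Big)^{1/j},\qquad \mathcal{A}^j=\{A_1A_2\cdots A_j: A_i\in\mathcal{A},\ i=1,\dots,j\},$$ where $\rho(A)$ is the spectral radius of the matrix $A$ (largest absolute value of its eigenvalues). $M^{1/2}$ denotes the symmetric positive definite square root of a positive definite matrix $M$; a prime denotes transposition; $\|\cdot\|$ is the Euclidean norm. For $p=1$ the matrices $B_i$ and $B_{g+1}$ are just $\Phi_1+\Psi_{i,1}$ and $\Phi_1$. Geometric ergodicity (Meyn and Tweedie, Chapter 15): for a measurable function $f\ge 1$ on the state space, a time-homogeneous Markov chain with $t$-step transition kernel $P^t$ is $f$-geometrically ergodic if it is positive Harris recurrent with invariant probability measure $\pi$ satisfying $\int f\,d\pi<\infty$, and there exists a constant $r>1$ such that $\sum_{t=1}^\infty r^t\,\|P^t(x,\cdot)-\pi\|_f<\infty$ for all states $x$, where $\|\nu\|_f=\sup_{|h|\le f}\left|\int h\,d\nu\right|$ (supremum over measurable $h$). Here $f(x)=1+\|x\|^2$ on $\mathbb{R}^{np}$. Second-order stationary means that second moments are finite and that means and autocovariances are invariant under time shifts. A process $(y_t)$ is $\beta$-mixing with geometrically decaying mixing numbers if there are constants $C<\infty$ and $\lambda\in(0,1)$ with $\beta(k)\le C\lambda^k$ for all $k\ge1$, where $$\beta(k)=\sup_t E\Big[\sup_{A\in\sigma(y_s:\,s\ge t+k)}\big|P(A\mid\sigma(y_s:\,s\le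 t))-P(A)\big|\Big]$$ (the inner supremum being an essential supremum). *)

theory Defs
  imports "HOL-Probability.Probability"
begin

section \<open>Matrices\<close>

definition pos_def :: "real^'n^'n \<Rightarrow> bool" where
  "pos_def A \<longleftrightarrow> transpose A = A \<and> (\<forall>x. x \<noteq> 0 \<longrightarrow> 0 < x \<bullet> (A *v x))"

text \<open>Well defined for positive definite arguments, which have exactly one positive definite root.\<close>

definition matrix_sqrt :: "real^'n^'n \<Rightarrow> real^'n^'n" where
  "matrix_sqrt A = (THE R. pos_def R \<and> R ** R = A)"

text \<open>The eigenvalues of a real matrix are taken in the complex numbers.\<close>

definition eigenvalues :: "real^'m^'m \<Rightarrow> complex set" where
  "eigenvalues A = {z. \<exists>v. v \<noteq> 0 \<and> map_matrix complex_of_real A *v v = z *s v}"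

definition spectral_radius :: "real^'m^'m \<Rightarrow> real" where
  "spectral_radius A = Max (cmod ` eigenvalues A)"

definition matrix_products :: "(real^'m^'m) set \<Rightarrow> nat \<Rightarrow> (real^'m^'m) set" where
  "matrix_products \<A> j = {foldr (**) As (mat 1) | As. length As = j \<and> set As \<subseteq> \<A>}"

definition joint_spectral_radius :: "(real^'m^'m) set \<Rightarrow> ereal" where
  "joint_spectral_radius \<A> =
     limsup (\<lambda>j. ereal (root j (SUP A\<in>matrix_products \<A> j. spectral_radius A)))"

section \<open>Stacked vectors\<close>

text \<open>
  The finite linearly ordered type \<open>'p\<close> provides the \<open>p = CARD('p)\<close> blocks of a vector in
  \<open>\<real>\<^sup>n\<^sup>p\<close>, which is rendered as \<open>real^('p \<times> 'n)\<close>; \<open>lag_of\<close> numbers the blocks by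
  \<open>1, \<dots>, p\<close>, and \<open>lag_pos\<close> is its inverse.  Families \<open>v\<close> of blocks are indexed by
  \<open>1, \<dots>, p\<close>, and their values at other indices are irrelevant.
\<close>

definition lag_of :: "'p::{finite,linorder} \<Rightarrow> nat" where
  "lag_of i = card {j. j \<le> i}"

definition lag_pos :: "nat \<Rightarrow> 'p::{finite,linorder}" where
  "lag_pos m = (THE i. lag_of i = m)"

definition stack :: "(nat \<Rightarrow> real^'n) \<Rightarrow> real^('p::{finite,linorder} \<times> 'n)" where
  "stack v = (\<chi> q. v (lag_of (fst q)) $ snd q)"

definition block :: "real^('p::{finite,linorder} \<times> 'n) \<Rightarrow> nat \<Rightarrow> real^'n" where
  "block z j = (\<chi> k. z $ (lag_pos j, k))"

text \<open>The block companion matrix with first block row \<open>A 1, \<dots>, A p\<close>.\<close>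

definition companion ::
  "(nat \<Rightarrow> real^'n^'n) \<Rightarrow> real^('p::{finite,linorder} \<times> 'n)^('p \<times> 'n)" where
  "companion A = (\<chi> r q.
     if lag_of (fst r) = 1 then A (lag_of (fst q)) $ snd r $ snd q
     else if lag_of (fst r) = lag_of (fst q) + 1 \<and> snd r = snd q then 1 else 0)"

lemma bij_betw_lag_of: "bij_betw lag_of (UNIV :: 'p::{finite,linorder} set) {1..CARD('p)}"
proof -
  have mono: "lag_of i < lag_of j" if "i < j" for i j :: 'p
    unfolding lag_of_def
  proof (rule psubset_card_mono)
    show "{k. k \<le> i} \<subset> {k. k \<le> j}"
      using that by (auto simp: psubset_eq set_eq_iff intro: exI[of _ j])
  qed simp
  have inj: "inj (lag_of :: 'p \<Rightarrow> nat)"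
    by (rule linorder_injI) (use mono in force)
  have "lag_of i \<in> {1..CARD('p)}" for i :: 'p
  proof -
    have "{j. j \<le> i} \<noteq> {}" by auto
    then have "0 < lag_of i" by (simp add: lag_of_def card_gt_0_iff)
    moreover have "lag_of i \<le> CARD('p)" unfolding lag_of_def by (rule card_mono) auto
    ultimately show ?thesis by simp
  qed
  then have sub: "range (lag_of :: 'p \<Rightarrow> nat) \<subseteq> {1..CARD('p)}" by auto
  have "card (range (lag_of :: 'p \<Rightarrow> nat)) = card {1..CARD('p)}"
    using card_image[OF inj] by simp
  then have "range (lag_of :: 'p \<Rightarrow> nat) = {1..CARD('p)}"
    using card_subset_eq[OF _ sub] by simp
  with inj show ?thesis by (simp add: bij_betw_def)
qed

lemma lag_pos_lag_of: "lag_pos (lag_of i) = i"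
  unfolding lag_pos_def
  using bij_betw_lag_of bij_betw_imp_inj_on by (intro the_equality) (auto dest: injD)

lemma lag_of_lag_pos:
  assumes "m \<in> {1..CARD('p)}"
  shows "lag_of (lag_pos m :: 'p::{finite,linorder}) = m"
proof -
  from assms have "m \<in> range (lag_of :: 'p \<Rightarrow> nat)"
    by (simp only: bij_betw_imp_surj_on[OF bij_betw_lag_of])
  then obtain i :: 'p where "m = lag_of i" by (elim imageE)
  then show ?thesis by (simp only: lag_pos_lag_of)
qed

lemma block_stack: "j \<in> {1..CARD('p)} \<Longrightarrow>
    block (stack v :: real^('p::{finite,linorder} \<times> 'n::finite)) j = v j"
  by (simp add: block_def stack_def lag_of_lag_pos vec_eq_iff)

lemma stack_block: "stack (block z) = z"
  by (simp add: block_def stack_def lag_pos_lag_of vec_eq_iff)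

section \<open>Markov chains\<close>

definition markov_kernel :: "'s measure \<Rightarrow> ('s \<Rightarrow> 's measure) \<Rightarrow> bool" where
  "markov_kernel S K \<longleftrightarrow> K \<in> S \<rightarrow>\<^sub>M prob_algebra S"

primrec kernel_pow :: "'s measure \<Rightarrow> ('s \<Rightarrow> 's measure) \<Rightarrow> nat \<Rightarrow> 's \<Rightarrow> 's measure" where
  "kernel_pow S K 0 x = return S x"
| "kernel_pow S K (Suc t) x = kernel_pow S K t x \<bind> K"

text \<open>The law, on sequences indexed by \<open>t = 0, 1, 2, \<dots>\<close>, of the chain started at \<open>x\<close>.\<close>

definition path_step :: "'s measure \<Rightarrow> ('s \<Rightarrow> 's measure) \<Rightarrow> 's \<Rightarrow> nat \<Rightarrow> (nat \<Rightarrow> 's) \<Rightarrow> 's measure"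
  where
  "path_step S K x t \<omega> = (case t of 0 \<Rightarrow> return S x | Suc u \<Rightarrow> K (\<omega> u))"

definition path_measure :: "'s measure \<Rightarrow> ('s \<Rightarrow> 's measure) \<Rightarrow> 's \<Rightarrow> (nat \<Rightarrow> 's) measure" where
  "path_measure S K x =
     projective_family.lim UNIV (Ionescu_Tulcea.CI (path_step S K x) (\<lambda>_. S)) (\<lambda>_. S)"

lemma Ionescu_Tulcea_path_step:
  assumes K: "markov_kernel S K" and x: "x \<in> space S"
  shows "Ionescu_Tulcea (path_step S K x) (\<lambda>_. S)"
proof -
  note [measurable] = measurable_prob_algebraD[OF K[unfolded markov_kernel_def]]
  have 1: "path_step S K x i \<in> PiM {0..<i} (\<lambda>_. S) \<rightarrow>\<^sub>M subprob_algebra S" for i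
  proof (cases i)
    case 0
    have "return S x \<in> space (subprob_algebra S)"
      using x by (simp add: space_subprob_algebra prob_space_return prob_space_imp_subprob_space)
    then show ?thesis by (simp add: 0 path_step_def[abs_def])
  next
    case (Suc u)
    have "(\<lambda>\<omega>. K (\<omega> u)) \<in> PiM {0..<Suc u} (\<lambda>_. S) \<rightarrow>\<^sub>M subprob_algebra S"
      by measurable
    then show ?thesis by (simp add: Suc path_step_def[abs_def])
  qed
  have 2: "prob_space (path_step S K x i \<omega>)" if "\<omega> \<in> space (PiM {0..<i} (\<lambda>_. S))" for i \<omega>
  proof (cases i)
    case 0
    then show ?thesis using x by (simp add: path_step_def prob_space_return)
  next
    case (Suc u)
    then have "\<omega> u \<in> space S" using that by (auto simp: space_PiM)
    then have "K (\<omega> u) \<in> space (prob_algebra S)"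
      by (rule measurable_space[OF K[unfolded markov_kernel_def]])
    then show ?thesis by (simp add: Suc path_step_def space_prob_algebra)
  qed
  show ?thesis
    by (rule Ionescu_Tulcea.intro) (fact 1, rule 2)
qed

definition hit_prob :: "'s measure \<Rightarrow> ('s \<Rightarrow> 's measure) \<Rightarrow> 's \<Rightarrow> 's set \<Rightarrow> real" where
  "hit_prob S K x A =
     measure (path_measure S K x) {\<omega> \<in> space (path_measure S K x). \<exists>t\<ge>1. \<omega> t \<in> A}"

definition inf_often_prob :: "'s measure \<Rightarrow> ('s \<Rightarrow> 's measure) \<Rightarrow> 's \<Rightarrow> 's set \<Rightarrow> real" where
  "inf_often_prob S K x A =
     measure (path_measure S K x) {\<omega> \<in> space (path_measure S K x). infinite {t. t \<ge> 1 \<and> \<omega> t \<in> A}}"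

definition irreducibility_measure :: "'s measure \<Rightarrow> ('s \<Rightarrow> 's measure) \<Rightarrow> 's measure \<Rightarrow> bool" where
  "irreducibility_measure S K \<phi> \<longleftrightarrow>
     sets \<phi> = sets S \<and> sigma_finite_measure \<phi> \<and> emeasure \<phi> (space S) \<noteq> 0 \<and>
     (\<forall>A\<in>sets S. emeasure \<phi> A > 0 \<longrightarrow> (\<forall>x\<in>space S. hit_prob S K x A > 0))"

definition maximal_irreducibility_measure ::
  "'s measure \<Rightarrow> ('s \<Rightarrow> 's measure) \<Rightarrow> 's measure \<Rightarrow> bool" where
  "maximal_irreducibility_measure S K \<psi> \<longleftrightarrow>
     irreducibility_measure S K \<psi> \<and>
     (\<forall>\<phi>. irreducibility_measure S K \<phi> \<longrightarrow> absolutely_continuous \<psi> \<phi>)"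

definition harris_recurrent :: "'s measure \<Rightarrow> ('s \<Rightarrow> 's measure) \<Rightarrow> bool" where
  "harris_recurrent S K \<longleftrightarrow>
     (\<exists>\<psi>. maximal_irreducibility_measure S K \<psi> \<and>
        (\<forall>A\<in>sets S. emeasure \<psi> A > 0 \<longrightarrow> (\<forall>x\<in>A. inf_often_prob S K x A = 1)))"

definition invariant_prob :: "'s measure \<Rightarrow> ('s \<Rightarrow> 's measure) \<Rightarrow> 's measure \<Rightarrow> bool" where
  "invariant_prob S K \<pi> \<longleftrightarrow> prob_space \<pi> \<and> sets \<pi> = sets S \<and> \<pi> \<bind> K = \<pi>"

text \<open>
  The \<open>f\<close>-norm of \<open>\<mu> - \<nu>\<close>.  It is infinite when \<open>f\<close> fails to be integrable, so that the
  convention that nonintegrable functions have Bochner integral 0 plays no role.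
\<close>

definition f_norm_diff :: "'s measure \<Rightarrow> ('s \<Rightarrow> real) \<Rightarrow> 's measure \<Rightarrow> 's measure \<Rightarrow> ennreal" where
  "f_norm_diff S f \<mu> \<nu> =
     (if integrable \<mu> f \<and> integrable \<nu> f
      then SUP h\<in>{h \<in> borel_measurable S. \<forall>x\<in>space S. \<bar>h x\<bar> \<le> f x}.
             ennreal \<bar>(\<integral>x. h x \<partial>\<mu>) - (\<integral>x. h x \<partial>\<nu>)\<bar>
      else \<infinity>)"

definition geometrically_ergodic :: "'s measure \<Rightarrow> ('s \<Rightarrow> 's measure) \<Rightarrow> ('s \<Rightarrow> real) \<Rightarrow> bool" where
  "geometrically_ergodic S K f \<longleftrightarrow>
     f \<in> borel_measurable S \<and> (\<forall>x\<in>space S. 1 \<le> f x) \<and> markov_kernel S K \<and>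
     harris_recurrent S K \<and>
     (\<exists>\<pi>. invariant_prob S K \<pi> \<and> (\<integral>\<^sup>+x. ennreal (f x) \<partial>\<pi>) < \<infinity> \<and>
        (\<exists>r>1. \<forall>x\<in>space S.
           (\<Sum>t. ennreal (r ^ Suc t) * f_norm_diff S f (kernel_pow S K (Suc t) x) \<pi>) < \<infinity>))"

section \<open>Stochastic processes\<close>

definition gen_sigma :: "'a measure \<Rightarrow> 's measure \<Rightarrow> ('t \<Rightarrow> 'a \<Rightarrow> 's) \<Rightarrow> 't set \<Rightarrow> 'a measure" where
  "gen_sigma M S X I = sigma (space M) (\<Union>t\<in>I. {X t -` A \<inter> space M | A. A \<in> sets S})"

text \<open>A time-homogeneous Markov chain, with respect to its natural filtration.\<close>

definition markov_chain ::
  "'a measure \<Rightarrow> 's measure \<Rightarrow> ('s \<Rightarrow> 's measure) \<Rightarrow> (nat \<Rightarrow> 'a \<Rightarrow> 's) \<Rightarrow> bool" where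
  "markov_chain M S K Z \<longleftrightarrow>
     markov_kernel S K \<and> (\<forall>t. Z t \<in> M \<rightarrow>\<^sub>M S) \<and>
     (\<forall>t. \<forall>A\<in>sets S. AE \<omega> in M.
        real_cond_exp M (gen_sigma M S Z {..t}) (indicator (Z (Suc t) -` A \<inter> space M)) \<omega>
        = measure (K (Z t \<omega>)) A)"

text \<open>In the following notions the time set is \<open>{a..}\<close>.\<close>

definition strictly_stationary :: "'a measure \<Rightarrow> 's measure \<Rightarrow> int \<Rightarrow> (int \<Rightarrow> 'a \<Rightarrow> 's) \<Rightarrow> bool" where
  "strictly_stationary M S a X \<longleftrightarrow>
     (\<forall>t\<ge>a. X t \<in> M \<rightarrow>\<^sub>M S) \<and>
     (\<forall>J h. finite J \<and> J \<subseteq> {a..} \<and> 0 \<le> h \<longrightarrow>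
        distr M (PiM J (\<lambda>_. S)) (\<lambda>\<omega>. \<lambda>t\<in>J. X (t + h) \<omega>) =
        distr M (PiM J (\<lambda>_. S)) (\<lambda>\<omega>. \<lambda>t\<in>J. X t \<omega>))"

definition cross_cov :: "'a measure \<Rightarrow> ('a \<Rightarrow> real^'n) \<Rightarrow> ('a \<Rightarrow> real^'n) \<Rightarrow> real^'n^'n" where
  "cross_cov M X Y = (\<chi> k l.
     \<integral>\<omega>. (X \<omega> - (\<integral>\<omega>. X \<omega> \<partial>M)) $ k * (Y \<omega> - (\<integral>\<omega>. Y \<omega> \<partial>M)) $ l \<partial>M)"

definition second_order_stationary :: "'a measure \<Rightarrow> int \<Rightarrow> (int \<Rightarrow> 'a \<Rightarrow> real^'n) \<Rightarrow> bool" where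
  "second_order_stationary M a X \<longleftrightarrow>
     (\<forall>t\<ge>a. X t \<in> borel_measurable M \<and> integrable M (\<lambda>\<omega>. (norm (X t \<omega>))\<^sup>2)) \<and>
     (\<forall>t\<ge>a. \<forall>h\<ge>0. (\<integral>\<omega>. X (t + h) \<omega> \<partial>M) = (\<integral>\<omega>. X t \<omega> \<partial>M)) \<and>
     (\<forall>t\<ge>a. \<forall>u\<ge>a. \<forall>h\<ge>0. cross_cov M (X (t + h)) (X (u + h)) = cross_cov M (X t) (X u))"

text \<open>
  The essential supremum of a family of functions; it always exists over a \<open>\<sigma>\<close>-finite measure
  and is unique almost everywhere.
\<close>

definition is_ess_sup :: "'a measure \<Rightarrow> ('a \<Rightarrow> ennreal) set \<Rightarrow> ('a \<Rightarrow> ennreal) \<Rightarrow> bool" where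
  "is_ess_sup M F u \<longleftrightarrow>
     u \<in> borel_measurable M \<and> (\<forall>f\<in>F. AE \<omega> in M. f \<omega> \<le> u \<omega>) \<and>
     (\<forall>w\<in>borel_measurable M. (\<forall>f\<in>F. AE \<omega> in M. f \<omega> \<le> w \<omega>) \<longrightarrow> (AE \<omega> in M. u \<omega> \<le> w \<omega>))"

definition ess_sup :: "'a measure \<Rightarrow> ('a \<Rightarrow> ennreal) set \<Rightarrow> 'a \<Rightarrow> ennreal" where
  "ess_sup M F = (SOME u. is_ess_sup M F u)"

definition beta_coeff :: "'a measure \<Rightarrow> 's measure \<Rightarrow> int \<Rightarrow> (int \<Rightarrow> 'a \<Rightarrow> 's) \<Rightarrow> nat \<Rightarrow> ennreal" where
  "beta_coeff M S a X k =
     (SUP t\<in>{a..}. \<integral>\<^sup>+\<omega>. ess_sup M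
        ((\<lambda>A \<omega>. ennreal \<bar>real_cond_exp M (gen_sigma M S X {a..t}) (indicator A) \<omega> - measure M A\<bar>)
          ` sets (gen_sigma M S X {t + int k..})) \<omega> \<partial>M)"

definition geometric_beta_mixing :: "'a measure \<Rightarrow> 's measure \<Rightarrow> int \<Rightarrow> (int \<Rightarrow> 'a \<Rightarrow> 's) \<Rightarrow> bool" where
  "geometric_beta_mixing M S a X \<longleftrightarrow>
     (\<forall>t\<ge>a. X t \<in> M \<rightarrow>\<^sub>M S) \<and>
     (\<exists>C\<ge>0. \<exists>r. 0 < r \<and> r < 1 \<and> (\<forall>k\<ge>1. beta_coeff M S a X k \<le> ennreal (C * r ^ k)))"

section \<open>The vector smooth transition autoregression\<close>

text \<open>The right-hand side of the model equation; \<open>v j\<close> stands for \<open>y\<^sub>t\<^sub>-\<^sub>j\<close> and \<open>e\<close> for \<open>\<epsilon>\<^sub>t\<close>.\<close>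

definition vstar ::
  "nat \<Rightarrow> (nat \<Rightarrow> real^'n) \<Rightarrow> (nat \<Rightarrow> real^'n^'n) \<Rightarrow> (nat \<Rightarrow> nat \<Rightarrow> real^'n^'n) \<Rightarrow>
   (nat \<Rightarrow> real^'n^'n) \<Rightarrow> (nat \<Rightarrow> real \<Rightarrow> real) \<Rightarrow> (real^('p::{finite,linorder} \<times> 'n) \<Rightarrow> real) \<Rightarrow>
   (nat \<Rightarrow> real^'n) \<Rightarrow> real^'n \<Rightarrow> real^'n" where
  "vstar g \<mu> \<Phi> \<Psi> \<Omega> G s v e =
     (let w = (\<lambda>i. G i (s (stack v))) in
      \<mu> 0 + (\<Sum>j=1..CARD('p). \<Phi> j *v v j)
      + (\<Sum>i=1..g. w i *\<^sub>R (\<mu> i + (\<Sum>j=1..CARD('p). \<Psi> i j *v v j)))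
      + matrix_sqrt ((1 - (\<Sum>i=1..g. w i)) *\<^sub>R \<Omega> 0 + (\<Sum>i=1..g. w i *\<^sub>R \<Omega> i)) *v e)"

text \<open>
  \<open>y\<close> is the process driven by \<open>\<epsilon>\<^sub>1, \<epsilon>\<^sub>2, \<dots>\<close> and started from initial values
  \<open>y\<^sub>0, \<dots>, y\<^sub>-\<^sub>p\<^sub>+\<^sub>1\<close> that are independent of the driving sequence.
\<close>

definition vstar_process ::
  "nat \<Rightarrow> (nat \<Rightarrow> real^'n) \<Rightarrow> (nat \<Rightarrow> real^'n^'n) \<Rightarrow> (nat \<Rightarrow> nat \<Rightarrow> real^'n^'n) \<Rightarrow>
   (nat \<Rightarrow> real^'n^'n) \<Rightarrow> (nat \<Rightarrow> real \<Rightarrow> real) \<Rightarrow> (real^('p::{finite,linorder} \<times> 'n) \<Rightarrow> real) \<Rightarrow>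
   'a measure \<Rightarrow> (nat \<Rightarrow> 'a \<Rightarrow> real^'n) \<Rightarrow> (int \<Rightarrow> 'a \<Rightarrow> real^'n) \<Rightarrow> bool" where
  "vstar_process g \<mu> \<Phi> \<Psi> \<Omega> G s M \<epsilon> y \<longleftrightarrow>
     (\<forall>t\<in>{1 - int CARD('p)..0}. y t \<in> borel_measurable M) \<and>
     prob_space.indep_set M
       (sets (gen_sigma M borel y {1 - int CARD('p)..0})) (sets (gen_sigma M borel \<epsilon> {1..})) \<and>
     (\<forall>t\<ge>1. \<forall>\<omega>\<in>space M.
        y (int t) \<omega> = vstar g \<mu> \<Phi> \<Psi> \<Omega> G s (\<lambda>j. y (int t - int j) \<omega>) (\<epsilon> t \<omega>))"

text \<open>\<open>Z\<^sub>t = (y\<^sub>t', \<dots>, y\<^sub>t\<^sub>-\<^sub>p\<^sub>+\<^sub>1')'\<close>\<close>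

definition state_process ::
  "(int \<Rightarrow> 'a \<Rightarrow> real^'n) \<Rightarrow> nat \<Rightarrow> 'a \<Rightarrow> real^('p::{finite,linorder} \<times> 'n)" where
  "state_process y t \<omega> = stack (\<lambda>j. y (int t - int j + 1) \<omega>)"

text \<open>
  The one-step transition kernel of the state process: the law of the new state
  \<open>(y\<^sub>t', y\<^sub>t\<^sub>-\<^sub>1', \<dots>, y\<^sub>t\<^sub>-\<^sub>p\<^sub>+\<^sub>1')'\<close> when the old state is \<open>z = (y\<^sub>t\<^sub>-\<^sub>1', \<dots>, y\<^sub>t\<^sub>-\<^sub>p')'\<close> and
  \<open>\<epsilon>\<^sub>t\<close> has law \<open>D\<close>.
\<close>

definition vstar_kernel ::
  "nat \<Rightarrow> (nat \<Rightarrow> real^'n) \<Rightarrow> (nat \<Rightarrow> real^'n^'n) \<Rightarrow> (nat \<Rightarrow> nat \<Rightarrow> real^'n^'n) \<Rightarrow>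
   (nat \<Rightarrow> real^'n^'n) \<Rightarrow> (nat \<Rightarrow> real \<Rightarrow> real) \<Rightarrow> (real^('p::{finite,linorder} \<times> 'n) \<Rightarrow> real) \<Rightarrow>
   (real^'n) measure \<Rightarrow> real^('p \<times> 'n) \<Rightarrow> (real^('p \<times> 'n)) measure" where
  "vstar_kernel g \<mu> \<Phi> \<Psi> \<Omega> G s D z =
     distr D borel
       (\<lambda>e. stack (\<lambda>j. if j = 1 then vstar g \<mu> \<Phi> \<Psi> \<Omega> G s (block z) e else block z (j - 1)))"

end

theory Submission
  imports Defs "HOL-Computational_Algebra.Fundamental_Theorem_Algebra"
begin

text \<open>
  \<^bold>\<open>Lyapunov function.\<close>  A finite set of matrices with joint spectral radius below 1 contracts some
  norm.  Traces of long products decay exponentially; modulo the radical of the trace form, which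
  consists of nilpotent elements, traces control the norm, and the radical acts strictly upper triangularly
  along a flag.  Hence long products tend to 0, and a suitable maximum over products is an adapted norm.
  The conditional mean of the state is, up to a bounded term, a convex combination of the companion
  matrices applied to the previous state, so the square of the adapted norm satisfies a geometric drift
  condition.

  \<^bold>\<open>Minorization.\<close>  Each step writes an innovation, with density bounded below on compact sets, into
  the first block, so on bounded sets the \<open>p\<close>-step kernel dominates a multiple of the law of a chain that
  overwrites all \<open>p\<close> blocks.  By the contraction argument of Hairer and Mattingly this gives a unique
  invariant law and convergence at a geometric rate in the weighted norm.  Harris recurrence follows from
  the convergence along sparse times.

  \<^bold>\<open>Stationarity and mixing.\<close>  The solution is a fixed function of the current state and of
  the future innovations, which are independent of the past.  Starting from the invariant law makes it
  stationary, and the mixing coefficients are bounded by the mean distance to equilibrium of the kernel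
  after the corresponding number of steps.
\<close>

text \<open>The joint spectral radius is defined here through eigenvalues of products. Spectral
  radii are neither subadditive nor submultiplicative, so no norm estimate follows directly; the
  passage to norms is the substance of the Berger-Wang theorem. The trace offers a way around: it is
  linear and bounded by dimension times spectral radius, so estimates for all long products spread
  over the algebra that they span. What the trace cannot see is nilpotent, and nilpotency supplies
  the missing decay. The function \<open>s\<close> is only Borel, so the kernel need not map
  continuous functions to continuous functions, and weak limits of laws would not be known to be
  invariant. Convergence uniform over events replaces them, and compactness enters only through
  explicit bounds that dominate the mean and the covariance on bounded sets. For
  \<open>p > 1\<close> a single step moves all but one block deterministically, so minorization can
  be expected only after \<open>p\<close> steps. The Lyapunov function dominates the squared norm,
  hence one contraction theorem yields bounded sublevel sets, convergence in the weighted norm and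
  second moments of the invariant law.\<close>

section \<open>Trace forms of matrix algebras\<close>

lemma coeff_prod_0:
  fixes q :: "'i \<Rightarrow> 'a::comm_ring_1 poly"
  shows "coeff (prod q S) 0 = (\<Prod>i\<in>S. coeff (q i) 0)"
  by (induction S rule: infinite_finite_induct) (auto simp: coeff_mult)

lemma coeff_prod_1:
  fixes q :: "'i \<Rightarrow> 'a::comm_ring_1 poly"
  assumes "finite S"
  shows "coeff (prod q S) 1 = (\<Sum>i\<in>S. coeff (q i) 1 * (\<Prod>j\<in>S-{i}. coeff (q j) 0))"
  using assms
proof (induction S rule: finite_induct)
  case (insert x S)
  have "(\<Sum>i\<in>S. coeff (q i) 1 * (\<Prod>j\<in>insert x S-{i}. coeff (q j) 0))
      = (\<Sum>i\<in>S. coeff (q x) 0 * (coeff (q i) 1 * (\<Prod>j\<in>S-{i}. coeff (q j) 0)))"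
  proof (rule sum.cong[OF refl])
    fix i assume "i \<in> S"
    then have "insert x S - {i} = insert x (S - {i})" using insert by auto
    then show "coeff (q i) 1 * (\<Prod>j\<in>insert x S-{i}. coeff (q j) 0)
      = coeff (q x) 0 * (coeff (q i) 1 * (\<Prod>j\<in>S-{i}. coeff (q j) 0))"
      using insert by simp
  qed
  moreover have "insert x S - {x} = S" using insert by auto
  ultimately show ?case
    using insert by (simp add: coeff_mult coeff_prod_0 sum_distrib_left del: One_nat_def)
      (simp add: coeff_prod_0 sum_distrib_left)
qed simp

text \<open>This is \<open>det (I - z A)\<close>. Its constant coefficient is 1, its linear
  coefficient is minus the trace, and its roots are the reciprocals of the nonzero eigenvalues; the
  eigenvalue 0 merely lowers the degree.\<close>

definition rev_charpoly :: "'a::comm_ring_1^'m^'m \<Rightarrow> 'a poly" where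
  "rev_charpoly A = det (\<chi> i j. [:mat 1 $ i $ j, - A $ i $ j:])"

lemma poly_rev_charpoly:
  "poly (rev_charpoly A) z = det (\<chi> i j. mat 1 $ i $ j - z * A $ i $ j)"
  unfolding rev_charpoly_def det_def
  by (simp add: poly_sum poly_prod algebra_simps)

lemma coeff_0_rev_charpoly: "coeff (rev_charpoly A) 0 = 1"
proof -
  have "coeff (rev_charpoly A) 0 = poly (rev_charpoly A) 0" by (simp add: poly_0_coeff_0)
  also have "\<dots> = det (mat 1)"
    by (simp add: poly_rev_charpoly)
  finally show ?thesis by simp
qed

text \<open>A permutation other than the identity moves at least two points. Its product in the
  determinant then has two factors without constant term and contributes nothing in degree
  one.\<close>

lemma coeff_1_rev_charpoly: "coeff (rev_charpoly (A::'a::comm_ring_1^'m^'m)) 1 = - trace A"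
proof -
  let ?q = "\<lambda>\<sigma> i. [:mat 1 $ i $ \<sigma> i, - A $ i $ \<sigma> i:] :: 'a poly"
  have *: "coeff (\<Prod>i\<in>UNIV. ?q \<sigma> i) 1 = (if \<sigma> = id then - trace A else 0)"
    if s: "\<sigma> permutes (UNIV::'m set)" for \<sigma>
  proof (cases "\<sigma> = id")
    case True
    then show ?thesis by (simp add: coeff_prod_1 trace_def mat_def sum_negf del: One_nat_def) (simp add: sum_negf)
  next
    case False
    have "(\<Prod>j\<in>UNIV-{i}. coeff (?q \<sigma> j) 0) = 0" for i
    proof -
      obtain j where j: "\<sigma> j \<noteq> j" using False by (auto simp: fun_eq_iff)
      obtain j' where j': "\<sigma> j' \<noteq> j'" "j' \<noteq> i"
      proof (cases "j = i")
        case True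
        have "\<sigma> (\<sigma> j) \<noteq> \<sigma> j" using j permutes_inj[OF s] by (auto dest: injD)
        then show ?thesis using that[of "\<sigma> j"] True j by auto
      qed (use that j in auto)
      show ?thesis
        by (rule prod_zero) (use j' in \<open>auto simp: mat_def intro!: bexI[of _ j']\<close>)
    qed
    then show ?thesis using False by (simp add: coeff_prod_1 del: One_nat_def)
  qed
  have c: "coeff (of_int k * q) 1 = of_int k * coeff q 1" for k and q :: "'a poly"
    by (simp add: of_int_poly)
  have "coeff (rev_charpoly A) 1
      = (\<Sum>\<sigma>\<in>{\<sigma>. \<sigma> permutes UNIV}. of_int (sign \<sigma>) * coeff (\<Prod>i\<in>UNIV. ?q \<sigma> i) 1)"
    unfolding rev_charpoly_def det_def by (simp add: coeff_sum c del: One_nat_def)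
  also have "\<dots> = (\<Sum>\<sigma>\<in>{\<sigma>. \<sigma> permutes (UNIV::'m set)}. if \<sigma> = id then - trace A else 0)"
    by (rule sum.cong) (use * in \<open>auto simp: sign_id\<close>)
  also have "\<dots> = - trace A" by (simp add: permutes_id)
  finally show ?thesis .
qed

lemma degree_rev_charpoly: "degree (rev_charpoly (A::'a::comm_ring_1^'m^'m)) \<le> CARD('m)"
  unfolding rev_charpoly_def det_def
proof (rule degree_sum_le)
  fix \<sigma> :: "'m \<Rightarrow> 'm"
  have "degree (\<Prod>i\<in>UNIV. [:mat 1 $ i $ \<sigma> i, - A $ i $ \<sigma> i:] :: 'a poly) \<le> CARD('m)"
  proof -
    have "degree (\<Prod>i\<in>UNIV. [:mat 1 $ i $ \<sigma> i, - A $ i $ \<sigma> i:] :: 'a poly)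
        \<le> (\<Sum>i\<in>UNIV. degree ([:mat 1 $ i $ \<sigma> i, - A $ i $ \<sigma> i:] :: 'a poly))"
      by (rule degree_prod_sum_le[OF finite, unfolded o_def])
    also have "\<dots> \<le> (\<Sum>i\<in>(UNIV::'m set). 1)" by (rule sum_mono) auto
    finally show ?thesis by simp
  qed
  then show "degree (of_int (sign \<sigma>) * (\<Prod>i\<in>UNIV. (\<chi> i j. [:mat 1 $ i $ j, - A $ i $ j:]) $ i $ \<sigma> i))
      \<le> CARD('m)"
    using degree_mult_le[of "of_int (sign \<sigma>)" "\<Prod>i\<in>UNIV. [:mat 1 $ i $ \<sigma> i, - A $ i $ \<sigma> i:] :: 'a poly"]
    by (simp only: vec_lambda_beta degree_of_int)
qed (auto intro: finite_permutations)

text \<open>Up to a constant, \<open>p\<close> is the product of the factors \<open>1 - x z\<close>,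
  where \<open>xs\<close> lists the reciprocals of the roots with multiplicity; the linear
  coefficient is then Vieta's formula. Each induction step splits off one root.\<close>

lemma poly_linear_factors:
  fixes p :: "complex poly"
  assumes "coeff p 0 \<noteq> 0"
  shows "\<exists>xs. length xs = degree p \<and> (\<forall>x\<in>set xs. x \<noteq> 0 \<and> poly p (1/x) = 0) \<and>
    coeff p 1 = - coeff p 0 * sum_list xs"
  using assms
proof (induction "degree p" arbitrary: p)
  case 0
  then show ?case by (intro exI[of _ "[]"]) (simp add: coeff_eq_0)
next
  case (Suc n)
  have "\<not> constant (poly p)" using Suc.hyps(2) constant_degree[of p] by simp
  then obtain z where z: "poly p z = 0" using fundamental_theorem_of_algebra by blast
  have z0: "z \<noteq> 0" using z Suc.prems by (auto simp: poly_0_coeff_0)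
  obtain q where q: "p = [:-z, 1:] * q" using z by (auto simp: poly_eq_0_iff_dvd)
  have q0: "coeff p 0 = - z * coeff q 0" "coeff p 1 = coeff q 0 - z * coeff q 1"
    by (simp_all add: q coeff_pCons)
  have "q \<noteq> 0" using Suc.prems q by auto
  then have "degree p = Suc (degree q)" unfolding q by (subst degree_mult_eq) auto
  then have "n = degree q" using Suc.hyps by simp
  from Suc.hyps(1)[OF this] q0 Suc.prems obtain xs where xs: "length xs = degree q"
    "\<forall>x\<in>set xs. x \<noteq> 0 \<and> poly q (1/x) = 0" "coeff q 1 = - coeff q 0 * sum_list xs" by auto
  have "coeff p 1 = - coeff p 0 * sum_list (1/z # xs)"
    using z0 q0 xs(3) by (simp add: field_simps)
  then show ?case
    using xs z0 z \<open>n = degree q\<close> Suc.hyps(2) by (intro exI[of _ "1/z # xs"]) (auto simp: q)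
qed

lemma one_minus_smult_matrix_vector:
  fixes A :: "'a::comm_ring_1^'m^'m"
  shows "(\<chi> i j. mat 1 $ i $ j - c * A $ i $ j) *v v = v - c *s (A *v v)"
proof -
  have "(\<chi> i j. mat 1 $ i $ j - c * A $ i $ j) = mat 1 - (\<chi> i j. c * A $ i $ j)"
    by (simp add: vec_eq_iff)
  moreover have "(\<chi> i j. c * A $ i $ j) *v v = c *s (A *v v)"
    by (simp add: vec_eq_iff matrix_vector_mult_def sum_distrib_left mult.assoc)
  ultimately show ?thesis by (simp add: matrix_vector_mult_diff_rdistrib)
qed

lemma trace_eq_sum_eigenvalues:
  fixes A :: "complex^'m^'m"
  obtains xs where "length xs = degree (rev_charpoly A)" "trace A = sum_list xs"
    "\<And>x. x \<in> set xs \<Longrightarrow> x \<noteq> 0 \<and> (\<exists>v. v \<noteq> 0 \<and> A *v v = x *s v)"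
proof -
  obtain xs where xs: "length xs = degree (rev_charpoly A)"
    "\<forall>x\<in>set xs. x \<noteq> 0 \<and> poly (rev_charpoly A) (1/x) = 0"
    "coeff (rev_charpoly A) 1 = - coeff (rev_charpoly A) 0 * sum_list xs"
    using poly_linear_factors[of "rev_charpoly A"] by (auto simp: coeff_0_rev_charpoly)
  have "\<exists>v. v \<noteq> 0 \<and> A *v v = x *s v" if "x \<in> set xs" for x
  proof -
    have x: "x \<noteq> 0" "poly (rev_charpoly A) (1/x) = 0" using xs that by auto
    let ?B = "\<chi> i j. mat 1 $ i $ j - (1/x) * A $ i $ j"
    \<comment> \<open>A root \<open>1/x\<close> makes \<open>I - A/x\<close> singular, and its
      kernel consists of eigenvectors for \<open>x\<close>.\<close>
    have "\<not> invertible ?B" using x by (simp add: invertible_det_nz poly_rev_charpoly)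
    then obtain v where v: "v \<noteq> 0" "?B *v v = 0"
      using matrix_left_invertible_ker[of ?B] by (auto simp: invertible_left_inverse)
    have "?B *v v = v - (1/x) *s (A *v v)"
      by (rule one_minus_smult_matrix_vector)
    with v have "v = (1/x) *s (A *v v)" by simp
    then have "x *s v = A *v v" using x(1) by (metis divide_self_if times_divide_eq_right
        mult.right_neutral vector_smult_assoc vector_smult_lid)
    then show ?thesis using v by auto
  qed
  moreover have "trace A = sum_list xs"
    using xs(3) by (simp add: coeff_0_rev_charpoly coeff_1_rev_charpoly del: One_nat_def)
  ultimately show ?thesis using that xs by blast
qed

lemma trace_complexification: "trace (map_matrix complex_of_real A) = complex_of_real (trace A)"
  by (simp add: trace_def map_matrix_def)

text \<open>At most \<open>CARD('m)\<close> nonzero eigenvalues, counted with multiplicity, sum to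
  the trace. This turns a bound on spectral radii into a bound on a linear functional.\<close>

lemma abs_trace_le:
  fixes A :: "real^'m^'m" and r :: real
  assumes "\<And>z. z \<in> eigenvalues A \<Longrightarrow> cmod z \<le> r" "0 \<le> r"
  shows "\<bar>trace A\<bar> \<le> CARD('m) * r"
proof -
  let ?C = "map_matrix complex_of_real A"
  obtain xs where xs: "length xs = degree (rev_charpoly ?C)" "trace ?C = sum_list xs"
    "\<And>x. x \<in> set xs \<Longrightarrow> x \<noteq> 0 \<and> (\<exists>v. v \<noteq> 0 \<and> ?C *v v = x *s v)"
    by (rule trace_eq_sum_eigenvalues[of ?C]) blast
  have *: "cmod (sum_list ys) \<le> length ys * r" if "\<forall>x\<in>set ys. cmod x \<le> r" for ys
    using that
  proof (induction ys)
    case (Cons y ys)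
    then show ?case using norm_triangle_ineq[of y "sum_list ys"] by (simp add: algebra_simps)
  qed simp
  have "\<bar>trace A\<bar> = cmod (sum_list xs)"
    using xs(2) by (metis trace_complexification norm_of_real)
  also have "\<dots> \<le> length xs * r"
    using xs(3) assms(1) by (intro *) (auto simp: eigenvalues_def)
  also have "\<dots> \<le> CARD('m) * r"
    using xs(1) degree_rev_charpoly[of ?C] assms(2) by (intro mult_right_mono) auto
  finally show ?thesis .
qed

text \<open>\<open>spectral_radius\<close> is a \<open>Max\<close>, which dominates its elements
  only over a finite set. The value 0 is inserted separately because \<open>rev_charpoly\<close>
  sees only nonzero eigenvalues.\<close>

lemma finite_eigenvalues: "finite (eigenvalues (A::real^'m^'m))"
proof -
  let ?C = "map_matrix complex_of_real A"
  have "eigenvalues A \<subseteq> insert 0 ((\<lambda>z. 1/z) ` {z. poly (rev_charpoly ?C) z = 0})"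
  proof
    fix x assume "x \<in> eigenvalues A"
    then obtain v where v: "v \<noteq> 0" "?C *v v = x *s v" by (auto simp: eigenvalues_def)
    show "x \<in> insert 0 ((\<lambda>z. 1/z) ` {z. poly (rev_charpoly ?C) z = 0})"
    proof (cases "x = 0")
      case False
      let ?B = "\<chi> i j. mat 1 $ i $ j - (1/x) * ?C $ i $ j"
      have "?B *v v = v - (1/x) *s (?C *v v)"
        by (rule one_minus_smult_matrix_vector)
      also have "\<dots> = 0" using False v(2) by (simp add: vector_smult_assoc)
      finally have "\<not> invertible ?B" using v(1) matrix_left_invertible_ker[of ?B]
        by (auto simp: invertible_left_inverse)
      then have "poly (rev_charpoly ?C) (1/x) = 0" by (simp add: invertible_det_nz poly_rev_charpoly)
      then show ?thesis using False by (intro insertI2 image_eqI[of _ _ "1/x"]) auto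
    qed simp
  qed
  moreover have "rev_charpoly ?C \<noteq> 0" using coeff_0_rev_charpoly[of ?C] by auto
  then have "finite (insert 0 ((\<lambda>z. 1/z) ` {z. poly (rev_charpoly ?C) z = 0}))"
    by (intro finite.insertI finite_imageI poly_roots_finite)
  ultimately show ?thesis by (rule finite_subset)
qed

lemma cmod_eigenvalue_le: "z \<in> eigenvalues A \<Longrightarrow> cmod z \<le> spectral_radius A"
  unfolding spectral_radius_def by (intro Max_ge) (auto simp: finite_eigenvalues)

lemma matrix_diff_rdistrib: "(A - B) ** C = A ** C - B ** (C :: 'a::ring_1^'k^'m)"
  by (simp add: matrix_matrix_mult_def vec_eq_iff left_diff_distrib sum_subtractf)

text \<open>All nonzero eigenvalues of an idempotent are 1, so its trace equals the degree of
  \<open>rev_charpoly\<close>. Degree 0 makes \<open>det (I - e)\<close> equal to 1, and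
  \<open>I - e\<close> can then be cancelled from \<open>(I - e) e = 0\<close>.\<close>

lemma idempotent_trace_zero:
  fixes e :: "real^'m^'m"
  assumes "e ** e = e" "trace e = 0"
  shows "e = 0"
proof -
  let ?C = "map_matrix complex_of_real e"
  have CC: "?C ** ?C = ?C"
  proof -
    have "?C ** ?C = map_matrix complex_of_real (e ** e)"
      by (simp add: matrix_matrix_mult_def map_matrix_def vec_eq_iff)
    then show ?thesis by (simp only: assms(1))
  qed
  obtain xs where xs: "length xs = degree (rev_charpoly ?C)" "trace ?C = sum_list xs"
    "\<And>x. x \<in> set xs \<Longrightarrow> x \<noteq> 0 \<and> (\<exists>v. v \<noteq> 0 \<and> ?C *v v = x *s v)"
    by (rule trace_eq_sum_eigenvalues[of ?C]) blast
  have one: "x = 1" if "x \<in> set xs" for x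
  proof -
    obtain v where v: "x \<noteq> 0" "v \<noteq> 0" "?C *v v = x *s v" using xs(3)[OF \<open>x \<in> set xs\<close>] by auto
    have "?C *v (?C *v v) = ?C *v v" by (simp only: matrix_vector_mul_assoc CC)
    then have "x *s (x *s v) = x *s v" by (simp add: v(3) vec.scale)
    then have "x * x = x" using v(2) by (auto simp: vector_smult_assoc vector_mul_rcancel)
    then show ?thesis using v(1) by simp
  qed
  then have "sum_list xs = of_nat (length xs)"
  proof -
    have "map (\<lambda>x. x) xs = map (\<lambda>_. 1) xs" using one by (intro map_cong) auto
    then have "sum_list xs = sum_list (map (\<lambda>_. 1) xs)" by simp
    then show ?thesis by (simp add: sum_list_triv)
  qed
  moreover have "sum_list xs = 0"
    using xs(2) assms(2) trace_complexification[of e] by simp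
  ultimately have "degree (rev_charpoly ?C) = 0" using xs(1) by simp
  then obtain k where k: "rev_charpoly ?C = [:k:]" by (rule degree_eq_zeroE)
  then have "k = 1" using coeff_0_rev_charpoly[of ?C] by simp
  then have "det (\<chi> i j. mat 1 $ i $ j - 1 * ?C $ i $ j) = 1"
    using poly_rev_charpoly[of ?C 1] k by simp
  moreover have "(\<chi> i j. mat 1 $ i $ j - 1 * ?C $ i $ j) = mat 1 - ?C" by (simp add: vec_eq_iff)
  ultimately have "invertible (mat 1 - ?C)" by (simp add: invertible_det_nz)
  then obtain R where R: "R ** (mat 1 - ?C) = mat 1" by (auto simp: invertible_left_inverse)
  have "(mat 1 - ?C) ** ?C = 0"
    by (simp only: CC matrix_diff_rdistrib) simp
  moreover have "R ** 0 = (0 :: complex^'m^'m)" by (simp add: matrix_matrix_mult_def vec_eq_iff)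
  ultimately have "?C = 0" using R by (metis matrix_mul_assoc matrix_mul_lid)
  then show ?thesis by (simp add: vec_eq_iff map_matrix_def)
qed

lemma bilinear_matrix_mult: "bilinear ((**) :: real^'k^'m \<Rightarrow> real^'n^'k \<Rightarrow> real^'n^'m)"
  unfolding bilinear_def
  by (auto intro!: linearI simp: matrix_matrix_mult_def vec_eq_iff algebra_simps sum.distrib sum_distrib_left)

lemmas bounded_bilinear_matrix_mult =
  bilinear_matrix_mult[unfolded bilinear_conv_bounded_bilinear]

lemma bilinear_matrix_vector_mult: "bilinear ((*v) :: real^'k^'m \<Rightarrow> real^'k \<Rightarrow> real^'m)"
  unfolding bilinear_def
  by (auto intro!: linearI simp: matrix_vector_mult_def vec_eq_iff algebra_simps sum.distrib sum_distrib_left)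

lemmas bounded_bilinear_matrix_vector_mult =
  bilinear_matrix_vector_mult[unfolded bilinear_conv_bounded_bilinear]

lemma linear_trace: "linear (trace :: real^'m^'m \<Rightarrow> real)"
  by (auto intro!: linearI simp: trace_def sum.distrib sum_distrib_left)

lemma linear_trace_mult: "linear (\<lambda>a. trace (a ** (b::real^'m^'m)))"
  using linear_compose[OF _ linear_trace, of "\<lambda>a. a ** b"] bilinear_matrix_mult
  unfolding bilinear_def o_def by blast

lemma linear_trace_mult': "linear (\<lambda>a. trace ((b::real^'m^'m) ** a))"
  by (subst trace_mul_sym) (rule linear_trace_mult)

section \<open>The radical of the trace form on the algebra spanned by a matrix monoid\<close>

locale matrix_monoid =
  fixes S :: "(real^'m^'m) set"
  assumes one: "mat 1 \<in> S" and mult: "a \<in> S \<Longrightarrow> b \<in> S \<Longrightarrow> a ** b \<in> S"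
begin

lemma span_mult:
  assumes "a \<in> span S" "b \<in> span S"
  shows "a ** b \<in> span S"
proof -
  have *: "x ** b \<in> span S" if "x \<in> S" for x
    using assms(2)
  proof (induction b rule: span_induct_alt)
    case base
    then show ?case using bilinear_rzero[OF bilinear_matrix_mult] by (auto simp: span_zero)
  next
    case (step c y z)
    then show ?case using that mult
      by (simp add: bilinear_radd[OF bilinear_matrix_mult] bilinear_rmul[OF bilinear_matrix_mult]
          span_add span_scale span_base)
  qed
  show ?thesis using assms(1)
  proof (induction a rule: span_induct_alt)
    case base
    then show ?case using bilinear_lzero[OF bilinear_matrix_mult] by (auto simp: span_zero)
  next
    case (step c y z)
    then show ?case using *
      by (simp add: bilinear_ladd[OF bilinear_matrix_mult] bilinear_lmul[OF bilinear_matrix_mult]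
          span_add span_scale)
  qed
qed

definition rad :: "(real^'m^'m) set" where
  "rad = {a \<in> span S. \<forall>b\<in>span S. trace (a ** b) = 0}"

lemma subspace_rad: "subspace rad"
  unfolding rad_def
  by (rule subspaceI)
    (auto simp: span_zero span_add span_scale linear_0[OF linear_trace]
      linear_add[OF linear_trace_mult] linear_scale[OF linear_trace_mult])

lemma rad_span: "a \<in> rad \<Longrightarrow> a \<in> span S"
  by (simp add: rad_def)

lemma rad_mult_right: "a \<in> rad \<Longrightarrow> b \<in> span S \<Longrightarrow> a ** b \<in> rad"
  by (auto simp: rad_def span_mult matrix_mul_assoc[symmetric])

definition mpow :: "real^'m^'m \<Rightarrow> nat \<Rightarrow> real^'m^'m" where
  "mpow a k = ((**) a ^^ k) (mat 1)"

lemma mpow_0: "mpow a 0 = mat 1" and mpow_Suc: "mpow a (Suc k) = a ** mpow a k"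
  by (simp_all add: mpow_def)

lemma mpow_add: "mpow a (i + j) = mpow a i ** mpow a j"
  by (induction i) (simp_all add: mpow_0 mpow_Suc matrix_mul_assoc)

lemma mpow_span: "a \<in> span S \<Longrightarrow> mpow a k \<in> span S"
  by (induction k) (simp_all add: mpow_0 mpow_Suc span_base one span_mult)

text \<open>A non-nilpotent element of the radical of the trace form would produce, by Fitting's
  argument, a nonzero idempotent in it; but idempotents have trace equal to their rank.\<close>

lemma rad_nilpotent:
  assumes a: "a \<in> rad"
  shows "\<exists>k. mpow a k = 0"
proof -
  \<comment> \<open>Some tail span has least dimension, so the powers from \<open>k\<close> on and
    those from \<open>2*k\<close> on span the same space. Hence \<open>mpow a k\<close> is
    \<open>mpow a (2*k)\<close> times a polynomial \<open>x\<close> in \<open>a\<close>.\<close>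
  define T where "T k = span (mpow a ` {k..})" for k
  have "\<exists>k\<ge>1. \<forall>j\<ge>1. dim (T k) \<le> dim (T j)"
    using ex_has_least_nat[of "\<lambda>k. 1 \<le> k" 1 "\<lambda>k. dim (T k)"] by auto
  then obtain k where k: "k \<ge> 1" "dim (T k) \<le> dim (T (2*k))" by force
  have "T (2*k) \<subseteq> T k" unfolding T_def by (intro span_mono image_mono) auto
  then have "T (2*k) = T k"
    using k(2) by (intro subspace_dim_equal) (auto simp: T_def)
  then have "mpow a k \<in> T (2*k)" by (auto simp: T_def intro: span_base)
  moreover have "mpow a ` {2*k..} = (**) (mpow a (2*k)) ` range (mpow a)"
  proof -
    have "{2*k..} = range (\<lambda>i. 2*k+i)"
      by (auto simp: image_def) (metis le_iff_add)
    then show ?thesis by (simp add: image_image mpow_add)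
  qed
  ultimately have "mpow a k \<in> span ((**) (mpow a (2*k)) ` range (mpow a))"
    by (simp add: T_def)
  moreover have "linear ((**) (mpow a (2*k)))"
    using bilinear_matrix_mult by (auto simp: bilinear_def)
  ultimately have "mpow a k \<in> (**) (mpow a (2*k)) ` span (range (mpow a))"
    by (metis linear_span_image)
  then obtain x where x: "x \<in> span (range (mpow a))" "mpow a k = mpow a (2*k) ** x"
    by (rule imageE)
  have comm: "mpow a k ** x = x ** mpow a k"
    using x(1)
  proof (induction x rule: span_induct_alt)
    case base
    then show ?case using bilinear_lzero[OF bilinear_matrix_mult] bilinear_rzero[OF bilinear_matrix_mult]
      by metis
  next
    case (step c y z)
    have "mpow a k ** y = y ** mpow a k" using step(1) by (auto simp: mpow_add[symmetric] add.commute)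
    then show ?case using step(2)
      by (simp add: bilinear_ladd[OF bilinear_matrix_mult] bilinear_lmul[OF bilinear_matrix_mult]
         bilinear_radd[OF bilinear_matrix_mult] bilinear_rmul[OF bilinear_matrix_mult])
  qed
  \<comment> \<open>Since \<open>x\<close> commutes with \<open>mpow a k\<close>, this is an
    idempotent. As \<open>k \<ge> 1\<close>, a factor \<open>a\<close> can be pulled out in front,
    which places it in \<open>rad\<close>.\<close>
  define e where "e = mpow a k ** x"
  have "e ** e = mpow a k ** (x ** mpow a k) ** x" by (simp add: e_def matrix_mul_assoc)
  also have "\<dots> = mpow a (2*k) ** x ** x" by (simp add: comm[symmetric] mult_2 mpow_add matrix_mul_assoc)
  also have "\<dots> = e" by (simp add: x(2)[symmetric] e_def)
  finally have ee: "e ** e = e" .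
  have xS: "x \<in> span S"
    using x(1) span_minimal[of "range (mpow a)" "span S"] mpow_span[OF rad_span[OF a]]
    by (auto simp: subspace_span)
  obtain k' where "k = Suc k'" using k(1) by (cases k) auto
  then have "e = a ** (mpow a k' ** x)" by (simp add: e_def mpow_Suc matrix_mul_assoc)
  then have "e \<in> rad" using rad_mult_right[OF a] xS mpow_span[OF rad_span[OF a]] span_mult by auto
  then have "trace (e ** mat 1) = 0" using one span_base unfolding rad_def by blast
  then have "e = 0" using idempotent_trace_zero[OF ee] by simp
  have "mpow a k = mpow a k ** e"
    using x(2) by (simp add: e_def mult_2 mpow_add matrix_mul_assoc)
  also have "\<dots> = 0" using \<open>e = 0\<close> bilinear_rzero[OF bilinear_matrix_mult] by auto
  finally show ?thesis by auto
qed

text \<open>If \<open>a\<close> is nilpotent, some power vanishes and \<open>w\<close> itself lies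
  in \<open>U\<close>; this is the contradiction wanted in the next lemma.\<close>

lemma mpow_fix_mod:
  assumes "subspace U" "\<And>u. u \<in> U \<Longrightarrow> a *v u \<in> U" "w - a *v w \<in> U"
  shows "w - mpow a k *v w \<in> U"
proof (induction k)
  case (Suc k)
  have "a *v (w - mpow a k *v w) \<in> U" using Suc assms(2) by blast
  then have "(w - a *v w) + a *v (w - mpow a k *v w) \<in> U"
    using assms(1,3) by (blast intro: subspace_add)
  then show ?case by (simp add: mpow_Suc matrix_vector_mult_diff_distrib matrix_vector_mul_assoc)
qed (use assms(1) in \<open>auto simp: mpow_0 subspace_0\<close>)

text \<open>An argument of Engel type. Take a minimal invariant subspace \<open>W\<close> strictly
  above \<open>U\<close> and \<open>w\<close> in \<open>W\<close> outside \<open>U\<close>. If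
  \<open>rad\<close> does not send \<open>w\<close> into \<open>U\<close>, then \<open>rad\<close>
  applied to \<open>w\<close>, together with \<open>U\<close>, fills \<open>W\<close>, so
  \<open>w = a w + u\<close> with \<open>a\<close> in \<open>rad\<close> and \<open>u\<close> in
  \<open>U\<close>. Iterating contradicts the nilpotency of \<open>a\<close>.\<close>

lemma rad_annihilates_mod:
  assumes U: "subspace U" "U \<noteq> UNIV" and inv: "\<And>a u. a \<in> rad \<Longrightarrow> u \<in> U \<Longrightarrow> a *v u \<in> U"
  shows "\<exists>v. v \<notin> U \<and> (\<forall>a\<in>rad. a *v v \<in> U)"
proof -
  define P where "P W \<longleftrightarrow> subspace W \<and> U \<subset> W \<and> (\<forall>a\<in>rad. \<forall>u\<in>W. a *v u \<in> W)" for W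
  have "P UNIV" using U by (auto simp: P_def)
  then obtain W where W: "P W" "\<And>W'. P W' \<Longrightarrow> dim W \<le> dim W'"
    using ex_has_least_nat[of P UNIV dim] by blast
  then obtain w where w: "w \<in> W" "w \<notin> U" by (auto simp: P_def)
  show ?thesis
  proof (rule ccontr)
    assume contr: "\<not> ?thesis"
    define W' where "W' = {x + y | x y. x \<in> (\<lambda>a. a *v w) ` rad \<and> y \<in> U}"
    have lin: "linear (\<lambda>a. a *v w)" using bilinear_matrix_vector_mult by (auto simp: bilinear_def)
    have sub: "subspace W'" unfolding W'_def
      by (intro subspace_sums linear_subspace_image lin subspace_rad U)
    have "0 \<in> U" using U by (simp add: subspace_0)
    have aw: "a *v w \<in> W'" if "a \<in> rad" for a
    proof -
      have "a *v w = a *v w + 0" by simp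
      then show ?thesis unfolding W'_def using that \<open>0 \<in> U\<close> by blast
    qed
    have UW': "U \<subseteq> W'"
    proof
      fix u assume "u \<in> U"
      moreover have "0 \<in> (\<lambda>a. a *v w) ` rad"
        using subspace_0[OF subspace_rad] by (intro image_eqI[of _ _ 0]) auto
      ultimately show "u \<in> W'" unfolding W'_def by force
    qed
    obtain a where "a \<in> rad" "a *v w \<notin> U" using contr w by auto
    then have "U \<subset> W'" using UW' aw by auto
    moreover have "a *v u \<in> W'" if "a \<in> rad" "u \<in> W'" for a u
    proof -
      obtain b y where "b \<in> rad" "y \<in> U" "u = b *v w + y" using \<open>u \<in> W'\<close> by (auto simp: W'_def)
      moreover from this have "a *v u = (a ** b) *v w + a *v y"
        by (simp add: matrix_vector_right_distrib matrix_vector_mul_assoc)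
      ultimately show ?thesis unfolding W'_def
        using inv[OF \<open>a \<in> rad\<close>] rad_mult_right[OF \<open>a \<in> rad\<close> rad_span[of b]] by auto
    qed
    ultimately have "P W'" using sub by (auto simp: P_def)
    then have "dim W \<le> dim W'" by (rule W(2))
    moreover have "W' \<subseteq> W"
      using W(1) w by (auto simp: W'_def P_def intro!: subspace_add)
    ultimately have "W' = W" using W(1) sub by (intro subspace_dim_equal) (auto simp: P_def)
    then obtain a u where au: "a \<in> rad" "u \<in> U" "w = a *v w + u"
      using w by (auto simp: W'_def)
    then have "w - a *v w \<in> U" by (metis add_diff_cancel_left')
    then have "w - mpow a k *v w \<in> U" for k
      using mpow_fix_mod[OF U(1) inv[OF au(1)]] by blast
    moreover obtain k where "mpow a k = 0" using rad_nilpotent[OF au(1)] by auto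
    ultimately have "w - 0 *v w \<in> U" by metis
    then show False using w by simp
  qed
qed

text \<open>The ascending annihilator series of \<open>rad\<close>: by construction
  \<open>rad\<close> lowers the level by one. The triangular form is thereby available without a
  choice of basis.\<close>

primrec flag :: "nat \<Rightarrow> (real^'m) set" where
  "flag 0 = {0}"
| "flag (Suc k) = {v. \<forall>a\<in>rad. a *v v \<in> flag k}"

lemma subspace_flag: "subspace (flag k)"
proof (induction k)
  case (Suc k)
  then show ?case
    by (auto intro!: subspaceI simp: subspace_0 subspace_add subspace_scale matrix_vector_right_distrib
        matrix_vector_mult_scaleR)
qed (simp add: subspace_def)

lemma flag_mono: "flag k \<subseteq> flag (Suc k)"
  by (induction k) auto

lemma flag_rad: "a \<in> rad \<Longrightarrow> v \<in> flag k \<Longrightarrow> a *v v \<in> flag k"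
  using flag_mono[of k] by auto

text \<open>Multiplying an element of \<open>rad\<close> by \<open>b\<close> on the right stays in
  \<open>rad\<close>, so a vector that \<open>rad\<close> sends one level down is still sent there
  after \<open>b\<close> has been applied.\<close>

lemma flag_span: "b \<in> span S \<Longrightarrow> v \<in> flag k \<Longrightarrow> b *v v \<in> flag k"
  by (cases k) (auto simp: matrix_vector_mul_assoc intro: rad_mult_right)

text \<open>By \<open>rad_annihilates_mod\<close> each level is strictly larger than the one before
  until the whole space is reached.\<close>

lemma flag_dim: "k \<le> dim (flag k) \<or> flag k = UNIV"
proof (induction k)
  case (Suc k)
  show ?case
  proof (cases "flag k = UNIV")
    case True
    then show ?thesis using flag_mono[of k] by auto
  next
    case False
    obtain v where "v \<notin> flag k" "\<forall>a\<in>rad. a *v v \<in> flag k"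
      using rad_annihilates_mod[OF subspace_flag False flag_rad] by blast
    then have "flag k \<subset> flag (Suc k)" using flag_mono[of k] by auto
    then have "span (flag k) \<subset> span (flag (Suc k))"
      using subspace_flag span_eq_iff by metis
    then have "dim (flag k) < dim (flag (Suc k))" by (rule dim_psubset)
    then show ?thesis using Suc False by auto
  qed
qed simp

lemma flag_UNIV: "flag CARD('m) = UNIV"
proof -
  have "flag CARD('m) = UNIV" if "CARD('m) \<le> dim (flag CARD('m))"
    using that subspace_dim_equal[of "flag CARD('m)" UNIV] subspace_flag by simp
  then show ?thesis using flag_dim[of "CARD('m)"] by auto
qed

text \<open>\<open>n\<close> is the orthogonal projection of \<open>X\<close> to \<open>rad\<close>.
  On the orthogonal complement of \<open>rad\<close> in the algebra the trace form is injective,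
  hence bounded below in finite dimension. The basis is taken inside \<open>S\<close>, so that
  \<open>X ** b\<close> is again a product whenever \<open>X\<close> is one.\<close>

lemma decompose_mod_rad:
  obtains B e where "finite B" "B \<subseteq> S" "e > 0"
    "\<And>X. X \<in> span S \<Longrightarrow> \<exists>n\<in>rad. X - n \<in> span S \<and> e * norm (X - n) \<le> (\<Sum>b\<in>B. \<bar>trace (X ** b)\<bar> * norm b)"
proof -
  obtain B where B: "B \<subseteq> S" "independent B" "S \<subseteq> span B" "card B = dim S"
    using basis_exists by blast
  have fin: "finite B" using B(2) by (rule independent_imp_finite)
  have spanB: "span B = span S" using span_mono[OF B(1)] span_mono[OF B(3)] by (simp add: span_span)
  \<comment> \<open>The traces against the basis, packed into one linear map whose kernel in
    \<open>span S\<close> is \<open>rad\<close>.\<close>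
  define f where "f X = (\<Sum>b\<in>B. trace (X ** b) *\<^sub>R b)" for X
  have f: "linear f" unfolding f_def
    by (intro linear_compose_sum ballI linearI)
      (simp_all add: linear_add[OF linear_trace_mult] linear_scale[OF linear_trace_mult] scaleR_add_left)
  define V where "V = {x \<in> span S. \<forall>w\<in>rad. orthogonal x w}"
  have V: "subspace V" unfolding V_def
    by (intro subspaceI) (auto simp: span_zero span_add span_scale orthogonal_def inner_add_left)
  have "x = 0" if "x \<in> V" "f x = 0" for x
  proof -
    have "trace (x ** b) = 0" if "b \<in> B" for b
      using \<open>f x = 0\<close> independentD[OF B(2) fin order_refl _ that] by (auto simp: f_def)
    then have "trace (x ** b) = 0" if "b \<in> span B" for b
      using linear_eq_0_on_span[OF linear_trace_mult', of B x] that by auto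
    then have "x \<in> rad" using \<open>x \<in> V\<close> by (auto simp: rad_def V_def spanB)
    then show "x = 0" using \<open>x \<in> V\<close> by (auto simp: V_def orthogonal_def)
  qed
  then obtain e where e: "e > 0" "\<And>x. x \<in> V \<Longrightarrow> norm (f x) \<ge> e * norm x"
    using injective_imp_isometric[OF closed_subspace[OF V] V linear_conv_bounded_linear[THEN iffD1, OF f]]
    by blast
  have "\<exists>n\<in>rad. X - n \<in> span S \<and> e * norm (X - n) \<le> (\<Sum>b\<in>B. \<bar>trace (X ** b)\<bar> * norm b)"
    if X: "X \<in> span S" for X
  proof -
    obtain y z where yz: "y \<in> span rad" "\<And>w. w \<in> span rad \<Longrightarrow> orthogonal z w" "X = y + z"
      using orthogonal_subspace_decomp_exists[of rad X] by blast
    have y: "y \<in> rad" using yz(1) subspace_rad span_eq_iff by metis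
    have z: "z = X - y" using yz by simp
    have zS: "z \<in> span S" unfolding z by (intro span_diff X rad_span y)
    then have "z \<in> V" using yz(2) by (auto simp: V_def span_base)
    have tr: "trace (z ** b) = trace (X ** b)" if "b \<in> B" for b
    proof -
      have "trace (y ** b) = 0" using y that B(1) span_base by (auto simp: rad_def)
      then show ?thesis by (simp add: z linear_diff[OF linear_trace_mult])
    qed
    have "e * norm z \<le> norm (f z)" using e(2) \<open>z \<in> V\<close> by auto
    also have "\<dots> \<le> (\<Sum>b\<in>B. \<bar>trace (X ** b)\<bar> * norm b)"
      unfolding f_def by (rule order_trans[OF norm_sum]) (simp add: tr)
    finally show ?thesis using y z zS by auto
  qed
  then show ?thesis using that fin B(1) e(1) by blast
qed

end

section \<open>Joint spectral radius and adapted norms\<close>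

lemma foldr_matrix_mult_append:
  "foldr (**) (As @ Bs) (mat 1) = foldr (**) As (mat 1) ** foldr (**) Bs (mat 1)"
  by (induction As) (simp_all add: matrix_mul_assoc)

lemma matrix_products_0: "matrix_products \<A> 0 = {mat 1}"
  by (auto simp: matrix_products_def)

lemma matrix_products_add: "matrix_products \<A> (i + j) =
    {X ** Y | X Y. X \<in> matrix_products \<A> i \<and> Y \<in> matrix_products \<A> j}"
proof (intro subset_antisym subsetI)
  fix Z assume "Z \<in> matrix_products \<A> (i + j)"
  then obtain As where As: "Z = foldr (**) As (mat 1)" "length As = i + j" "set As \<subseteq> \<A>"
    by (auto simp: matrix_products_def)
  then have "Z = foldr (**) (take i As) (mat 1) ** foldr (**) (drop i As) (mat 1)"
    by (metis append_take_drop_id foldr_matrix_mult_append)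
  moreover have "set (take i As) \<subseteq> \<A>" "set (drop i As) \<subseteq> \<A>"
    using As(3) set_take_subset[of i As] set_drop_subset[of i As] by auto
  moreover have "length (take i As) = i" "length (drop i As) = j" using As(2) by auto
  ultimately show "Z \<in> {X ** Y | X Y. X \<in> matrix_products \<A> i \<and> Y \<in> matrix_products \<A> j}"
    unfolding matrix_products_def by blast
next
  fix Z assume "Z \<in> {X ** Y | X Y. X \<in> matrix_products \<A> i \<and> Y \<in> matrix_products \<A> j}"
  then obtain As Bs where "Z = foldr (**) (As @ Bs) (mat 1)" "length (As @ Bs) = i + j" "set (As @ Bs) \<subseteq> \<A>"
    by (auto simp: matrix_products_def foldr_matrix_mult_append simp del: foldr_append)
  then show "Z \<in> matrix_products \<A> (i + j)" unfolding matrix_products_def by blast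
qed

lemma matrix_products_1: "matrix_products \<A> (Suc 0) = \<A>"
proof (intro subset_antisym subsetI)
  fix A assume "A \<in> \<A>"
  then show "A \<in> matrix_products \<A> (Suc 0)"
    unfolding matrix_products_def by (auto intro!: exI[of _ "[A]"])
qed (auto simp: matrix_products_def length_Suc_conv)

lemma matrix_products_Suc: "matrix_products \<A> (Suc j) =
    {X ** A | X A. X \<in> matrix_products \<A> j \<and> A \<in> \<A>}"
  using matrix_products_add[of \<A> j "Suc 0"] by (simp add: matrix_products_1)

lemma finite_matrix_products: "finite \<A> \<Longrightarrow> finite (matrix_products \<A> j)"
proof (induction j)
  case (Suc j)
  have "matrix_products \<A> (Suc j) = (\<lambda>(X, A). X ** A) ` (matrix_products \<A> j \<times> \<A>)"
    by (auto simp: matrix_products_Suc)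
  then show ?case using Suc by simp
qed (simp add: matrix_products_0)

text \<open>Blocks of length \<open>L\<close> become the new letters, so that an estimate per block
  can be iterated.\<close>

lemma matrix_products_mult:
  "matrix_products \<A> (L * N) \<subseteq> matrix_products (matrix_products \<A> L) N"
proof (induction N)
  case (Suc N)
  have "matrix_products \<A> (L * Suc N) = {X ** A | X A. X \<in> matrix_products \<A> (L * N) \<and> A \<in> matrix_products \<A> L}"
    using matrix_products_add[of \<A> "L * N" L] by (simp add: add.commute)
  then show ?case using Suc unfolding matrix_products_Suc by blast
qed (simp add: matrix_products_0)

lemma joint_spectral_radius_bound:
  fixes \<A> :: "(real^'m^'m) set"
  assumes "finite \<A>" "joint_spectral_radius \<A> < 1"
  obtains r J where "0 < r" "r < 1"
    "\<And>j X. j \<ge> J \<Longrightarrow> X \<in> matrix_products \<A> j \<Longrightarrow> spectral_radius X \<le> r ^ j"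
proof -
  let ?s = "\<lambda>j. SUP A\<in>matrix_products \<A> j. spectral_radius A"
  obtain x where x: "joint_spectral_radius \<A> < ereal x" "ereal x < 1"
    using ereal_dense2[OF assms(2)] by auto
  have "eventually (\<lambda>j. ereal (root j (?s j)) < ereal x) sequentially"
    using x(1) unfolding joint_spectral_radius_def by (rule Limsup_lessD)
  then obtain J where J: "\<And>j. j \<ge> J \<Longrightarrow> root j (?s j) < x"
    by (auto simp: eventually_sequentially)
  \<comment> \<open>The maximum keeps the rate positive even if \<open>x\<close> is not.\<close>
  define r where "r = max x (1/2)"
  have r: "0 < r" "r < 1" using x(2) by (auto simp: r_def one_ereal_def)
  \<comment> \<open>The index must be at least 1: \<open>root 0\<close> is constantly 0, and its
    power does not recover the argument.\<close>
  have "spectral_radius X \<le> r ^ j" if "j \<ge> max J 1" "X \<in> matrix_products \<A> j" for j X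
  proof -
    have "spectral_radius X \<le> ?s j"
      using that finite_matrix_products[OF assms(1)]
      by (intro cSUP_upper) (auto intro: bdd_above_finite)
    also have "?s j \<le> r ^ j"
    proof (cases "?s j \<ge> 0")
      case True
      then have "?s j = root j (?s j) ^ j" using that by (simp add: real_root_pow_pos2)
      also have "\<dots> \<le> r ^ j"
        using J[of j] that True by (intro power_mono) (auto simp: r_def real_root_ge_zero)
      finally show ?thesis .
    next
      case False
      then show ?thesis using r by (smt (verit) zero_le_power)
    qed
    finally show ?thesis .
  qed
  then show ?thesis using that r by blast
qed

text \<open>The factor applied first to the vector is split into \<open>n\<close> and
  \<open>Y - n\<close>. The part \<open>n\<close> drops to the level below, where decay is known by
  induction, and \<open>Y - n\<close> keeps the level but halves the norm. This convolves two
  geometric sequences, so a rate above both survives.\<close>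

theorem (in matrix_monoid) flag_decay:
  assumes \<T>: "\<And>X. X \<in> \<T> \<Longrightarrow> X \<in> span S \<and>
      (\<exists>n\<in>rad. (\<forall>v. norm (n *v v) \<le> D * norm v) \<and> (\<forall>v. norm ((X - n) *v v) \<le> norm v / 2))"
    and D: "0 \<le> D"
  shows "\<exists>C \<theta>. 0 \<le> C \<and> 0 < \<theta> \<and> \<theta> < 1 \<and>
    (\<forall>N. \<forall>X\<in>matrix_products \<T> N. \<forall>v\<in>flag k. norm (X *v v) \<le> C * \<theta> ^ N * norm v)"
proof (induction k)
  case 0
  show ?case by (rule exI[of _ 1], rule exI[of _ "1/2"]) (auto simp: )
next
  case (Suc k)
  then obtain C \<theta> where C: "0 \<le> C" "0 < \<theta>" "\<theta> < 1"
    and IH: "\<And>N X v. X \<in> matrix_products \<T> N \<Longrightarrow> v \<in> flag k \<Longrightarrow> norm (X *v v) \<le> C * \<theta> ^ N * norm v"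
    by blast
  \<comment> \<open>The rate is strictly above \<open>1/2\<close>, which leaves room for the
    contribution of the lower level; \<open>C'\<close> is chosen so that
    \<open>C * D + C' / 2 \<le> C' * \<theta>'\<close>, which closes the induction over
    \<open>N\<close>.\<close>
  define \<theta>' where "\<theta>' = (max (1/2) \<theta> + 1) / 2"
  have \<theta>': "1/2 < \<theta>'" "\<theta> \<le> \<theta>'" "\<theta>' < 1" using C by (auto simp: \<theta>'_def max_def)
  define C' where "C' = max 1 (C * D / (\<theta>' - 1/2))"
  have "C * D = C * D / (\<theta>' - 1/2) * (\<theta>' - 1/2)" using \<theta>' by simp
  also have "\<dots> \<le> C' * (\<theta>' - 1/2)" using \<theta>' by (intro mult_right_mono) (auto simp: C'_def)
  finally have CD: "C * D + C' / 2 \<le> C' * \<theta>'" by (simp add: algebra_simps)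
  have C': "1 \<le> C'" by (simp add: C'_def)
  have "norm (X *v v) \<le> C' * \<theta>' ^ N * norm v"
    if "X \<in> matrix_products \<T> N" "v \<in> flag (Suc k)" for N X v
    using that
  proof (induction N arbitrary: X v)
    case 0
    then show ?case using C' by (simp add: matrix_products_0 mult_right_mono[of 1 C' "norm v", simplified])
  next
    case (Suc N)
    then obtain X' Y where X': "X = X' ** Y" "X' \<in> matrix_products \<T> N" "Y \<in> \<T>"
      by (auto simp: matrix_products_Suc)
    obtain n where n: "n \<in> rad" "\<And>v. norm (n *v v) \<le> D * norm v"
      "\<And>v. norm ((Y - n) *v v) \<le> norm v / 2" and Y: "Y \<in> span S"
      using \<T>[OF X'(3)] by blast
    have "Y - n \<in> span S" using Y n(1) by (simp add: span_diff rad_span)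
    then have s: "(Y - n) *v v \<in> flag (Suc k)" using Suc.prems(2) by (rule flag_span)
    have nv: "n *v v \<in> flag k" using n(1) Suc.prems(2) by simp
    have "X *v v = X' *v (n *v v) + X' *v ((Y - n) *v v)"
      by (simp add: X'(1) matrix_vector_mul_assoc[symmetric] matrix_vector_mult_diff_rdistrib
          matrix_vector_mult_diff_distrib)
    then have "norm (X *v v) \<le> norm (X' *v (n *v v)) + norm (X' *v ((Y - n) *v v))"
      by (metis norm_triangle_ineq)
    also have "\<dots> \<le> C * \<theta> ^ N * (D * norm v) + C' * \<theta>' ^ N * (norm v / 2)"
      using C C' \<theta>' n(2,3)[of v]
      by (intro add_mono order_trans[OF IH[OF X'(2) nv]] order_trans[OF Suc.IH[OF X'(2) s]] mult_left_mono) auto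
    also have "\<dots> \<le> C * \<theta>' ^ N * (D * norm v) + C' * \<theta>' ^ N * (norm v / 2)"
      using C D \<theta>' by (intro add_right_mono mult_right_mono mult_left_mono power_mono) auto
    also have "\<dots> = (C * D + C' / 2) * (\<theta>' ^ N * norm v)" by (simp add: algebra_simps)
    also have "\<dots> \<le> C' * \<theta>' * (\<theta>' ^ N * norm v)"
      using CD \<theta>' by (intro mult_right_mono) auto
    finally show ?case by (simp add: algebra_simps)
  qed
  then show ?case using C' \<theta>' by (intro exI[of _ C'] exI[of _ \<theta>']) auto
qed

text \<open>Decay of eigenvalues is upgraded to decay of norms, the nontrivial half of the
  Berger-Wang theorem. Long products lie close to \<open>rad\<close>; taking them as letters makes
  \<open>flag_decay\<close> applicable, and the top level of the flag is the whole space.\<close>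

theorem joint_spectral_radius_contraction:
  fixes \<A> :: "(real^'m^'m) set"
  assumes fin: "finite \<A>" and jsr: "joint_spectral_radius \<A> < 1"
  obtains N where "N \<ge> 1" "\<And>X v. X \<in> matrix_products \<A> N \<Longrightarrow> norm (X *v v) \<le> norm v / 2"
proof -
  obtain r J where r: "0 < r" "r < 1"
    and rJ: "\<And>j X. j \<ge> J \<Longrightarrow> X \<in> matrix_products \<A> j \<Longrightarrow> spectral_radius X \<le> r ^ j"
    using joint_spectral_radius_bound[OF assms] by blast
  have tr: "\<bar>trace X\<bar> \<le> CARD('m) * r ^ j" if "j \<ge> J" "X \<in> matrix_products \<A> j" for j X
    using rJ[OF that] cmod_eigenvalue_le[of _ X] r by (intro abs_trace_le) (auto intro: order_trans)
  define S where "S = (\<Union>j. matrix_products \<A> j)"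
  interpret matrix_monoid S
  proof
    show "mat 1 \<in> S" using matrix_products_0[of \<A>] unfolding S_def by blast
    show "a ** b \<in> S" if "a \<in> S" "b \<in> S" for a b
      using that matrix_products_add[of \<A>] unfolding S_def by blast
  qed
  obtain B e where B: "finite B" "B \<subseteq> S" "e > 0" "\<And>X. X \<in> span S \<Longrightarrow>
      \<exists>n\<in>rad. X - n \<in> span S \<and> e * norm (X - n) \<le> (\<Sum>b\<in>B. \<bar>trace (X ** b)\<bar> * norm b)"
    using decompose_mod_rad by blast
  define C where "C = CARD('m) * (\<Sum>b\<in>B. norm b) / e"
  have small: "\<exists>n\<in>rad. norm (X - n) \<le> C * r ^ L" if L: "L \<ge> J" "X \<in> matrix_products \<A> L" for L X
  proof -
    have "X \<in> span S" using L(2) by (auto simp: S_def intro: span_base)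
    then obtain n where n: "n \<in> rad" "e * norm (X - n) \<le> (\<Sum>b\<in>B. \<bar>trace (X ** b)\<bar> * norm b)"
      using B(4) by blast
    have "(\<Sum>b\<in>B. \<bar>trace (X ** b)\<bar> * norm b) \<le> (\<Sum>b\<in>B. (CARD('m) * r ^ L) * norm b)"
    proof (intro sum_mono mult_right_mono)
      fix b assume "b \<in> B"
      then obtain l where "b \<in> matrix_products \<A> l" using B(2) by (auto simp: S_def)
      \<comment> \<open>Multiplication by a basis element only lengthens the product, and a longer
        product has the better trace bound.\<close>
      then have "X ** b \<in> matrix_products \<A> (L + l)" using L(2) by (auto simp: matrix_products_add)
      then have "\<bar>trace (X ** b)\<bar> \<le> CARD('m) * r ^ (L + l)" using L(1) by (intro tr) auto
      also have "\<dots> \<le> CARD('m) * r ^ L" using r by (intro mult_left_mono power_decreasing) auto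
      finally show "\<bar>trace (X ** b)\<bar> \<le> CARD('m) * r ^ L" .
    qed simp
    also have "\<dots> = e * (C * r ^ L)"
      using B(3) by (simp add: C_def sum_distrib_left[symmetric])
    finally have "e * norm (X - n) \<le> e * (C * r ^ L)" using n(2) by linarith
    then show ?thesis using n(1) B(3) by auto
  qed
  obtain K where K: "K > 0" "\<And>(A::real^'m^'m) x. norm (A *v x) \<le> norm A * norm x * K"
    using bounded_bilinear.pos_bounded[OF bounded_bilinear_matrix_vector_mult] by blast
  have C0: "0 \<le> C" using B(3) by (auto simp: C_def intro!: divide_nonneg_pos mult_nonneg_nonneg sum_nonneg)
  have "(\<lambda>L. K * (C * r ^ L)) \<longlonglongrightarrow> K * (C * 0)"
    by (intro tendsto_mult tendsto_const LIMSEQ_power_zero) (use r in auto)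
  then have "eventually (\<lambda>L. K * (C * r ^ L) < 1/2) sequentially"
    by (rule order_tendstoD) simp
  then have "eventually (\<lambda>L. K * (C * r ^ L) < 1/2 \<and> L \<ge> max J 1) sequentially"
    using eventually_ge_at_top by (rule eventually_conj)
  \<comment> \<open>For this \<open>L\<close> the part of a block outside \<open>rad\<close> has
    operator norm below \<open>1/2\<close>.\<close>
  then obtain L where L: "K * (C * r ^ L) < 1/2" "L \<ge> J" "L \<ge> 1"
    using eventually_happens'[of sequentially] by auto
  define \<T> where "\<T> = matrix_products \<A> L"
  have "bounded \<T>" unfolding \<T>_def using finite_matrix_products[OF fin] by (rule finite_imp_bounded)
  then obtain b where b: "\<And>X. X \<in> \<T> \<Longrightarrow> norm X \<le> b" "b > 0" by (auto simp: bounded_pos)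
  have D: "0 \<le> K * (b + C * r ^ L)" using K b C0 r by simp
  have \<T>: "X \<in> span S \<and> (\<exists>n\<in>rad. (\<forall>v. norm (n *v v) \<le> K * (b + C * r ^ L) * norm v) \<and>
      (\<forall>v. norm ((X - n) *v v) \<le> norm v / 2))" if X: "X \<in> \<T>" for X
  proof -
    obtain n where n: "n \<in> rad" "norm (X - n) \<le> C * r ^ L" using small[OF L(2)] X by (auto simp: \<T>_def)
    have "norm n \<le> b + C * r ^ L"
      using norm_triangle_sub[of n X] n(2) b(1)[OF X] by (simp add: norm_minus_commute)
    then have "norm (n *v v) \<le> K * (b + C * r ^ L) * norm v" for v
    proof -
      have "norm (n *v v) \<le> norm n * norm v * K" by (rule K)
      also have "\<dots> \<le> (b + C * r ^ L) * norm v * K"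
        using \<open>norm n \<le> _\<close> K by (intro mult_right_mono) auto
      finally show ?thesis by (simp add: mult_ac)
    qed
    moreover have "norm ((X - n) *v v) \<le> norm v / 2" for v
    proof -
      have "norm ((X - n) *v v) \<le> norm (X - n) * norm v * K" by (rule K)
      also have "\<dots> \<le> (C * r ^ L) * norm v * K" using n(2) K by (intro mult_right_mono) auto
      also have "\<dots> = (K * (C * r ^ L)) * norm v" by (simp add: mult_ac)
      also have "\<dots> \<le> 1/2 * norm v" using L(1) by (intro mult_right_mono) auto
      finally show ?thesis by simp
    qed
    moreover have "X \<in> span S" using X by (auto simp: \<T>_def S_def intro: span_base)
    ultimately show ?thesis using n(1) by blast
  qed
  obtain C1 \<theta> where C1: "0 \<le> C1" "0 < \<theta>" "\<theta> < 1"
    "\<And>N X v. X \<in> matrix_products \<T> N \<Longrightarrow> norm (X *v v) \<le> C1 * \<theta> ^ N * norm v"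
  proof -
    have "\<exists>C \<theta>. 0 \<le> C \<and> 0 < \<theta> \<and> \<theta> < 1 \<and>
        (\<forall>N. \<forall>X\<in>matrix_products \<T> N. \<forall>v\<in>flag CARD('m). norm (X *v v) \<le> C * \<theta> ^ N * norm v)"
      by (rule flag_decay[OF \<T> D])
    then show ?thesis unfolding flag_UNIV using that by blast
  qed
  have "(\<lambda>N. C1 * \<theta> ^ N) \<longlonglongrightarrow> C1 * 0"
    by (intro tendsto_mult tendsto_const LIMSEQ_power_zero) (use C1 in auto)
  then have "eventually (\<lambda>N. C1 * \<theta> ^ N < 1/2) sequentially"
    by (rule order_tendstoD) simp
  then have "eventually (\<lambda>N. C1 * \<theta> ^ N < 1/2 \<and> N \<ge> 1) sequentially"
    using eventually_ge_at_top by (rule eventually_conj)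
  then obtain N where N: "C1 * \<theta> ^ N < 1/2" "N \<ge> 1"
    using eventually_happens'[of sequentially] by auto
  show ?thesis
  proof (rule that[of "L * N"])
    show "L * N \<ge> 1" using L N by (simp add: Suc_le_eq)
    fix X v assume "X \<in> matrix_products \<A> (L * N)"
    then have "norm (X *v v) \<le> C1 * \<theta> ^ N * norm v"
      using matrix_products_mult C1(4) unfolding \<T>_def by blast
    also have "\<dots> \<le> 1/2 * norm v" using N by (intro mult_right_mono) auto
    finally show "norm (X *v v) \<le> norm v / 2" by simp
  qed
qed

text \<open>The adapted norm is the maximum of \<open>\<lambda>\<^sup>-\<^sup>k \<parallel>X v\<parallel>\<close> over the products \<open>X\<close> of \<open>k < N\<close> factors,
  where \<open>\<lambda>\<^sup>N = 1/2\<close>.\<close>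

theorem adapted_norm:
  fixes \<A> :: "(real^'m^'m) set"
  assumes fin: "finite \<A>" and jsr: "joint_spectral_radius \<A> < 1"
  obtains nrm :: "real^'m \<Rightarrow> real" and lam C :: real where "0 < lam" "lam < 1" "0 < C"
    "\<And>x. norm x \<le> nrm x" "\<And>x. nrm x \<le> C * norm x" "\<And>x y. nrm (x + y) \<le> nrm x + nrm y"
    "\<And>c x. 0 \<le> c \<Longrightarrow> nrm (c *\<^sub>R x) \<le> c * nrm x"
    "\<And>B x. B \<in> \<A> \<Longrightarrow> nrm (B *v x) \<le> lam * nrm x"
proof -
  obtain N where N: "N \<ge> 1" and half: "\<And>X v. X \<in> matrix_products \<A> N \<Longrightarrow> norm (X *v v) \<le> norm v / 2"
    using joint_spectral_radius_contraction[OF assms] by blast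
  define lam where "lam = root N (1/2)"
  have lam: "0 < lam" "lam < 1" "lam ^ N = 1/2"
    using N by (auto simp: lam_def real_root_pow_pos2)
  define I where "I = (SIGMA k:{..<N}. matrix_products \<A> k)"
  have I: "finite I" "(0, mat 1) \<in> I"
    using N finite_matrix_products[OF fin] by (auto simp: I_def matrix_products_0)
  define h where "h x = (\<lambda>(k::nat, X::real^'m^'m). norm (X *v x) / lam ^ k)" for x
  define nrm where "nrm x = Max (h x ` I)" for x
  have up: "norm (X *v x) / lam ^ k \<le> nrm x" if "k < N" "X \<in> matrix_products \<A> k" for k X x
    unfolding nrm_def using I that by (intro Max_ge) (auto simp: I_def h_def image_iff split_beta intro!: bexI[of _ "(k, X)"])
  have leI: "nrm x \<le> c" if "\<And>k X. k < N \<Longrightarrow> X \<in> matrix_products \<A> k \<Longrightarrow> norm (X *v x) / lam ^ k \<le> c" for x c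
    unfolding nrm_def using I that by (subst Max_le_iff) (auto simp: I_def h_def)
  obtain K where K: "K > 0" "\<And>(A::real^'m^'m) x. norm (A *v x) \<le> norm A * norm x * K"
    using bounded_bilinear.pos_bounded[OF bounded_bilinear_matrix_vector_mult] by blast
  define C where "C = 1 + (\<Sum>(k, X)\<in>I. norm X * K / lam ^ k)"
  have terms: "0 \<le> norm X * K / lam ^ k" for k and X :: "real^'m^'m" using lam K by simp
  have ge: "norm x \<le> nrm x" for x
    using up[of 0 "mat 1" x] N by (simp add: matrix_products_0)
  show ?thesis
  proof (rule that[of lam C nrm])
    show "0 < C" unfolding C_def using terms by (auto intro!: add_pos_nonneg sum_nonneg)
    show "norm x \<le> nrm x" for x by (rule ge)
    show "nrm x \<le> C * norm x" for x
    proof (rule leI)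
      fix k X assume kX: "k < N" "X \<in> matrix_products \<A> k"
      have "norm X * K / lam ^ k \<le> (\<Sum>(k, X)\<in>I. norm X * K / lam ^ k)"
        using member_le_sum[of "(k, X)" I "\<lambda>(k, X). norm X * K / lam ^ k"] kX I terms by (auto simp: I_def)
      then have "norm X * K / lam ^ k * norm x \<le> C * norm x"
        unfolding C_def by (intro mult_right_mono) auto
      moreover have "norm (X *v x) / lam ^ k \<le> norm X * norm x * K / lam ^ k"
        using K(2)[of X x] lam by (intro divide_right_mono) auto
      ultimately show "norm (X *v x) / lam ^ k \<le> C * norm x" by (simp add: mult_ac)
    qed
    show "nrm (x + y) \<le> nrm x + nrm y" for x y
    proof (rule leI)
      fix k X assume kX: "k < N" "X \<in> matrix_products \<A> k"
      have "norm (X *v (x + y)) / lam ^ k \<le> norm (X *v x) / lam ^ k + norm (X *v y) / lam ^ k"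
        using lam by (simp add: matrix_vector_right_distrib add_divide_distrib[symmetric] divide_right_mono norm_triangle_ineq)
      then show "norm (X *v (x + y)) / lam ^ k \<le> nrm x + nrm y"
        using up[OF kX, of x] up[OF kX, of y] by linarith
    qed
    show "nrm (c *\<^sub>R x) \<le> c * nrm x" if "0 \<le> c" for c x
    proof (rule leI)
      fix k X assume kX: "k < N" "X \<in> matrix_products \<A> k"
      have "norm (X *v (c *\<^sub>R x)) / lam ^ k = c * (norm (X *v x) / lam ^ k)"
        using that by (simp add: matrix_vector_mult_scaleR)
      then show "norm (X *v (c *\<^sub>R x)) / lam ^ k \<le> c * nrm x"
        using up[OF kX, of x] that by (simp only: mult_left_mono)
    qed
    show "nrm (B *v x) \<le> lam * nrm x" if "B \<in> \<A>" for B x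
    proof (rule leI)
      fix k X assume kX: "k < N" "X \<in> matrix_products \<A> k"
      have XB: "X ** B \<in> matrix_products \<A> (Suc k)" using kX that by (auto simp: matrix_products_Suc)
      have eq: "norm (X *v (B *v x)) / lam ^ k = lam * (norm ((X ** B) *v x) / lam ^ Suc k)"
        using lam by (simp add: matrix_vector_mul_assoc)
      have "norm ((X ** B) *v x) / lam ^ Suc k \<le> nrm x"
      proof (cases "Suc k < N")
        case True
        then show ?thesis using up[OF _ XB] by blast
      next
        \<comment> \<open>A product of \<open>N\<close> factors lies outside the index set. There
          the contraction by \<open>1/2\<close> compensates \<open>lam ^ N\<close> exactly, and the
          bound by the empty product, \<open>norm x \<le> nrm x\<close>, takes over.\<close>
        case False
        then have "Suc k = N" using kX by simp
        then have "lam ^ Suc k = 1/2" "norm ((X ** B) *v x) \<le> norm x / 2"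
          using half[of "X ** B" x] XB lam(3) by auto
        then show ?thesis using ge[of x] unfolding \<open>lam ^ Suc k = 1/2\<close> by simp
      qed
      then show "norm (X *v (B *v x)) / lam ^ k \<le> lam * nrm x"
        unfolding eq using lam by (intro mult_left_mono) auto
    qed
  qed (use lam in auto)
qed

section \<open>The square root of a positive definite matrix\<close>

text \<open>\<open>norm\<close> on matrices is the Frobenius norm, in which a contraction need not
  have norm below 1. The iteration below needs bounds on the operator norm.\<close>

definition op_bound :: "real^'n^'n \<Rightarrow> real \<Rightarrow> bool" where
  "op_bound A c \<longleftrightarrow> (\<forall>x. norm (A *v x) \<le> c * norm x)"

lemma op_bound_add: "op_bound A a \<Longrightarrow> op_bound B b \<Longrightarrow> op_bound (A + B) (a + b)"
  unfolding op_bound_def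
  by (auto simp: matrix_vector_mult_add_rdistrib algebra_simps intro: norm_triangle_le add_mono)

lemma op_bound_mult:
  assumes "op_bound A a" "op_bound B b" "0 \<le> a"
  shows "op_bound (A ** B) (a * b)"
  unfolding op_bound_def
proof
  fix x
  have "norm ((A ** B) *v x) \<le> a * norm (B *v x)"
    using assms(1) by (simp add: op_bound_def matrix_vector_mul_assoc[symmetric])
  also have "\<dots> \<le> a * (b * norm x)"
    using assms by (intro mult_left_mono) (auto simp: op_bound_def)
  finally show "norm ((A ** B) *v x) \<le> a * b * norm x" by simp
qed

lemma op_bound_scaleR: "op_bound A a \<Longrightarrow> op_bound (c *\<^sub>R A) (\<bar>c\<bar> * a)"
  unfolding op_bound_def
  by (simp add: scaleR_matrix_vector_assoc[symmetric] mult.assoc mult_left_mono)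

lemma op_bound_nonneg: "op_bound (A::real^'n^'n) a \<Longrightarrow> 0 \<le> a"
proof -
  assume "op_bound A a"
  then have "norm (A *v axis undefined 1) \<le> a * norm (axis undefined (1::real) :: real^'n)"
    unfolding op_bound_def by blast
  then show ?thesis using norm_ge_zero[of "A *v axis undefined 1"] by (simp only: norm_axis_1)
qed

text \<open>Limits of matrices are taken with respect to \<open>norm\<close>; the crude factor is
  harmless because it does not affect summability.\<close>

lemma op_bound_norm:
  fixes A :: "real^'n^'n" and a :: real
  assumes "op_bound A a"
  shows "norm A \<le> CARD('n) * (CARD('n) * a)"
proof -
  have entry: "\<bar>A $ i $ j\<bar> \<le> a" for i j
  proof -
    have "A *v axis j 1 = column j A" by (rule matrix_vector_mult_basis)
    then have "\<bar>A $ i $ j\<bar> = \<bar>(A *v axis j 1) $ i\<bar>" by (simp add: column_def)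
    also have "\<dots> \<le> norm (A *v axis j 1)" by (rule component_le_norm_cart)
    also have "\<dots> \<le> a * norm (axis j (1::real) :: real^'n)" using assms unfolding op_bound_def by blast
    finally show ?thesis by simp
  qed
  have "norm (A $ i) \<le> CARD('n) * a" for i
  proof -
    have "norm (A $ i) \<le> (\<Sum>j\<in>UNIV. \<bar>A $ i $ j\<bar>)" by (rule norm_le_l1_cart)
    also have "\<dots> \<le> (\<Sum>j\<in>(UNIV::'n set). a)" by (rule sum_mono) (rule entry)
    finally show ?thesis by simp
  qed
  moreover have "norm A \<le> (\<Sum>i\<in>UNIV. norm (A $ i))"
    unfolding norm_vec_def by (rule L2_set_le_sum) simp
  ultimately have "norm A \<le> (\<Sum>i\<in>(UNIV::'n set). CARD('n) * a)"
    by (meson order_trans sum_mono)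
  then show ?thesis by simp
qed

lemma op_bound_lim:
  assumes "X \<longlonglongrightarrow> L" "\<And>k. op_bound (X k) a"
  shows "op_bound L a"
  unfolding op_bound_def
proof
  fix x
  have "(\<lambda>k. X k *v x) \<longlonglongrightarrow> L *v x"
    by (rule bounded_bilinear.tendsto[OF bounded_bilinear_matrix_vector_mult assms(1) tendsto_const])
  then show "norm (L *v x) \<le> a * norm x"
    using assms(2) by (intro Lim_norm_ubound[OF sequentially_bot]) (auto simp: op_bound_def)
qed

text \<open>The iteration \<open>Y \<mapsto> (X + Y\<^sup>2) / 2\<close> converges to \<open>I - (I - X)\<^sup>1\<^sup>/\<^sup>2\<close> when \<open>X\<close> has operator norm
  less than one.\<close>

primrec sqrt_iter :: "real^'n^'n \<Rightarrow> nat \<Rightarrow> real^'n^'n" where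
  "sqrt_iter X 0 = 0"
| "sqrt_iter X (Suc k) = (1/2) *\<^sub>R (X + sqrt_iter X k ** sqrt_iter X k)"

lemma sqrt_iter_converges:
  fixes X :: "real^'n^'n"
  assumes X: "op_bound X q" and q: "q < 1"
  obtains Y where "sqrt_iter X \<longlonglongrightarrow> Y" "op_bound Y (1 - sqrt (1 - q))" "2 *\<^sub>R Y = X + Y ** Y"
proof -
  \<comment> \<open>The smaller fixed point of the scalar iteration
    \<open>s = (q + s * s) / 2\<close>; it bounds all iterates.\<close>
  define s where "s = 1 - sqrt (1 - q)"
  have q0: "0 \<le> q" using X by (rule op_bound_nonneg)
  have s: "0 \<le> s" "s < 1" using q q0 by (auto simp: s_def)
  have ss: "(q + s * s) / 2 = s"
  proof -
    have "q + s * s = 2 * s" using q by (simp add: s_def algebra_simps)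
    then show ?thesis by simp
  qed
  have bnd: "op_bound (sqrt_iter X k) s" for k
  proof (induction k)
    case 0
    then show ?case using s by (simp add: op_bound_def)
  next
    case (Suc k)
    have "op_bound ((1/2) *\<^sub>R (X + sqrt_iter X k ** sqrt_iter X k)) (\<bar>1/2\<bar> * (q + s * s))"
      using Suc X s by (intro op_bound_scaleR op_bound_add op_bound_mult)
    then show ?case using ss by simp
  qed
  have diff: "op_bound (sqrt_iter X (Suc k) - sqrt_iter X k) (s ^ k * (q / 2))" for k
  proof (induction k)
    case 0
    then show ?case using op_bound_scaleR[OF X, of "1/2"]
      by (simp add: bilinear_lzero[OF bilinear_matrix_mult])
  next
    case (Suc k)
    let ?a = "sqrt_iter X (Suc k)" and ?b = "sqrt_iter X k"
    \<comment> \<open>A difference of squares is \<open>a (a - b) + (a - b) b\<close>. Both factors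
      outside the difference are bounded by \<open>s\<close>, so together with \<open>1/2\<close>
      successive differences shrink by the factor \<open>s\<close>.\<close>
    have "sqrt_iter X (Suc (Suc k)) - ?a = (1/2) *\<^sub>R ((X + ?a ** ?a) - (X + ?b ** ?b))"
      by (simp only: sqrt_iter.simps(2)[of X "Suc k"] scaleR_diff_right) simp
    also have "(X + ?a ** ?a) - (X + ?b ** ?b) = ?a ** (?a - ?b) + (?a - ?b) ** ?b"
      by (simp add: bilinear_lsub[OF bilinear_matrix_mult] bilinear_rsub[OF bilinear_matrix_mult] del: sqrt_iter.simps)
    finally have eq: "sqrt_iter X (Suc (Suc k)) - ?a = (1/2) *\<^sub>R (?a ** (?a - ?b) + (?a - ?b) ** ?b)" .
    have "0 \<le> s ^ k * (q/2)" using s q0 by simp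
    then have "op_bound ((1/2) *\<^sub>R (?a ** (?a - ?b) + (?a - ?b) ** ?b))
        (\<bar>1/2\<bar> * (s * (s ^ k * (q/2)) + s ^ k * (q/2) * s))"
      using Suc bnd s by (intro op_bound_scaleR op_bound_add op_bound_mult)
    then show ?case unfolding eq by (simp add: algebra_simps)
  qed
  have "summable (\<lambda>k. sqrt_iter X (Suc k) - sqrt_iter X k)"
  proof (rule summable_comparison_test')
    show "summable (\<lambda>k. CARD('n) * (CARD('n) * (s ^ k * (q / 2))))"
      using s by (intro summable_mult summable_mult2 summable_geometric) simp
    show "norm (sqrt_iter X (Suc k) - sqrt_iter X k) \<le> CARD('n) * (CARD('n) * (s ^ k * (q / 2)))"
      if "0 \<le> k" for k
      by (rule op_bound_norm[OF diff])
  qed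
  then have "(\<lambda>n. \<Sum>k<n. sqrt_iter X (Suc k) - sqrt_iter X k)
      \<longlonglongrightarrow> (\<Sum>k. sqrt_iter X (Suc k) - sqrt_iter X k)"
    by (rule summable_LIMSEQ)
  moreover have "(\<Sum>k<n. sqrt_iter X (Suc k) - sqrt_iter X k) = sqrt_iter X n" for n
    by (subst sum_lessThan_telescope) simp
  ultimately obtain Y where Y: "sqrt_iter X \<longlonglongrightarrow> Y" by auto
  have "(\<lambda>k. (1/2) *\<^sub>R (X + sqrt_iter X k ** sqrt_iter X k)) \<longlonglongrightarrow> (1/2) *\<^sub>R (X + Y ** Y)"
    by (intro tendsto_scaleR tendsto_add tendsto_const bounded_bilinear.tendsto[OF bounded_bilinear_matrix_mult] Y)
  moreover have "(\<lambda>k. (1/2) *\<^sub>R (X + sqrt_iter X k ** sqrt_iter X k)) \<longlonglongrightarrow> Y"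
    using LIMSEQ_Suc[OF Y] by simp
  ultimately have "(1/2) *\<^sub>R (X + Y ** Y) = Y" by (rule LIMSEQ_unique)
  then have "2 *\<^sub>R Y = 2 *\<^sub>R ((1/2) *\<^sub>R (X + Y ** Y))" by simp
  then have "2 *\<^sub>R Y = X + Y ** Y" by simp
  then show ?thesis using that[OF Y] op_bound_lim[OF Y bnd] by (auto simp: s_def)
qed

lemma transpose_add: "transpose (A + B) = transpose A + transpose (B::'a::plus^'n^'m)"
  by (simp add: transpose_def vec_eq_iff)

lemma transpose_diff: "transpose (A - B) = transpose A - transpose (B::'a::minus^'n^'m)"
  by (simp add: transpose_def vec_eq_iff)

lemma transpose_sqrt_iter:
  "transpose X = X \<Longrightarrow> transpose (sqrt_iter X k) = sqrt_iter X k"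
  by (induction k) (simp_all add: transpose_add transpose_scalar matrix_transpose_mul, simp add: transpose_def vec_eq_iff)

lemma commute_sqrt_iter:
  assumes "X ** R = R ** X"
  shows "sqrt_iter X k ** R = R ** sqrt_iter X k"
proof (induction k)
  case 0
  then show ?case by (simp add: bilinear_lzero[OF bilinear_matrix_mult] bilinear_rzero[OF bilinear_matrix_mult])
next
  case (Suc k)
  have "(sqrt_iter X k ** sqrt_iter X k) ** R = R ** (sqrt_iter X k ** sqrt_iter X k)"
    by (metis Suc matrix_mul_assoc)
  then show ?case using assms
    by (simp add: bilinear_ladd[OF bilinear_matrix_mult] bilinear_radd[OF bilinear_matrix_mult]
        bilinear_lmul[OF bilinear_matrix_mult] bilinear_rmul[OF bilinear_matrix_mult])
qed

lemma transpose_lim: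
  fixes X :: "nat \<Rightarrow> real^'n^'n"
  assumes "X \<longlonglongrightarrow> Y"
  shows "(\<lambda>k. transpose (X k)) \<longlonglongrightarrow> transpose Y"
  unfolding transpose_def
  by (intro vec_tendstoI) (simp add: tendsto_vec_nth[OF tendsto_vec_nth[OF assms]])

text \<open>The step length \<open>t = a / b\<^sup>2\<close> minimizes
  \<open>1 - 2 t a + t\<^sup>2 b\<^sup>2\<close>, which bounds the squared operator norm of
  \<open>I - t A\<close>.\<close>

lemma op_bound_contraction:
  fixes A :: "real^'n^'n"
  assumes lo: "\<And>x. a * (norm x)\<^sup>2 \<le> x \<bullet> (A *v x)" and up: "op_bound A b" and a: "0 < a"
  shows "op_bound (mat 1 - (a / b\<^sup>2) *\<^sub>R A) (sqrt (1 - a\<^sup>2 / b\<^sup>2))" "0 < b" "a \<le> b"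
proof -
  have "a * (norm (axis undefined (1::real) :: real^'n))\<^sup>2 \<le>
      (axis undefined 1) \<bullet> (A *v axis undefined 1)" by (rule lo)
  also have "\<dots> \<le> norm (axis undefined (1::real) :: real^'n) * norm (A *v axis undefined 1)"
    by (rule norm_cauchy_schwarz)
  also have "\<dots> \<le> b * norm (axis undefined (1::real) :: real^'n)"
    using up unfolding op_bound_def by (metis norm_axis_1 mult_1)
  finally show ab: "a \<le> b" by simp
  then show b: "0 < b" using a by simp
  have "norm ((mat 1 - (a / b\<^sup>2) *\<^sub>R A) *v x) \<le> sqrt (1 - a\<^sup>2 / b\<^sup>2) * norm x" for x
  proof -
    have "(norm ((mat 1 - (a / b\<^sup>2) *\<^sub>R A) *v x))\<^sup>2 = (norm (x - (a / b\<^sup>2) *\<^sub>R (A *v x)))\<^sup>2"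
      by (simp add: matrix_vector_mult_diff_rdistrib scaleR_matrix_vector_assoc)
    also have "\<dots> = (norm x)\<^sup>2 - 2 * (a / b\<^sup>2) * (x \<bullet> (A *v x)) + (a / b\<^sup>2)\<^sup>2 * (norm (A *v x))\<^sup>2"
      by (simp only: power2_norm_eq_inner) (simp add: algebra_simps inner_commute power2_eq_square)
    also have "\<dots> \<le> (norm x)\<^sup>2 - 2 * (a / b\<^sup>2) * (a * (norm x)\<^sup>2) + (a / b\<^sup>2)\<^sup>2 * (b * norm x)\<^sup>2"
      using lo[of x] up a b by (intro add_mono diff_mono mult_left_mono power_mono) (auto simp: op_bound_def)
    also have "\<dots> = (1 - a\<^sup>2 / b\<^sup>2) * (norm x)\<^sup>2"
      using b by (simp add: field_simps power2_eq_square)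
    finally have "norm ((mat 1 - (a / b\<^sup>2) *\<^sub>R A) *v x) \<le> sqrt ((1 - a\<^sup>2 / b\<^sup>2) * (norm x)\<^sup>2)"
      by (rule real_le_rsqrt)
    then show ?thesis by (simp add: real_sqrt_mult)
  qed
  then show "op_bound (mat 1 - (a / b\<^sup>2) *\<^sub>R A) (sqrt (1 - a\<^sup>2 / b\<^sup>2))" by (simp add: op_bound_def)
qed

lemma symmetric_inner: "transpose A = A \<Longrightarrow> x \<bullet> (A *v y) = (A *v x) \<bullet> (y::real^'n)"
  by (metis dot_lmul_matrix vector_transpose_matrix)

text \<open>\<open>matrix_sqrt\<close> is a definite description. Exhibiting the root as a limit of
  polynomials in \<open>A\<close> gives existence and uniqueness at once, and later measurable
  dependence on \<open>A\<close>.\<close>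

lemma matrix_sqrt_limit:
  fixes A :: "real^'n^'n"
  assumes sym: "transpose A = A" and lo: "\<And>x. a * (norm x)\<^sup>2 \<le> x \<bullet> (A *v x)"
    and up: "op_bound A b" and a: "0 < a"
  shows "pos_def (matrix_sqrt A)" "matrix_sqrt A ** matrix_sqrt A = A"
    "(\<lambda>k. (b / sqrt a) *\<^sub>R (mat 1 - sqrt_iter (mat 1 - (a / b\<^sup>2) *\<^sub>R A) k)) \<longlonglongrightarrow> matrix_sqrt A"
proof -
  let ?X = "mat 1 - (a / b\<^sup>2) *\<^sub>R A"
  note b = op_bound_contraction(2,3)[OF lo up a]
  let ?q = "sqrt (1 - a\<^sup>2 / b\<^sup>2)"
  have q: "?q < 1" using a b by (simp add: power2_eq_square)
  obtain Y where Y: "sqrt_iter ?X \<longlonglongrightarrow> Y" "op_bound Y (1 - sqrt (1 - ?q))" "2 *\<^sub>R Y = ?X + Y ** Y"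
    using sqrt_iter_converges[OF op_bound_contraction(1)[OF lo up a] q] by blast
  \<comment> \<open>Undoes the scaling of \<open>A\<close> that made
    \<open>I - (a / b\<^sup>2) A\<close> a contraction.\<close>
  define c where "c = b / sqrt a"
  have c: "c > 0" "c * c * (a / b\<^sup>2) = 1" using a b by (auto simp: c_def power2_eq_square)
  define R where "R = c *\<^sub>R (mat 1 - Y)"
  have symX: "transpose ?X = ?X" by (simp add: transpose_diff transpose_scalar sym)
  have "transpose Y = Y"
    using LIMSEQ_unique[OF transpose_lim[OF Y(1)]] Y(1) by (simp add: transpose_sqrt_iter[OF symX])
  then have symR: "transpose R = R" by (simp add: R_def transpose_scalar transpose_diff)
  have "0 < x \<bullet> (R *v x)" if "x \<noteq> 0" for x
  proof -
    have "x \<bullet> (Y *v x) \<le> norm x * norm (Y *v x)" by (rule norm_cauchy_schwarz)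
    also have "\<dots> \<le> norm x * ((1 - sqrt (1 - ?q)) * norm x)"
      using Y(2) by (intro mult_left_mono) (auto simp: op_bound_def)
    also have "\<dots> < norm x * (1 * norm x)"
      using that q by (intro mult_strict_left_mono mult_strict_right_mono) auto
    finally have "x \<bullet> (Y *v x) < x \<bullet> x" by (simp add: norm_eq_sqrt_inner)
    then show ?thesis using c(1)
      by (simp add: R_def scaleR_matrix_vector_assoc[symmetric] matrix_vector_mult_diff_rdistrib inner_diff_right)
  qed
  then have pdR: "pos_def R" using symR by (simp add: pos_def_def)
  have "(mat 1 - Y) ** (mat 1 - Y) = mat 1 - 2 *\<^sub>R Y + Y ** Y"
    by (simp add: bilinear_lsub[OF bilinear_matrix_mult] bilinear_rsub[OF bilinear_matrix_mult] scaleR_2)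
  also have "\<dots> = (a / b\<^sup>2) *\<^sub>R A" by (simp add: Y(3))
  finally have RR: "R ** R = A"
    by (simp add: R_def bilinear_lmul[OF bilinear_matrix_mult] bilinear_rmul[OF bilinear_matrix_mult]
        c(2)[unfolded mult.assoc] mult.assoc del: times_divide_eq_right)
  \<comment> \<open>Another root \<open>Q\<close> commutes with \<open>A\<close>, hence with the
    iterates and with their limit. Then \<open>(R + Q) (R - Q) = 0\<close>, while
    \<open>R + Q\<close> is positive definite.\<close>
  have uniq: "Q = R" if Q: "pos_def Q" "Q ** Q = A" for Q
  proof -
    have "A ** Q = Q ** A" using Q(2) by (metis matrix_mul_assoc)
    then have "?X ** Q = Q ** ?X"
      by (simp add: bilinear_lsub[OF bilinear_matrix_mult] bilinear_rsub[OF bilinear_matrix_mult]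
        bilinear_lmul[OF bilinear_matrix_mult] bilinear_rmul[OF bilinear_matrix_mult])
    then have "sqrt_iter ?X k ** Q = Q ** sqrt_iter ?X k" for k by (rule commute_sqrt_iter)
    moreover have "(\<lambda>k. sqrt_iter ?X k ** Q) \<longlonglongrightarrow> Y ** Q" "(\<lambda>k. Q ** sqrt_iter ?X k) \<longlonglongrightarrow> Q ** Y"
      by (intro bounded_bilinear.tendsto[OF bounded_bilinear_matrix_mult] Y(1) tendsto_const)+
    ultimately have "Y ** Q = Q ** Y" using LIMSEQ_unique by simp
    then have comm: "R ** Q = Q ** R"
      by (simp add: R_def bilinear_lsub[OF bilinear_matrix_mult] bilinear_rsub[OF bilinear_matrix_mult]
        bilinear_lmul[OF bilinear_matrix_mult] bilinear_rmul[OF bilinear_matrix_mult])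
    have "(R + Q) ** (R - Q) = 0"
      by (simp add: bilinear_ladd[OF bilinear_matrix_mult] bilinear_rsub[OF bilinear_matrix_mult] RR Q(2) comm)
    then have "(R + Q) *v ((R - Q) *v x) = 0" for x by (simp add: matrix_vector_mul_assoc)
    then have "z \<bullet> (R *v z) + z \<bullet> (Q *v z) = 0" if "z = (R - Q) *v x" for x z
      using that by (metis inner_add_right inner_zero_right matrix_vector_mult_add_rdistrib)
    moreover have "0 < z \<bullet> (R *v z) + z \<bullet> (Q *v z)" if "z \<noteq> 0" for z
      using pdR Q(1) that unfolding pos_def_def by (intro add_pos_pos) auto
    ultimately have "(R - Q) *v x = 0" for x by force
    then have "R - Q = 0" by (simp add: matrix_eq)
    then show "Q = R" by simp
  qed
  have "matrix_sqrt A = R"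
    unfolding matrix_sqrt_def
  proof (rule the_equality)
    show "pos_def R \<and> R ** R = A" using pdR RR by (rule conjI)
    show "Q = R" if "pos_def Q \<and> Q ** Q = A" for Q
      by (rule uniq) (use that in auto)
  qed
  moreover have "(\<lambda>k. c *\<^sub>R (mat 1 - sqrt_iter ?X k)) \<longlonglongrightarrow> R"
    unfolding R_def by (rule tendsto_scaleR[OF tendsto_const tendsto_diff[OF tendsto_const Y(1)]])
  ultimately show "pos_def (matrix_sqrt A)" "matrix_sqrt A ** matrix_sqrt A = A"
    "(\<lambda>k. (b / sqrt a) *\<^sub>R (mat 1 - sqrt_iter ?X k)) \<longlonglongrightarrow> matrix_sqrt A"
    using pdR RR by (auto simp: c_def)
qed

lemma continuous_on_sqrt_iter: "continuous_on UNIV (\<lambda>X. sqrt_iter X k)"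
proof (induction k)
  case (Suc k)
  then show ?case
    by (auto intro!: continuous_intros bounded_bilinear.continuous_on[OF bounded_bilinear_matrix_mult])
qed simp

text \<open>The constants \<open>a\<close> and \<open>b\<close> are common to all \<open>z\<close>,
  so one sequence of continuous maps of \<open>f z\<close> converges to the root pointwise.\<close>

lemma measurable_matrix_sqrt:
  fixes f :: "'x \<Rightarrow> real^'n^'n"
  assumes f: "f \<in> borel_measurable M"
    and "\<And>z. transpose (f z) = f z" "\<And>z x. a * (norm x)\<^sup>2 \<le> x \<bullet> (f z *v x)"
    "\<And>z. op_bound (f z) b" "0 < a"
  shows "(\<lambda>z. matrix_sqrt (f z)) \<in> borel_measurable M"
proof (rule borel_measurable_LIMSEQ_metric)
  show "(\<lambda>k. (b / sqrt a) *\<^sub>R (mat 1 - sqrt_iter (mat 1 - (a / b\<^sup>2) *\<^sub>R f z) k)) \<longlonglongrightarrow> matrix_sqrt (f z)" for z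
    by (rule matrix_sqrt_limit) (use assms in auto)
  have [measurable]: "(\<lambda>X::real^'n^'n. sqrt_iter X k) \<in> borel_measurable borel" for k
    by (intro borel_measurable_continuous_onI continuous_on_sqrt_iter)
  show "(\<lambda>z. (b / sqrt a) *\<^sub>R (mat 1 - sqrt_iter (mat 1 - (a / b\<^sup>2) *\<^sub>R f z) k)) \<in> borel_measurable M" for k
    using f by measurable
qed

text \<open>The squared norm of the root applied to \<open>x\<close> is the quadratic form of
  \<open>A\<close> at \<open>x\<close>.\<close>

lemma matrix_sqrt_bounds:
  fixes A :: "real^'n^'n"
  assumes sym: "transpose A = A" and lo: "\<And>x. a * (norm x)\<^sup>2 \<le> x \<bullet> (A *v x)"
    and up: "op_bound A b" and a: "0 < a"
  shows "sqrt a * norm x \<le> norm (matrix_sqrt A *v x)" "norm (matrix_sqrt A *v x) \<le> sqrt b * norm x"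
proof -
  let ?R = "matrix_sqrt A"
  note R = matrix_sqrt_limit(1,2)[OF assms]
  have sym: "transpose ?R = ?R" using R(1) by (simp add: pos_def_def)
  have eq: "(norm (?R *v x))\<^sup>2 = x \<bullet> (A *v x)"
    by (simp add: power2_norm_eq_inner symmetric_inner[OF sym, symmetric] matrix_vector_mul_assoc R(2))
  have "(sqrt a * norm x)\<^sup>2 \<le> (norm (?R *v x))\<^sup>2"
    using lo[of x] a by (simp add: eq power_mult_distrib)
  then show "sqrt a * norm x \<le> norm (?R *v x)" by (rule power2_le_imp_le) simp
  have "x \<bullet> (A *v x) \<le> norm x * norm (A *v x)" by (rule norm_cauchy_schwarz)
  also have "\<dots> \<le> norm x * (b * norm x)"
    using up by (intro mult_left_mono) (auto simp: op_bound_def)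
  also have "\<dots> = (sqrt b * norm x)\<^sup>2"
    using op_bound_contraction(2)[OF lo up a] by (simp add: power2_eq_square)
  finally show "norm (?R *v x) \<le> sqrt b * norm x"
    unfolding eq[symmetric] by (rule power2_le_imp_le)
      (use op_bound_contraction(2)[OF lo up a] in auto)
qed

lemma pos_def_bounds:
  assumes "pos_def (A::real^'n^'n)"
  obtains a where "a > 0" "\<And>x. a * (norm x)\<^sup>2 \<le> x \<bullet> (A *v x)"
proof -
  have cont: "continuous_on (sphere 0 1) (\<lambda>x. x \<bullet> (A *v x))"
    by (intro continuous_intros matrix_vector_mult_linear_continuous_on)
  have ne: "sphere (0::real^'n) 1 \<noteq> {}"
    using norm_axis_1[of undefined] by (auto simp: sphere_def dist_norm intro!: exI[of _ "axis undefined 1"])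
  obtain m where m: "m \<in> sphere 0 1" "\<And>x. x \<in> sphere 0 1 \<Longrightarrow> m \<bullet> (A *v m) \<le> x \<bullet> (A *v x)"
    using continuous_attains_inf[OF compact_sphere ne cont] by blast
  show ?thesis
  proof (rule that[of "m \<bullet> (A *v m)"])
    have "m \<noteq> 0" using m(1) by auto
    then show "0 < m \<bullet> (A *v m)" using assms by (simp add: pos_def_def)
    show "m \<bullet> (A *v m) * (norm x)\<^sup>2 \<le> x \<bullet> (A *v x)" for x
    proof (cases "x = 0")
      case False
      have "m \<bullet> (A *v m) \<le> ((1 / norm x) *\<^sub>R x) \<bullet> (A *v ((1 / norm x) *\<^sub>R x))"
        using False by (intro m(2)) simp
      also have "\<dots> = (x \<bullet> (A *v x)) / (norm x)\<^sup>2"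
        by (simp add: matrix_vector_mult_scaleR power2_eq_square)
      finally show ?thesis using False by (simp add: field_simps)
    qed simp
  qed
qed

lemma op_bound_exists: "\<exists>b. op_bound (A::real^'n^'n) b"
  unfolding op_bound_def
  using linear_bounded[OF matrix_vector_mul_linear, of A] by (auto simp: mult.commute)

section \<open>Geometric ergodicity of chains with drift and minorization\<close>

lemma space_prob_algebraD:
  assumes "\<mu> \<in> space (prob_algebra S)"
  shows "sets \<mu> = sets S" "prob_space \<mu>" "space \<mu> = space S"
  using assms by (auto simp: space_prob_algebra dest: sets_eq_imp_space_eq)

lemma nn_integral_bind_prob_algebra:
  assumes \<mu>: "\<mu> \<in> space (prob_algebra S)" and N: "N \<in> S \<rightarrow>\<^sub>M prob_algebra T"
    and f: "f \<in> borel_measurable T"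
  shows "(\<integral>\<^sup>+x. f x \<partial>(\<mu> \<bind> N)) = (\<integral>\<^sup>+x. \<integral>\<^sup>+y. f y \<partial>N x \<partial>\<mu>)"
  using measurable_prob_algebraD[OF N] space_prob_algebraD(1)[OF \<mu>]
  by (intro nn_integral_bind[OF f]) (simp cong: measurable_cong_sets)

lemma measurable_nn_integral_kernel:
  assumes "N \<in> S \<rightarrow>\<^sub>M prob_algebra T" "f \<in> borel_measurable T"
  shows "(\<lambda>x. \<integral>\<^sup>+y. f y \<partial>N x) \<in> borel_measurable S"
  using measurable_compose[OF measurable_prob_algebraD[OF assms(1)]
      nn_integral_measurable_subprob_algebra[OF assms(2)]] .

lemma measurable_integral_kernel:
  fixes f :: "_ \<Rightarrow> real"
  assumes "N \<in> S \<rightarrow>\<^sub>M prob_algebra T" "f \<in> borel_measurable T"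
  shows "(\<lambda>x. \<integral>y. f y \<partial>N x) \<in> borel_measurable S"
  using measurable_compose[OF measurable_prob_algebraD[OF assms(1)]
      integral_measurable_subprob_algebra[OF assms(2)]] .

lemma integrable_dominated:
  fixes f W :: "'s \<Rightarrow> real"
  assumes "f \<in> borel_measurable M" "\<And>x. x \<in> space M \<Longrightarrow> \<bar>f x\<bar> \<le> W x" "(\<integral>\<^sup>+x. ennreal (W x) \<partial>M) < \<infinity>"
  shows "integrable M f"
proof (rule integrableI_bounded[OF assms(1)])
  have "(\<integral>\<^sup>+x. ennreal (norm (f x)) \<partial>M) \<le> (\<integral>\<^sup>+x. ennreal (W x) \<partial>M)"
    by (intro nn_integral_mono) (simp add: assms(2) ennreal_leI)
  then show "(\<integral>\<^sup>+x. ennreal (norm (f x)) \<partial>M) < \<infinity>" using assms(3) by (rule order.strict_trans1)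
qed

text \<open>Test functions are unbounded and only dominated by \<open>W\<close>. Positive and
  negative parts are therefore integrated separately as nonnegative functions, and \<open>W\<close>
  makes all these integrals finite.\<close>

lemma integral_bind_prob_algebra:
  fixes f W :: "'s \<Rightarrow> real"
  assumes \<mu>: "\<mu> \<in> space (prob_algebra S)" and N: "N \<in> S \<rightarrow>\<^sub>M prob_algebra T"
    and f: "f \<in> borel_measurable T" and W: "W \<in> borel_measurable T"
    and fW: "\<And>x. x \<in> space T \<Longrightarrow> \<bar>f x\<bar> \<le> W x"
    and fin: "\<And>x. x \<in> space S \<Longrightarrow> (\<integral>\<^sup>+y. ennreal (W y) \<partial>N x) < \<infinity>"
    and fin2: "(\<integral>\<^sup>+x. \<integral>\<^sup>+y. ennreal (W y) \<partial>N x \<partial>\<mu>) < \<infinity>"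
  shows "(\<integral>x. f x \<partial>(\<mu> \<bind> N)) = (\<integral>x. \<integral>y. f y \<partial>N x \<partial>\<mu>)"
    "integrable (\<mu> \<bind> N) f" "integrable \<mu> (\<lambda>x. \<integral>y. f y \<partial>N x)"
proof -
  note s = space_prob_algebraD[OF \<mu>]
  have N': "N x \<in> space (prob_algebra T)" if "x \<in> space S" for x
    using measurable_space[OF N that] .
  have bind: "\<mu> \<bind> N \<in> space (prob_algebra T)"
    using measurable_space[OF measurable_bind_prob_space[OF measurable_ident N]] \<mu> by auto
  have iN: "integrable (N x) f" if "x \<in> space S" for x
    using fin[OF that] fW f space_prob_algebraD[OF N'[OF that]]
    by (intro integrable_dominated[of f _ W]) (auto cong: measurable_cong_sets)
  show ib: "integrable (\<mu> \<bind> N) f"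
    using fin2 fW f W space_prob_algebraD[OF bind]
    by (intro integrable_dominated[of f _ W])
      (auto simp: nn_integral_bind_prob_algebra[OF \<mu> N] cong: measurable_cong_sets)
  have part: "(\<integral>x. enn2real (\<integral>\<^sup>+y. g y \<partial>N x) \<partial>\<mu>) = enn2real (\<integral>\<^sup>+x. g x \<partial>(\<mu> \<bind> N))"
      "integrable \<mu> (\<lambda>x. enn2real (\<integral>\<^sup>+y. g y \<partial>N x))"
    if g[measurable]: "g \<in> borel_measurable T" and gW: "\<And>x. x \<in> space T \<Longrightarrow> g x \<le> ennreal (W x)" for g
  proof -
    have le: "(\<integral>\<^sup>+y. g y \<partial>N x) \<le> (\<integral>\<^sup>+y. ennreal (W y) \<partial>N x)" if "x \<in> space S" for x
      using space_prob_algebraD(3)[OF N'[OF that]] by (intro nn_integral_mono) (simp add: gW)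
    have m: "(\<lambda>x. \<integral>\<^sup>+y. g y \<partial>N x) \<in> borel_measurable \<mu>"
      using measurable_nn_integral_kernel[OF N g] s(1) by (simp cong: measurable_cong_sets)
    have eq: "(\<integral>\<^sup>+x. ennreal (enn2real (\<integral>\<^sup>+y. g y \<partial>N x)) \<partial>\<mu>) = (\<integral>\<^sup>+x. \<integral>\<^sup>+y. g y \<partial>N x \<partial>\<mu>)"
      using le fin s(3) by (intro nn_integral_cong ennreal_enn2real) (auto intro: order.strict_trans1)
    also have "\<dots> = (\<integral>\<^sup>+x. g x \<partial>(\<mu> \<bind> N))"
      by (rule nn_integral_bind_prob_algebra[OF \<mu> N g, symmetric])
    finally show "(\<integral>x. enn2real (\<integral>\<^sup>+y. g y \<partial>N x) \<partial>\<mu>) = enn2real (\<integral>\<^sup>+x. g x \<partial>(\<mu> \<bind> N))"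
      using m by (subst integral_eq_nn_integral) auto
    have "(\<integral>\<^sup>+x. \<integral>\<^sup>+y. g y \<partial>N x \<partial>\<mu>) \<le> (\<integral>\<^sup>+x. \<integral>\<^sup>+y. ennreal (W y) \<partial>N x \<partial>\<mu>)"
      by (rule nn_integral_mono) (simp add: le s(3))
    then have "(\<integral>\<^sup>+x. \<integral>\<^sup>+y. g y \<partial>N x \<partial>\<mu>) < \<infinity>" using fin2 by (rule order.strict_trans1)
    then show "integrable \<mu> (\<lambda>x. enn2real (\<integral>\<^sup>+y. g y \<partial>N x))"
      using m eq by (intro integrableI_nonneg) auto
  qed
  have p: "(\<lambda>x. ennreal (f x)) \<in> borel_measurable T" "(\<lambda>x. ennreal (- f x)) \<in> borel_measurable T"
    using f by measurable
  have pW: "ennreal (f x) \<le> ennreal (W x)" "ennreal (- f x) \<le> ennreal (W x)" if "x \<in> space T" for x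
    using fW[OF that] by (auto intro!: ennreal_leI)
  have eqN: "(\<integral>y. f y \<partial>N x) = enn2real (\<integral>\<^sup>+y. ennreal (f y) \<partial>N x) - enn2real (\<integral>\<^sup>+y. ennreal (- f y) \<partial>N x)"
    if "x \<in> space S" for x by (rule real_lebesgue_integral_def[OF iN[OF that]])
  have "(\<integral>x. \<integral>y. f y \<partial>N x \<partial>\<mu>) = (\<integral>x. enn2real (\<integral>\<^sup>+y. ennreal (f y) \<partial>N x) - enn2real (\<integral>\<^sup>+y. ennreal (- f y) \<partial>N x) \<partial>\<mu>)"
    using eqN s(3) by (intro Bochner_Integration.integral_cong) auto
  also have "\<dots> = (\<integral>x. f x \<partial>(\<mu> \<bind> N))"
    using part[OF p(1) pW(1)] part[OF p(2) pW(2)]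
    by (simp add: real_lebesgue_integral_def[OF ib])
  finally show "(\<integral>x. f x \<partial>(\<mu> \<bind> N)) = (\<integral>x. \<integral>y. f y \<partial>N x \<partial>\<mu>)" by simp
  have "integrable \<mu> (\<lambda>x. enn2real (\<integral>\<^sup>+y. ennreal (f y) \<partial>N x) - enn2real (\<integral>\<^sup>+y. ennreal (- f y) \<partial>N x))"
    using part[OF p(1) pW(1)] part[OF p(2) pW(2)] by (intro Bochner_Integration.integrable_diff) auto
  then show "integrable \<mu> (\<lambda>x. \<integral>y. f y \<partial>N x)"
    using eqN s(3) by (subst Bochner_Integration.integrable_cong[OF refl]) auto
qed

locale markov =
  fixes S :: "'s measure" and K :: "'s \<Rightarrow> 's measure"
  assumes markov_kernel: "markov_kernel S K"
begin

lemma K[measurable]: "K \<in> S \<rightarrow>\<^sub>M prob_algebra S"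
  using markov_kernel by (simp add: markov_kernel_def)

lemma kernel_pow_measurable[measurable]: "kernel_pow S K t \<in> S \<rightarrow>\<^sub>M prob_algebra S"
proof (induction t)
  case 0
  have "kernel_pow S K 0 = return S" by (rule ext) simp
  then show ?case by simp
next
  case (Suc t)
  have "kernel_pow S K (Suc t) = (\<lambda>x. kernel_pow S K t x \<bind> K)" by (rule ext) simp
  then show ?case using measurable_bind_prob_space[OF Suc K] by simp
qed

lemma kernel_pow_space: "x \<in> space S \<Longrightarrow> kernel_pow S K t x \<in> space (prob_algebra S)"
  by (rule measurable_space[OF kernel_pow_measurable])

lemmas kernel_powD = space_prob_algebraD[OF kernel_pow_space]

lemma kernel_pow_add:
  assumes x: "x \<in> space S"
  shows "kernel_pow S K (s + t) x = kernel_pow S K s x \<bind> kernel_pow S K t"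
proof (induction t)
  case 0
  have "kernel_pow S K 0 = return (kernel_pow S K s x)"
    by (intro ext) (simp only: kernel_pow.simps(1) return_sets_cong[OF kernel_powD(1)[OF x]])
  then show ?case by (simp add: bind_return')
next
  case (Suc t)
  have "kernel_pow S K (s + Suc t) x = (kernel_pow S K s x \<bind> kernel_pow S K t) \<bind> K"
    using Suc by simp
  also have "\<dots> = kernel_pow S K s x \<bind> (\<lambda>y. kernel_pow S K t y \<bind> K)"
    using measurable_prob_algebraD[OF kernel_pow_measurable[of t]] measurable_prob_algebraD[OF K] kernel_powD(1)[OF x]
    by (intro bind_assoc[where N = S and R = S]) (simp_all cong: measurable_cong_sets)
  also have "(\<lambda>y. kernel_pow S K t y \<bind> K) = kernel_pow S K (Suc t)" by (intro ext) simp
  finally show ?case .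
qed

lemma nn_integral_kernel_pow_add:
  assumes "x \<in> space S" "f \<in> borel_measurable S"
  shows "(\<integral>\<^sup>+z. f z \<partial>kernel_pow S K (s + t) x) = (\<integral>\<^sup>+y. \<integral>\<^sup>+z. f z \<partial>kernel_pow S K t y \<partial>kernel_pow S K s x)"
  unfolding kernel_pow_add[OF assms(1)]
  by (rule nn_integral_bind_prob_algebra[OF kernel_pow_space[OF assms(1)] kernel_pow_measurable assms(2)])

lemma kernel_pow_1: "x \<in> space S \<Longrightarrow> kernel_pow S K (Suc 0) x = K x"
  using bind_return[OF measurable_prob_algebraD[OF K]] by simp

lemma invariant_pow:
  assumes inv: "invariant_prob S K \<pi>"
  shows "\<pi> \<bind> kernel_pow S K t = \<pi>"
proof (induction t)
  case 0
  have "kernel_pow S K 0 = return \<pi>"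
    using inv by (intro ext) (simp add: invariant_prob_def return_sets_cong[of \<pi> S])
  then show ?case by (simp add: bind_return')
next
  case (Suc t)
  have s: "sets \<pi> = sets S" using inv by (simp add: invariant_prob_def)
  have "\<pi> \<bind> kernel_pow S K (Suc t) = \<pi> \<bind> (\<lambda>x. kernel_pow S K t x \<bind> K)"
    by (rule arg_cong[where f = "bind \<pi>"], rule ext) simp
  also have "\<dots> = (\<pi> \<bind> kernel_pow S K t) \<bind> K"
    using measurable_prob_algebraD[OF kernel_pow_measurable[of t]] measurable_prob_algebraD[OF K]
    by (intro bind_assoc[symmetric, where N = S and R = S]) (simp_all add: measurable_cong_sets[OF s refl])
  finally show ?case using Suc inv by (simp add: invariant_prob_def del: kernel_pow.simps)
qed

end

lemma ennreal_affine:
  "0 \<le> a \<Longrightarrow> 0 \<le> x \<Longrightarrow> 0 \<le> b \<Longrightarrow> ennreal a * ennreal x + ennreal b = ennreal (a * x + b)"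
  by (simp add: ennreal_mult)

lemma nn_integral_minorization:
  assumes s: "sets \<nu> = sets \<mu>"
    and dom: "\<And>A. A \<in> sets \<mu> \<Longrightarrow> ennreal \<alpha> * emeasure \<nu> A \<le> emeasure \<mu> A"
    and h: "h \<in> borel_measurable \<mu>"
  shows "ennreal \<alpha> * (\<integral>\<^sup>+x. h x \<partial>\<nu>) \<le> (\<integral>\<^sup>+x. h x \<partial>\<mu>)"
proof -
  have "scale_measure (ennreal \<alpha>) \<nu> \<le> \<mu>"
    using dom s by (subst le_measure) auto
  then have "(\<integral>\<^sup>+x. h x \<partial>scale_measure (ennreal \<alpha>) \<nu>) \<le> (\<integral>\<^sup>+x. h x \<partial>\<mu>)"
    using s by (intro nn_integral_mono_measure) auto
  then show ?thesis using h s by (subst (asm) nn_integral_scale_measure) (auto cong: measurable_cong_sets)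
qed

text \<open>The remainder of \<mu> after subtracting \<alpha> times \<nu> is a positive measure, so
  the integral of \<phi> against it is at most that of \<open>W\<close>. This is expressed without
  forming the remainder, by testing with \<open>W - \<phi>\<close> and
  \<open>W + \<phi>\<close>.\<close>

lemma integral_minorization:
  fixes \<phi> W :: "'s \<Rightarrow> real"
  assumes s: "sets \<nu> = sets \<mu>" and \<alpha>: "0 < \<alpha>"
    and dom: "\<And>A. A \<in> sets \<mu> \<Longrightarrow> ennreal \<alpha> * emeasure \<nu> A \<le> emeasure \<mu> A"
    and \<phi>: "\<phi> \<in> borel_measurable \<mu>" and W: "W \<in> borel_measurable \<mu>"
    and \<phi>W: "\<And>x. x \<in> space \<mu> \<Longrightarrow> \<bar>\<phi> x\<bar> \<le> W x"
    and fin: "(\<integral>\<^sup>+x. ennreal (W x) \<partial>\<mu>) < \<infinity>"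
  shows "\<bar>(\<integral>x. \<phi> x \<partial>\<mu>) - \<alpha> * (\<integral>x. \<phi> x \<partial>\<nu>)\<bar> \<le> (\<integral>x. W x \<partial>\<mu>) - \<alpha> * (\<integral>x. W x \<partial>\<nu>)"
    "integrable \<nu> W"
proof -
  have sp: "space \<nu> = space \<mu>" using s by (rule sets_eq_imp_space_eq)
  have "ennreal \<alpha> * (\<integral>\<^sup>+x. ennreal (W x) \<partial>\<nu>) \<le> (\<integral>\<^sup>+x. ennreal (W x) \<partial>\<mu>)"
    using W by (intro nn_integral_minorization[OF s dom]) auto
  then have "ennreal \<alpha> * (\<integral>\<^sup>+x. ennreal (W x) \<partial>\<nu>) < \<infinity>" using fin by (rule order.strict_trans1)
  then have finN: "(\<integral>\<^sup>+x. ennreal (W x) \<partial>\<nu>) < \<infinity>"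
    using \<alpha> by (auto simp: ennreal_mult_less_top)
  have W0: "0 \<le> W x" if "x \<in> space \<mu>" for x using \<phi>W[OF that] by linarith
  have mN: "\<phi> \<in> borel_measurable \<nu>" "W \<in> borel_measurable \<nu>"
    using \<phi> W s by (simp_all cong: measurable_cong_sets)
  have i: "integrable \<mu> \<phi>" "integrable \<nu> \<phi>" "integrable \<mu> W" "integrable \<nu> W"
    using integrable_dominated[OF \<phi> \<phi>W fin] integrable_dominated[OF mN(1) _ finN] \<phi>W sp
      integrable_dominated[OF W _ fin] integrable_dominated[OF mN(2) _ finN] W0 by auto
  then show "integrable \<nu> W" by simp
  have key: "\<alpha> * (\<integral>x. h x \<partial>\<nu>) \<le> (\<integral>x. h x \<partial>\<mu>)"
    if h: "integrable \<mu> h" "integrable \<nu> h" "\<And>x. x \<in> space \<mu> \<Longrightarrow> 0 \<le> h x" for h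
  proof -
    have "ennreal \<alpha> * (\<integral>\<^sup>+x. ennreal (h x) \<partial>\<nu>) \<le> (\<integral>\<^sup>+x. ennreal (h x) \<partial>\<mu>)"
      using h(1) by (intro nn_integral_minorization[OF s dom]) auto
    moreover have "(\<integral>\<^sup>+x. ennreal (h x) \<partial>\<nu>) = ennreal (\<integral>x. h x \<partial>\<nu>)"
      "(\<integral>\<^sup>+x. ennreal (h x) \<partial>\<mu>) = ennreal (\<integral>x. h x \<partial>\<mu>)"
      using h sp by (auto intro!: nn_integral_eq_integral)
    ultimately have "ennreal (\<alpha> * (\<integral>x. h x \<partial>\<nu>)) \<le> ennreal (\<integral>x. h x \<partial>\<mu>)"
      using \<alpha> by (simp add: ennreal_mult')
    then show ?thesis using h by (subst (asm) ennreal_le_iff) (auto intro!: integral_nonneg_AE)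
  qed
  have "0 \<le> W x - \<phi> x" "0 \<le> W x + \<phi> x" if "x \<in> space \<mu>" for x
    using \<phi>W[OF that] by linarith+
  then have "\<alpha> * (\<integral>x. W x - \<phi> x \<partial>\<nu>) \<le> (\<integral>x. W x - \<phi> x \<partial>\<mu>)" "\<alpha> * (\<integral>x. W x + \<phi> x \<partial>\<nu>) \<le> (\<integral>x. W x + \<phi> x \<partial>\<mu>)"
    using i by (intro key Bochner_Integration.integrable_add Bochner_Integration.integrable_diff; blast)+
  then show "\<bar>(\<integral>x. \<phi> x \<partial>\<mu>) - \<alpha> * (\<integral>x. \<phi> x \<partial>\<nu>)\<bar> \<le> (\<integral>x. W x \<partial>\<mu>) - \<alpha> * (\<integral>x. W x \<partial>\<nu>)"
    using i by (simp add: algebra_simps abs_le_iff)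
qed

text \<open>Up to \<open>1/n\<close>, \<phi> is the average of the indicators of the level sets
  \<open>n \<phi> \<ge> i\<close> for \<open>i = 1..n\<close>. Averaging keeps the error
  \<open>e\<close>, whereas a general simple function would sum errors.\<close>

lemma uniform_setwise_integral:
  fixes \<phi> :: "'s \<Rightarrow> real"
  assumes "prob_space \<mu>" "prob_space \<nu>" and s: "sets \<nu> = sets \<mu>"
    and le: "\<And>A. A \<in> sets \<mu> \<Longrightarrow> \<bar>measure \<mu> A - measure \<nu> A\<bar> \<le> e"
    and \<phi>: "\<phi> \<in> borel_measurable \<mu>" "\<And>x. x \<in> space \<mu> \<Longrightarrow> 0 \<le> \<phi> x \<and> \<phi> x \<le> 1"
  shows "\<bar>(\<integral>x. \<phi> x \<partial>\<mu>) - (\<integral>x. \<phi> x \<partial>\<nu>)\<bar> \<le> e"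
proof (rule field_le_epsilon)
  fix \<delta> :: real assume "\<delta> > 0"
  then obtain n where n: "n > 0" "2 / real n < \<delta>"
    using ex_inverse_of_nat_less[of "\<delta>/2"] by (auto simp: field_simps)
  interpret \<mu>: prob_space \<mu> by fact
  interpret \<nu>: prob_space \<nu> by fact
  have sp: "space \<nu> = space \<mu>" using s by (rule sets_eq_imp_space_eq)
  define A where "A i = {x \<in> space \<mu>. real i \<le> real n * \<phi> x}" for i
  have A: "A i \<in> sets \<mu>" "A i \<in> sets \<nu>" for i using \<phi>(1) s by (auto simp: A_def)
  define f where "f x = (\<Sum>i=1..n. indicator (A i) x) / real n" for x
  have f: "\<bar>\<phi> x - f x\<bar> \<le> 1 / real n" if x: "x \<in> space \<mu>" for x
  proof -
    define k where "k = nat \<lfloor>real n * \<phi> x\<rfloor>"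
    have \<phi>01: "0 \<le> \<phi> x" "\<phi> x \<le> 1" using \<phi>(2)[OF x] by blast+
    then have n\<phi>: "real n * \<phi> x \<le> real n" "0 \<le> real n * \<phi> x" by (simp_all add: mult_left_le)
    have k: "real k = of_int \<lfloor>real n * \<phi> x\<rfloor>" using n\<phi> by (simp add: k_def)
    then have kn: "k \<le> n" and iff: "real i \<le> real n * \<phi> x \<longleftrightarrow> i \<le> k" for i
      using n\<phi> by linarith+
    have "{i\<in>{1..n}. real i \<le> real n * \<phi> x} = {1..k}"
      unfolding iff using kn by auto
    then have "(\<Sum>i=1..n. indicator (A i) x) = real k"
      using x by (simp add: A_def indicator_def sum.If_cases Int_def)
    also note k
    finally have "f x = of_int \<lfloor>real n * \<phi> x\<rfloor> / real n" by (simp add: f_def)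
    then have "\<phi> x - f x = (real n * \<phi> x - of_int \<lfloor>real n * \<phi> x\<rfloor>) / real n" using n by (simp add: field_simps)
    moreover have "\<bar>real n * \<phi> x - of_int \<lfloor>real n * \<phi> x\<rfloor>\<bar> \<le> 1" by linarith
    ultimately show ?thesis using n by (simp add: divide_right_mono)
  qed
  have f0: "\<bar>f x\<bar> \<le> 1" for x
  proof -
    have "(\<Sum>i=1..n. indicator (A i) x) \<le> (\<Sum>i=1..n. 1::real)" by (intro sum_mono) (auto simp: indicator_def)
    moreover have "0 \<le> (\<Sum>i=1..n. indicator (A i) x :: real)" by (intro sum_nonneg) auto
    ultimately show ?thesis using n by (simp add: f_def)
  qed
  have fm: "f \<in> borel_measurable \<mu>" unfolding f_def using A by measurable
  have i1: "integrable \<mu> \<phi>" "integrable \<mu> f"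
    using \<phi> fm f0 by (auto intro!: \<mu>.integrable_const_bound[where B=1])
  have i2: "integrable \<nu> \<phi>" "integrable \<nu> f"
    using \<phi> fm f0 s sp by (auto intro!: \<nu>.integrable_const_bound[where B=1] cong: measurable_cong_sets)
  have d: "\<bar>(\<integral>x. \<phi> x \<partial>M) - (\<integral>x. f x \<partial>M)\<bar> \<le> 1 / real n"
    if "prob_space M" "integrable M \<phi>" "integrable M f" "space M = space \<mu>" for M
  proof -
    interpret M: prob_space M by fact
    have "\<bar>\<integral>x. \<phi> x - f x \<partial>M\<bar> \<le> (\<integral>x. \<bar>\<phi> x - f x\<bar> \<partial>M)" by (rule integral_abs_bound)
    also have "\<dots> \<le> (\<integral>x. 1 / real n \<partial>M)"
      using that f by (intro integral_mono) auto
    finally show ?thesis using that M.prob_space by simp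
  qed
  have "(\<integral>x. f x \<partial>\<mu>) = (\<Sum>i=1..n. measure \<mu> (A i)) / real n"
    "(\<integral>x. f x \<partial>\<nu>) = (\<Sum>i=1..n. measure \<nu> (A i)) / real n"
    unfolding f_def using A by (simp_all add: Bochner_Integration.integral_sum sp Int_absorb2[OF sets.sets_into_space] less_top[symmetric])
  then have "\<bar>(\<integral>x. f x \<partial>\<mu>) - (\<integral>x. f x \<partial>\<nu>)\<bar> = \<bar>\<Sum>i=1..n. measure \<mu> (A i) - measure \<nu> (A i)\<bar> / real n"
    using n by (simp add: sum_subtractf diff_divide_distrib[symmetric])
  also have "\<dots> \<le> (\<Sum>i=1..n. e) / real n"
    using n A by (intro divide_right_mono order_trans[OF sum_abs] sum_mono le) auto
  also have "\<dots> = e" using n by simp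
  finally show "\<bar>(\<integral>x. \<phi> x \<partial>\<mu>) - (\<integral>x. \<phi> x \<partial>\<nu>)\<bar> \<le> e + \<delta>"
    using d[OF \<open>prob_space \<mu>\<close> i1 refl] d[OF \<open>prob_space \<nu>\<close> i2 sp] n(2) by (simp add: field_simps)
qed

section \<open>Consequences of the drift condition\<close>

locale markov_drift = markov S K for S :: "'s measure" and K +
  fixes V :: "'s \<Rightarrow> real" and \<gamma> b :: real
  assumes V[measurable]: "V \<in> borel_measurable S" and V0: "x \<in> space S \<Longrightarrow> 0 \<le> V x"
    and \<gamma>: "0 \<le> \<gamma>" "\<gamma> < 1" and b: "0 \<le> b"
    and drift: "x \<in> space S \<Longrightarrow> (\<integral>\<^sup>+y. ennreal (V y) \<partial>K x) \<le> ennreal (\<gamma> * V x + b)"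
begin

text \<open>The fixed point of \<open>v \<mapsto> \<gamma> * v + b\<close>; it bounds what the
  constant \<open>b\<close> contributes over any number of steps.\<close>

definition B where "B = b / (1 - \<gamma>)"

lemma B: "0 \<le> B" "\<gamma> * B + b = B"
  using \<gamma> b by (auto simp: B_def field_simps)

lemma drift_pow:
  assumes x: "x \<in> space S"
  shows "(\<integral>\<^sup>+y. ennreal (V y) \<partial>kernel_pow S K t x) \<le> ennreal (\<gamma> ^ t * V x + B)"
proof (induction t)
  case 0
  have "V x \<le> V x + B" using B by simp
  then show ?case using x by (simp add: nn_integral_return ennreal_leI)
next
  case (Suc t)
  note P = kernel_powD[OF x]
  interpret prob_space "kernel_pow S K t x" by (rule P)
  have "(\<integral>\<^sup>+y. ennreal (V y) \<partial>kernel_pow S K (Suc t) x) = (\<integral>\<^sup>+y. \<integral>\<^sup>+z. ennreal (V z) \<partial>K y \<partial>kernel_pow S K t x)"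
    using nn_integral_bind_prob_algebra[OF kernel_pow_space[OF x] K] by simp
  also have "\<dots> \<le> (\<integral>\<^sup>+y. ennreal \<gamma> * ennreal (V y) + ennreal b \<partial>kernel_pow S K t x)"
    using drift V0 \<gamma> b by (intro nn_integral_mono) (auto simp: P ennreal_mult'[symmetric] ennreal_plus[symmetric] simp del: ennreal_plus)
  also have "\<dots> = ennreal \<gamma> * (\<integral>\<^sup>+y. ennreal (V y) \<partial>kernel_pow S K t x) + ennreal b"
    by (subst nn_integral_add)
      (auto simp: nn_integral_cmult measurable_cong_sets[OF P(1) refl] emeasure_space_1)
  also have "\<dots> \<le> ennreal \<gamma> * ennreal (\<gamma> ^ t * V x + B) + ennreal b"
    by (intro add_right_mono mult_left_mono Suc) simp
  also have "\<dots> = ennreal (\<gamma> * (\<gamma> ^ t * V x + B) + b)"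
    using \<gamma> b B V0[OF x] by (intro ennreal_affine) auto
  also have "\<gamma> * (\<gamma> ^ t * V x + B) + b = \<gamma> ^ Suc t * V x + B" using B by (simp add: algebra_simps)
  finally show ?case .
qed

lemma nn_integral_V_finite: "x \<in> space S \<Longrightarrow> (\<integral>\<^sup>+y. ennreal (c * (1 + V y)) \<partial>kernel_pow S K t x) < \<infinity>"
proof (cases "0 \<le> c")
  case True
  assume x: "x \<in> space S"
  note P = kernel_powD[OF x]
  interpret prob_space "kernel_pow S K t x" by (rule P)
  have "(\<integral>\<^sup>+y. ennreal (c * (1 + V y)) \<partial>kernel_pow S K t x) = (\<integral>\<^sup>+y. ennreal c * (1 + ennreal (V y)) \<partial>kernel_pow S K t x)"
    using V0 True by (intro nn_integral_cong) (simp add: P ennreal_mult' ennreal_plus)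
  also have "\<dots> = ennreal c * (1 + (\<integral>\<^sup>+y. ennreal (V y) \<partial>kernel_pow S K t x))"
    by (simp add: nn_integral_cmult nn_integral_add measurable_cong_sets[OF P(1) refl] emeasure_space_1)
  also have "\<dots> < \<infinity>"
    using drift_pow[OF x, of t] by (auto simp: ennreal_mult_less_top intro: order.strict_trans1)
  finally show ?thesis .
next
  case False
  assume x: "x \<in> space S"
  have "(\<integral>\<^sup>+y. ennreal (c * (1 + V y)) \<partial>kernel_pow S K t x) = (\<integral>\<^sup>+y. 0 \<partial>kernel_pow S K t x)"
    using V0 False by (intro nn_integral_cong) (simp add: kernel_powD[OF x] ennreal_neg mult_nonpos_nonneg)
  then show ?thesis by simp
qed

text \<open>The ball of radius \<open>c\<close> in the supremum norm weighted by
  \<open>1 + V\<close>.\<close>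

definition Vbdd :: "('s \<Rightarrow> real) \<Rightarrow> real \<Rightarrow> bool" where
  "Vbdd \<phi> c \<longleftrightarrow> \<phi> \<in> borel_measurable S \<and> (\<forall>x\<in>space S. \<bar>\<phi> x\<bar> \<le> c * (1 + V x))"

lemma Vbdd_integrable: "Vbdd \<phi> c \<Longrightarrow> x \<in> space S \<Longrightarrow> integrable (kernel_pow S K t x) \<phi>"
  using nn_integral_V_finite[of x t c]
  by (intro integrable_dominated[where W = "\<lambda>y. c * (1 + V y)"])
    (auto simp: Vbdd_def kernel_powD measurable_cong_sets[OF kernel_powD(1) refl])

lemma Vbdd_V: "Vbdd V 1"
  using V0 by (auto simp: Vbdd_def)

lemma drift_pow_real:
  assumes x: "x \<in> space S"
  shows "(\<integral>y. V y \<partial>kernel_pow S K t x) \<le> \<gamma> ^ t * V x + B"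
proof -
  have "ennreal (\<integral>y. V y \<partial>kernel_pow S K t x) = (\<integral>\<^sup>+y. ennreal (V y) \<partial>kernel_pow S K t x)"
    using Vbdd_integrable[OF Vbdd_V x] V0 by (subst nn_integral_eq_integral) (auto simp: kernel_powD[OF x])
  also have "\<dots> \<le> ennreal (\<gamma> ^ t * V x + B)" by (rule drift_pow[OF x])
  finally show ?thesis using \<gamma> B V0[OF x] by (subst (asm) ennreal_le_iff) auto
qed

lemma integral_pow_add:
  assumes \<phi>: "Vbdd \<phi> c" and x: "x \<in> space S"
  shows "(\<integral>z. \<phi> z \<partial>kernel_pow S K (s + t) x) = (\<integral>y. \<integral>z. \<phi> z \<partial>kernel_pow S K t y \<partial>kernel_pow S K s x)"
  unfolding kernel_pow_add[OF x]
proof (rule integral_bind_prob_algebra(1)[OF kernel_pow_space[OF x] kernel_pow_measurable])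
  show "\<phi> \<in> borel_measurable S" "\<And>x. x \<in> space S \<Longrightarrow> \<bar>\<phi> x\<bar> \<le> c * (1 + V x)"
    using \<phi> by (auto simp: Vbdd_def)
  show "(\<integral>\<^sup>+y. \<integral>\<^sup>+z. ennreal (c * (1 + V z)) \<partial>kernel_pow S K t y \<partial>kernel_pow S K s x) < \<infinity>"
    using nn_integral_V_finite[OF x, of "s + t" c] V
    by (subst nn_integral_kernel_pow_add[OF x, symmetric]) auto
  show "(\<lambda>z. c * (1 + V z)) \<in> borel_measurable S" by measurable
qed (rule nn_integral_V_finite)

lemma abs_integral_pow_le:
  assumes \<phi>: "\<phi> \<in> borel_measurable S" "\<And>y. y \<in> space S \<Longrightarrow> \<bar>\<phi> y\<bar> \<le> c0 + c1 * V y"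
    and c: "0 \<le> c0" "0 \<le> c1" and x: "x \<in> space S"
  shows "\<bar>\<integral>y. \<phi> y \<partial>kernel_pow S K t x\<bar> \<le> c0 + c1 * (\<integral>y. V y \<partial>kernel_pow S K t x)"
proof -
  note P = kernel_powD[OF x]
  interpret prob_space "kernel_pow S K t x" by (rule P)
  have iV: "integrable (kernel_pow S K t x) V" by (rule Vbdd_integrable[OF Vbdd_V x])
  have "Vbdd \<phi> (c0 + c1)"
    unfolding Vbdd_def using \<phi> V0 c by (force simp: algebra_simps intro: order_trans)
  then have "integrable (kernel_pow S K t x) \<phi>" using x by (rule Vbdd_integrable)
  have "\<bar>\<integral>y. \<phi> y \<partial>kernel_pow S K t x\<bar> \<le> (\<integral>y. \<bar>\<phi> y\<bar> \<partial>kernel_pow S K t x)" by (rule integral_abs_bound)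
  also have "\<dots> \<le> (\<integral>y. c0 + c1 * V y \<partial>kernel_pow S K t x)"
    using \<phi>(2) iV \<open>integrable _ \<phi>\<close> by (intro integral_mono) (auto simp: P)
  also have "\<dots> = c0 + c1 * (\<integral>y. V y \<partial>kernel_pow S K t x)" using iV by (simp add: prob_space)
  finally show ?thesis .
qed

text \<open>The radius does not grow with \<open>t\<close>, because
  \<open>\<gamma> ^ t \<le> 1\<close> and the accumulated drift is at most \<open>B\<close>.\<close>

lemma Vbdd_integral_pow:
  assumes \<phi>: "Vbdd \<phi> c" and c: "0 \<le> c"
  shows "Vbdd (\<lambda>x. \<integral>y. \<phi> y \<partial>kernel_pow S K t x) (c * (1 + B))"
  unfolding Vbdd_def
proof (intro conjI ballI)
  show "(\<lambda>x. \<integral>y. \<phi> y \<partial>kernel_pow S K t x) \<in> borel_measurable S"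
    using \<phi> by (intro measurable_integral_kernel[OF kernel_pow_measurable]) (simp add: Vbdd_def)
  fix x assume x: "x \<in> space S"
  have "\<bar>\<integral>y. \<phi> y \<partial>kernel_pow S K t x\<bar> \<le> c + c * (\<integral>y. V y \<partial>kernel_pow S K t x)"
    using \<phi> c by (intro abs_integral_pow_le x) (auto simp: Vbdd_def algebra_simps)
  also have "\<dots> \<le> c + c * (\<gamma> ^ t * V x + B)"
    using drift_pow_real[OF x] c by (intro add_left_mono mult_left_mono)
  also have "\<dots> \<le> c + c * (V x + B + B * V x)"
  proof (intro add_left_mono mult_left_mono c)
    have "\<gamma> ^ t * V x \<le> V x" using \<gamma> V0[OF x] by (intro mult_left_le_one_le) (auto simp: power_le_one)
    moreover have "0 \<le> B * V x" using B V0[OF x] by simp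
    ultimately show "\<gamma> ^ t * V x + B \<le> V x + B + B * V x" by linarith
  qed
  also have "\<dots> = c * (1 + B) * (1 + V x)" by (simp add: algebra_simps)
  finally show "\<bar>\<integral>y. \<phi> y \<partial>kernel_pow S K t x\<bar> \<le> c * (1 + B) * (1 + V x)" .
qed

end

text \<open>Here \<open>s\<close> stands for \<open>V x + V y\<close>. Below \<open>R\<close> the
  minorization saves \<open>2 * \<alpha>\<close>, and the weight \<beta> is so small that the drift
  constant costs at most \<alpha>. From \<open>R\<close> on the drift alone wins, since
  \<open>\<gamma> * s + 2 * B \<le> g0 * s\<close> with \<open>g0 < 1\<close>.\<close>

lemma hairer_mattingly_arith:
  fixes \<alpha> \<gamma> B R \<beta> s :: real
  assumes "0 < \<alpha>" "\<alpha> \<le> 1" "0 \<le> \<gamma>" "\<gamma> < 1" "0 \<le> B" "R > 2 * B / (1 - \<gamma>)" "\<beta> = \<alpha> / (2 * B + 1)"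
  obtains a where "0 < a" "a < 1"
    "\<And>s. 0 \<le> s \<Longrightarrow> 2 + \<beta> * (\<gamma> * s + 2 * B) - (if s < R then 2 * \<alpha> else 0) \<le> a * (2 + \<beta> * s)"
proof -
  have R0: "R > 0" using assms by (smt (verit) divide_nonneg_pos mult_nonneg_nonneg)
  have \<beta>: "\<beta> > 0" using assms by simp
  define g0 where "g0 = \<gamma> + 2 * B / R"
  have g0: "0 \<le> g0" "g0 < 1"
  proof -
    show "0 \<le> g0" using assms R0 by (simp add: g0_def)
    have "2 * B < R * (1 - \<gamma>)" using assms by (simp add: field_simps)
    then show "g0 < 1" using R0 by (simp add: g0_def field_simps)
  qed
  \<comment> \<open>The last term is the ratio
    \<open>(2 + \<beta> * g0 * s) / (2 + \<beta> * s)\<close> at \<open>s = R\<close>, where it is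
    largest over \<open>s \<ge> R\<close>.\<close>
  define a where "a = max (max (1 - \<alpha>/2) \<gamma>) ((2 + \<beta> * g0 * R) / (2 + \<beta> * R))"
  have "(2 + \<beta> * g0 * R) / (2 + \<beta> * R) < 1"
    using \<beta> R0 g0 by (simp add: divide_less_eq add_pos_pos)
  then have a: "0 < a" "a < 1" using assms by (auto simp: a_def less_max_iff_disj)
  have "2 + \<beta> * (\<gamma> * s + 2 * B) - (if s < R then 2 * \<alpha> else 0) \<le> a * (2 + \<beta> * s)" if s: "0 \<le> s" for s
  proof (cases "s < R")
    case True
    have "\<beta> * (2 * B + 1) = \<alpha>" using assms by simp
    then have "2 * B * \<beta> \<le> \<alpha>" using \<beta> by (simp add: algebra_simps)
    then have "2 + \<beta> * (\<gamma> * s + 2 * B) - 2 * \<alpha> \<le> 2 * (1 - \<alpha>/2) + \<gamma> * (\<beta> * s)" by (simp add: algebra_simps)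
    also have "\<dots> \<le> 2 * a + a * (\<beta> * s)"
      using s \<beta> by (intro add_mono mult_left_mono mult_right_mono) (auto simp: a_def)
    finally show ?thesis using True by (simp add: algebra_simps)
  next
    case False
    have "2 * B = (2 * B / R) * R" using R0 by simp
    also have "\<dots> \<le> (2 * B / R) * s" using False R0 assms by (intro mult_left_mono) auto
    finally have "\<beta> * (\<gamma> * s + 2 * B) \<le> \<beta> * (g0 * s)"
      using \<beta> by (intro mult_left_mono) (auto simp: g0_def algebra_simps)
    moreover have "2 + \<beta> * (g0 * s) \<le> (2 + \<beta> * g0 * R) / (2 + \<beta> * R) * (2 + \<beta> * s)"
    proof -
      have "0 \<le> 2 * \<beta> * (1 - g0) * (s - R)" using False g0 \<beta> by simp
      then have "(2 + \<beta> * (g0 * s)) * (2 + \<beta> * R) \<le> (2 + \<beta> * g0 * R) * (2 + \<beta> * s)"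
        by (simp add: algebra_simps)
      then show ?thesis using \<beta> R0 by (simp add: pos_le_divide_eq add_pos_pos)
    qed
    moreover have "\<dots> \<le> a * (2 + \<beta> * s)"
      using s \<beta> by (intro mult_right_mono) (auto simp: a_def)
    ultimately show ?thesis using False by simp
  qed
  then show ?thesis using that a by blast
qed

text \<open>Every sublevel set of \<open>V\<close> is a small set, with the same number
  \<open>p\<close> of steps but a constant and a measure that may depend on the level.\<close>

locale harris_chain = markov_drift S K V \<gamma> b for S :: "'s measure" and K V \<gamma> b +
  fixes p :: nat
  assumes nonempty: "space S \<noteq> {}"
    and p: "p \<ge> 1"
    and minor: "\<And>R. \<exists>\<alpha> \<nu>. 0 < \<alpha> \<and> \<alpha> \<le> 1 \<and> prob_space \<nu> \<and> sets \<nu> = sets S \<and>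
      (\<forall>x\<in>space S. V x \<le> R \<longrightarrow> (\<forall>A\<in>sets S. ennreal \<alpha> * emeasure \<nu> A \<le> emeasure (kernel_pow S K p x) A))"
begin

text \<open>The argument of Hairer and Mattingly: the \<open>p\<close>-step kernel contracts the seminorm
  \<open>sup |\<phi> x - \<phi> y| / (2 + \<beta> V x + \<beta> V y)\<close>.\<close>

lemma seminorm_contraction:
  obtains \<beta> a where "0 < \<beta>" "0 < a" "a < 1"
    "\<And>\<phi> c x y. \<phi> \<in> borel_measurable S \<Longrightarrow> 0 \<le> c \<Longrightarrow>
      (\<And>x y. x \<in> space S \<Longrightarrow> y \<in> space S \<Longrightarrow> \<bar>\<phi> x - \<phi> y\<bar> \<le> c * (2 + \<beta> * (V x + V y))) \<Longrightarrow>
      x \<in> space S \<Longrightarrow> y \<in> space S \<Longrightarrow>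
      \<bar>(\<integral>z. \<phi> z \<partial>kernel_pow S K p x) - (\<integral>z. \<phi> z \<partial>kernel_pow S K p y)\<bar> \<le> a * c * (2 + \<beta> * (V x + V y))"
proof -
  define \<gamma>' where "\<gamma>' = \<gamma> ^ p"
  have \<gamma>': "0 \<le> \<gamma>'" "\<gamma>' < 1"
    using \<gamma> p by (auto simp: \<gamma>'_def power_less_one_iff)
  \<comment> \<open>The summand 1 makes \<open>R\<close> strictly larger than the threshold required
    for the contraction.\<close>
  define R where "R = 2 * B / (1 - \<gamma>') + 1"
  obtain \<alpha> \<nu> where \<alpha>: "0 < \<alpha>" "\<alpha> \<le> 1" and \<nu>: "prob_space \<nu>" "sets \<nu> = sets S"
    and dom: "\<And>x A. x \<in> space S \<Longrightarrow> V x \<le> R \<Longrightarrow> A \<in> sets S \<Longrightarrow> ennreal \<alpha> * emeasure \<nu> A \<le> emeasure (kernel_pow S K p x) A"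
    using minor[of R] by blast
  interpret \<nu>: prob_space \<nu> by fact
  define \<beta> where "\<beta> = \<alpha> / (2 * B + 1)"
  have \<beta>: "0 < \<beta>" using \<alpha> B by (simp add: \<beta>_def)
  obtain a where a: "0 < a" "a < 1"
    "\<And>s. 0 \<le> s \<Longrightarrow> 2 + \<beta> * (\<gamma>' * s + 2 * B) - (if s < R then 2 * \<alpha> else 0) \<le> a * (2 + \<beta> * s)"
    using hairer_mattingly_arith[OF \<alpha> \<gamma>' B(1) _ \<beta>_def, of R] unfolding R_def by auto
  have main: "\<bar>(\<integral>z. \<phi> z \<partial>kernel_pow S K p x) - (\<integral>z. \<phi> z \<partial>kernel_pow S K p y)\<bar> \<le> a * c * (2 + \<beta> * (V x + V y))"
    if \<phi>[measurable]: "\<phi> \<in> borel_measurable S" and c: "0 \<le> c"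
      and lip: "\<And>x y. x \<in> space S \<Longrightarrow> y \<in> space S \<Longrightarrow> \<bar>\<phi> x - \<phi> y\<bar> \<le> c * (2 + \<beta> * (V x + V y))"
      and x: "x \<in> space S" and y: "y \<in> space S" for \<phi> c x y
  proof -
    define W where "W z = c + c * \<beta> * V z" for z
    have W0: "0 \<le> W z" if "z \<in> space S" for z using c \<beta> V0[OF that] by (simp add: W_def)
    have lip': "\<phi> z - W z \<le> \<phi> w + W w" if "z \<in> space S" "w \<in> space S" for z w
      using lip[OF that] by (simp add: W_def algebra_simps abs_le_iff)
    \<comment> \<open>A function whose increments are controlled by the weighted distance is, after
      subtraction of a constant, bounded by \<open>W\<close>: any number between the supremum of
      \<open>\<phi> - W\<close> and the infimum of \<open>\<phi> + W\<close> serves. The constant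
      drops out of differences of integrals.\<close>
    define c0 where "c0 = (SUP z\<in>space S. \<phi> z - W z)"
    have "\<phi> z - W z \<le> c0" if "z \<in> space S" for z
      unfolding c0_def using that lip'[OF _ x] by (intro cSUP_upper bdd_aboveI2) auto
    moreover have "c0 \<le> \<phi> w + W w" if "w \<in> space S" for w
      unfolding c0_def using that x lip' by (intro cSUP_least) auto
    ultimately have \<psi>W: "\<bar>\<phi> z - c0\<bar> \<le> W z" if "z \<in> space S" for z
      using that by (force simp: abs_le_iff)
    define \<psi> where "\<psi> z = \<phi> z - c0" for z
    have \<psi>[measurable]: "\<psi> \<in> borel_measurable S" unfolding \<psi>_def by measurable
    have W[measurable]: "W \<in> borel_measurable S" unfolding W_def by measurable
    have b\<psi>: "\<bar>\<psi> z\<bar> \<le> c + c * \<beta> * V z" if "z \<in> space S" for z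
      using \<psi>W[OF that] by (simp add: \<psi>_def W_def)
    have VW: "Vbdd W (c + c * \<beta>)"
      unfolding Vbdd_def using W0 V0 c \<beta> by (auto simp: W_def algebra_simps add_increasing2)
    then have V\<psi>: "Vbdd \<psi> (c + c * \<beta>)"
      using b\<psi> unfolding Vbdd_def W_def by (force intro: order_trans)
    have int\<phi>: "(\<integral>z. \<phi> z \<partial>kernel_pow S K p u) = (\<integral>z. \<psi> z \<partial>kernel_pow S K p u) + c0"
      and intW: "(\<integral>z. W z \<partial>kernel_pow S K p u) \<le> c * (1 + \<beta> * (\<gamma>' * V u + B))"
      and int\<psi>: "\<bar>\<integral>z. \<psi> z \<partial>kernel_pow S K p u\<bar> \<le> c * (1 + \<beta> * (\<gamma>' * V u + B))"
      if u: "u \<in> space S" for u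
    proof -
      interpret prob_space "kernel_pow S K p u" by (rule kernel_powD[OF u])
      have "(\<integral>z. \<phi> z \<partial>kernel_pow S K p u) = (\<integral>z. \<psi> z + c0 \<partial>kernel_pow S K p u)" by (simp add: \<psi>_def)
      also have "\<dots> = (\<integral>z. \<psi> z \<partial>kernel_pow S K p u) + c0"
        using Vbdd_integrable[OF V\<psi> u] by (simp add: prob_space)
      finally show "(\<integral>z. \<phi> z \<partial>kernel_pow S K p u) = (\<integral>z. \<psi> z \<partial>kernel_pow S K p u) + c0" .
      have *: "c + c * \<beta> * (\<integral>z. V z \<partial>kernel_pow S K p u) \<le> c * (1 + \<beta> * (\<gamma>' * V u + B))"
        using mult_left_mono[OF drift_pow_real[OF u, of p], of "c * \<beta>"] c \<beta> by (simp add: \<gamma>'_def algebra_simps)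
      have "(\<integral>z. W z \<partial>kernel_pow S K p u) = c + c * \<beta> * (\<integral>z. V z \<partial>kernel_pow S K p u)"
        unfolding W_def using Vbdd_integrable[OF Vbdd_V u, of p] by (simp add: prob_space)
      then show "(\<integral>z. W z \<partial>kernel_pow S K p u) \<le> c * (1 + \<beta> * (\<gamma>' * V u + B))" using * by simp
      show "\<bar>\<integral>z. \<psi> z \<partial>kernel_pow S K p u\<bar> \<le> c * (1 + \<beta> * (\<gamma>' * V u + B))"
        using abs_integral_pow_le[OF \<psi> b\<psi> c _ u, of p] c \<beta> * by force
    qed
    let ?s = "V x + V y"
    have "\<bar>(\<integral>z. \<psi> z \<partial>kernel_pow S K p x) - (\<integral>z. \<psi> z \<partial>kernel_pow S K p y)\<bar>
        \<le> c * (2 + \<beta> * (\<gamma>' * ?s + 2 * B) - (if ?s < R then 2 * \<alpha> else 0))"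
    proof (cases "?s < R")
      case False
      have "\<bar>(\<integral>z. \<psi> z \<partial>kernel_pow S K p x) - (\<integral>z. \<psi> z \<partial>kernel_pow S K p y)\<bar>
          \<le> c * (1 + \<beta> * (\<gamma>' * V x + B)) + c * (1 + \<beta> * (\<gamma>' * V y + B))"
        using int\<psi>[OF x] int\<psi>[OF y] by linarith
      then show ?thesis using False by (simp add: algebra_simps)
    next
      case True
      then have VR: "V x \<le> R" "V y \<le> R" using V0[OF x] V0[OF y] by auto
      have m: "\<bar>(\<integral>z. \<psi> z \<partial>kernel_pow S K p u) - \<alpha> * (\<integral>z. \<psi> z \<partial>\<nu>)\<bar> \<le> c * (1 + \<beta> * (\<gamma>' * V u + B)) - \<alpha> * c"
        if u: "u \<in> space S" "V u \<le> R" for u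
      proof -
        note P = kernel_powD[OF u(1), of p]
        have "(\<integral>\<^sup>+x. ennreal (W x) \<partial>kernel_pow S K p u) \<le> (\<integral>\<^sup>+x. ennreal ((c + c * \<beta>) * (1 + V x)) \<partial>kernel_pow S K p u)"
          using VW by (intro nn_integral_mono ennreal_leI) (auto simp: P Vbdd_def abs_le_iff)
        then have fin: "(\<integral>\<^sup>+x. ennreal (W x) \<partial>kernel_pow S K p u) < \<infinity>"
          using nn_integral_V_finite[OF u(1), of p "c + c * \<beta>"] by (rule order.strict_trans1)
        have sets: "sets \<nu> = sets (kernel_pow S K p u)" using \<nu> P by simp
        have ms: "\<psi> \<in> borel_measurable (kernel_pow S K p u)" "W \<in> borel_measurable (kernel_pow S K p u)"
          using \<psi> W by (simp_all add: measurable_cong_sets[OF P(1) refl])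
        have d: "ennreal \<alpha> * emeasure \<nu> A \<le> emeasure (kernel_pow S K p u) A" if "A \<in> sets (kernel_pow S K p u)" for A
          using dom[OF u] that P by simp
        have \<psi>W': "\<bar>\<psi> z\<bar> \<le> W z" if "z \<in> space (kernel_pow S K p u)" for z
          using that b\<psi> P by (simp add: W_def)
        note M = integral_minorization[OF sets \<alpha>(1) d ms \<psi>W' fin]
        have "c \<le> (\<integral>z. W z \<partial>\<nu>)"
        proof -
          have "(\<integral>z. c \<partial>\<nu>) \<le> (\<integral>z. W z \<partial>\<nu>)"
            using M(2) V0 c \<beta> sets_eq_imp_space_eq[OF \<nu>(2)] by (intro integral_mono) (auto simp: W_def)
          then show ?thesis by (simp add: \<nu>.prob_space)
        qed
        then have "\<alpha> * c \<le> \<alpha> * (\<integral>z. W z \<partial>\<nu>)" using \<alpha> by simp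
        then show ?thesis using M(1) intW[OF u(1)] by linarith
      qed
      \<comment> \<open>The common term
        \<open>\<alpha> * (\<integral>z. \<psi> z \<partial>\<nu>)\<close> cancels, and each
        remainder has gained \<open>\<alpha> * c\<close> because \<open>W \<ge> c\<close>.\<close>
      have "\<bar>(\<integral>z. \<psi> z \<partial>kernel_pow S K p x) - (\<integral>z. \<psi> z \<partial>kernel_pow S K p y)\<bar>
          \<le> (c * (1 + \<beta> * (\<gamma>' * V x + B)) - \<alpha> * c) + (c * (1 + \<beta> * (\<gamma>' * V y + B)) - \<alpha> * c)"
        using m[OF x VR(1)] m[OF y VR(2)] by linarith
      then show ?thesis using True by (simp add: algebra_simps)
    qed
    also have "\<dots> \<le> c * (a * (2 + \<beta> * ?s))"
      using c V0[OF x] V0[OF y] by (intro mult_left_mono a(3)) auto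
    finally show ?thesis using int\<phi>[OF x] int\<phi>[OF y] by (simp add: mult_ac)
  qed
  show ?thesis by (rule that[OF \<beta> a(1,2)]) (rule main)
qed

lemma uniform_decay:
  obtains C \<rho> where "0 \<le> C" "0 < \<rho>" "\<rho> < 1"
    "\<And>\<phi> x y t. Vbdd \<phi> 1 \<Longrightarrow> x \<in> space S \<Longrightarrow> y \<in> space S \<Longrightarrow>
      \<bar>(\<integral>z. \<phi> z \<partial>kernel_pow S K t x) - (\<integral>z. \<phi> z \<partial>kernel_pow S K t y)\<bar> \<le> C * \<rho> ^ t * (1 + V x + V y)"
proof -
  obtain \<beta> a where \<beta>: "0 < \<beta>" and a: "0 < a" "a < 1" and
    step: "\<And>\<phi> c x y. \<phi> \<in> borel_measurable S \<Longrightarrow> 0 \<le> c \<Longrightarrow>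
      (\<And>x y. x \<in> space S \<Longrightarrow> y \<in> space S \<Longrightarrow> \<bar>\<phi> x - \<phi> y\<bar> \<le> c * (2 + \<beta> * (V x + V y))) \<Longrightarrow>
      x \<in> space S \<Longrightarrow> y \<in> space S \<Longrightarrow>
      \<bar>(\<integral>z. \<phi> z \<partial>kernel_pow S K p x) - (\<integral>z. \<phi> z \<partial>kernel_pow S K p y)\<bar> \<le> a * c * (2 + \<beta> * (V x + V y))"
    using seminorm_contraction by blast
  \<comment> \<open>The contraction by \<open>a\<close> takes \<open>p\<close> steps, so the rate
    per step is the \<open>p\<close>-th root.\<close>
  define \<rho> where "\<rho> = root p a"
  have \<rho>: "0 < \<rho>" "\<rho> < 1" "\<rho> ^ p = a"
    using a p by (auto simp: \<rho>_def real_root_pow_pos2)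
  \<comment> \<open>Converts the weight \<open>1 + V\<close> with radius \<open>1 + B\<close> into
    the weight \<open>2 + \<beta> * (V x + V y)\<close> of the seminorm.\<close>
  define c1 where "c1 = (1 + B) * max 1 (1 / \<beta>)"
  have c1: "0 \<le> c1" using B \<beta> by (simp add: c1_def max_def)
  define C where "C = c1 * (2 + \<beta>) / \<rho> ^ p"
  have C: "0 \<le> C" using c1 \<beta> \<rho>(1) by (simp add: C_def)
  have pq: "\<bar>(\<integral>z. \<phi> z \<partial>kernel_pow S K (p * q) x) - (\<integral>z. \<phi> z \<partial>kernel_pow S K (p * q) y)\<bar>
      \<le> a ^ q * c1 * (2 + \<beta> * (V x + V y))"
    if \<phi>: "Vbdd \<phi> (1 + B)" and x: "x \<in> space S" and y: "y \<in> space S" for \<phi> q x y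
    using x y
  proof (induction q arbitrary: x y)
    case 0
    have "\<bar>\<phi> x\<bar> \<le> (1 + B) * (1 + V x)" "\<bar>\<phi> y\<bar> \<le> (1 + B) * (1 + V y)"
      using \<phi> 0 unfolding Vbdd_def by blast+
    then have "\<bar>\<phi> x - \<phi> y\<bar> \<le> (1 + B) * (1 + V x) + (1 + B) * (1 + V y)" by linarith
    also have "\<dots> = (1 + B) * (2 + 1 * (V x + V y))" by (simp add: algebra_simps)
    also have "\<dots> \<le> (1 + B) * (max 1 (1 / \<beta>) * (2 + \<beta> * (V x + V y)))"
    proof (rule mult_left_mono)
      have "2 * 1 \<le> 2 * max 1 (1 / \<beta>)" by simp
      moreover have "1 * (V x + V y) \<le> (max 1 (1 / \<beta>) * \<beta>) * (V x + V y)"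
        using V0 0 \<beta> by (intro mult_right_mono) (auto simp: max_def field_simps)
      ultimately show "2 + 1 * (V x + V y) \<le> max 1 (1 / \<beta>) * (2 + \<beta> * (V x + V y))"
        by (simp add: algebra_simps)
    qed (use B in simp)
    finally have "\<bar>\<phi> x - \<phi> y\<bar> \<le> c1 * (2 + \<beta> * (V x + V y))" by (simp add: c1_def)
    then show ?case using 0 \<phi> by (simp add: integral_return Vbdd_def)
  next
    case (Suc q)
    have eq: "(\<integral>z. \<phi> z \<partial>kernel_pow S K (p * Suc q) u) = (\<integral>v. \<integral>z. \<phi> z \<partial>kernel_pow S K (p * q) v \<partial>kernel_pow S K p u)"
      if "u \<in> space S" for u
      using integral_pow_add[OF \<phi> that, of p "p * q"] by simp
    have "(\<lambda>v. \<integral>z. \<phi> z \<partial>kernel_pow S K (p * q) v) \<in> borel_measurable S"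
      using \<phi> by (intro measurable_integral_kernel[OF kernel_pow_measurable]) (simp add: Vbdd_def)
    then show ?case unfolding eq[OF Suc.prems(1)] eq[OF Suc.prems(2)]
      using step[OF _ _ Suc.IH Suc.prems] a c1 by (simp add: mult.assoc)
  qed
  have "\<bar>(\<integral>z. \<phi> z \<partial>kernel_pow S K t x) - (\<integral>z. \<phi> z \<partial>kernel_pow S K t y)\<bar> \<le> C * \<rho> ^ t * (1 + V x + V y)"
    if \<phi>: "Vbdd \<phi> 1" and x: "x \<in> space S" and y: "y \<in> space S" for \<phi> x y t
  proof -
    \<comment> \<open>The \<open>r\<close> steps left over by the division are moved to the test
      function, which stays in the ball of radius \<open>1 + B\<close>. The division by
      \<open>\<rho> ^ p\<close> in \<open>C\<close> pays for them.\<close>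
    define q r where "q = t div p" and "r = t mod p"
    have "r < p" using p by (simp add: r_def)
    moreover have "t = p * q + r" by (simp add: q_def r_def)
    ultimately have t: "t = p * q + r" "t \<le> p * q + p" by simp_all
    define \<psi> where "\<psi> v = (\<integral>z. \<phi> z \<partial>kernel_pow S K r v)" for v
    have eq: "(\<integral>z. \<phi> z \<partial>kernel_pow S K t u) = (\<integral>v. \<psi> v \<partial>kernel_pow S K (p * q) u)"
      if "u \<in> space S" for u
      unfolding \<psi>_def t(1) by (rule integral_pow_add[OF \<phi> that])
    have "Vbdd \<psi> (1 + B)" using Vbdd_integral_pow[OF \<phi>, of r] unfolding \<psi>_def by simp
    from pq[OF this x y, of q]
    have "\<bar>(\<integral>z. \<phi> z \<partial>kernel_pow S K t x) - (\<integral>z. \<phi> z \<partial>kernel_pow S K t y)\<bar>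
        \<le> a ^ q * (c1 * (2 + \<beta> * (V x + V y)))" by (simp add: eq x y mult.assoc)
    also have "\<dots> \<le> (\<rho> ^ t / \<rho> ^ p) * (c1 * ((2 + \<beta>) * (1 + V x + V y)))"
    proof (intro mult_mono)
      have "\<rho> ^ (p * q + p) \<le> \<rho> ^ t" using \<rho> t(2) by (intro power_decreasing) auto
      then have "a ^ q * \<rho> ^ p \<le> \<rho> ^ t" by (simp only: power_add power_mult \<rho>(3))
      then show "a ^ q \<le> \<rho> ^ t / \<rho> ^ p"
        using \<rho>(1) by (simp only: pos_le_divide_eq zero_less_power)
      show "2 + \<beta> * (V x + V y) \<le> (2 + \<beta>) * (1 + V x + V y)"
        using \<beta> V0[OF x] V0[OF y] by (simp add: algebra_simps)
    qed (use \<rho> c1 \<beta> V0[OF x] V0[OF y] in auto)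
    also have "\<dots> = C * \<rho> ^ t * (1 + V x + V y)" by (simp add: C_def)
    finally show ?thesis .
  qed
  then show ?thesis using that C \<rho> by blast
qed

end

section \<open>Existence of the invariant law and convergence to it\<close>

lemma summable_Cauchy_rate:
  fixes f :: "nat \<Rightarrow> real"
  assumes step: "\<And>t. \<bar>f (Suc t) - f t\<bar> \<le> D * \<rho> ^ t" and \<rho>: "0 < \<rho>" "\<rho> < 1"
  shows "convergent f" "\<bar>lim f - f t\<bar> \<le> D / (1 - \<rho>) * \<rho> ^ t"
proof -
  have summ: "summable (\<lambda>t. f (Suc t) - f t)"
  proof (rule summable_comparison_test')
    show "summable (\<lambda>t. D * \<rho> ^ t)"
      by (intro summable_mult summable_geometric) (use \<rho> in simp)
    show "norm (f (Suc t) - f t) \<le> D * \<rho> ^ t" if "0 \<le> t" for t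
      unfolding real_norm_def by (rule step)
  qed
  have tele: "(\<lambda>n. f n - f 0) \<longlonglongrightarrow> (\<Sum>t. f (Suc t) - f t)"
    using summable_LIMSEQ[OF summ] by (simp only: sum_lessThan_telescope)
  then have "(\<lambda>n. (f n - f 0) + f 0) \<longlonglongrightarrow> (\<Sum>t. f (Suc t) - f t) + f 0"
    by (intro tendsto_add tendsto_const)
  then show conv: "convergent f" by (auto simp: convergent_def)
  then have L: "f \<longlonglongrightarrow> lim f" by (simp add: convergent_LIMSEQ_iff)
  have le: "\<bar>f (t + n) - f t\<bar> \<le> D / (1 - \<rho>) * \<rho> ^ t" for n
  proof -
    have D: "0 \<le> D" using step[of 0] by simp
    have "f (t + n) - f t = (\<Sum>k<n. f (Suc (t + k)) - f (t + k))"
      using sum_lessThan_telescope[of "\<lambda>k. f (t + k)" n] by simp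
    then have "\<bar>f (t + n) - f t\<bar> \<le> (\<Sum>k<n. D * \<rho> ^ (t + k))"
      using step by (auto intro!: order_trans[OF sum_abs] sum_mono)
    also have "\<dots> = D * \<rho> ^ t * (\<Sum>k<n. \<rho> ^ k)" by (simp add: sum_distrib_left power_add mult.assoc)
    also have "(\<Sum>k<n. \<rho> ^ k) = (1 - \<rho> ^ n) / (1 - \<rho>)" using \<rho> by (simp add: sum_gp_strict)
    also have "D * \<rho> ^ t * ((1 - \<rho> ^ n) / (1 - \<rho>)) \<le> D * \<rho> ^ t * (1 / (1 - \<rho>))"
      using D \<rho> by (intro mult_left_mono divide_right_mono) auto
    finally show ?thesis by simp
  qed
  have "(\<lambda>n. \<bar>f (n + t) - f t\<bar>) \<longlonglongrightarrow> \<bar>lim f - f t\<bar>"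
    by (intro tendsto_rabs tendsto_diff tendsto_const LIMSEQ_ignore_initial_segment L)
  then show "\<bar>lim f - f t\<bar> \<le> D / (1 - \<rho>) * \<rho> ^ t"
    by (rule LIMSEQ_le_const2) (use le in \<open>auto simp: add.commute\<close>)
qed

lemma LIMSEQ_of_abs_le:
  fixes f e :: "nat \<Rightarrow> real"
  assumes "\<And>t. \<bar>l - f t\<bar> \<le> e t" "e \<longlonglongrightarrow> 0"
  shows "f \<longlonglongrightarrow> l"
proof -
  have "(\<lambda>t. f t - l) \<longlonglongrightarrow> 0"
    by (rule Lim_null_comparison[OF _ assms(2)]) (use assms(1) in \<open>simp add: abs_minus_commute\<close>)
  then show ?thesis by (rule LIM_zero_cancel)
qed

text \<open>The error \<open>e t\<close> is the same for all sets. For continuity at the empty set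
  one fixed \<open>t\<close> with small error then suffices, and the continuity of that single
  \<open>\<mu> t\<close> does the rest.\<close>

lemma measure_of_setwise_limit:
  fixes \<mu> :: "nat \<Rightarrow> 's measure"
  assumes prob: "\<And>t. prob_space (\<mu> t)" "\<And>t. sets (\<mu> t) = sets S"
    and L: "\<And>A t. A \<in> sets S \<Longrightarrow> \<bar>L A - measure (\<mu> t) A\<bar> \<le> e t" and e: "e \<longlonglongrightarrow> 0"
  obtains \<pi> where "prob_space \<pi>" "sets \<pi> = sets S" "\<And>A. A \<in> sets S \<Longrightarrow> measure \<pi> A = L A"
proof -
  have sp: "space (\<mu> t) = space S" for t using prob(2) by (rule sets_eq_imp_space_eq)
  interpret prob_space "\<mu> t" for t by (rule prob)
  have lim: "(\<lambda>t. measure (\<mu> t) A) \<longlonglongrightarrow> L A" if "A \<in> sets S" for A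
    by (rule LIMSEQ_of_abs_le[OF L[OF that] e])
  have L0: "0 \<le> L A" if "A \<in> sets S" for A
    by (rule LIMSEQ_le_const[OF lim[OF that]]) auto
  have Lsp: "L (space S) = 1"
    using LIMSEQ_unique[OF lim[OF sets.top]] prob_space sp by (simp add: LIMSEQ_unique[OF lim[OF sets.top, unfolded sp[symmetric]]])
  have Lempty: "L {} = 0"
    using LIMSEQ_unique[OF lim[OF sets.empty_sets], of 0] by simp
  have pos: "positive (sets S) (\<lambda>A. ennreal (L A))" using Lempty by (simp add: positive_def)
  have "countably_additive (sets S) (\<lambda>A. ennreal (L A))"
  proof (rule sets.empty_continuous_imp_countably_additive[OF pos])
    show "additive (sets S) (\<lambda>A. ennreal (L A))"
    proof (unfold additive_def, intro ballI impI)
      fix A A' assume A: "A \<in> sets S" "A' \<in> sets S" "A \<inter> A' = {}"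
      have "(\<lambda>t. measure (\<mu> t) A + measure (\<mu> t) A') \<longlonglongrightarrow> L A + L A'" using A by (intro tendsto_add lim)
      moreover have "measure (\<mu> t) (A \<union> A') = measure (\<mu> t) A + measure (\<mu> t) A'" for t
        using A prob(2) by (intro finite_measure_Union) auto
      ultimately have "L (A \<union> A') = L A + L A'"
        using lim[of "A \<union> A'"] A by (auto intro: LIMSEQ_unique)
      then show "ennreal (L (A \<union> A')) = ennreal (L A) + ennreal (L A')" using L0 A by simp
    qed
    fix A :: "nat \<Rightarrow> 's set" assume A: "range A \<subseteq> sets S" "decseq A" "(\<Inter>i. A i) = {}"
    have "(\<lambda>i. L (A i)) \<longlonglongrightarrow> 0"
    proof (rule LIMSEQ_I)
      fix r :: real assume r: "0 < r"
      obtain t where t: "e t < r/2"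
        using order_tendstoD(2)[OF e, of "r/2"] r eventually_happens'[of sequentially] by auto
      have "(\<lambda>i. measure (\<mu> t) (A i)) \<longlonglongrightarrow> measure (\<mu> t) (\<Inter>i. A i)"
        using A prob(2) by (intro finite_Lim_measure_decseq) auto
      then have "eventually (\<lambda>i. measure (\<mu> t) (A i) < r/2) sequentially"
        using A(3) r by (intro order_tendstoD(2)) auto
      then obtain n where n: "\<And>i. i \<ge> n \<Longrightarrow> measure (\<mu> t) (A i) < r/2" by (auto simp: eventually_sequentially)
      have "norm (L (A i) - 0) < r" if "i \<ge> n" for i
      proof -
        have "A i \<in> sets S" using A by auto
        then show ?thesis using L[of "A i" t] L0[of "A i"] n[OF that] t by auto
      qed
      then show "\<exists>n. \<forall>i\<ge>n. norm (L (A i) - 0) < r" by auto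
    qed
    then show "(\<lambda>i. ennreal (L (A i))) \<longlonglongrightarrow> 0"
      using tendsto_ennrealI[of "\<lambda>i. L (A i)" 0] by simp
  qed simp
  then have em: "emeasure (measure_of (space S) (sets S) (\<lambda>A. ennreal (L A))) A = ennreal (L A)"
    if "A \<in> sets S" for A
    using pos that by (intro emeasure_measure_of_sigma) (auto intro: sets.sigma_algebra_axioms)
  let ?\<pi> = "measure_of (space S) (sets S) (\<lambda>A. ennreal (L A))"
  show ?thesis
  proof (rule that[of ?\<pi>])
    show s: "sets ?\<pi> = sets S" by simp
    show "prob_space ?\<pi>" using em[of "space S"] Lsp by (intro prob_spaceI) simp
    show "measure ?\<pi> A = L A" if "A \<in> sets S" for A
      using em[OF that] L0[OF that] by (simp add: measure_def)
  qed
qed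

context harris_chain
begin

theorem geometric_convergence:
  obtains \<pi> C \<rho> where "invariant_prob S K \<pi>" "(\<integral>\<^sup>+x. ennreal (V x) \<partial>\<pi>) < \<infinity>" "0 \<le> C" "0 < \<rho>" "\<rho> < 1"
    "\<And>\<phi> x t. Vbdd \<phi> 1 \<Longrightarrow> x \<in> space S \<Longrightarrow> integrable \<pi> \<phi> \<and>
      \<bar>(\<integral>z. \<phi> z \<partial>kernel_pow S K t x) - (\<integral>z. \<phi> z \<partial>\<pi>)\<bar> \<le> C * \<rho> ^ t * (1 + V x)"
proof -
  obtain C \<rho> where C: "0 \<le> C" and \<rho>: "0 < \<rho>" "\<rho> < 1" and decay:
    "\<And>\<phi> x y t. Vbdd \<phi> 1 \<Longrightarrow> x \<in> space S \<Longrightarrow> y \<in> space S \<Longrightarrow>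
      \<bar>(\<integral>z. \<phi> z \<partial>kernel_pow S K t x) - (\<integral>z. \<phi> z \<partial>kernel_pow S K t y)\<bar> \<le> C * \<rho> ^ t * (1 + V x + V y)"
    using uniform_decay by blast
  obtain x0 where x0: "x0 \<in> space S" using nonempty by blast
  define \<mu> where "\<mu> t = kernel_pow S K t x0" for t
  note P = kernel_powD[OF x0, folded \<mu>_def]
  \<comment> \<open>The law at time \<open>t + 1\<close> is the law at time \<open>t\<close> with a
    starting point \<open>y\<close> drawn from \<open>K x0\<close>. \<open>D\<close> bounds the mean
    of \<open>C * (1 + V x0 + V y)\<close> over \<open>y\<close>.\<close>
  define D where "D = C * (1 + V x0) + C * (\<gamma> ^ Suc 0 * V x0 + B)"
  have step: "\<bar>(\<integral>z. \<phi> z \<partial>\<mu> (Suc t)) - (\<integral>z. \<phi> z \<partial>\<mu> t)\<bar> \<le> D * \<rho> ^ t" if \<phi>: "Vbdd \<phi> 1" for \<phi> t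
  proof -
    let ?g = "\<lambda>y. \<integral>z. \<phi> z \<partial>kernel_pow S K t y"
    interpret prob_space "kernel_pow S K (Suc 0) x0" by (rule kernel_powD[OF x0])
    have g: "Vbdd ?g (1 + B)" using Vbdd_integral_pow[OF \<phi>] by simp
    have ig: "integrable (kernel_pow S K (Suc 0) x0) ?g" by (rule Vbdd_integrable[OF g x0])
    have "(\<integral>z. \<phi> z \<partial>\<mu> (Suc t)) = (\<integral>y. ?g y \<partial>kernel_pow S K (Suc 0) x0)"
      using integral_pow_add[OF \<phi> x0, of "Suc 0" t] by (simp only: \<mu>_def add_Suc add_0)
    moreover have "(\<integral>y. ?g y - ?g x0 \<partial>kernel_pow S K (Suc 0) x0) = (\<integral>y. ?g y \<partial>kernel_pow S K (Suc 0) x0) - ?g x0"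
      using ig by (simp add: prob_space del: kernel_pow.simps)
    ultimately have "(\<integral>z. \<phi> z \<partial>\<mu> (Suc t)) - (\<integral>z. \<phi> z \<partial>\<mu> t) = (\<integral>y. ?g y - ?g x0 \<partial>kernel_pow S K (Suc 0) x0)"
      by (simp add: \<mu>_def)
    also have "\<bar>\<dots>\<bar> \<le> C * \<rho> ^ t * (1 + V x0) + C * \<rho> ^ t * (\<integral>y. V y \<partial>kernel_pow S K (Suc 0) x0)"
    proof (rule abs_integral_pow_le[OF _ _ _ _ x0])
      show "(\<lambda>y. ?g y - ?g x0) \<in> borel_measurable S" using g by (auto simp: Vbdd_def)
      show "\<bar>?g y - ?g x0\<bar> \<le> C * \<rho> ^ t * (1 + V x0) + C * \<rho> ^ t * V y" if "y \<in> space S" for y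
        using decay[OF \<phi> that x0, of t] by (simp add: algebra_simps)
    qed (use C \<rho> V0[OF x0] in auto)
    also have "\<dots> \<le> C * \<rho> ^ t * (1 + V x0) + C * \<rho> ^ t * (\<gamma> ^ Suc 0 * V x0 + B)"
      using C \<rho> by (intro add_left_mono mult_left_mono drift_pow_real[OF x0]) auto
    also have "\<dots> = D * \<rho> ^ t" by (simp add: D_def algebra_simps)
    finally show ?thesis .
  qed
  have ind: "Vbdd (indicator A) 1" if "A \<in> sets S" for A
    using that V0 by (auto simp: Vbdd_def indicator_def)
  have m_ind: "(\<integral>z. indicator A z \<partial>\<mu> t) = measure (\<mu> t) A" if "A \<in> sets S" for A t
    using that P by (simp add: Int_absorb2[OF sets.sets_into_space])
  define L where "L A = lim (\<lambda>t. measure (\<mu> t) A)" for A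
  define e where "e t = D / (1 - \<rho>) * \<rho> ^ t" for t
  have rate: "\<bar>L A - measure (\<mu> t) A\<bar> \<le> e t" if "A \<in> sets S" for A t
    using summable_Cauchy_rate(2)[OF step[OF ind[OF that], unfolded m_ind[OF that]] \<rho>] by (simp add: L_def e_def)
  have "(\<lambda>t. D / (1 - \<rho>) * \<rho> ^ t) \<longlonglongrightarrow> D / (1 - \<rho>) * 0"
    by (intro tendsto_mult tendsto_const LIMSEQ_power_zero) (use \<rho> in auto)
  then have e0: "e \<longlonglongrightarrow> 0" by (simp add: e_def[abs_def])
  obtain \<pi> where \<pi>: "prob_space \<pi>" "sets \<pi> = sets S" "\<And>A. A \<in> sets S \<Longrightarrow> measure \<pi> A = L A"
    using measure_of_setwise_limit[of \<mu> S L e] P rate e0 by blast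
  interpret \<pi>: prob_space \<pi> by fact
  have spi: "space \<pi> = space S" using \<pi>(2) by (rule sets_eq_imp_space_eq)
  have pispace: "\<pi> \<in> space (prob_algebra S)" using \<pi> by (simp add: space_prob_algebra)
  have close: "\<bar>(\<integral>x. \<phi> x \<partial>\<pi>) - (\<integral>x. \<phi> x \<partial>\<mu> t)\<bar> \<le> e t"
    if "\<phi> \<in> borel_measurable S" "\<And>x. x \<in> space S \<Longrightarrow> 0 \<le> \<phi> x \<and> \<phi> x \<le> 1" for \<phi> :: "'s \<Rightarrow> real" and t
    using rate \<pi> that spi P
    by (intro uniform_setwise_integral) (auto simp: measurable_cong_sets[OF \<pi>(2) refl])
  have tends: "(\<lambda>t. \<integral>x. \<phi> x \<partial>\<mu> t) \<longlonglongrightarrow> (\<integral>x. \<phi> x \<partial>\<pi>)"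
    if "\<phi> \<in> borel_measurable S" "\<And>x. x \<in> space S \<Longrightarrow> 0 \<le> \<phi> x \<and> \<phi> x \<le> 1" for \<phi> :: "'s \<Rightarrow> real"
    by (rule LIMSEQ_of_abs_le[OF close[OF that] e0])
  have bindsp: "\<pi> \<bind> K \<in> space (prob_algebra S)"
    using measurable_space[OF measurable_bind_prob_space[OF measurable_ident K]] pispace by auto
  \<comment> \<open>For the measurable function \<open>?g\<close>, with values between 0 and 1, the
    integrals against \<open>\<mu> t\<close> converge without any continuity of the kernel. They
    equal the measures at time \<open>t + 1\<close>, whose limit is again that of \<pi>.\<close>
  have inv: "\<pi> \<bind> K = \<pi>"
  proof (rule measure_eqI)
    show "sets (\<pi> \<bind> K) = sets \<pi>" using space_prob_algebraD(1)[OF bindsp] \<pi>(2) by simp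
    fix A assume "A \<in> sets (\<pi> \<bind> K)"
    then have A: "A \<in> sets S" using space_prob_algebraD(1)[OF bindsp] by simp
    let ?g = "\<lambda>x. measure (K x) A"
    have g[measurable]: "?g \<in> borel_measurable S" using A by measurable
    have Kp: "prob_space (K x)" if "x \<in> space S" for x
      using space_prob_algebraD(2)[OF measurable_space[OF K that]] .
    have g01: "0 \<le> ?g x \<and> ?g x \<le> 1" if "x \<in> space S" for x
      using prob_space.prob_le_1[OF Kp[OF that]] by simp
    have eqt: "(\<integral>x. ?g x \<partial>\<mu> t) = measure (\<mu> (Suc t)) A" for t
    proof -
      have "(\<integral>x. ?g x \<partial>\<mu> t) = (\<integral>x. \<integral>z. indicator A z \<partial>kernel_pow S K (Suc 0) x \<partial>\<mu> t)"
        using A P by (intro Bochner_Integration.integral_cong)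
          (auto simp: kernel_pow_1 Int_absorb2[OF sets.sets_into_space] space_prob_algebraD[OF measurable_space[OF K]] simp del: kernel_pow.simps)
      also have "\<dots> = (\<integral>z. indicator A z \<partial>\<mu> (Suc t))"
        using integral_pow_add[OF ind[OF A] x0, of t "Suc 0"] by (simp add: \<mu>_def del: kernel_pow.simps)
      finally show ?thesis using m_ind[OF A] by simp
    qed
    have "(\<lambda>t. measure (\<mu> (Suc t)) A) \<longlonglongrightarrow> (\<integral>x. ?g x \<partial>\<pi>)"
      using tends[OF g g01] by (simp add: eqt)
    moreover have "(\<lambda>t. measure (\<mu> (Suc t)) A) \<longlonglongrightarrow> measure \<pi> A"
    proof -
      have "(\<lambda>t. \<integral>x. (indicator A x :: real) \<partial>\<mu> t) \<longlonglongrightarrow> (\<integral>x. indicator A x \<partial>\<pi>)"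
        using A by (intro tends) auto
      then have "(\<lambda>t. measure (\<mu> t) A) \<longlonglongrightarrow> measure \<pi> A"
      proof -
        have "(\<integral>x. (indicator A x :: real) \<partial>\<pi>) = measure \<pi> A"
          using A \<pi>(2) by (simp add: Int_absorb2[OF sets.sets_into_space])
        then show ?thesis using \<open>(\<lambda>t. \<integral>x. (indicator A x :: real) \<partial>\<mu> t) \<longlonglongrightarrow> _\<close>
          by (simp only: m_ind[OF A])
      qed
      then show ?thesis by (rule LIMSEQ_Suc)
    qed
    ultimately have gA: "(\<integral>x. ?g x \<partial>\<pi>) = measure \<pi> A" by (rule LIMSEQ_unique)
    have "emeasure (\<pi> \<bind> K) A = (\<integral>\<^sup>+x. emeasure (K x) A \<partial>\<pi>)"
      by (rule emeasure_bind_prob_algebra[OF pispace K A])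
    also have "\<dots> = (\<integral>\<^sup>+x. ennreal (?g x) \<partial>\<pi>)"
      using finite_measure.emeasure_eq_measure[OF prob_space.finite_measure[OF Kp]]
      by (intro nn_integral_cong) (simp add: spi)
    also have "\<dots> = ennreal (\<integral>x. ?g x \<partial>\<pi>)"
      using g g01 by (intro nn_integral_eq_integral \<pi>.integrable_const_bound[where B=1])
        (auto simp: spi measurable_cong_sets[OF \<pi>(2) refl])
    finally show "emeasure (\<pi> \<bind> K) A = emeasure \<pi> A" by (simp add: gA \<pi>.emeasure_eq_measure)
  qed
  then have invP: "invariant_prob S K \<pi>" using \<pi> by (simp add: invariant_prob_def)
  note invpow = invariant_pow[OF invP]
  define EV where "EV = V x0 + B"
  \<comment> \<open>So far integrals converge only for functions with values between 0 and 1.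
    \<open>V\<close> is cut off at \<open>m\<close> and divided by \<open>m\<close>; the resulting
    bound \<open>EV\<close> is free of \<open>m\<close>, so monotone convergence removes the
    cut.\<close>
  have trunc: "(\<integral>\<^sup>+x. ennreal (min (V x) (real m)) \<partial>\<pi>) \<le> ennreal EV" for m
  proof (cases "m = 0")
    case True
    have "(\<integral>\<^sup>+x. ennreal (min (V x) (real m)) \<partial>\<pi>) = (\<integral>\<^sup>+x. 0 \<partial>\<pi>)"
      using True by (intro nn_integral_cong) (simp add: spi min_absorb2[OF V0])
    then show ?thesis by simp
  next
    case False
    define h where "h x = min (V x) (real m) / real m" for x
    have \<phi>: "h \<in> borel_measurable S" "\<And>x. x \<in> space S \<Longrightarrow> 0 \<le> h x \<and> h x \<le> 1"
      using False V0 by (auto simp: min_def h_def[abs_def])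
    have hn: "norm (h x) \<le> 1" if "x \<in> space S" for x using \<phi>(2)[OF that] by simp
    have "(\<integral>x. h x \<partial>\<mu> t) \<le> EV / real m" for t
    proof -
      have "(\<integral>x. h x \<partial>\<mu> t) \<le> (\<integral>x. V x / real m \<partial>\<mu> t)"
      proof (rule integral_mono)
        show "integrable (\<mu> t) h"
          using \<phi>(1) hn prob_space.finite_measure[OF P(2)[of t]]
          by (intro finite_measure.integrable_const_bound[where B=1] AE_I2) (auto simp: P(3) measurable_cong_sets[OF P(1) refl])
        show "integrable (\<mu> t) (\<lambda>x. V x / real m)"
          using Vbdd_integrable[OF Vbdd_V x0] by (simp add: \<mu>_def)
      qed (simp add: h_def divide_right_mono)
      also have "\<dots> = (\<integral>x. V x \<partial>\<mu> t) / real m" by simp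
      also have "\<dots> \<le> EV / real m"
      proof (rule divide_right_mono)
        have "(\<integral>x. V x \<partial>\<mu> t) \<le> \<gamma> ^ t * V x0 + B" unfolding \<mu>_def by (rule drift_pow_real[OF x0])
        also have "\<dots> \<le> EV" using \<gamma> V0[OF x0] by (simp add: EV_def mult_left_le_one_le power_le_one)
        finally show "(\<integral>x. V x \<partial>\<mu> t) \<le> EV" .
      qed simp
      finally show ?thesis .
    qed
    then have le: "(\<integral>x. h x \<partial>\<pi>) \<le> EV / real m"
      by (intro LIMSEQ_le_const2[OF tends[OF \<phi>]]) auto
    have i: "integrable \<pi> h"
      using \<phi>(1) hn by (intro \<pi>.integrable_const_bound[where B=1] AE_I2) (auto simp: spi measurable_cong_sets[OF \<pi>(2) refl])
    then have "integrable \<pi> (\<lambda>x. real m * h x)" by (rule integrable_mult_right)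
    then have i2: "integrable \<pi> (\<lambda>x. min (V x) (real m))" using False by (simp add: h_def)
    have "(\<integral>x. min (V x) (real m) \<partial>\<pi>) = real m * (\<integral>x. h x \<partial>\<pi>)" using False by (simp add: h_def)
    also have "\<dots> \<le> EV" using le False by (simp add: field_simps)
    finally have "(\<integral>x. min (V x) (real m) \<partial>\<pi>) \<le> EV" .
    moreover have "(\<integral>\<^sup>+x. ennreal (min (V x) (real m)) \<partial>\<pi>) = ennreal (\<integral>x. min (V x) (real m) \<partial>\<pi>)"
      using V0 by (intro nn_integral_eq_integral i2) (auto simp: spi)
    ultimately show ?thesis by (simp add: ennreal_leI)
  qed
  have nnV: "(\<integral>\<^sup>+x. ennreal (V x) \<partial>\<pi>) \<le> ennreal EV"
  proof -
    have "(\<integral>\<^sup>+x. ennreal (V x) \<partial>\<pi>) = (\<integral>\<^sup>+x. (SUP m. ennreal (min (V x) (real m))) \<partial>\<pi>)"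
    proof (rule nn_integral_cong)
      fix x
      obtain m where m: "V x \<le> real m" using real_arch_simple by blast
      show "ennreal (V x) = (SUP m. ennreal (min (V x) (real m)))"
        by (rule antisym) (use m in \<open>auto intro!: SUP_upper2[of m] SUP_least ennreal_leI\<close>)
    qed
    also have "\<dots> = (SUP m. \<integral>\<^sup>+x. ennreal (min (V x) (real m)) \<partial>\<pi>)"
      by (intro nn_integral_monotone_convergence_SUP)
        (auto simp: incseq_def le_fun_def measurable_cong_sets[OF \<pi>(2) refl] intro!: ennreal_leI)
    also have "\<dots> \<le> ennreal EV" using trunc by (intro SUP_least)
    finally show ?thesis .
  qed
  then have finV: "(\<integral>\<^sup>+x. ennreal (V x) \<partial>\<pi>) < \<infinity>" by (rule order.strict_trans1) simp
  have iV: "integrable \<pi> V"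
    using finV V0 by (intro integrable_dominated[of V _ V]) (auto simp: spi measurable_cong_sets[OF \<pi>(2) refl])
  define EP where "EP = (\<integral>x. V x \<partial>\<pi>)"
  have EP: "0 \<le> EP" unfolding EP_def using V0 by (intro integral_nonneg_AE) (auto simp: spi)
  have fin1V: "(\<integral>\<^sup>+x. ennreal (1 * (1 + V x)) \<partial>\<pi>) < \<infinity>"
  proof -
    have "(\<integral>\<^sup>+x. ennreal (1 * (1 + V x)) \<partial>\<pi>) = (\<integral>\<^sup>+x. 1 + ennreal (V x) \<partial>\<pi>)"
      using V0 by (intro nn_integral_cong) (simp add: spi ennreal_plus)
    also have "\<dots> = 1 + (\<integral>\<^sup>+x. ennreal (V x) \<partial>\<pi>)"
      by (subst nn_integral_add) (auto simp: \<pi>.emeasure_space_1 measurable_cong_sets[OF \<pi>(2) refl])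
    finally show ?thesis using finV by simp
  qed
  \<comment> \<open>By invariance the integral of \<phi> is the \<pi>-average of the integrals of
    \<phi> against the \<open>t\<close>-step laws from \<open>y\<close>. Averaging the two-point
    decay over \<open>y\<close> brings in the mean \<open>EP\<close> of \<open>V\<close>.\<close>
  have final: "integrable \<pi> \<phi> \<and>
      \<bar>(\<integral>z. \<phi> z \<partial>kernel_pow S K t x) - (\<integral>z. \<phi> z \<partial>\<pi>)\<bar> \<le> (C * (1 + EP)) * \<rho> ^ t * (1 + V x)"
    if \<phi>: "Vbdd \<phi> 1" and x: "x \<in> space S" for \<phi> x t
  proof -
    let ?g = "\<lambda>y. \<integral>z. \<phi> z \<partial>kernel_pow S K t y"
    have fin2: "(\<integral>\<^sup>+x. \<integral>\<^sup>+y. ennreal (1 * (1 + V y)) \<partial>kernel_pow S K t x \<partial>\<pi>) < \<infinity>"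
      using fin1V nn_integral_bind_prob_algebra[OF pispace kernel_pow_measurable[of t], of "\<lambda>y. ennreal (1 * (1 + V y))"]
      by (simp add: invpow)
    have \<phi>m: "\<phi> \<in> borel_measurable S" and \<phi>W: "\<And>x. x \<in> space S \<Longrightarrow> \<bar>\<phi> x\<bar> \<le> 1 * (1 + V x)"
      using \<phi> unfolding Vbdd_def by blast+
    have Wm: "(\<lambda>x. 1 * (1 + V x)) \<in> borel_measurable S" by measurable
    note I = integral_bind_prob_algebra[OF pispace kernel_pow_measurable \<phi>m Wm \<phi>W nn_integral_V_finite fin2,
        unfolded invpow]
    have I1: "(\<integral>x. \<phi> x \<partial>\<pi>) = (\<integral>x. ?g x \<partial>\<pi>)" and I2: "integrable \<pi> \<phi>" and I3: "integrable \<pi> ?g"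
      by (rule I; assumption)+
    have "?g x - (\<integral>z. \<phi> z \<partial>\<pi>) = (\<integral>y. ?g x - ?g y \<partial>\<pi>)"
      using I1 I3 by (simp add: \<pi>.prob_space)
    also have "\<bar>\<dots>\<bar> \<le> (\<integral>y. \<bar>?g x - ?g y\<bar> \<partial>\<pi>)" by (rule integral_abs_bound)
    also have "\<dots> \<le> (\<integral>y. C * \<rho> ^ t * (1 + V x) + C * \<rho> ^ t * V y \<partial>\<pi>)"
      using I3 iV decay[OF \<phi> x, of _ t] by (intro integral_mono) (auto simp: spi algebra_simps)
    also have "\<dots> = C * \<rho> ^ t * (1 + V x + EP)" using iV by (simp add: \<pi>.prob_space EP_def algebra_simps)
    also have "\<dots> \<le> C * \<rho> ^ t * ((1 + EP) * (1 + V x))"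
      using C \<rho> EP V0[OF x] by (intro mult_left_mono) (auto simp: algebra_simps)
    finally show ?thesis using I2 by (simp add: mult_ac)
  qed
  show ?thesis
  proof (rule that[OF invP finV _ \<rho> final])
    show "0 \<le> C * (1 + EP)" using C EP by simp
  qed
qed

end

section \<open>Path measures and Harris recurrence\<close>

context markov
begin

context
  fixes x assumes x: "x \<in> space S"
begin

interpretation IT: Ionescu_Tulcea "path_step S K x" "\<lambda>_. S"
  by (rule Ionescu_Tulcea_path_step[OF markov_kernel x])

lemma path_measure_eq: "path_measure S K x = IT.PF.lim"
  by (simp add: path_measure_def)

lemma sets_path_measure: "sets (path_measure S K x) = sets (PiM UNIV (\<lambda>_. S))"
  by (simp add: path_measure_eq)

lemma space_path_measure: "space (path_measure S K x) = space (PiM UNIV (\<lambda>_. S))"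
  by (rule sets_eq_imp_space_eq[OF sets_path_measure])

lemma measurable_restrict_path: "(\<lambda>\<omega>. restrict \<omega> J) \<in> path_measure S K x \<rightarrow>\<^sub>M PiM J (\<lambda>_. S)"
  by (simp add: measurable_cong_sets[OF sets_path_measure refl] measurable_restrict_subset)

lemma prob_space_path_measure: "prob_space (path_measure S K x)"
proof -
  have "prob_space (distr (path_measure S K x) (PiM {} (\<lambda>_. S)) (\<lambda>\<omega>. restrict \<omega> {}))"
    unfolding path_measure_eq by (subst IT.distr_lim) (auto intro: IT.PF.prob_space_P)
  then show ?thesis by (rule prob_space_distrD[OF measurable_restrict_path])
qed

lemma nn_integral_path_prefix:
  assumes f[measurable]: "f \<in> borel_measurable (PiM {0..<n} (\<lambda>_. S))"
  shows "(\<integral>\<^sup>+\<omega>. f (restrict \<omega> {0..<n}) \<partial>path_measure S K x) = (\<integral>\<^sup>+\<omega>. f \<omega> \<partial>IT.C 0 n (\<lambda>_. undefined))"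
proof -
  have up: "IT.up_to {0..<n} = n"
    by (intro antisym) (auto simp: IT.up_to_iff, metis IT.up_to_less atLeastLessThan_iff finite_atLeastLessThan le0 linorder_not_less less_irrefl)
  have "(\<integral>\<^sup>+\<omega>. f (restrict \<omega> {0..<n}) \<partial>path_measure S K x) =
      (\<integral>\<^sup>+\<omega>. f \<omega> \<partial>distr (path_measure S K x) (PiM {0..<n} (\<lambda>_. S)) (\<lambda>\<omega>. restrict \<omega> {0..<n}))"
    by (subst nn_integral_distr) (auto intro: measurable_restrict_path)
  also have "distr (path_measure S K x) (PiM {0..<n} (\<lambda>_. S)) (\<lambda>\<omega>. restrict \<omega> {0..<n}) =
      distr (IT.C 0 n (\<lambda>_. undefined)) (PiM {0..<n} (\<lambda>_. S)) (\<lambda>\<omega>. restrict \<omega> {0..<n})"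
    unfolding path_measure_eq by (subst IT.distr_lim) (auto simp: IT.CI_def up)
  also have "\<dots> = IT.C 0 n (\<lambda>_. undefined)"
    using IT.distr_C[of n n "\<lambda>_. undefined" 0] by simp
  finally show ?thesis .
qed

text \<open>The Markov property with a factor that sees the path up to time \<open>n\<close>. It is
  read off the last kernel of the Ionescu-Tulcea construction.\<close>

lemma nn_integral_path_step:
  assumes f[measurable]: "f \<in> borel_measurable (PiM {0..<Suc n} (\<lambda>_. S))"
    and g[measurable]: "g \<in> borel_measurable S"
  shows "(\<integral>\<^sup>+\<omega>. f (restrict \<omega> {0..<Suc n}) * g (\<omega> (Suc n)) \<partial>path_measure S K x) =
    (\<integral>\<^sup>+\<omega>. f (restrict \<omega> {0..<Suc n}) * (\<integral>\<^sup>+z. g z \<partial>K (\<omega> n)) \<partial>path_measure S K x)"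
proof -
  let ?h = "\<lambda>\<omega>. f (restrict \<omega> {0..<Suc n}) * g (\<omega> (Suc n))"
  have h: "?h \<in> borel_measurable (PiM {0..<Suc (Suc n)} (\<lambda>_. S))"
  proof -
    have [measurable]: "(\<lambda>\<omega>. restrict \<omega> {0..<Suc n}) \<in> PiM {0..<Suc (Suc n)} (\<lambda>_. S) \<rightarrow>\<^sub>M PiM {0..<Suc n} (\<lambda>_. S)"
      by (intro measurable_restrict_subset) auto
    have [measurable]: "(\<lambda>\<omega>. \<omega> (Suc n)) \<in> PiM {0..<Suc (Suc n)} (\<lambda>_. S) \<rightarrow>\<^sub>M S"
      by (intro measurable_component_singleton) auto
    show ?thesis by measurable
  qed
  let ?k = "\<lambda>\<omega>. f \<omega> * (\<integral>\<^sup>+z. g z \<partial>K (\<omega> n))"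
  have [measurable]: "(\<lambda>\<omega>. \<omega> n) \<in> PiM {0..<Suc n} (\<lambda>_. S) \<rightarrow>\<^sub>M S"
    by (intro measurable_component_singleton) auto
  have [measurable]: "(\<lambda>y. \<integral>\<^sup>+z. g z \<partial>K y) \<in> borel_measurable S"
    by (rule measurable_nn_integral_kernel[OF K g])
  have k: "?k \<in> borel_measurable (PiM {0..<Suc n} (\<lambda>_. S))" by measurable
  have "(\<integral>\<^sup>+\<omega>. ?h \<omega> \<partial>path_measure S K x) = (\<integral>\<^sup>+\<omega>. ?h (restrict \<omega> {0..<Suc (Suc n)}) \<partial>path_measure S K x)"
    by (intro nn_integral_cong) (simp add: Int_absorb1)
  also have "\<dots> = (\<integral>\<^sup>+\<omega>. ?h \<omega> \<partial>IT.C 0 (Suc (Suc n)) (\<lambda>_. undefined))" by (rule nn_integral_path_prefix[OF h])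
  also have "\<dots> = (\<integral>\<^sup>+\<omega>. \<integral>\<^sup>+\<omega>'. ?h \<omega>' \<partial>IT.eP (Suc n) \<omega> \<partial>IT.C 0 (Suc n) (\<lambda>_. undefined))"
  proof -
    have "IT.C 0 (Suc (Suc n)) (\<lambda>_. undefined) = IT.C 0 (Suc n) (\<lambda>_. undefined) \<bind> IT.eP (Suc n)" by simp
    moreover have "IT.eP (Suc n) \<in> IT.C 0 (Suc n) (\<lambda>_. undefined) \<rightarrow>\<^sub>M subprob_algebra (PiM {0..<Suc (Suc n)} (\<lambda>_. S))"
    proof -
      have "sets (IT.C 0 (Suc n) (\<lambda>_. undefined)) = sets (PiM {0..<Suc n} (\<lambda>_. S))"
        using IT.sets_C[of "\<lambda>_. undefined" 0 "Suc n"] by (simp del: IT.C.simps)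
      from measurable_cong_sets[OF this refl] IT.measurable_eP[of "Suc n"] show ?thesis by blast
    qed
    ultimately show ?thesis using nn_integral_bind[OF h] by (simp del: IT.C.simps)
  qed
  also have "\<dots> = (\<integral>\<^sup>+\<omega>. ?k \<omega> \<partial>IT.C 0 (Suc n) (\<lambda>_. undefined))"
  proof (rule nn_integral_cong)
    fix \<omega> assume "\<omega> \<in> space (IT.C 0 (Suc n) (\<lambda>_. undefined))"
    then have \<omega>: "\<omega> \<in> space (PiM {0..<Suc n} (\<lambda>_. S))"
      using IT.space_C[of "\<lambda>_. undefined" 0 "Suc n"] by (simp del: IT.C.simps)
    then have \<omega>n: "\<omega> n \<in> space S" by (auto simp: space_PiM PiE_iff)
    \<comment> \<open>Elements of the product space are \<open>undefined\<close> outside the index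
      set, so restricting after the update at \<open>Suc n\<close> gives back the whole of
      \<open>\<omega>\<close>.\<close>
    have r: "restrict (fun_upd \<omega> (Suc n) z) {0..<Suc n} = \<omega>" for z
    proof
      fix i show "restrict (fun_upd \<omega> (Suc n) z) {0..<Suc n} i = \<omega> i"
      proof (cases "i \<in> {0..<Suc n}")
        case True
        then have "i \<noteq> Suc n" by simp
        with True show ?thesis by (simp only: restrict_apply' fun_upd_apply if_False)
      next
        case False
        with \<omega> have "\<omega> i = undefined" unfolding space_PiM by (rule PiE_arb)
        with False show ?thesis unfolding restrict_def by (simp only: if_False)
      qed
    qed
    have "(\<integral>\<^sup>+\<omega>'. ?h \<omega>' \<partial>IT.eP (Suc n) \<omega>) = (\<integral>\<^sup>+z. ?h (fun_upd \<omega> (Suc n) z) \<partial>path_step S K x (Suc n) \<omega>)"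
      by (rule IT.nn_integral_eP[OF \<omega> h])
    also have "\<dots> = (\<integral>\<^sup>+z. f \<omega> * g z \<partial>K (\<omega> n))" by (simp only: r path_step_def nat.case fun_upd_same)
    also have "\<dots> = ?k \<omega>"
      using g measurable_cong_sets[OF space_prob_algebraD(1)[OF measurable_space[OF K \<omega>n]] refl]
      by (intro nn_integral_cmult) blast
    finally show "(\<integral>\<^sup>+\<omega>'. ?h \<omega>' \<partial>IT.eP (Suc n) \<omega>) = ?k \<omega>" .
  qed
  also have "\<dots> = (\<integral>\<^sup>+\<omega>. ?k (restrict \<omega> {0..<Suc n}) \<partial>path_measure S K x)"
    by (rule nn_integral_path_prefix[OF k, symmetric])
  also have "\<dots> = (\<integral>\<^sup>+\<omega>. f (restrict \<omega> {0..<Suc n}) * (\<integral>\<^sup>+z. g z \<partial>K (\<omega> n)) \<partial>path_measure S K x)"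
  proof (rule nn_integral_cong)
    fix \<omega> :: "nat \<Rightarrow> 's"
    have "restrict \<omega> {0..<Suc n} n = \<omega> n" by (rule restrict_apply') simp
    then show "?k (restrict \<omega> {0..<Suc n}) = f (restrict \<omega> {0..<Suc n}) * (\<integral>\<^sup>+z. g z \<partial>K (\<omega> n))"
      by (simp only:)
  qed
  finally show ?thesis .
qed

lemma nn_integral_path_0:
  assumes g[measurable]: "g \<in> borel_measurable S"
  shows "(\<integral>\<^sup>+\<omega>. g (\<omega> 0) \<partial>path_measure S K x) = g x"
proof -
  have [measurable]: "(\<lambda>\<omega>. \<omega> 0) \<in> PiM {0..<Suc 0} (\<lambda>_. S) \<rightarrow>\<^sub>M S"
    by (intro measurable_component_singleton) auto
  have h: "(\<lambda>\<omega>. g (\<omega> 0)) \<in> borel_measurable (PiM {0..<Suc 0} (\<lambda>_. S))" by measurable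
  have u: "(\<lambda>_. undefined) \<in> space (PiM {0..<0::nat} (\<lambda>_. S))" by (simp add: space_PiM)
  have "(\<integral>\<^sup>+\<omega>. g (\<omega> 0) \<partial>path_measure S K x) = (\<integral>\<^sup>+\<omega>. g (restrict \<omega> {0..<Suc 0} 0) \<partial>path_measure S K x)" by simp
  also have "\<dots> = (\<integral>\<^sup>+\<omega>. g (\<omega> 0) \<partial>IT.C 0 (Suc 0) (\<lambda>_. undefined))" by (rule nn_integral_path_prefix[OF h])
  also have "IT.C 0 (Suc 0) (\<lambda>_. undefined) = IT.eP 0 (\<lambda>_. undefined)"
    using bind_return[OF IT.measurable_eP[of 0] u] by simp
  also have "(\<integral>\<^sup>+\<omega>. g (\<omega> 0) \<partial>IT.eP 0 (\<lambda>_. undefined)) = (\<integral>\<^sup>+z. g z \<partial>return S x)"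
    using IT.nn_integral_eP[OF u h] by (simp add: path_step_def)
  finally show ?thesis using x by (simp add: nn_integral_return)
qed

text \<open>The factor \<open>f\<close> for the past is kept so that the chain can be watched at
  sparse times, conditionally on what has been seen before.\<close>

lemma nn_integral_path_pow:
  assumes f[measurable]: "f \<in> borel_measurable (PiM {0..<Suc n} (\<lambda>_. S))"
    and g: "g \<in> borel_measurable S"
  shows "(\<integral>\<^sup>+\<omega>. f (restrict \<omega> {0..<Suc n}) * g (\<omega> (n + s)) \<partial>path_measure S K x) =
    (\<integral>\<^sup>+\<omega>. f (restrict \<omega> {0..<Suc n}) * (\<integral>\<^sup>+z. g z \<partial>kernel_pow S K s (\<omega> n)) \<partial>path_measure S K x)"
  using g
proof (induction s arbitrary: g)
  case 0
  show ?case
    using 0 by (intro nn_integral_cong)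
      (auto simp: space_path_measure space_PiM PiE_iff nn_integral_return intro!: arg_cong2[where f = "(*)"])
next
  case (Suc s)
  have f': "(\<lambda>\<omega>. f (restrict \<omega> {0..<Suc n})) \<in> borel_measurable (PiM {0..<Suc (n + s)} (\<lambda>_. S))"
    by (rule measurable_compose[OF _ f], rule measurable_restrict_subset) auto
  have r: "restrict (restrict \<omega> {0..<Suc (n + s)}) {0..<Suc n} = restrict \<omega> {0..<Suc n}" for \<omega> :: "nat \<Rightarrow> 's"
    by (simp add: restrict_restrict Int_absorb1)
  have Kg: "(\<lambda>y. \<integral>\<^sup>+z. g z \<partial>K y) \<in> borel_measurable S"
    by (rule measurable_nn_integral_kernel[OF K Suc.prems])
  have "(\<integral>\<^sup>+\<omega>. f (restrict \<omega> {0..<Suc n}) * g (\<omega> (n + Suc s)) \<partial>path_measure S K x) =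
      (\<integral>\<^sup>+\<omega>. f (restrict \<omega> {0..<Suc n}) * (\<integral>\<^sup>+z. g z \<partial>K (\<omega> (n + s))) \<partial>path_measure S K x)"
    using nn_integral_path_step[OF f' Suc.prems] by (simp add: r)
  also have "\<dots> = (\<integral>\<^sup>+\<omega>. f (restrict \<omega> {0..<Suc n}) * (\<integral>\<^sup>+y. \<integral>\<^sup>+z. g z \<partial>K y \<partial>kernel_pow S K s (\<omega> n)) \<partial>path_measure S K x)"
    by (rule Suc.IH[OF Kg])
  also have "\<dots> = (\<integral>\<^sup>+\<omega>. f (restrict \<omega> {0..<Suc n}) * (\<integral>\<^sup>+z. g z \<partial>kernel_pow S K (Suc s) (\<omega> n)) \<partial>path_measure S K x)"
  proof (rule nn_integral_cong)
    fix \<omega> assume "\<omega> \<in> space (path_measure S K x)"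
    then have "\<omega> n \<in> space S" by (auto simp: space_path_measure space_PiM)
    then show "f (restrict \<omega> {0..<Suc n}) * (\<integral>\<^sup>+y. \<integral>\<^sup>+z. g z \<partial>K y \<partial>kernel_pow S K s (\<omega> n)) =
        f (restrict \<omega> {0..<Suc n}) * (\<integral>\<^sup>+z. g z \<partial>kernel_pow S K (Suc s) (\<omega> n))"
      using nn_integral_bind_prob_algebra[OF kernel_pow_space K Suc.prems] by simp
  qed
  finally show ?case .
qed

lemma nn_integral_path_marginal:
  assumes g: "g \<in> borel_measurable S"
  shows "(\<integral>\<^sup>+\<omega>. g (\<omega> t) \<partial>path_measure S K x) = (\<integral>\<^sup>+z. g z \<partial>kernel_pow S K t x)"
proof -
  have "(\<integral>\<^sup>+\<omega>. g (\<omega> t) \<partial>path_measure S K x) = (\<integral>\<^sup>+\<omega>. (\<integral>\<^sup>+z. g z \<partial>kernel_pow S K t (\<omega> 0)) \<partial>path_measure S K x)"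
    using nn_integral_path_pow[of "\<lambda>_. 1" 0 g t] g by simp
  also have "\<dots> = (\<integral>\<^sup>+z. g z \<partial>kernel_pow S K t x)"
    by (rule nn_integral_path_0[OF measurable_nn_integral_kernel[OF kernel_pow_measurable g]])
  finally show ?thesis .
qed

lemma measurable_path_component: "(\<lambda>\<omega>. \<omega> t) \<in> path_measure S K x \<rightarrow>\<^sub>M S"
  by (simp add: measurable_cong_sets[OF sets_path_measure refl])

lemma path_event_sets: "A \<in> sets S \<Longrightarrow> {\<omega> \<in> space (path_measure S K x). \<omega> t \<in> A} \<in> sets (path_measure S K x)"
proof -
  assume "A \<in> sets S"
  then have "(\<lambda>\<omega>. \<omega> t) -` A \<inter> space (path_measure S K x) \<in> sets (path_measure S K x)"
    by (rule measurable_sets[OF measurable_path_component])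
  moreover have "(\<lambda>\<omega>. \<omega> t) -` A \<inter> space (path_measure S K x) = {\<omega> \<in> space (path_measure S K x). \<omega> t \<in> A}"
    by auto
  ultimately show ?thesis by simp
qed

lemma measure_path_marginal:
  assumes A: "A \<in> sets S"
  shows "measure (path_measure S K x) {\<omega> \<in> space (path_measure S K x). \<omega> t \<in> A} = measure (kernel_pow S K t x) A"
proof -
  have "emeasure (path_measure S K x) {\<omega> \<in> space (path_measure S K x). \<omega> t \<in> A} =
      (\<integral>\<^sup>+\<omega>. indicator {\<omega> \<in> space (path_measure S K x). \<omega> t \<in> A} \<omega> \<partial>path_measure S K x)"
    by (rule nn_integral_indicator[OF path_event_sets[OF A], symmetric])
  also have "\<dots> = (\<integral>\<^sup>+\<omega>. indicator A (\<omega> t) \<partial>path_measure S K x)"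
    by (intro nn_integral_cong) (simp add: indicator_def)
  also have "\<dots> = emeasure (kernel_pow S K t x) A"
    using A kernel_powD(1)[OF x] by (subst nn_integral_path_marginal) auto
  finally show ?thesis by (simp add: measure_def)
qed

text \<open>Hitting is a countable union over times, so it has positive probability as soon as, and
  only if, some single time does. Irreducibility thereby becomes a statement about kernel
  powers.\<close>

lemma hit_prob_pos_iff:
  assumes A: "A \<in> sets S"
  shows "hit_prob S K x A > 0 \<longleftrightarrow> (\<exists>t\<ge>1. measure (kernel_pow S K t x) A > 0)"
proof -
  interpret prob_space "path_measure S K x" by (rule prob_space_path_measure)
  let ?E = "\<lambda>t. {\<omega> \<in> space (path_measure S K x). \<omega> t \<in> A}"
  let ?H = "{\<omega> \<in> space (path_measure S K x). \<exists>t\<ge>1. \<omega> t \<in> A}"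
  have H: "?H = (\<Union>t\<in>{1..}. ?E t)" by auto
  have ev: "?E t \<in> events" for t by (rule path_event_sets[OF A])
  have Hev: "?H \<in> events" unfolding H using ev by (intro sets.countable_UN') auto
  show ?thesis
  proof
    assume "hit_prob S K x A > 0"
    then have "prob ?H \<noteq> 0" by (simp add: hit_prob_def)
    then have nH: "?H \<notin> null_sets (path_measure S K x)" using measure_eq_0_null_sets by blast
    have "\<exists>t\<in>{1..}. ?E t \<notin> null_sets (path_measure S K x)"
    proof (rule ccontr)
      assume "\<not> (\<exists>t\<in>{1..}. ?E t \<notin> null_sets (path_measure S K x))"
      then have "(\<Union>t\<in>{1..}. ?E t) \<in> null_sets (path_measure S K x)"
        by (intro null_sets_UN') (blast, simp)
      then show False using nH unfolding H by (rule notE[rotated])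
    qed
    then obtain t where t: "t \<in> {1..}" "?E t \<notin> null_sets (path_measure S K x)" by (elim bexE)
    have "prob (?E t) \<noteq> 0"
    proof
      assume "prob (?E t) = 0"
      then have "emeasure (path_measure S K x) (?E t) = 0" by (simp only: emeasure_eq_measure ennreal_0)
      then show False using t(2) ev by (blast intro: null_setsI)
    qed
    then have "measure (kernel_pow S K t x) A > 0"
      unfolding measure_path_marginal[OF A] zero_less_measure_iff .
    then show "\<exists>t\<ge>1. measure (kernel_pow S K t x) A > 0" using t(1) by auto
  next
    assume "\<exists>t\<ge>1. measure (kernel_pow S K t x) A > 0"
    then obtain t where t: "t \<ge> 1" "0 < prob (?E t)"
      unfolding measure_path_marginal[OF A, symmetric] by (elim exE conjE)
    have "?E t \<subseteq> ?H" using t(1) by blast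
    then have "prob (?E t) \<le> prob ?H" by (rule finite_measure_mono[OF _ Hev])
    with t(2) have "0 < prob ?H" by (rule less_le_trans)
    then show "hit_prob S K x A > 0" unfolding hit_prob_def .
  qed
qed

end

end

lemma all_less_Suc_split: "(\<forall>i<Suc n. Q i) \<longleftrightarrow> (\<forall>i<n. Q i) \<and> Q n"
  by (auto simp: less_Suc_eq)

section \<open>Harris recurrence from geometric convergence\<close>

context harris_chain
begin

context
  fixes \<pi> :: "'s measure" and C \<rho> :: real
  assumes inv: "invariant_prob S K \<pi>" and C: "0 \<le> C" and \<rho>: "0 < \<rho>" "\<rho> < 1"
    and conv: "\<And>\<phi> x t. Vbdd \<phi> 1 \<Longrightarrow> x \<in> space S \<Longrightarrow> integrable \<pi> \<phi> \<and>
      \<bar>(\<integral>z. \<phi> z \<partial>kernel_pow S K t x) - (\<integral>z. \<phi> z \<partial>\<pi>)\<bar> \<le> C * \<rho> ^ t * (1 + V x)"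
begin

interpretation \<pi>: prob_space \<pi>
  using inv by (simp add: invariant_prob_def)

lemma sets_pi: "sets \<pi> = sets S"
  using inv by (simp add: invariant_prob_def)

lemma measure_convergence:
  assumes A: "A \<in> sets S" and x: "x \<in> space S"
  shows "\<bar>measure (kernel_pow S K t x) A - measure \<pi> A\<bar> \<le> C * \<rho> ^ t * (1 + V x)"
proof -
  have "Vbdd (indicator A) 1" using A V0 by (auto simp: Vbdd_def indicator_def)
  from conv[OF this x, of t] show ?thesis
    using A kernel_powD(1,3)[OF x] sets_pi sets_eq_imp_space_eq[OF sets_pi]
    by (simp add: Int_absorb2[OF sets.sets_into_space])
qed

text \<open>Observing the chain at times \<open>T, T + s, T + 2s, \<dots>\<close>, each time it is outside \<open>A\<close> with
  conditional probability at most \<open>1 - \<pi> A\<close> up to an error \<open>O(\<rho>\<^sup>s)\<close>.\<close>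

lemma never_hit_zero:
  assumes A[measurable]: "A \<in> sets S" and a: "0 < measure \<pi> A" and x: "x \<in> space S"
  shows "{\<omega> \<in> space (path_measure S K x). \<forall>t\<ge>T. \<omega> t \<notin> A} \<in> null_sets (path_measure S K x)"
proof -
  let ?P = "path_measure S K x"
  interpret P: prob_space ?P by (rule prob_space_path_measure[OF x])
  define a where "a = measure \<pi> A"
  have a01: "0 < a" "a \<le> 1" using a by (auto simp: a_def)
  \<comment> \<open>Bounds the mean of \<open>1 + V\<close> along the chain at all times
    simultaneously.\<close>
  define D where "D = 1 + (V x + B)"
  have D: "0 \<le> D" using V0[OF x] B by (simp add: D_def)
  define N where "N = {\<omega> \<in> space ?P. \<forall>t\<ge>T. \<omega> t \<notin> A}"
  have comp[measurable]: "(\<lambda>\<omega>. \<omega> t) \<in> ?P \<rightarrow>\<^sub>M S" for t by (rule measurable_path_component[OF x])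
  have Nev: "N \<in> sets ?P" unfolding N_def by measurable
  \<comment> \<open>The set is avoided at the first \<open>k\<close> times of the grid with spacing
    \<open>s\<close>, a larger event than avoiding it forever.\<close>
  define G where "G s k = {\<omega> \<in> space ?P. \<forall>i<k. \<omega> (T + i * s) \<notin> A}" for s k :: nat
  have Gev[measurable]: "G s k \<in> sets ?P" for s k unfolding G_def by measurable
  have step: "P.prob (G s (Suc (Suc k))) \<le> (1 - a) * P.prob (G s (Suc k)) + C * \<rho> ^ s * D" for s k
  proof -
    let ?n = "T + k * s"
    let ?I = "PiM {0..<Suc ?n} (\<lambda>_. S)"
    define F where "F = {\<omega> \<in> space ?I. \<forall>i\<in>{..<Suc k}. \<omega> (T + i * s) \<notin> A}"
    have F: "F \<in> sets ?I" unfolding F_def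
    proof (rule sets.sets_Collect_finite_All')
      fix i assume "i \<in> {..<Suc k}"
      then have "T + i * s \<in> {0..<Suc ?n}" by (simp add: mult_right_mono less_Suc_eq_le)
      then have [measurable]: "(\<lambda>\<omega>. \<omega> (T + i * s)) \<in> ?I \<rightarrow>\<^sub>M S" by (rule measurable_component_singleton)
      show "{\<omega> \<in> space ?I. \<omega> (T + i * s) \<notin> A} \<in> sets ?I" by measurable
    qed auto
    have FG: "indicator F (restrict \<omega> {0..<Suc ?n}) = (indicator (G s (Suc k)) \<omega> :: ennreal)"
      if \<omega>: "\<omega> \<in> space ?P" for \<omega>
    proof -
      have 1: "restrict \<omega> {0..<Suc ?n} \<in> space ?I"
        using measurable_space[OF measurable_restrict_path[OF x] \<omega>] .
      have 2: "restrict \<omega> {0..<Suc ?n} (T + i * s) = \<omega> (T + i * s)" if "i < Suc k" for i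
      proof (rule restrict_apply')
        show "T + i * s \<in> {0..<Suc ?n}" using that by (simp add: mult_right_mono less_Suc_eq_le)
      qed
      have "restrict \<omega> {0..<Suc ?n} \<in> F \<longleftrightarrow> \<omega> \<in> G s (Suc k)"
      proof -
        have "(\<forall>i<Suc k. restrict \<omega> {0..<Suc ?n} (T + i * s) \<notin> A) \<longleftrightarrow> (\<forall>i<Suc k. \<omega> (T + i * s) \<notin> A)"
          by (intro all_cong1 imp_cong refl) (simp only: 2)
        then show ?thesis
          unfolding F_def G_def mem_Collect_eq Ball_def lessThan_iff using 1 \<omega> by blast
      qed
      then show ?thesis unfolding indicator_def by (simp only:)
    qed
    have "emeasure ?P (G s (Suc (Suc k))) = (\<integral>\<^sup>+\<omega>. indicator (G s (Suc (Suc k))) \<omega> \<partial>?P)"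
      by (rule nn_integral_indicator[OF Gev, symmetric])
    also have "\<dots> = (\<integral>\<^sup>+\<omega>. indicator F (restrict \<omega> {0..<Suc ?n}) * indicator (space S - A) (\<omega> (?n + s)) \<partial>?P)"
    proof (rule nn_integral_cong)
      fix \<omega> assume \<omega>: "\<omega> \<in> space ?P"
      have "\<omega> (?n + s) \<in> space S" using measurable_space[OF comp \<omega>] .
      moreover have "?n + s = T + Suc k * s" by simp
      ultimately show "indicator (G s (Suc (Suc k))) \<omega> =
          indicator F (restrict \<omega> {0..<Suc ?n}) * (indicator (space S - A) (\<omega> (?n + s)) :: ennreal)"
      proof -
        have "\<omega> \<in> G s (Suc (Suc k)) \<longleftrightarrow> \<omega> \<in> G s (Suc k) \<and> \<omega> (?n + s) \<in> space S - A"
          unfolding G_def mem_Collect_eq Diff_iff all_less_Suc_split[of "Suc k"] \<open>?n + s = T + Suc k * s\<close>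
          using \<omega> \<open>\<omega> (?n + s) \<in> space S\<close>[unfolded \<open>?n + s = T + Suc k * s\<close>] by blast
        then show ?thesis by (subst FG[OF \<omega>]) (simp only: indicator_def of_bool_conj)
      qed
    qed
    also have "\<dots> = (\<integral>\<^sup>+\<omega>. indicator F (restrict \<omega> {0..<Suc ?n}) *
        (\<integral>\<^sup>+z. indicator (space S - A) z \<partial>kernel_pow S K s (\<omega> ?n)) \<partial>?P)"
      using F by (intro nn_integral_path_pow[OF x]) auto
    also have "\<dots> \<le> (\<integral>\<^sup>+\<omega>. ennreal (1 - a) * indicator (G s (Suc k)) \<omega> + ennreal (C * \<rho> ^ s) * ennreal (1 + V (\<omega> ?n)) \<partial>?P)"
    proof (rule nn_integral_mono)
      fix \<omega> assume \<omega>: "\<omega> \<in> space ?P"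
      have y: "\<omega> ?n \<in> space S" using measurable_space[OF comp \<omega>] .
      interpret Q: prob_space "kernel_pow S K s (\<omega> ?n)" by (rule kernel_powD[OF y])
      have "(\<integral>\<^sup>+z. indicator (space S - A) z \<partial>kernel_pow S K s (\<omega> ?n)) = ennreal (Q.prob (space S - A))"
        using A kernel_powD(1)[OF y] by (subst nn_integral_indicator) (auto simp: Q.emeasure_eq_measure)
      also have "Q.prob (space S - A) = 1 - Q.prob A"
        using Q.prob_compl[of A] A kernel_powD(1,3)[OF y] by simp
      also have "ennreal (1 - Q.prob A) \<le> ennreal ((1 - a) + C * \<rho> ^ s * (1 + V (\<omega> ?n)))"
        using measure_convergence[OF A y, of s] by (intro ennreal_leI) (simp add: a_def)
      also have "\<dots> = ennreal (1 - a) + ennreal (C * \<rho> ^ s) * ennreal (1 + V (\<omega> ?n))"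
        using a01 C \<rho> V0[OF y] by (simp add: ennreal_plus ennreal_mult)
      finally show "indicator F (restrict \<omega> {0..<Suc ?n}) * (\<integral>\<^sup>+z. indicator (space S - A) z \<partial>kernel_pow S K s (\<omega> ?n))
          \<le> ennreal (1 - a) * indicator (G s (Suc k)) \<omega> + ennreal (C * \<rho> ^ s) * ennreal (1 + V (\<omega> ?n))"
        unfolding FG[OF \<omega>] by (simp split: split_indicator)
    qed
    also have "\<dots> = ennreal (1 - a) * emeasure ?P (G s (Suc k)) + ennreal (C * \<rho> ^ s) * (\<integral>\<^sup>+\<omega>. ennreal (1 + V (\<omega> ?n)) \<partial>?P)"
      by (subst nn_integral_add) (auto simp: nn_integral_cmult)
    also have "(\<integral>\<^sup>+\<omega>. ennreal (1 + V (\<omega> ?n)) \<partial>?P) = (\<integral>\<^sup>+z. ennreal (1 + V z) \<partial>kernel_pow S K ?n x)"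
      by (rule nn_integral_path_marginal[OF x]) measurable
    also have "\<dots> = ennreal (\<integral>z. 1 + V z \<partial>kernel_pow S K ?n x)"
      using Vbdd_integrable[OF Vbdd_V x, of ?n] prob_space.finite_measure[OF kernel_powD(2)[OF x, of ?n]] V0
      by (intro nn_integral_eq_integral) (auto simp: kernel_powD[OF x] finite_measure.integrable_const)
    also have "\<dots> \<le> ennreal D"
    proof (rule ennreal_leI)
      interpret Q: prob_space "kernel_pow S K ?n x" by (rule kernel_powD[OF x])
      have "(\<integral>z. 1 + V z \<partial>kernel_pow S K ?n x) = 1 + (\<integral>z. V z \<partial>kernel_pow S K ?n x)"
        using Vbdd_integrable[OF Vbdd_V x, of ?n] by (simp add: Q.prob_space)
      also have "\<dots> \<le> 1 + (\<gamma> ^ ?n * V x + B)" by (intro add_left_mono drift_pow_real[OF x])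
      also have "\<dots> \<le> D" using \<gamma> V0[OF x] by (simp add: D_def mult_left_le_one_le power_le_one)
      finally show "(\<integral>z. 1 + V z \<partial>kernel_pow S K ?n x) \<le> D" .
    qed
    finally have "ennreal (P.prob (G s (Suc (Suc k)))) \<le>
        ennreal (1 - a) * ennreal (P.prob (G s (Suc k))) + ennreal (C * \<rho> ^ s) * ennreal D"
      by (simp add: P.emeasure_eq_measure mult_left_mono)
    also have "\<dots> = ennreal ((1 - a) * P.prob (G s (Suc k)) + C * \<rho> ^ s * D)"
      using a01 C \<rho> D by (simp add: ennreal_plus ennreal_mult)
    finally show ?thesis
      using a01 C \<rho> D by (subst (asm) ennreal_le_iff) auto
  qed
  \<comment> \<open>\<open>C * \<rho> ^ s * D / a\<close> is the fixed point of the recursion in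
    \<open>step\<close>, and the distance to it contracts by \<open>1 - a\<close>.\<close>
  have bound: "P.prob (G s (Suc k)) \<le> (1 - a) ^ k + C * \<rho> ^ s * D / a" for s k
  proof (induction k)
    case 0
    have "0 \<le> C * \<rho> ^ s * D / a" using C \<rho> D a01 by simp
    then show ?case using P.prob_le_1[of "G s (Suc 0)"] unfolding power_0 by linarith
  next
    case (Suc k)
    have "P.prob (G s (Suc (Suc k))) \<le> (1 - a) * P.prob (G s (Suc k)) + C * \<rho> ^ s * D" by (rule step)
    also have "\<dots> \<le> (1 - a) * ((1 - a) ^ k + C * \<rho> ^ s * D / a) + C * \<rho> ^ s * D"
      using Suc a01 by (intro add_right_mono mult_left_mono) auto
    also have "\<dots> = (1 - a) ^ Suc k + C * \<rho> ^ s * D / a" using a01 by (simp add: field_simps)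
    finally show ?case .
  qed
  have "P.prob N \<le> (1 - a) ^ k + C * \<rho> ^ s * D / a" for s k
  proof -
    have "N \<subseteq> G s (Suc k)" unfolding N_def G_def by auto
    then have "P.prob N \<le> P.prob (G s (Suc k))" by (rule P.finite_measure_mono[OF _ Gev])
    then show ?thesis using bound[of s k] by linarith
  qed
  \<comment> \<open>The number of observations tends to infinity while the spacing is fixed; only
    afterwards does the spacing grow, which removes the error term.\<close>
  moreover have "(\<lambda>k. (1 - a) ^ k + C * \<rho> ^ s * D / a) \<longlonglongrightarrow> 0 + C * \<rho> ^ s * D / a" for s
    by (intro tendsto_add tendsto_const LIMSEQ_power_zero) (use a01 in auto)
  ultimately have "P.prob N \<le> 0 + C * \<rho> ^ s * D / a" for s
    by (intro LIMSEQ_le_const[of "\<lambda>k. (1 - a) ^ k + C * \<rho> ^ s * D / a"]) auto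
  moreover have "(\<lambda>s. 0 + C * \<rho> ^ s * D / a) \<longlonglongrightarrow> 0 + C * 0 * D / a"
    by (intro tendsto_add tendsto_divide tendsto_mult tendsto_const LIMSEQ_power_zero) (use \<rho> a01 in auto)
  ultimately have "P.prob N \<le> 0 + C * 0 * D / a"
    by (intro LIMSEQ_le_const[of "\<lambda>s. 0 + C * \<rho> ^ s * D / a"]) auto
  then have "P.prob N = 0" using measure_nonneg[of ?P N] by simp
  then have "emeasure ?P N = 0" by (simp add: P.emeasure_eq_measure)
  then show ?thesis using Nev unfolding N_def by (rule null_setsI)
qed

text \<open>The complement is the countable union over \<open>T\<close> of the events that
  \<open>A\<close> is avoided from time \<open>T\<close> on, all of them null.\<close>

lemma inf_often_prob_1:
  assumes A[measurable]: "A \<in> sets S" and a: "0 < measure \<pi> A" and x: "x \<in> space S"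
  shows "inf_often_prob S K x A = 1"
proof -
  let ?P = "path_measure S K x"
  interpret P: prob_space ?P by (rule prob_space_path_measure[OF x])
  let ?N = "\<lambda>T. {\<omega> \<in> space ?P. \<forall>t\<ge>T. \<omega> t \<notin> A}"
  have null: "(\<Union>T. ?N T) \<in> null_sets ?P" using never_hit_zero[OF assms] by (intro null_sets_UN) auto
  have "infinite {t. t \<ge> 1 \<and> \<omega> t \<in> A} \<longleftrightarrow> \<not> (\<exists>T. \<forall>t\<ge>T. \<omega> t \<notin> A)" for \<omega> :: "nat \<Rightarrow> 's"
  proof -
    have "infinite {t. t \<ge> 1 \<and> \<omega> t \<in> A} \<longleftrightarrow> (\<forall>m. \<exists>n\<ge>m. n \<ge> 1 \<and> \<omega> n \<in> A)"
      by (simp add: infinite_nat_iff_unbounded_le)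
    also have "\<dots> \<longleftrightarrow> (\<forall>m. \<exists>n\<ge>m. \<omega> n \<in> A)"
    proof
      assume R: "\<forall>m. \<exists>n\<ge>m. \<omega> n \<in> A"
      show "\<forall>m. \<exists>n\<ge>m. n \<ge> 1 \<and> \<omega> n \<in> A"
      proof
        fix m
        obtain n where "n \<ge> max m 1" "\<omega> n \<in> A" using R by blast
        then show "\<exists>n\<ge>m. n \<ge> 1 \<and> \<omega> n \<in> A" by (intro exI[of _ n]) simp
      qed
    qed blast
    finally show ?thesis by blast
  qed
  then have "{\<omega> \<in> space ?P. infinite {t. t \<ge> 1 \<and> \<omega> t \<in> A}} = space ?P - (\<Union>T. ?N T)" by blast
  then have "inf_often_prob S K x A = P.prob (space ?P - (\<Union>T. ?N T))" by (simp only: inf_often_prob_def)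
  also have "\<dots> = 1"
    using P.prob_compl[OF null_setsD2[OF null]] measure_eq_0_null_sets[OF null] by linarith
  finally show ?thesis .
qed

text \<open>Convergence gives every set of positive \<pi>-measure positive probability at some late
  time. For maximality, a \<pi>-null set has, by invariance, probability 0 at all times from almost
  every start, so a measure that charges it cannot be an irreducibility measure.\<close>

lemma maximal_irreducibility_pi: "maximal_irreducibility_measure S K \<pi>"
  unfolding maximal_irreducibility_measure_def irreducibility_measure_def
proof (intro conjI allI impI ballI)
  show "sets \<pi> = sets S" by (rule sets_pi)
  show "sigma_finite_measure \<pi>" ..
  show "emeasure \<pi> (space S) \<noteq> 0"
    using \<pi>.emeasure_space_1 sets_eq_imp_space_eq[OF sets_pi] by simp
next
  fix A x assume A: "A \<in> sets S" and "0 < emeasure \<pi> A" and x: "x \<in> space S"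
  then have pos: "0 < measure \<pi> A" by (simp add: \<pi>.emeasure_eq_measure)
  have "(\<lambda>t. C * \<rho> ^ t * (1 + V x)) \<longlonglongrightarrow> C * 0 * (1 + V x)"
    by (intro tendsto_mult tendsto_const LIMSEQ_power_zero) (use \<rho> in auto)
  then have "eventually (\<lambda>t. C * \<rho> ^ t * (1 + V x) < measure \<pi> A) sequentially"
    using pos by (intro order_tendstoD(2)) auto
  then have "eventually (\<lambda>t. C * \<rho> ^ t * (1 + V x) < measure \<pi> A \<and> t \<ge> 1) sequentially"
    using eventually_ge_at_top by (rule eventually_conj)
  then obtain t where "C * \<rho> ^ t * (1 + V x) < measure \<pi> A" "t \<ge> 1"
    using eventually_happens'[of sequentially] by auto
  then have "measure (kernel_pow S K t x) A > 0" using measure_convergence[OF A x, of t] by linarith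
  then show "0 < hit_prob S K x A" using hit_prob_pos_iff[OF x A] \<open>t \<ge> 1\<close> by blast
next
  fix \<phi> assume \<phi>: "sets \<phi> = sets S \<and> sigma_finite_measure \<phi> \<and> emeasure \<phi> (space S) \<noteq> 0 \<and>
      (\<forall>A\<in>sets S. 0 < emeasure \<phi> A \<longrightarrow> (\<forall>x\<in>space S. 0 < hit_prob S K x A))"
  show "absolutely_continuous \<pi> \<phi>"
    unfolding absolutely_continuous_def
  proof
    fix A assume null: "A \<in> null_sets \<pi>"
    then have A: "A \<in> sets S" using sets_pi by auto
    have "emeasure \<phi> A = 0"
    proof (rule ccontr)
      assume "emeasure \<phi> A \<noteq> 0"
      then have hit: "0 < hit_prob S K x A" if "x \<in> space S" for x
        using \<phi> A that by (simp add: zero_less_iff_neq_zero)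
      have "AE x in \<pi>. emeasure (kernel_pow S K t x) A = 0" for t
      proof -
        have "\<pi> \<in> space (prob_algebra S)"
          using sets_pi \<pi>.prob_space_axioms by (simp add: space_prob_algebra)
        from emeasure_bind_prob_algebra[OF this kernel_pow_measurable A, of t]
        have "(\<integral>\<^sup>+x. emeasure (kernel_pow S K t x) A \<partial>\<pi>) = 0"
          using null by (simp add: invariant_pow[OF inv] null_sets_def)
        moreover have "(\<lambda>x. emeasure (kernel_pow S K t x) A) \<in> borel_measurable S"
          using A by (intro measurable_emeasure_kernel[OF measurable_prob_algebraD[OF kernel_pow_measurable]])
        then have "(\<lambda>x. emeasure (kernel_pow S K t x) A) \<in> borel_measurable \<pi>"
          unfolding measurable_cong_sets[OF sets_pi refl] .
        ultimately show ?thesis by (simp add: nn_integral_0_iff_AE)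
      qed
      then have allt: "AE x in \<pi>. \<forall>t. emeasure (kernel_pow S K t x) A = 0" by (subst AE_all_countable) blast
      have ex: "\<exists>t. emeasure (kernel_pow S K t x) A \<noteq> 0" if "x \<in> space \<pi>" for x
      proof -
        have x: "x \<in> space S" using that sets_eq_imp_space_eq[OF sets_pi] by simp
        obtain t where "0 < measure (kernel_pow S K t x) A"
          using hit[OF x] hit_prob_pos_iff[OF x A] by blast
        then have "emeasure (kernel_pow S K t x) A \<noteq> 0" by (auto simp: measure_def)
        then show ?thesis ..
      qed
      have "AE x in \<pi>. False"
        by (rule AE_mp[OF allt]) (rule AE_I2, use ex in blast)
      then show False by simp
    qed
    then show "A \<in> null_sets \<phi>" using A \<phi> by auto
  qed
qed

lemma harris_recurrent_chain: "harris_recurrent S K"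
  unfolding harris_recurrent_def
proof (intro exI[of _ \<pi>] conjI maximal_irreducibility_pi ballI impI)
  fix A x assume "A \<in> sets S" "0 < emeasure \<pi> A" "x \<in> A"
  then show "inf_often_prob S K x A = 1"
    using sets.sets_into_space by (intro inf_often_prob_1) (auto simp: \<pi>.emeasure_eq_measure)
qed

text \<open>A function bounded by \<open>f\<close> lies, after division by \<open>c\<close>, in the
  unit ball of the weighted norm, for which the rate is known.\<close>

lemma f_norm_decay:
  assumes f[measurable]: "f \<in> borel_measurable S" and c: "0 < c" "\<And>x. x \<in> space S \<Longrightarrow> 1 \<le> f x \<and> f x \<le> c * (1 + V x)"
    and x: "x \<in> space S"
  shows "f_norm_diff S f (kernel_pow S K t x) \<pi> \<le> ennreal (c * (C * \<rho> ^ t * (1 + V x)))" "integrable \<pi> f"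
proof -
  have Vb: "Vbdd (\<lambda>z. h z / c) 1" if h: "h \<in> borel_measurable S" "\<forall>x\<in>space S. \<bar>h x\<bar> \<le> f x" for h
    unfolding Vbdd_def
  proof (intro conjI ballI)
    show "(\<lambda>z. h z / c) \<in> borel_measurable S" using h by measurable
    fix z assume z: "z \<in> space S"
    then have "\<bar>h z\<bar> \<le> c * (1 + V z)" using h(2) c(2)[OF z] by force
    then show "\<bar>h z / c\<bar> \<le> 1 * (1 + V z)" using c(1) by (simp add: field_simps)
  qed
  have main: "integrable \<pi> h \<and> integrable (kernel_pow S K t x) h \<and>
      \<bar>(\<integral>z. h z \<partial>kernel_pow S K t x) - (\<integral>z. h z \<partial>\<pi>)\<bar> \<le> c * (C * \<rho> ^ t * (1 + V x))"
    if h: "h \<in> borel_measurable S" "\<forall>x\<in>space S. \<bar>h x\<bar> \<le> f x" for h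
  proof -
    have i: "integrable \<pi> (\<lambda>z. h z / c)" "integrable (kernel_pow S K t x) (\<lambda>z. h z / c)"
      and b: "\<bar>(\<integral>z. h z / c \<partial>kernel_pow S K t x) - (\<integral>z. h z / c \<partial>\<pi>)\<bar> \<le> C * \<rho> ^ t * (1 + V x)"
      using conv[OF Vb[OF h] x, of t] Vbdd_integrable[OF Vb[OF h] x] by blast+
    have "(\<integral>z. h z / c \<partial>kernel_pow S K t x) - (\<integral>z. h z / c \<partial>\<pi>) =
        ((\<integral>z. h z \<partial>kernel_pow S K t x) - (\<integral>z. h z \<partial>\<pi>)) / c" by (simp add: diff_divide_distrib)
    with b c(1) have "\<bar>(\<integral>z. h z \<partial>kernel_pow S K t x) - (\<integral>z. h z \<partial>\<pi>)\<bar> \<le> c * (C * \<rho> ^ t * (1 + V x))"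
      by (simp add: abs_divide pos_divide_le_eq mult.commute)
    then show ?thesis using i c(1) integrable_mult_right[OF i(1), of c] integrable_mult_right[OF i(2), of c] by simp
  qed
  have f': "f \<in> borel_measurable S" "\<forall>x\<in>space S. \<bar>f x\<bar> \<le> f x" using c(2) by force+
  note fi = main[OF f']
  show "integrable \<pi> f" using fi by blast
  show "f_norm_diff S f (kernel_pow S K t x) \<pi> \<le> ennreal (c * (C * \<rho> ^ t * (1 + V x)))"
    unfolding f_norm_diff_def using fi main by (auto intro!: SUP_least ennreal_leI)
qed

lemma geometrically_ergodic_chain:
  assumes f[measurable]: "f \<in> borel_measurable S" and c: "0 < c" "\<And>x. x \<in> space S \<Longrightarrow> 1 \<le> f x \<and> f x \<le> c * (1 + V x)"
  shows "geometrically_ergodic S K f"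
  unfolding geometrically_ergodic_def
proof (intro conjI)
  show "f \<in> borel_measurable S" "\<forall>x\<in>space S. 1 \<le> f x" using f c by auto
  show "markov_kernel S K" by (rule markov_kernel)
  show "harris_recurrent S K" by (rule harris_recurrent_chain)
  \<comment> \<open>Any \<open>r\<close> strictly between 1 and \<open>1 / \<rho>\<close> makes the
    series geometric; with this one the ratio \<open>r * \<rho>\<close> is
    \<open>sqrt \<rho>\<close>.\<close>
  define r where "r = 1 / sqrt \<rho>"
  have r: "r > 1" "0 < r * \<rho>" "r * \<rho> < 1"
  proof -
    show "r > 1" using \<rho> by (simp add: r_def)
    have "r * \<rho> = sqrt \<rho>" using \<rho> real_div_sqrt[of \<rho>] by (simp add: r_def)
    then show "0 < r * \<rho>" "r * \<rho> < 1" using \<rho> by auto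
  qed
  obtain x0 where x0: "x0 \<in> space S" using nonempty by blast
  have "integrable \<pi> f" by (rule f_norm_decay(2)[OF f c x0])
  moreover have "\<And>x. x \<in> space \<pi> \<Longrightarrow> 0 \<le> f x" using c(2) sets_eq_imp_space_eq[OF sets_pi] by force
  ultimately have fin: "(\<integral>\<^sup>+x. ennreal (f x) \<partial>\<pi>) < \<infinity>" by (subst nn_integral_eq_integral) auto
  have sum: "(\<Sum>t. ennreal (r ^ Suc t) * f_norm_diff S f (kernel_pow S K (Suc t) x) \<pi>) < \<infinity>" if x: "x \<in> space S" for x
  proof -
    let ?D = "c * C * (1 + V x)"
    have D: "0 \<le> ?D" using c(1) C V0[OF x] by simp
    have "(\<Sum>t. ennreal (r ^ Suc t) * f_norm_diff S f (kernel_pow S K (Suc t) x) \<pi>) \<le> (\<Sum>t. ennreal (?D * (r * \<rho>) ^ Suc t))"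
    proof (rule suminf_le)
      fix t
      have "ennreal (r ^ Suc t) * f_norm_diff S f (kernel_pow S K (Suc t) x) \<pi>
          \<le> ennreal (r ^ Suc t) * ennreal (c * (C * \<rho> ^ Suc t * (1 + V x)))"
        by (intro mult_left_mono f_norm_decay(1)[OF f c x] zero_le)
      also have "\<dots> = ennreal (?D * (r * \<rho>) ^ Suc t)"
        using r by (subst ennreal_mult'[symmetric]) (simp_all add: power_mult_distrib mult_ac)
      finally show "ennreal (r ^ Suc t) * f_norm_diff S f (kernel_pow S K (Suc t) x) \<pi> \<le> ennreal (?D * (r * \<rho>) ^ Suc t)" .
    qed auto
    also have "\<dots> = ennreal (\<Sum>t. ?D * (r * \<rho>) ^ Suc t)"
    proof (rule suminf_ennreal2)
      show "0 \<le> ?D * (r * \<rho>) ^ Suc t" for t using D r by simp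
      have "summable (\<lambda>t. (r * \<rho>) ^ Suc t)" using r by (subst summable_Suc_iff) (intro summable_geometric, simp)
      then show "summable (\<lambda>t. ?D * (r * \<rho>) ^ Suc t)" by (rule summable_mult)
    qed
    also have "\<dots> < \<infinity>" by simp
    finally show ?thesis .
  qed
  show "\<exists>\<pi>. invariant_prob S K \<pi> \<and> (\<integral>\<^sup>+x. ennreal (f x) \<partial>\<pi>) < \<infinity> \<and>
        (\<exists>r>1. \<forall>x\<in>space S. (\<Sum>t. ennreal (r ^ Suc t) * f_norm_diff S f (kernel_pow S K (Suc t) x) \<pi>) < \<infinity>)"
    using inv fin r(1) sum by blast
qed

end

end

section \<open>Random recursions\<close>

text \<open>\<open>e t\<close> drives the step from \<open>t\<close> to \<open>t + 1\<close>, so the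
  innovation of time \<open>t + 1\<close> sits at index \<open>t\<close>. This is the origin of the
  shifts by \<open>Suc\<close> further on.\<close>

primrec rsol :: "('s \<Rightarrow> 'e \<Rightarrow> 's) \<Rightarrow> 's \<Rightarrow> (nat \<Rightarrow> 'e) \<Rightarrow> nat \<Rightarrow> 's" where
  "rsol F z e 0 = z"
| "rsol F z e (Suc t) = F (rsol F z e t) (e t)"

text \<open>\<open>comb_seq m e e'\<close> follows \<open>e\<close> before index \<open>m\<close>
  and \<open>e'\<close> afterwards. Invariance under the choice of \<open>e'\<close> is the form in
  which dependence on the first \<open>m\<close> innovations only is expressed throughout.\<close>

lemma rsol_comb_seq_le: "t \<le> m \<Longrightarrow> rsol F z (comb_seq m e e') t = rsol F z e t"
  by (induction t) (simp_all add: comb_seq_less)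

lemma rsol_add: "rsol F z e (m + t) = rsol F (rsol F z e m) (\<lambda>i. e (m + i)) t"
  by (induction t) simp_all

lemma comb_seq_shift: "(\<lambda>i. comb_seq m e e' (m + i)) = e'"
  by (simp add: comb_seq_def)

lemma gen_sigma_sets_subset:
  assumes sa: "sigma_algebra (space N) \<Sigma>"
    and "\<And>t A. t \<in> I \<Longrightarrow> A \<in> sets T \<Longrightarrow> {\<omega> \<in> space N. X t \<omega> \<in> A} \<in> \<Sigma>"
  shows "sets (gen_sigma N T X I) \<subseteq> \<Sigma>"
proof -
  have eq: "X t -` A \<inter> space N = {\<omega> \<in> space N. X t \<omega> \<in> A}" for t A by auto
  have "sets (gen_sigma N T X I) = sigma_sets (space N) (\<Union>t\<in>I. {X t -` A \<inter> space N | A. A \<in> sets T})"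
    unfolding gen_sigma_def by (rule sets_measure_of) auto
  also have "\<dots> \<subseteq> \<Sigma>"
    by (rule sigma_algebra.sigma_sets_subset[OF sa]) (use assms(2) in \<open>auto simp: eq\<close>)
  finally show ?thesis .
qed

text \<open>In this context \<open>S\<close> is the product law of an innovation sequence, while the
  state space is \<open>borel\<close>.\<close>

locale random_recursion = sequence_space D for D :: "'e::topological_space measure" +
  fixes F :: "'s::topological_space \<Rightarrow> 'e \<Rightarrow> 's"
  assumes sets_D: "sets D = sets borel"
    and F_measurable: "(\<lambda>(z, e). F z e) \<in> borel \<Otimes>\<^sub>M borel \<rightarrow>\<^sub>M borel"
begin

definition kernel :: "'s \<Rightarrow> 's measure" where
  "kernel z = distr D borel (F z)"

lemma F_D[measurable]: "(\<lambda>(z, e). F z e) \<in> borel \<Otimes>\<^sub>M D \<rightarrow>\<^sub>M borel"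
  using F_measurable by (simp add: measurable_cong_sets[OF sets_pair_measure_cong[OF refl sets_D] refl])

lemma space_D: "space D = UNIV"
  using sets_eq_imp_space_eq[OF sets_D] by simp

lemma space_Seq: "space S = UNIV"
  by (simp add: space_PiM space_D)

lemma measurable_kernel: "kernel \<in> borel \<rightarrow>\<^sub>M prob_algebra borel"
proof -
  have "D \<in> space (prob_algebra D)" by (simp add: space_prob_algebra M.prob_space_axioms)
  then have "(\<lambda>_. D) \<in> borel \<rightarrow>\<^sub>M prob_algebra D" by simp
  from measurable_distr_prob_space2[OF this F_D] show ?thesis
    unfolding kernel_def[abs_def] .
qed

sublocale markov borel kernel
  by unfold_locales (simp add: markov_kernel_def measurable_kernel)

lemma measurable_rsol: "(\<lambda>(z, e). rsol F z e t) \<in> borel \<Otimes>\<^sub>M S \<rightarrow>\<^sub>M borel"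
proof (induction t)
  case (Suc t)
  have [measurable]: "(\<lambda>x. rsol F (fst x) (snd x) t) \<in> borel \<Otimes>\<^sub>M S \<rightarrow>\<^sub>M borel"
    using Suc by (simp add: split_beta')
  have "(\<lambda>x. (rsol F (fst x) (snd x) t, snd x t)) \<in> borel \<Otimes>\<^sub>M S \<rightarrow>\<^sub>M borel \<Otimes>\<^sub>M D" by measurable
  from measurable_compose[OF this F_D] show ?case by (simp add: split_beta')
qed (simp add: split_beta')

lemma measurable_rsol'[measurable]: "rsol F z \<in> S \<rightarrow>\<^sub>M PiM UNIV (\<lambda>_. borel)"
proof (rule measurable_PiM_single')
  show "(\<lambda>e. rsol F z e t) \<in> S \<rightarrow>\<^sub>M borel" for t
    using measurable_compose[OF measurable_Pair1'[of z borel S] measurable_rsol[of t]] by simp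
qed simp

lemma measurable_shift[measurable]: "(\<lambda>e i. e (m + i)) \<in> S \<rightarrow>\<^sub>M S"
  by (rule measurable_PiM_single') (auto simp: space_D)

text \<open>Gluing two independent copies of an i.i.d. sequence at index \<open>m\<close> reproduces
  its law.\<close>

lemma nn_integral_comb_seq:
  assumes f: "f \<in> borel_measurable S"
  shows "(\<integral>\<^sup>+e. f e \<partial>S) = (\<integral>\<^sup>+e. \<integral>\<^sup>+e'. f (comb_seq m e e') \<partial>S \<partial>S)"
proof -
  have "(\<integral>\<^sup>+e. f e \<partial>S) = (\<integral>\<^sup>+e. f e \<partial>distr (S \<Otimes>\<^sub>M S) S (\<lambda>(\<omega>, \<omega>'). comb_seq m \<omega> \<omega>'))"
    by (simp only: PiM_comb_seq)
  also have "\<dots> = (\<integral>\<^sup>+x. f (case_prod (comb_seq m) x) \<partial>(S \<Otimes>\<^sub>M S))"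
    using f by (intro nn_integral_distr measurable_comb_seq) simp
  also have "\<dots> = (\<integral>\<^sup>+e. \<integral>\<^sup>+e'. f (comb_seq m e e') \<partial>S \<partial>S)"
    using measurable_compose[OF measurable_comb_seq f] by (subst P.nn_integral_fst[symmetric]) simp_all
  finally show ?thesis .
qed

text \<open>The innovations after time \<open>m\<close> are independent of everything up to time \<open>m\<close>.\<close>

lemma nn_integral_split:
  assumes \<phi>: "\<phi> \<in> borel_measurable S" "\<And>e e'. \<phi> (comb_seq m e e') = \<phi> e"
    and \<psi>: "\<psi> \<in> borel_measurable (borel \<Otimes>\<^sub>M S)"
  shows "(\<integral>\<^sup>+e. \<phi> e * \<psi> (rsol F z e m, \<lambda>i. e (m + i)) \<partial>S) =
    (\<integral>\<^sup>+e. \<phi> e * (\<integral>\<^sup>+e'. \<psi> (rsol F z e m, e') \<partial>S) \<partial>S)"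
proof -
  have p: "(\<lambda>e. (rsol F z e m, \<lambda>i. e (m + i))) \<in> S \<rightarrow>\<^sub>M borel \<Otimes>\<^sub>M S" by measurable
  have f: "(\<lambda>e. \<phi> e * \<psi> (rsol F z e m, \<lambda>i. e (m + i))) \<in> borel_measurable S"
    using \<phi>(1) measurable_compose[OF p \<psi>] by measurable
  have c: "(\<lambda>e'. \<psi> (rsol F z e m, e')) \<in> borel_measurable S" for e
    using measurable_compose[OF measurable_Pair1' \<psi>, of "rsol F z e m"] by simp
  show ?thesis
    unfolding nn_integral_comb_seq[OF f, of m]
    by (simp add: \<phi>(2) comb_seq_shift rsol_comb_seq_le nn_integral_cmult[OF c])
qed

lemma nn_integral_component:
  assumes "f \<in> borel_measurable D"
  shows "(\<integral>\<^sup>+e. f (e 0) \<partial>S) = (\<integral>\<^sup>+u. f u \<partial>D)"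
proof -
  have "(\<integral>\<^sup>+u. f u \<partial>distr S D (\<lambda>e. e 0)) = (\<integral>\<^sup>+e. f (e 0) \<partial>S)"
    using assms by (intro nn_integral_distr) auto
  then show ?thesis using PiM_component[of 0] by simp
qed

lemma emeasure_distr_nn_integral:
  assumes "f \<in> M' \<rightarrow>\<^sub>M L" "A \<in> sets L"
  shows "emeasure (distr M' L f) A = (\<integral>\<^sup>+u. indicator A (f u) \<partial>M')"
proof -
  have "emeasure (distr M' L f) A = (\<integral>\<^sup>+x. indicator A x \<partial>distr M' L f)"
    using assms by (intro nn_integral_indicator[symmetric]) simp
  also have "\<dots> = (\<integral>\<^sup>+u. indicator A (f u) \<partial>M')" using assms by (intro nn_integral_distr) auto
  finally show ?thesis .
qed

lemma kernel_pow_eq: "kernel_pow borel kernel t z = distr S borel (\<lambda>e. rsol F z e t)"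
proof (induction t)
  case 0
  show ?case
    by (rule measure_eqI) (simp_all add: emeasure_distr indicator_def P.emeasure_space_1 prob_space.emeasure_space_1[OF prob_space_axioms, unfolded space_Seq] space_Seq)
next
  case (Suc t)
  show ?case
  proof (rule measure_eqI)
    have m: "kernel_pow borel kernel (Suc t) z \<in> space (prob_algebra borel)" by (rule kernel_pow_space) simp
    show "sets (kernel_pow borel kernel (Suc t) z) = sets (distr S borel (\<lambda>e. rsol F z e (Suc t)))"
      using space_prob_algebraD(1)[OF m] by simp
    fix A assume "A \<in> sets (kernel_pow borel kernel (Suc t) z)"
    then have A[measurable]: "A \<in> sets borel" using space_prob_algebraD(1)[OF m] by simp
    have KA: "(\<lambda>y. emeasure (kernel y) A) \<in> borel_measurable borel"
      by (rule measurable_emeasure_kernel[OF measurable_prob_algebraD[OF measurable_kernel] A])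
    have F1: "(\<lambda>u. F y u) \<in> D \<rightarrow>\<^sub>M borel" for y
      using measurable_compose[OF measurable_Pair1'[of y borel D] F_D] by simp
    have Fy: "(\<lambda>u. indicator A (F y u) :: ennreal) \<in> borel_measurable D" for y
      by (rule measurable_compose[OF F1]) simp
    have Ky: "emeasure (kernel y) A = (\<integral>\<^sup>+u. indicator A (F y u) \<partial>D)" for y
      unfolding kernel_def using F1[of y] A by (rule emeasure_distr_nn_integral)
    have F0: "(\<lambda>x. (fst x, snd x 0)) \<in> borel \<Otimes>\<^sub>M S \<rightarrow>\<^sub>M borel \<Otimes>\<^sub>M D" by measurable
    have ind: "(\<lambda>x. indicator A (F (fst x) (snd x 0)) :: ennreal) \<in> borel_measurable (borel \<Otimes>\<^sub>M S)"
      using measurable_compose[OF measurable_compose[OF F0 F_D], of "indicator A"] by (simp add: split_beta')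
    have "emeasure (kernel_pow borel kernel (Suc t) z) A = (\<integral>\<^sup>+y. emeasure (kernel y) A \<partial>kernel_pow borel kernel t z)"
      using emeasure_bind_prob_algebra[OF kernel_pow_space measurable_kernel A] by simp
    also have "\<dots> = (\<integral>\<^sup>+e. emeasure (kernel (rsol F z e t)) A \<partial>S)"
      unfolding Suc using KA by (subst nn_integral_distr) simp_all
    also have "\<dots> = (\<integral>\<^sup>+e. 1 * (\<integral>\<^sup>+e'. indicator A (F (rsol F z e t) (e' 0)) \<partial>S) \<partial>S)"
      unfolding Ky by (simp add: nn_integral_component[OF Fy])
    also have "\<dots> = (\<integral>\<^sup>+e. 1 * indicator A (F (rsol F z e t) (e t)) \<partial>S)"
      using nn_integral_split[of "\<lambda>_. 1" t, OF _ _ ind, of z] by simp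
    also have "\<dots> = (\<integral>\<^sup>+e. indicator A (rsol F z e (Suc t)) \<partial>S)" by simp
    also have "\<dots> = emeasure (distr S borel (\<lambda>e. rsol F z e (Suc t))) A"
      by (rule emeasure_distr_nn_integral[symmetric]) (use A in measurable)
    finally show "emeasure (kernel_pow borel kernel (Suc t) z) A = emeasure (distr S borel (\<lambda>e. rsol F z e (Suc t))) A" .
  qed
qed

lemma nn_integral_shift:
  assumes \<psi>: "\<psi> \<in> borel_measurable (borel \<Otimes>\<^sub>M S)"
  shows "(\<integral>\<^sup>+e. \<psi> (rsol F z e m, \<lambda>i. e (m + i)) \<partial>S) =
    (\<integral>\<^sup>+x. (\<integral>\<^sup>+e'. \<psi> (x, e') \<partial>S) \<partial>kernel_pow borel kernel m z)"
proof -
  have "(\<lambda>x. \<integral>\<^sup>+e'. \<psi> (x, e') \<partial>S) \<in> borel_measurable borel"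
    using \<psi> by (rule P.borel_measurable_nn_integral_fst)
  then show ?thesis
    using nn_integral_split[of "\<lambda>_. 1" m, OF _ _ \<psi>, of z]
    by (simp add: kernel_pow_eq nn_integral_distr)
qed

end

text \<open>The product form of the joint law carries both assumptions at once: the innovations are
  i.i.d. and independent of the initial state.\<close>

locale recursive_process = random_recursion D F + N: prob_space N
  for D :: "'e::topological_space measure" and F :: "'s::topological_space \<Rightarrow> 'e \<Rightarrow> 's" and N :: "'w measure" +
  fixes \<mu> :: "'s measure" and Z0 :: "'w \<Rightarrow> 's" and \<eta> :: "'w \<Rightarrow> nat \<Rightarrow> 'e"
  assumes \<mu>: "\<mu> \<in> space (prob_algebra borel)"
    and joint_measurable: "(\<lambda>\<omega>. (Z0 \<omega>, \<eta> \<omega>)) \<in> N \<rightarrow>\<^sub>M borel \<Otimes>\<^sub>M PiM UNIV (\<lambda>_. D)"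
    and joint: "distr N (borel \<Otimes>\<^sub>M PiM UNIV (\<lambda>_. D)) (\<lambda>\<omega>. (Z0 \<omega>, \<eta> \<omega>)) = \<mu> \<Otimes>\<^sub>M PiM UNIV (\<lambda>_. D)"
begin

definition Z :: "nat \<Rightarrow> 'w \<Rightarrow> 's" where "Z t \<omega> = rsol F (Z0 \<omega>) (\<eta> \<omega>) t"

text \<open>Events determined by the initial state and the first \<open>m\<close> innovations,
  expressed by insensitivity of \<open>b\<close> to the innovations from index \<open>m\<close> on.
  This form can be inserted into \<open>nn_integral_split\<close> directly.\<close>

definition past :: "nat \<Rightarrow> 'w set set" where
  "past m = {{\<omega> \<in> space N. (Z0 \<omega>, \<eta> \<omega>) \<in> b} | b.
     b \<in> sets (borel \<Otimes>\<^sub>M S) \<and> (\<forall>z e e'. (z, comb_seq m e e') \<in> b \<longleftrightarrow> (z, e) \<in> b)}"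

text \<open>Events determined by the state at time \<open>u\<close> and the innovations that drive
  the steps after \<open>u\<close>.\<close>

definition future :: "nat \<Rightarrow> 'w set set" where
  "future u = {{\<omega> \<in> space N. (Z u \<omega>, \<lambda>i. \<eta> \<omega> (u + i)) \<in> c} | c. c \<in> sets (borel \<Otimes>\<^sub>M S)}"

lemmas sets_mu = space_prob_algebraD(1)[OF \<mu>]

lemma measurable_shifted: "(\<lambda>x. (rsol F (fst x) (snd x) u, \<lambda>i. snd x (u + i))) \<in> borel \<Otimes>\<^sub>M S \<rightarrow>\<^sub>M borel \<Otimes>\<^sub>M S"
proof (rule measurable_Pair)
  show "(\<lambda>x. rsol F (fst x) (snd x) u) \<in> borel \<Otimes>\<^sub>M S \<rightarrow>\<^sub>M borel"
    using measurable_rsol[of u] by (simp add: split_beta')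
  show "(\<lambda>x i. snd x (u + i)) \<in> borel \<Otimes>\<^sub>M S \<rightarrow>\<^sub>M S"
    by (rule measurable_compose[OF measurable_snd measurable_shift])
qed

lemma measurable_Z: "Z t \<in> N \<rightarrow>\<^sub>M borel"
  using measurable_compose[OF joint_measurable measurable_rsol[of t]] unfolding Z_def[abs_def] by simp

lemma past_events: "past m \<subseteq> sets N"
  unfolding past_def using measurable_sets[OF joint_measurable]
  by (auto simp: vimage_def Int_def conj_commute)

lemma nn_integral_joint:
  assumes f: "f \<in> borel_measurable (borel \<Otimes>\<^sub>M S)"
  shows "(\<integral>\<^sup>+\<omega>. f (Z0 \<omega>, \<eta> \<omega>) \<partial>N) = (\<integral>\<^sup>+z. \<integral>\<^sup>+e. f (z, e) \<partial>S \<partial>\<mu>)"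
proof -
  have "(\<integral>\<^sup>+\<omega>. f (Z0 \<omega>, \<eta> \<omega>) \<partial>N) = (\<integral>\<^sup>+x. f x \<partial>(\<mu> \<Otimes>\<^sub>M S))"
  proof -
    have "(\<integral>\<^sup>+x. f x \<partial>distr N (borel \<Otimes>\<^sub>M S) (\<lambda>\<omega>. (Z0 \<omega>, \<eta> \<omega>))) = (\<integral>\<^sup>+\<omega>. f (Z0 \<omega>, \<eta> \<omega>) \<partial>N)"
      using f by (intro nn_integral_distr joint_measurable) simp
    then show ?thesis by (simp only: joint)
  qed
  also have "\<dots> = (\<integral>\<^sup>+z. \<integral>\<^sup>+e. f (z, e) \<partial>S \<partial>\<mu>)"
    using f by (intro P.nn_integral_fst[symmetric])
      (simp add: measurable_cong_sets[OF sets_pair_measure_cong[OF sets_mu refl] refl])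
  finally show ?thesis .
qed

text \<open>Given the first \<open>m\<close> innovations, \<open>Z u\<close> has the law of
  \<open>u - m\<close> kernel steps from \<open>Z m\<close>, and the innovations from
  \<open>u\<close> on are independent of it. The Markov property, stationarity and mixing are all
  drawn from this identity.\<close>

lemma past_future:
  assumes B: "B \<in> past m" and c: "c \<in> sets (borel \<Otimes>\<^sub>M S)" and mu: "m \<le> u"
  shows "emeasure N (B \<inter> {\<omega> \<in> space N. (Z u \<omega>, \<lambda>i. \<eta> \<omega> (u + i)) \<in> c}) =
    (\<integral>\<^sup>+\<omega>. indicator B \<omega> * (\<integral>\<^sup>+x. emeasure S (Pair x -` c) \<partial>kernel_pow borel kernel (u - m) (Z m \<omega>)) \<partial>N)"
proof -
  obtain b where b: "B = {\<omega> \<in> space N. (Z0 \<omega>, \<eta> \<omega>) \<in> b}" "b \<in> sets (borel \<Otimes>\<^sub>M S)"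
    "\<And>z e e'. (z, comb_seq m e e') \<in> b \<longleftrightarrow> (z, e) \<in> b" using B unfolding past_def by blast
  define k where "k = u - m"
  have u: "u = m + k" using mu by (simp add: k_def)
  define \<psi> :: "'s \<times> (nat \<Rightarrow> 'e) \<Rightarrow> ennreal" where "\<psi> x = indicator c (rsol F (fst x) (snd x) k, \<lambda>i. snd x (k + i))" for x
  have \<psi>: "\<psi> \<in> borel_measurable (borel \<Otimes>\<^sub>M S)"
    unfolding \<psi>_def[abs_def] by (rule measurable_compose[OF measurable_shifted borel_measurable_indicator[OF c]])
  have h: "(\<integral>\<^sup>+e'. indicator c (x, e') \<partial>S) = emeasure S (Pair x -` c)" for x
  proof -
    have "(\<integral>\<^sup>+e'. indicator c (x, e') \<partial>S) = (\<integral>\<^sup>+e'. indicator (Pair x -` c) e' \<partial>S)"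
      by (intro nn_integral_cong) (simp add: indicator_def)
    also have "\<dots> = emeasure S (Pair x -` c)" by (rule nn_integral_indicator[OF sets_Pair1[OF c]])
    finally show ?thesis .
  qed
  have \<psi>S: "(\<integral>\<^sup>+e'. \<psi> (x, e') \<partial>S) = (\<integral>\<^sup>+y. emeasure S (Pair y -` c) \<partial>kernel_pow borel kernel k x)" for x
    using nn_integral_shift[of "indicator c" x k] c unfolding \<psi>_def by (simp add: h)
  have \<psi>m: "(\<lambda>x. \<integral>\<^sup>+e'. \<psi> (x, e') \<partial>S) \<in> borel_measurable borel"
    using \<psi> by (rule P.borel_measurable_nn_integral_fst)
  have ib: "indicator b \<in> borel_measurable (borel \<Otimes>\<^sub>M S)" using b(2) by simp
  have Bev: "B \<in> sets N" using B past_events by auto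
  let ?C = "{\<omega> \<in> space N. (Z u \<omega>, \<lambda>i. \<eta> \<omega> (u + i)) \<in> c}"
  have Cev: "?C \<in> sets N"
    using measurable_sets[OF measurable_compose[OF joint_measurable measurable_shifted[of u]] c]
    by (simp add: Z_def vimage_def Int_def conj_commute)
  let ?f = "\<lambda>x. indicator b x * \<psi> (rsol F (fst x) (snd x) m, \<lambda>i. snd x (m + i))"
  let ?g = "\<lambda>x. indicator b x * (\<integral>\<^sup>+e'. \<psi> (rsol F (fst x) (snd x) m, e') \<partial>S)"
  have f: "?f \<in> borel_measurable (borel \<Otimes>\<^sub>M S)"
    using measurable_compose[OF measurable_shifted[of m] \<psi>] ib by (intro borel_measurable_times_ennreal) auto
  have g: "?g \<in> borel_measurable (borel \<Otimes>\<^sub>M S)"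
    using measurable_compose[OF measurable_rsol[of m] \<psi>m] ib
    by (intro borel_measurable_times_ennreal) (auto simp: split_beta')
  have "emeasure N (B \<inter> ?C) = (\<integral>\<^sup>+\<omega>. indicator (B \<inter> ?C) \<omega> \<partial>N)"
    using Bev Cev by (intro nn_integral_indicator[symmetric]) auto
  also have "\<dots> = (\<integral>\<^sup>+\<omega>. ?f (Z0 \<omega>, \<eta> \<omega>) \<partial>N)"
    by (intro nn_integral_cong) (auto simp: b(1) \<psi>_def Z_def u rsol_add add.assoc indicator_def)
  also have "\<dots> = (\<integral>\<^sup>+z. \<integral>\<^sup>+e. ?f (z, e) \<partial>S \<partial>\<mu>)" by (rule nn_integral_joint[OF f])
  also have "\<dots> = (\<integral>\<^sup>+z. \<integral>\<^sup>+e. ?g (z, e) \<partial>S \<partial>\<mu>)"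
  proof (rule nn_integral_cong)
    fix z
    have "(\<lambda>e. indicator b (z, e) :: ennreal) \<in> borel_measurable S"
      using measurable_compose[OF measurable_Pair1' ib, of z] by simp
    from nn_integral_split[OF this _ \<psi>, of m z] b(3)
    show "(\<integral>\<^sup>+e. ?f (z, e) \<partial>S) = (\<integral>\<^sup>+e. ?g (z, e) \<partial>S)" by (simp add: indicator_def)
  qed
  also have "\<dots> = (\<integral>\<^sup>+\<omega>. ?g (Z0 \<omega>, \<eta> \<omega>) \<partial>N)" by (rule nn_integral_joint[OF g, symmetric])
  also have "\<dots> = (\<integral>\<^sup>+\<omega>. indicator B \<omega> * (\<integral>\<^sup>+x. emeasure S (Pair x -` c) \<partial>kernel_pow borel kernel (u - m) (Z m \<omega>)) \<partial>N)"
    by (intro nn_integral_cong) (auto simp: b(1) \<psi>S Z_def k_def indicator_def)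
  finally show ?thesis .
qed

lemma past_sigma_algebra: "sigma_algebra (space N) (past m)"
proof -
  have 1: "past m \<subseteq> Pow (space N)" by (auto simp: past_def)
  have 2: "{} \<in> past m" unfolding past_def by (auto intro!: exI[of _ "{}"])
  have 3: "space N - B \<in> past m" if BB: "B \<in> past m" for B
  proof -
    obtain b where b: "B = {\<omega> \<in> space N. (Z0 \<omega>, \<eta> \<omega>) \<in> b}" "b \<in> sets (borel \<Otimes>\<^sub>M S)"
      "\<And>z e e'. (z, comb_seq m e e') \<in> b \<longleftrightarrow> (z, e) \<in> b" using BB unfolding past_def by blast
    have "space (borel \<Otimes>\<^sub>M S) - b \<in> sets (borel \<Otimes>\<^sub>M S)" using b(2) by (rule sets.compl_sets)
    moreover have "space (borel \<Otimes>\<^sub>M S) - b = - b" by (auto simp: space_pair_measure space_Seq)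
    ultimately have "- b \<in> sets (borel \<Otimes>\<^sub>M S)" by (simp only:)
    moreover have "space N - B = {\<omega> \<in> space N. (Z0 \<omega>, \<eta> \<omega>) \<in> - b}" using b(1) by auto
    ultimately show ?thesis unfolding past_def using b(3) by blast
  qed
  have 4: "(\<Union>i. B i) \<in> past m" if "range B \<subseteq> past m" for B :: "nat \<Rightarrow> 'w set"
  proof -
    have "\<forall>i. \<exists>b. B i = {\<omega> \<in> space N. (Z0 \<omega>, \<eta> \<omega>) \<in> b} \<and> b \<in> sets (borel \<Otimes>\<^sub>M S) \<and>
        (\<forall>z e e'. (z, comb_seq m e e') \<in> b \<longleftrightarrow> (z, e) \<in> b)" using that unfolding past_def by blast
    from choice[OF this] obtain b where b: "\<And>i. B i = {\<omega> \<in> space N. (Z0 \<omega>, \<eta> \<omega>) \<in> b i}" "\<And>i. b i \<in> sets (borel \<Otimes>\<^sub>M S)"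
      "\<And>i z e e'. (z, comb_seq m e e') \<in> b i \<longleftrightarrow> (z, e) \<in> b i" by blast
    show ?thesis unfolding past_def
    proof (intro CollectI exI conjI allI)
      show "(\<Union>i. B i) = {\<omega> \<in> space N. (Z0 \<omega>, \<eta> \<omega>) \<in> (\<Union>i. b i)}" unfolding b(1) by blast
      show "(\<Union>i. b i) \<in> sets (borel \<Otimes>\<^sub>M S)" using b(2) by (intro sets.countable_UN) blast
      show "(z, comb_seq m e e') \<in> (\<Union>i. b i) \<longleftrightarrow> (z, e) \<in> (\<Union>i. b i)" for z e e'
        unfolding UN_iff b(3) ..
    qed
  qed
  show ?thesis unfolding sigma_algebra_iff2 using 1 2 3 4 by blast
qed

lemma future_sigma_algebra: "sigma_algebra (space N) (future u)"
proof -
  have 1: "future u \<subseteq> Pow (space N)" by (auto simp: future_def)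
  have 2: "{} \<in> future u" unfolding future_def by (auto intro!: exI[of _ "{}"])
  have 3: "space N - A \<in> future u" if AA: "A \<in> future u" for A
  proof -
    obtain c where c: "A = {\<omega> \<in> space N. (Z u \<omega>, \<lambda>i. \<eta> \<omega> (u + i)) \<in> c}" "c \<in> sets (borel \<Otimes>\<^sub>M S)"
      using AA unfolding future_def by blast
    have "space (borel \<Otimes>\<^sub>M S) - c \<in> sets (borel \<Otimes>\<^sub>M S)" using c(2) by (rule sets.compl_sets)
    moreover have "space N - A = {\<omega> \<in> space N. (Z u \<omega>, \<lambda>i. \<eta> \<omega> (u + i)) \<in> space (borel \<Otimes>\<^sub>M S) - c}"
      using c(1) by (auto simp: space_pair_measure space_Seq)
    ultimately show ?thesis unfolding future_def by blast
  qed
  have 4: "(\<Union>i. A i) \<in> future u" if "range A \<subseteq> future u" for A :: "nat \<Rightarrow> 'w set"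
  proof -
    have "\<forall>i. \<exists>c. A i = {\<omega> \<in> space N. (Z u \<omega>, \<lambda>i. \<eta> \<omega> (u + i)) \<in> c} \<and> c \<in> sets (borel \<Otimes>\<^sub>M S)"
      using that unfolding future_def by blast
    from choice[OF this] obtain c where c: "\<And>i. A i = {\<omega> \<in> space N. (Z u \<omega>, \<lambda>i. \<eta> \<omega> (u + i)) \<in> c i}"
      "\<And>i. c i \<in> sets (borel \<Otimes>\<^sub>M S)" by blast
    show ?thesis unfolding future_def
    proof (intro CollectI exI conjI)
      show "(\<Union>i. A i) = {\<omega> \<in> space N. (Z u \<omega>, \<lambda>i. \<eta> \<omega> (u + i)) \<in> (\<Union>i. c i)}" unfolding c(1) by blast
      show "(\<Union>i. c i) \<in> sets (borel \<Otimes>\<^sub>M S)" using c(2) by (intro sets.countable_UN) blast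
    qed
  qed
  show ?thesis unfolding sigma_algebra_iff2 using 1 2 3 4 by blast
qed

lemma pastI:
  assumes "(\<lambda>x. f (fst x) (snd x)) \<in> borel \<Otimes>\<^sub>M S \<rightarrow>\<^sub>M T" "A \<in> sets T"
    and "\<And>z e e'. f z (comb_seq m e e') = f z e"
  shows "{\<omega> \<in> space N. f (Z0 \<omega>) (\<eta> \<omega>) \<in> A} \<in> past m"
proof -
  have "(\<lambda>x. f (fst x) (snd x)) -` A \<inter> space (borel \<Otimes>\<^sub>M S) \<in> sets (borel \<Otimes>\<^sub>M S)"
    using assms by (intro measurable_sets)
  then have "{x. f (fst x) (snd x) \<in> A} \<in> sets (borel \<Otimes>\<^sub>M S)"
    by (simp add: space_pair_measure space_Seq vimage_def)
  then show ?thesis unfolding past_def using assms(3)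
    by (intro CollectI exI[of _ "{x. f (fst x) (snd x) \<in> A}"]) auto
qed

lemma futureI:
  assumes "(\<lambda>x. f (fst x) (snd x)) \<in> borel \<Otimes>\<^sub>M S \<rightarrow>\<^sub>M T" "A \<in> sets T"
  shows "{\<omega> \<in> space N. f (Z u \<omega>) (\<lambda>i. \<eta> \<omega> (u + i)) \<in> A} \<in> future u"
proof -
  have "(\<lambda>x. f (fst x) (snd x)) -` A \<inter> space (borel \<Otimes>\<^sub>M S) \<in> sets (borel \<Otimes>\<^sub>M S)"
    using assms by (intro measurable_sets)
  then have "{x. f (fst x) (snd x) \<in> A} \<in> sets (borel \<Otimes>\<^sub>M S)"
    by (simp add: space_pair_measure space_Seq vimage_def)
  then show ?thesis unfolding future_def
    by (intro CollectI exI[of _ "{x. f (fst x) (snd x) \<in> A}"]) auto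
qed

end

section \<open>Stationarity and mixing of random recursions\<close>

text \<open>\<open>ess_sup\<close> is defined by choice, so existence has to be secured. Among
  countable subfamilies one has a supremum of maximal integral; the bound \<open>w\<close> makes
  this integral finite, and a member exceeding the supremum on a set of positive measure would
  increase it.\<close>

lemma is_ess_sup_exists:
  assumes F: "F \<noteq> {}" "\<And>f. f \<in> F \<Longrightarrow> f \<in> borel_measurable M"
    and w: "w \<in> borel_measurable M" "\<And>f. f \<in> F \<Longrightarrow> AE x in M. f x \<le> w x" "(\<integral>\<^sup>+x. w x \<partial>M) < \<infinity>"
  shows "\<exists>u. is_ess_sup M F u"
proof -
  define sp where "sp C x = (SUP f\<in>C. f x)" for C :: "('a \<Rightarrow> ennreal) set" and x
  define CC where "CC = {C. C \<subseteq> F \<and> countable C}"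
  define I where "I C = (\<integral>\<^sup>+x. sp C x \<partial>M)" for C
  have meas: "sp C \<in> borel_measurable M" if "C \<in> CC" for C
    unfolding sp_def[abs_def] using that F(2) by (intro borel_measurable_SUP) (auto simp: CC_def)
  have spw: "AE x in M. sp C x \<le> w' x" if C: "C \<in> CC" and w': "\<And>f. f \<in> F \<Longrightarrow> AE x in M. f x \<le> w' x" for C w'
  proof -
    have "AE x in M. \<forall>f\<in>C. f x \<le> w' x"
      using C w' by (subst AE_ball_countable) (auto simp: CC_def)
    then show ?thesis unfolding sp_def by (rule AE_mp) (auto intro!: AE_I2 SUP_least)
  qed
  have mono: "sp C x \<le> sp C' x" if "C \<subseteq> C'" for C C' x unfolding sp_def using that by (rule SUP_subset_mono) simp
  have "{} \<in> CC" by (simp add: CC_def)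
  then have "I ` CC \<noteq> {}" by blast
  from ennreal_Sup_countable_SUP[OF this] obtain g :: "nat \<Rightarrow> ennreal" where
    g: "range g \<subseteq> I ` CC" "Sup (I ` CC) = (SUP i. g i)" by blast
  then have "\<forall>i. \<exists>C. C \<in> CC \<and> g i = I C" by blast
  from choice[OF this] obtain C where C: "\<And>i. C i \<in> CC" "\<And>i. g i = I (C i)" by blast
  define U where "U = (\<Union>i. C i)"
  have U: "U \<in> CC" using C(1) by (auto simp: U_def CC_def)
  have sup: "Sup (I ` CC) \<le> I U"
    unfolding g(2) C(2) by (intro SUP_least) (auto simp: I_def U_def intro!: nn_integral_mono mono)
  have IUw: "I U \<le> (\<integral>\<^sup>+x. w x \<partial>M)" unfolding I_def using spw[OF U w(2)] by (rule nn_integral_mono_AE)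
  then have IU: "I U \<noteq> \<infinity>" using w(3) by auto
  have "AE x in M. f x \<le> sp U x" if f: "f \<in> F" for f
  proof (rule ccontr)
    assume n: "\<not> (AE x in M. f x \<le> sp U x)"
    have fU: "insert f U \<in> CC" using U f by (auto simp: CC_def)
    have "\<not> (AE x in M. sp (insert f U) x \<le> sp U x)"
    proof
      have "f x \<le> sp (insert f U) x" for x unfolding sp_def by (rule SUP_upper) simp
      note le = order_trans[OF this]
      assume "AE x in M. sp (insert f U) x \<le> sp U x"
      then have "AE x in M. f x \<le> sp U x" by (rule eventually_mono) (rule le)
      then show False using n by blast
    qed
    then have "I U < I (insert f U)"
      unfolding I_def using IU meas[OF U] meas[OF fU]
      by (intro nn_integral_less) (auto simp: I_def intro!: AE_I2 mono)
    moreover have "I (insert f U) \<le> Sup (I ` CC)" using fU by (intro Sup_upper) auto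
    ultimately show False using sup by (simp add: leD order_trans)
  qed
  then have "is_ess_sup M F (sp U)"
    unfolding is_ess_sup_def using meas[OF U] spw[OF U] by blast
  then show ?thesis by blast
qed

lemma nn_integral_ess_sup_le:
  assumes F: "F \<noteq> {}" "\<And>f. f \<in> F \<Longrightarrow> f \<in> borel_measurable M"
    and w: "w \<in> borel_measurable M" "\<And>f. f \<in> F \<Longrightarrow> AE x in M. f x \<le> w x" "(\<integral>\<^sup>+x. w x \<partial>M) < \<infinity>"
  shows "(\<integral>\<^sup>+x. ess_sup M F x \<partial>M) \<le> (\<integral>\<^sup>+x. w x \<partial>M)"
proof -
  have "is_ess_sup M F (ess_sup M F)"
    unfolding ess_sup_def using is_ess_sup_exists[OF assms] by (rule someI_ex)
  then have "AE x in M. ess_sup M F x \<le> w x" using w(1,2) unfolding is_ess_sup_def by blast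
  then show ?thesis by (rule nn_integral_mono_AE)
qed

context finite_measure_subalgebra
begin

text \<open>The hypothesis is tested with the event that the conditional expectation is positive,
  which belongs to the subalgebra.\<close>

lemma real_cond_exp_nonpos:
  assumes f: "integrable M f" and le: "\<And>B. B \<in> sets F \<Longrightarrow> (\<integral>x. indicator B x * f x \<partial>M) \<le> 0"
  shows "AE x in M. real_cond_exp M F f x \<le> 0"
proof -
  let ?q = "real_cond_exp M F f"
  have q: "integrable M ?q" by (rule real_cond_exp_int(1)[OF f])
  have qF: "?q \<in> borel_measurable F" by (rule borel_measurable_cond_exp)
  define B where "B = {x \<in> space F. ?q x > 0}"
  have B: "B \<in> sets F" unfolding B_def using qF by measurable
  have BM: "B \<in> sets M" using B subalg by (auto simp: subalgebra_def)
  have sp: "space F = space M" using subalg by (simp add: subalgebra_def)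
  have i: "integrable M (\<lambda>x. indicator B x * ?q x)"
    using integrable_mult_indicator[OF BM q] by simp
  have nn: "0 \<le> indicator B x * ?q x" for x by (auto simp: B_def indicator_def)
  have "(\<integral>x. indicator B x * ?q x \<partial>M) = (\<integral>x. indicator B x * f x \<partial>M)"
    using real_cond_exp_intA[OF f B] by (simp add: set_lebesgue_integral_def)
  moreover have "0 \<le> (\<integral>x. indicator B x * ?q x \<partial>M)"
    by (rule Bochner_Integration.integral_nonneg) (rule nn)
  ultimately have "(\<integral>x. indicator B x * ?q x \<partial>M) = 0" using le[OF B] by linarith
  then have "AE x in M. indicator B x * ?q x = 0"
    using integral_nonneg_eq_0_iff_AE[OF i] nn by simp
  then show ?thesis
    by (rule AE_mp) (auto intro!: AE_I2 simp: B_def sp indicator_def split: if_splits)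
qed

end

text \<open>A covariance bound on every event of \<open>G\<close> is localized to a pointwise bound,
  by applying \<open>real_cond_exp_nonpos\<close> to the centred indicator and to its negative, each
  reduced by \<open>W\<close>.\<close>

lemma (in prob_space) cond_exp_deviation_le:
  assumes sub: "subalgebra M G" and A: "A \<in> sets M" and W: "integrable M W"
    and le: "\<And>B. B \<in> sets G \<Longrightarrow> \<bar>prob (B \<inter> A) - prob B * prob A\<bar> \<le> (\<integral>x. indicator B x * W x \<partial>M)"
  shows "AE x in M. \<bar>real_cond_exp M G (indicator A) x - prob A\<bar> \<le> real_cond_exp M G W x"
proof -
  interpret G: finite_measure_subalgebra M G
    by unfold_locales (rule sub)
  have iA: "integrable M (indicator A :: 'a \<Rightarrow> real)" using A by (intro integrable_real_indicator) (auto simp: less_top[symmetric])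
  have ic: "integrable M (\<lambda>_. prob A)" by simp
  have cond_c: "AE x in M. real_cond_exp M G (\<lambda>_. prob A) x = prob A"
    by (rule G.real_cond_exp_F_meas[OF ic]) simp
  have int: "(\<integral>x. indicator B x * indicator A x \<partial>M) = prob (B \<inter> A)" "(\<integral>x. indicator B x * prob A \<partial>M) = prob B * prob A"
    "integrable M (\<lambda>x. indicator B x * indicator A x :: real)" "integrable M (\<lambda>x. indicator B x * prob A)"
    "integrable M (\<lambda>x. indicator B x * W x)" if "B \<in> sets G" for B
  proof -
    have B: "B \<in> sets M" using that sub by (auto simp: subalgebra_def)
    have "(\<integral>x. indicator B x * indicator A x \<partial>M) = (\<integral>x. (indicator (B \<inter> A) x :: real) \<partial>M)"
      by (intro Bochner_Integration.integral_cong) (auto simp: indicator_def)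
    also have "\<dots> = prob (B \<inter> A)" using A B sets.sets_into_space[OF B] by (simp add: Int_absorb2 Int_absorb1 Int_assoc inf.absorb1 inf.coboundedI1)
    finally show "(\<integral>x. indicator B x * indicator A x \<partial>M) = prob (B \<inter> A)" .
    show "(\<integral>x. indicator B x * prob A \<partial>M) = prob B * prob A"
      using B sets.sets_into_space[OF B] by (simp add: Int_absorb2)
    show "integrable M (\<lambda>x. indicator B x * indicator A x :: real)" "integrable M (\<lambda>x. indicator B x * prob A)"
      "integrable M (\<lambda>x. indicator B x * W x)"
      using integrable_mult_indicator[OF B iA] integrable_mult_indicator[OF B ic] integrable_mult_indicator[OF B W] by simp_all
  qed
  have up: "AE x in M. real_cond_exp M G (\<lambda>x. (indicator A x - prob A) - W x) x \<le> 0"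
  proof (rule G.real_cond_exp_nonpos)
    show "integrable M (\<lambda>x. (indicator A x - prob A) - W x)" using iA ic W by auto
    fix B assume B: "B \<in> sets G"
    have "(\<integral>x. indicator B x * ((indicator A x - prob A) - W x) \<partial>M) =
        (\<integral>x. (indicator B x * indicator A x - indicator B x * prob A) - indicator B x * W x \<partial>M)"
      by (simp add: right_diff_distrib)
    also have "\<dots> = prob (B \<inter> A) - prob B * prob A - (\<integral>x. indicator B x * W x \<partial>M)"
      using int[OF B] by simp
    finally show "(\<integral>x. indicator B x * ((indicator A x - prob A) - W x) \<partial>M) \<le> 0" using le[OF B] by simp
  qed
  have lo: "AE x in M. real_cond_exp M G (\<lambda>x. (prob A - indicator A x) - W x) x \<le> 0"
  proof (rule G.real_cond_exp_nonpos)
    show "integrable M (\<lambda>x. (prob A - indicator A x) - W x)" using iA ic W by auto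
    fix B assume B: "B \<in> sets G"
    have "(\<integral>x. indicator B x * ((prob A - indicator A x) - W x) \<partial>M) =
        (\<integral>x. (indicator B x * prob A - indicator B x * indicator A x) - indicator B x * W x \<partial>M)"
      by (simp add: right_diff_distrib)
    also have "\<dots> = prob B * prob A - prob (B \<inter> A) - (\<integral>x. indicator B x * W x \<partial>M)"
      using int[OF B] by simp
    finally show "(\<integral>x. indicator B x * ((prob A - indicator A x) - W x) \<partial>M) \<le> 0" using le[OF B] by simp
  qed
  have id: "integrable M (\<lambda>x. indicator A x - prob A)" "integrable M (\<lambda>x. prob A - indicator A x)" using iA ic by auto
  from up lo cond_c G.real_cond_exp_diff[OF iA ic] G.real_cond_exp_diff[OF ic iA]
    G.real_cond_exp_diff[OF id(1) W] G.real_cond_exp_diff[OF id(2) W]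
  show ?thesis by eventually_elim (simp add: abs_le_iff)
qed

lemma subalgebra_gen_sigma:
  assumes "\<And>t. t \<in> I \<Longrightarrow> X t \<in> M \<rightarrow>\<^sub>M T"
  shows "subalgebra M (gen_sigma M T X I)"
proof -
  have "sets (gen_sigma M T X I) = sigma_sets (space M) (\<Union>t\<in>I. {X t -` A \<inter> space M | A. A \<in> sets T})"
    unfolding gen_sigma_def by (rule sets_measure_of) auto
  also have "\<dots> \<subseteq> sets M"
    by (rule sets.sigma_sets_subset) (use assms in \<open>auto intro: measurable_sets\<close>)
  finally show ?thesis by (simp add: subalgebra_def gen_sigma_def space_measure_of_conv)
qed

lemma gen_sigma_vimage: "t \<in> I \<Longrightarrow> A \<in> sets T \<Longrightarrow> X t -` A \<inter> space M \<in> sets (gen_sigma M T X I)"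
proof -
  assume "t \<in> I" "A \<in> sets T"
  moreover have "sets (gen_sigma M T X I) = sigma_sets (space M) (\<Union>t\<in>I. {X t -` A \<inter> space M | A. A \<in> sets T})"
    unfolding gen_sigma_def by (rule sets_measure_of) auto
  ultimately show ?thesis by (auto intro!: sigma_sets.Basic)
qed

lemma space_gen_sigma: "space (gen_sigma M T X I) = space M"
  by (simp add: gen_sigma_def space_measure_of_conv)

lemma measurable_gen_sigma: "t \<in> I \<Longrightarrow> X t \<in> space M \<rightarrow> space T \<Longrightarrow> X t \<in> gen_sigma M T X I \<rightarrow>\<^sub>M T"
  by (rule measurableI) (auto simp: space_gen_sigma gen_sigma_vimage)

text \<open>One function, the conditional expectation of \<open>W\<close>, dominates the deviations
  for all events \<open>A\<close> simultaneously. Hence it dominates their essential supremum, and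
  it integrates to the mean of \<open>W\<close>.\<close>

lemma (in prob_space) nn_integral_beta_le:
  assumes sub: "subalgebra M G" and \<A>: "\<A> \<noteq> {}" "\<A> \<subseteq> sets M" and W: "integrable M W" "\<And>x. 0 \<le> W x"
    and le: "\<And>A B. A \<in> \<A> \<Longrightarrow> B \<in> sets G \<Longrightarrow> \<bar>prob (B \<inter> A) - prob B * prob A\<bar> \<le> (\<integral>x. indicator B x * W x \<partial>M)"
  shows "(\<integral>\<^sup>+x. ess_sup M ((\<lambda>A x. ennreal \<bar>real_cond_exp M G (indicator A) x - prob A\<bar>) ` \<A>) x \<partial>M) \<le> ennreal (\<integral>x. W x \<partial>M)"
proof -
  interpret G: finite_measure_subalgebra M G
    by unfold_locales (rule sub)
  let ?w = "\<lambda>x. ennreal (real_cond_exp M G W x)"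
  have pos: "AE x in M. 0 \<le> real_cond_exp M G W x"
    using W by (intro G.real_cond_exp_pos) auto
  have "(\<integral>\<^sup>+x. ?w x \<partial>M) = ennreal (\<integral>x. real_cond_exp M G W x \<partial>M)"
    by (rule nn_integral_eq_integral[OF G.real_cond_exp_int(1)[OF W(1)] pos])
  also have "\<dots> = ennreal (\<integral>x. W x \<partial>M)" by (simp only: G.real_cond_exp_int(2)[OF W(1)])
  finally have w: "(\<integral>\<^sup>+x. ?w x \<partial>M) = ennreal (\<integral>x. W x \<partial>M)" .
  have "(\<integral>\<^sup>+x. ess_sup M ((\<lambda>A x. ennreal \<bar>real_cond_exp M G (indicator A) x - prob A\<bar>) ` \<A>) x \<partial>M) \<le> (\<integral>\<^sup>+x. ?w x \<partial>M)"
  proof (rule nn_integral_ess_sup_le)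
    show "(\<lambda>A x. ennreal \<bar>real_cond_exp M G (indicator A) x - prob A\<bar>) ` \<A> \<noteq> {}" using \<A> by simp
    show "f \<in> borel_measurable M" if "f \<in> (\<lambda>A x. ennreal \<bar>real_cond_exp M G (indicator A) x - prob A\<bar>) ` \<A>" for f
      using that by auto
    show "AE x in M. f x \<le> ?w x" if f: "f \<in> (\<lambda>A x. ennreal \<bar>real_cond_exp M G (indicator A) x - prob A\<bar>) ` \<A>" for f
    proof -
      obtain A where A: "A \<in> \<A>" "f = (\<lambda>x. ennreal \<bar>real_cond_exp M G (indicator A) x - prob A\<bar>)" using f by auto
      have "AE x in M. \<bar>real_cond_exp M G (indicator A) x - prob A\<bar> \<le> real_cond_exp M G W x"
        using A(1) \<A>(2) W(1) le by (intro cond_exp_deviation_le[OF sub]) auto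
      then show ?thesis unfolding A(2) by (rule AE_mp) (auto intro!: AE_I2 ennreal_leI)
    qed
    show "(\<integral>\<^sup>+x. ?w x \<partial>M) < \<infinity>" unfolding w by simp
  qed simp
  then show ?thesis unfolding w .
qed

context recursive_process
begin

lemma past_gen_sigma_Z: "sets (gen_sigma N borel Z {..t}) \<subseteq> past t"
proof (rule gen_sigma_sets_subset[OF past_sigma_algebra])
  fix s A assume s: "s \<in> {..t}" and A: "A \<in> sets (borel :: 's measure)"
  show "{\<omega> \<in> space N. Z s \<omega> \<in> A} \<in> past t"
    unfolding Z_def using s A measurable_rsol[of s]
    by (intro pastI[of "\<lambda>z e. rsol F z e s"]) (auto simp: split_beta' rsol_comb_seq_le)
qed

lemma markov_chain_Z: "markov_chain N borel kernel Z"
  unfolding markov_chain_def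
proof (intro conjI allI ballI)
  show "markov_kernel borel kernel" by (rule markov_kernel)
  show "Z t \<in> N \<rightarrow>\<^sub>M borel" for t by (rule measurable_Z)
  fix t A assume A: "A \<in> sets (borel :: 's measure)"
  let ?G = "gen_sigma N borel Z {..t}"
  have sub: "subalgebra N ?G" by (rule subalgebra_gen_sigma) (rule measurable_Z)
  interpret G: finite_measure_subalgebra N ?G by unfold_locales (rule sub)
  let ?E = "Z (Suc t) -` A \<inter> space N"
  have E: "?E \<in> sets N" using A by (rule measurable_sets[OF measurable_Z])
  have Kprob: "prob_space (kernel z)" for z
    using measurable_space[OF measurable_kernel, of z] by (simp add: space_prob_algebra)
  let ?g = "\<lambda>\<omega>. measure (kernel (Z t \<omega>)) A"
  have KA: "(\<lambda>z. measure (kernel z) A) \<in> borel_measurable borel"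
    by (rule measurable_compose[OF measurable_kernel measurable_measure_prob_algebra[OF A]])
  have ZG: "Z t \<in> ?G \<rightarrow>\<^sub>M borel" by (rule measurable_gen_sigma) auto
  have gG: "?g \<in> borel_measurable ?G" by (rule measurable_compose[OF ZG KA])
  have gN: "?g \<in> borel_measurable N" by (rule measurable_compose[OF measurable_Z KA])
  have g1: "norm (?g \<omega>) \<le> 1" for \<omega> using prob_space.prob_le_1[OF Kprob] by simp
  show "AE \<omega> in N. real_cond_exp N ?G (indicator ?E) \<omega> = ?g \<omega>"
  proof (rule G.real_cond_exp_charact)
    show "integrable N (indicator ?E :: _ \<Rightarrow> real)"
      using E by (intro integrable_real_indicator) (auto simp: less_top[symmetric])
    show ig: "integrable N ?g" by (rule N.integrable_const_bound[where B=1]) (use g1 gN in auto)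
    show "?g \<in> borel_measurable ?G" by (rule gG)
    fix B assume B: "B \<in> sets ?G"
    then have Bp: "B \<in> past t" and BN: "B \<in> sets N" using past_gen_sigma_Z sub by (auto simp: subalgebra_def)
    \<comment> \<open>The cylinder that records the state at time \<open>t + 1\<close> and forgets
      all later innovations.\<close>
    let ?c = "A \<times> (UNIV :: (nat \<Rightarrow> 'e) set)"
    have c: "?c \<in> sets (borel \<Otimes>\<^sub>M S)" using A sets.top[of S] by (intro pair_measureI) (auto simp: space_Seq)
    have "emeasure S (Pair x -` ?c) = indicator A x" for x
      using P.emeasure_space_1 by (auto simp: space_Seq indicator_def)
    then have "(\<integral>\<^sup>+x. emeasure S (Pair x -` ?c) \<partial>kernel_pow borel kernel (Suc t - t) z) = emeasure (kernel z) A" for z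
      using A kernel_pow_1[of z] measurable_space[OF measurable_kernel, of z]
      by (simp add: Suc_diff_le space_prob_algebra)
    then have "emeasure N (B \<inter> {\<omega> \<in> space N. (Z (Suc t) \<omega>, \<lambda>i. \<eta> \<omega> (Suc t + i)) \<in> ?c}) =
        (\<integral>\<^sup>+\<omega>. indicator B \<omega> * emeasure (kernel (Z t \<omega>)) A \<partial>N)"
      using past_future[OF Bp c, of "Suc t"] by simp
    also have "\<dots> = (\<integral>\<^sup>+\<omega>. ennreal (indicator B \<omega> * ?g \<omega>) \<partial>N)"
      using finite_measure.emeasure_eq_measure[OF prob_space.finite_measure[OF Kprob]]
      by (intro nn_integral_cong) (simp add: indicator_def)
    also have "\<dots> = ennreal (\<integral>\<omega>. indicator B \<omega> * ?g \<omega> \<partial>N)"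
      using integrable_mult_indicator[OF BN ig] by (intro nn_integral_eq_integral) auto
    also have "B \<inter> {\<omega> \<in> space N. (Z (Suc t) \<omega>, \<lambda>i. \<eta> \<omega> (Suc t + i)) \<in> ?c} = B \<inter> ?E" by auto
    finally have "N.prob (B \<inter> ?E) = (\<integral>\<omega>. indicator B \<omega> * ?g \<omega> \<partial>N)"
      by (simp add: N.emeasure_eq_measure Bochner_Integration.integral_nonneg)
    moreover have "(\<integral>\<omega>. indicator B \<omega> * indicator ?E \<omega> \<partial>N) = N.prob (B \<inter> ?E)"
    proof -
      have "(\<integral>\<omega>. indicator B \<omega> * indicator ?E \<omega> \<partial>N) = (\<integral>\<omega>. (indicator (B \<inter> ?E) \<omega> :: real) \<partial>N)"
        by (intro Bochner_Integration.integral_cong) (auto simp: indicator_def)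
      then show ?thesis by (simp add: Int_assoc)
    qed
    ultimately show "set_lebesgue_integral N B (indicator ?E) = set_lebesgue_integral N B ?g"
      by (simp add: set_lebesgue_integral_def)
  qed
qed

end

section \<open>Processes started from the invariant law\<close>

locale stationary_process = recursive_process +
  assumes inv: "invariant_prob borel kernel \<mu>"
begin

lemma emeasure_future:
  assumes c: "c \<in> sets (borel \<Otimes>\<^sub>M S)"
  shows "emeasure N {\<omega> \<in> space N. (Z u \<omega>, \<lambda>i. \<eta> \<omega> (u + i)) \<in> c} = (\<integral>\<^sup>+x. emeasure S (Pair x -` c) \<partial>\<mu>)"
proof -
  let ?h = "\<lambda>x. emeasure S (Pair x -` c)"
  have h: "?h \<in> borel_measurable borel" using P.measurable_emeasure_Pair[OF c] by simp
  interpret sa: sigma_algebra "space N" "past 0" by (rule past_sigma_algebra)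
  have "space N \<in> past 0" by (rule sa.top)
  from past_future[OF this c, of u]
  have "emeasure N {\<omega> \<in> space N. (Z u \<omega>, \<lambda>i. \<eta> \<omega> (u + i)) \<in> c} =
      (\<integral>\<^sup>+\<omega>. indicator (space N) \<omega> * (\<integral>\<^sup>+x. ?h x \<partial>kernel_pow borel kernel u (Z 0 \<omega>)) \<partial>N)"
    by (simp add: Int_absorb1)
  also have "\<dots> = (\<integral>\<^sup>+\<omega>. (\<integral>\<^sup>+x. ?h x \<partial>kernel_pow borel kernel u (Z0 \<omega>)) \<partial>N)"
    by (intro nn_integral_cong) (simp add: Z_def)
  also have "\<dots> = (\<integral>\<^sup>+z. \<integral>\<^sup>+e. (\<integral>\<^sup>+x. ?h x \<partial>kernel_pow borel kernel u z) \<partial>S \<partial>\<mu>)"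
  proof -
    have "(\<lambda>x. \<integral>\<^sup>+y. ?h y \<partial>kernel_pow borel kernel u (fst x)) \<in> borel_measurable (borel \<Otimes>\<^sub>M S)"
      by (rule measurable_compose[OF measurable_fst measurable_nn_integral_kernel[OF kernel_pow_measurable h]])
    from nn_integral_joint[OF this] show ?thesis by (simp only: fst_conv)
  qed
  also have "\<dots> = (\<integral>\<^sup>+z. (\<integral>\<^sup>+x. ?h x \<partial>kernel_pow borel kernel u z) \<partial>\<mu>)"
    using P.emeasure_space_1 by simp
  also have "\<dots> = (\<integral>\<^sup>+x. ?h x \<partial>(\<mu> \<bind> kernel_pow borel kernel u))"
    by (rule nn_integral_bind_prob_algebra[OF \<mu> kernel_pow_measurable h, symmetric])
  finally show ?thesis by (simp add: invariant_pow[OF inv])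
qed

text \<open>The pair of current state and remaining innovations has a law that does not depend on
  time. A process obtained from this pair by fixed functions is therefore strictly
  stationary.\<close>

lemma distr_shift:
  "distr N (borel \<Otimes>\<^sub>M S) (\<lambda>\<omega>. (Z m \<omega>, \<lambda>i. \<eta> \<omega> (m + i))) = \<mu> \<Otimes>\<^sub>M S"
proof (rule measure_eqI)
  show "sets (distr N (borel \<Otimes>\<^sub>M S) (\<lambda>\<omega>. (Z m \<omega>, \<lambda>i. \<eta> \<omega> (m + i)))) = sets (\<mu> \<Otimes>\<^sub>M S)"
    by (simp add: sets_pair_measure_cong[OF sets_mu refl])
  fix c assume "c \<in> sets (distr N (borel \<Otimes>\<^sub>M S) (\<lambda>\<omega>. (Z m \<omega>, \<lambda>i. \<eta> \<omega> (m + i))))"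
  then have c: "c \<in> sets (borel \<Otimes>\<^sub>M S)" by simp
  have m: "(\<lambda>\<omega>. (Z m \<omega>, \<lambda>i. \<eta> \<omega> (m + i))) \<in> N \<rightarrow>\<^sub>M borel \<Otimes>\<^sub>M S"
    using measurable_compose[OF joint_measurable measurable_shifted[of m]] unfolding Z_def[abs_def] by simp
  have "emeasure (distr N (borel \<Otimes>\<^sub>M S) (\<lambda>\<omega>. (Z m \<omega>, \<lambda>i. \<eta> \<omega> (m + i)))) c =
      emeasure N {\<omega> \<in> space N. (Z m \<omega>, \<lambda>i. \<eta> \<omega> (m + i)) \<in> c}"
    using c m by (simp add: emeasure_distr vimage_def Int_def conj_commute)
  also have "\<dots> = (\<integral>\<^sup>+x. emeasure S (Pair x -` c) \<partial>\<mu>)" by (rule emeasure_future[OF c])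
  also have "\<dots> = emeasure (\<mu> \<Otimes>\<^sub>M S) c"
    using c by (intro P.emeasure_pair_measure_alt[symmetric]) (simp add: sets_pair_measure_cong[OF sets_mu refl])
  finally show "emeasure (distr N (borel \<Otimes>\<^sub>M S) (\<lambda>\<omega>. (Z m \<omega>, \<lambda>i. \<eta> \<omega> (m + i)))) c = emeasure (\<mu> \<Otimes>\<^sub>M S) c" .
qed

text \<open>With \<open>h x\<close> the probability of the future event given the state
  \<open>x\<close> at time \<open>u\<close>, the joint probability averages the
  \<open>(u - m)\<close>-step mean of \<open>h\<close> from \<open>Z m\<close>, and the product of
  probabilities replaces that mean by the integral against \<mu>. \<open>V\<close> denotes here the
  bound on the difference of the two.\<close>

lemma mixing_bound:
  assumes B: "B \<in> past m" and A: "A \<in> future u" and mu: "m \<le> u"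
    and decay: "\<And>h x. h \<in> borel_measurable borel \<Longrightarrow> (\<And>y. \<bar>h y\<bar> \<le> 1) \<Longrightarrow>
      \<bar>(\<integral>y. h y \<partial>kernel_pow borel kernel (u - m) x) - (\<integral>y. h y \<partial>\<mu>)\<bar> \<le> V x"
    and V: "integrable N (\<lambda>\<omega>. V (Z m \<omega>))"
  shows "\<bar>N.prob (B \<inter> A) - N.prob B * N.prob A\<bar> \<le> (\<integral>\<omega>. indicator B \<omega> * V (Z m \<omega>) \<partial>N)"
proof -
  obtain c where c: "c \<in> sets (borel \<Otimes>\<^sub>M S)" "A = {\<omega> \<in> space N. (Z u \<omega>, \<lambda>i. \<eta> \<omega> (u + i)) \<in> c}"
    using A unfolding future_def by blast
  define h where "h x = measure S (Pair x -` c)" for x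
  have hS: "emeasure S (Pair x -` c) = ennreal (h x)" for x by (simp add: h_def P.emeasure_eq_measure)
  have "(\<lambda>x. emeasure S (Pair x -` c)) \<in> borel_measurable borel" using P.measurable_emeasure_Pair[OF c(1)] by simp
  then have h: "h \<in> borel_measurable borel" unfolding h_def measure_def by measurable
  have h01: "0 \<le> h x" "h x \<le> 1" for x by (simp_all add: h_def)
  have BN: "B \<in> sets N" using B past_events by auto
  interpret mu: prob_space \<mu> using space_prob_algebraD(2)[OF \<mu>] .
  have hint: "integrable Q h" "(\<integral>\<^sup>+x. ennreal (h x) \<partial>Q) = ennreal (\<integral>x. h x \<partial>Q)" if Q: "Q \<in> space (prob_algebra borel)" for Q
  proof -
    interpret Q: prob_space Q using space_prob_algebraD(2)[OF Q] .
    show "integrable Q h"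
      using h h01 space_prob_algebraD(1)[OF Q]
      by (intro Q.integrable_const_bound[where B=1]) (auto simp: measurable_cong_sets[OF space_prob_algebraD(1)[OF Q] refl])
    then show "(\<integral>\<^sup>+x. ennreal (h x) \<partial>Q) = ennreal (\<integral>x. h x \<partial>Q)" using h01 by (intro nn_integral_eq_integral) auto
  qed
  let ?g = "\<lambda>z. \<integral>x. h x \<partial>kernel_pow borel kernel (u - m) z"
  have ksp: "kernel_pow borel kernel (u - m) z \<in> space (prob_algebra borel)" for z by (rule kernel_pow_space) simp
  have g01: "0 \<le> ?g z" "?g z \<le> 1" for z
  proof -
    interpret Q: prob_space "kernel_pow borel kernel (u - m) z" using space_prob_algebraD(2)[OF ksp] .
    show "0 \<le> ?g z" using h01 by (intro Bochner_Integration.integral_nonneg) auto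
    have "?g z \<le> (\<integral>x. 1 \<partial>kernel_pow borel kernel (u - m) z)"
      using hint(1)[OF ksp, of z] h01 by (intro integral_mono) auto
    then show "?g z \<le> 1" by (simp add: Q.prob_space)
  qed
  have gm: "(\<lambda>\<omega>. ?g (Z m \<omega>)) \<in> borel_measurable N"
    by (rule measurable_compose[OF measurable_Z measurable_integral_kernel[OF kernel_pow_measurable h]])
  have gi: "integrable N (\<lambda>\<omega>. ?g (Z m \<omega>))"
    using gm g01 by (intro N.integrable_const_bound[where B=1]) auto
  have "emeasure N (B \<inter> A) = (\<integral>\<^sup>+\<omega>. indicator B \<omega> * (\<integral>\<^sup>+x. emeasure S (Pair x -` c) \<partial>kernel_pow borel kernel (u - m) (Z m \<omega>)) \<partial>N)"
    unfolding c(2) by (rule past_future[OF B c(1) mu])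
  also have "\<dots> = (\<integral>\<^sup>+\<omega>. ennreal (indicator B \<omega> * ?g (Z m \<omega>)) \<partial>N)"
    unfolding hS by (intro nn_integral_cong) (simp add: hint(2)[OF ksp] indicator_def)
  also have "\<dots> = ennreal (\<integral>\<omega>. indicator B \<omega> * ?g (Z m \<omega>) \<partial>N)"
    using integrable_mult_indicator[OF BN gi] g01 by (intro nn_integral_eq_integral) auto
  finally have BA: "N.prob (B \<inter> A) = (\<integral>\<omega>. indicator B \<omega> * ?g (Z m \<omega>) \<partial>N)"
    using g01 by (simp add: N.emeasure_eq_measure Bochner_Integration.integral_nonneg)
  have "emeasure N A = ennreal (\<integral>x. h x \<partial>\<mu>)"
    unfolding c(2) emeasure_future[OF c(1)] hS by (rule hint(2)[OF \<mu>])
  then have PA: "N.prob A = (\<integral>x. h x \<partial>\<mu>)" using h01 by (simp add: N.emeasure_eq_measure Bochner_Integration.integral_nonneg)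
  have iB: "integrable N (\<lambda>\<omega>. indicator B \<omega> * N.prob A)"
    using integrable_mult_indicator[OF BN, of "\<lambda>_. N.prob A"] by simp
  have "N.prob (B \<inter> A) - N.prob B * N.prob A = (\<integral>\<omega>. indicator B \<omega> * ?g (Z m \<omega>) - indicator B \<omega> * N.prob A \<partial>N)"
    using integrable_mult_indicator[OF BN gi] iB sets.sets_into_space[OF BN] by (simp add: BA Int_absorb2)
  also have "\<bar>\<dots>\<bar> \<le> (\<integral>\<omega>. \<bar>indicator B \<omega> * ?g (Z m \<omega>) - indicator B \<omega> * N.prob A\<bar> \<partial>N)"
    by (rule integral_abs_bound)
  also have "\<dots> \<le> (\<integral>\<omega>. indicator B \<omega> * V (Z m \<omega>) \<partial>N)"
  proof (rule integral_mono)
    show "integrable N (\<lambda>\<omega>. \<bar>indicator B \<omega> * ?g (Z m \<omega>) - indicator B \<omega> * N.prob A\<bar>)"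
      using integrable_mult_indicator[OF BN gi] iB by auto
    show "integrable N (\<lambda>\<omega>. indicator B \<omega> * V (Z m \<omega>))" using integrable_mult_indicator[OF BN V] by simp
    show "\<bar>indicator B \<omega> * ?g (Z m \<omega>) - indicator B \<omega> * N.prob A\<bar> \<le> indicator B \<omega> * V (Z m \<omega>)" for \<omega>
      using decay[OF h, of "Z m \<omega>"] h01 by (simp add: PA indicator_def)
  qed
  finally show ?thesis .
qed

end

section \<open>The vector smooth transition autoregression\<close>

definition push :: "real^('p::{finite,linorder} \<times> 'n::finite) \<Rightarrow> real^'n \<Rightarrow> real^('p \<times> 'n)" where
  "push z u = stack (\<lambda>j. if j = 1 then u else block z (j - 1))"

lemma lag_of_range: "lag_of (i::'p::{finite,linorder}) \<in> {1..CARD('p)}"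
  using bij_betw_lag_of bij_betwE by blast

lemma push_component:
  "push z u $ q = (if lag_of (fst q) = 1 then u $ snd q else z $ (lag_pos (lag_of (fst q) - 1), snd q))"
  by (simp add: push_def stack_def block_def)

lemma block_push: "j \<in> {1..CARD('p)} \<Longrightarrow>
    block (push (z::real^('p::{finite,linorder} \<times> 'n::finite)) u) j = (if j = 1 then u else block z (j - 1))"
  unfolding push_def by (rule block_stack)

lemma linear_push: "linear (\<lambda>(z, u). push z u)"
  by (rule linearI) (auto simp: vec_eq_iff push_component)

lemma push_add: "push (z + z') (u + u') = push z u + push z' u'"
  by (simp add: vec_eq_iff push_component)

lemma push_scaleR: "push (c *\<^sub>R z) (c *\<^sub>R u) = c *\<^sub>R push z u"
  by (simp add: vec_eq_iff push_component)

lemma push_bounded: "\<exists>L>0. \<forall>(z::real^('p::{finite,linorder} \<times> 'n::finite)) u. norm (push z u) \<le> L * (norm z + norm u)"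
proof -
  obtain L where L: "L > 0" "\<And>x. norm ((\<lambda>(z::real^('p \<times> 'n), u). push z u) x) \<le> L * norm x"
    using linear_bounded_pos[OF linear_push] by blast
  have "norm (push z u) \<le> L * (norm z + norm u)" for z :: "real^('p \<times> 'n)" and u
  proof -
    have "norm (push z u) \<le> L * norm (z, u)" using L(2)[of "(z, u)"] by simp
    also have "\<dots> \<le> L * (norm z + norm u)" using L(1) norm_Pair_le[of z u] by (intro mult_left_mono) auto
    finally show ?thesis .
  qed
  then show ?thesis using L(1) by blast
qed

lemma borel_measurable_pair_iff: "f \<in> borel \<Otimes>\<^sub>M borel \<rightarrow>\<^sub>M M \<longleftrightarrow> f \<in> borel \<rightarrow>\<^sub>M M"
  for f :: "'a::second_countable_topology \<times> 'b::second_countable_topology \<Rightarrow> 'c"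
  by (simp only: borel_prod)

lemma measurable_push_pair: "(\<lambda>(z, u). push z u) \<in> borel \<Otimes>\<^sub>M borel \<rightarrow>\<^sub>M borel"
  unfolding borel_measurable_pair_iff
  by (intro borel_measurable_continuous_onI linear_continuous_on linear_conv_bounded_linear[THEN iffD1] linear_push)

lemma linear_block: "linear (\<lambda>z. block z j)"
  by (rule linearI) (simp_all add: vec_eq_iff block_def)

lemma continuous_on_block: "continuous_on UNIV (\<lambda>z. block z j)"
  by (intro linear_continuous_on linear_conv_bounded_linear[THEN iffD1] linear_block)

lemma measurable_block[measurable]: "(\<lambda>z. block z j) \<in> borel_measurable borel"
  by (intro borel_measurable_continuous_onI continuous_on_block)

text \<open>The first block row computes the new value and the identity blocks below it move every
  other block one lag back. All companion matrices thus share the same shift and differ only in the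
  inserted value.\<close>

lemma companion_mult:
  fixes A :: "nat \<Rightarrow> real^'n^'n" and z :: "real^('p::{finite,linorder} \<times> 'n::finite)"
  shows "companion A *v z = push z (\<Sum>j=1..CARD('p). A j *v block z j)"
proof (rule vec_eq_iff[THEN iffD2], rule allI)
  fix q :: "'p \<times> 'n"
  obtain i k where q: "q = (i, k)" by (cases q)
  show "(companion A *v z) $ q = push z (\<Sum>j=1..CARD('p). A j *v block z j) $ q"
  proof (cases "lag_of i = 1")
    case True
    have "(companion A *v z) $ q = (\<Sum>r\<in>UNIV. A (lag_of (fst r)) $ k $ snd r * z $ r)"
      using True by (simp add: matrix_vector_mult_def companion_def q)
    also have "\<dots> = (\<Sum>i'\<in>UNIV. \<Sum>k'\<in>UNIV. A (lag_of i') $ k $ k' * z $ (i', k'))"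
      by (simp add: sum.cartesian_product split_beta' UNIV_Times_UNIV[symmetric] del: UNIV_Times_UNIV)
    also have "\<dots> = (\<Sum>i'\<in>(UNIV :: 'p set). (\<lambda>j. (A j *v block z j) $ k) (lag_of i'))"
      by (simp add: matrix_vector_mult_def block_def lag_pos_lag_of)
    also have "\<dots> = (\<Sum>j\<in>{1..CARD('p)}. (A j *v block z j) $ k)"
      by (rule sum.reindex_bij_betw[OF bij_betw_lag_of])
    finally show ?thesis using True by (simp add: push_component q)
  next
    case False
    then have "lag_of i - 1 \<in> {1..CARD('p)}" using lag_of_range[of i] by auto
    then have l: "lag_of (lag_pos (lag_of i - 1) :: 'p) = lag_of i - 1" by (rule lag_of_lag_pos)
    have iff: "lag_of i = lag_of i' + 1 \<longleftrightarrow> i' = lag_pos (lag_of i - 1)" for i' :: 'p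
    proof
      assume "lag_of i = lag_of i' + 1"
      then show "i' = lag_pos (lag_of i - 1)" by (simp add: lag_pos_lag_of)
    next
      assume "i' = lag_pos (lag_of i - 1)"
      then show "lag_of i = lag_of i' + 1" using l lag_of_range[of i] by simp
    qed
    have "companion A $ q $ r = (if r = (lag_pos (lag_of i - 1), k) then 1 else 0)" for r
    proof -
      obtain i' k' where r: "r = (i', k')" by (cases r)
      show ?thesis
        unfolding companion_def vec_lambda_beta q r fst_conv snd_conv iff prod.inject using False by auto
    qed
    then have "(companion A *v z) $ q = (\<Sum>r\<in>UNIV. (if r = (lag_pos (lag_of i - 1), k) then 1 else 0) * z $ r)"
      by (simp only: matrix_vector_mult_def vec_lambda_beta)
    also have "\<dots> = z $ (lag_pos (lag_of i - 1), k)"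
      by (simp add: if_distrib[of "\<lambda>x. x * _"] cong: if_cong)
    finally show ?thesis using False by (simp add: push_component q)
  qed
qed

locale vstar_model =
  fixes g :: nat and \<mu> :: "nat \<Rightarrow> real^'n" and \<Phi> :: "nat \<Rightarrow> real^'n^'n" and \<Psi> :: "nat \<Rightarrow> nat \<Rightarrow> real^'n^'n"
    and \<Omega> :: "nat \<Rightarrow> real^'n^'n" and G :: "nat \<Rightarrow> real \<Rightarrow> real"
    and s :: "real^('p::{finite,linorder} \<times> 'n::finite) \<Rightarrow> real" and D :: "(real^'n) measure" and d :: "real^'n \<Rightarrow> real"
  assumes \<Omega>: "\<And>i. i \<in> {0..g} \<Longrightarrow> pos_def (\<Omega> i)"
    and G: "\<And>i. i \<in> {1..g} \<Longrightarrow> continuous_on UNIV (G i)" "\<And>i u. i \<in> {1..g} \<Longrightarrow> 0 \<le> G i u"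
    and G1: "\<And>u. (\<Sum>i=1..g. G i u) \<le> 1"
    and s: "s \<in> borel_measurable borel"
    and prob_D: "prob_space D" and sets_D: "sets D = sets borel"
    and second_moment: "integrable D (\<lambda>e. (norm e)\<^sup>2)"
    and dens: "D = density lborel (\<lambda>x. ennreal (d x))" "(\<lambda>x. ennreal (d x)) \<in> borel_measurable borel"
    and d_low: "\<And>K. compact K \<Longrightarrow> \<exists>b>0. \<forall>x\<in>K. b \<le> d x"
    and jsr: "joint_spectral_radius
           ((\<lambda>i. companion (\<lambda>j. \<Phi> j + \<Psi> i j)) ` {1..g} \<union> {companion \<Phi>}
             :: (real^('p \<times> 'n)^('p \<times> 'n)) set) < 1"
begin

definition w :: "nat \<Rightarrow> real^('p \<times> 'n) \<Rightarrow> real" where "w i z = G i (s z)"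

text \<open>The weight of the regime with coefficients \<Phi> and covariance
  \<open>\<Omega> 0\<close>; together with the \<open>w i\<close> it completes a convex
  combination.\<close>

definition w0 :: "real^('p \<times> 'n) \<Rightarrow> real" where "w0 z = 1 - (\<Sum>i=1..g. w i z)"

definition cov :: "real^('p \<times> 'n) \<Rightarrow> real^'n^'n" where
  "cov z = w0 z *\<^sub>R \<Omega> 0 + (\<Sum>i=1..g. w i z *\<^sub>R \<Omega> i)"

definition mean :: "real^('p \<times> 'n) \<Rightarrow> real^'n" where
  "mean z = \<mu> 0 + (\<Sum>j=1..CARD('p). \<Phi> j *v block z j)
      + (\<Sum>i=1..g. w i z *\<^sub>R (\<mu> i + (\<Sum>j=1..CARD('p). \<Psi> i j *v block z j)))"

definition F :: "real^('p \<times> 'n) \<Rightarrow> real^'n \<Rightarrow> real^('p \<times> 'n)" where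
  "F z e = push z (mean z + matrix_sqrt (cov z) *v e)"

lemma vstar_eq: "vstar g \<mu> \<Phi> \<Psi> \<Omega> G s (block z) e = mean z + matrix_sqrt (cov z) *v e"
  by (simp add: vstar_def Let_def stack_block mean_def cov_def w0_def w_def)

lemma w_nonneg: "i \<in> {1..g} \<Longrightarrow> 0 \<le> w i z" by (simp add: w_def G)

lemma w0_nonneg: "0 \<le> w0 z" using G1[of "s z"] by (simp add: w0_def w_def)

lemma w_sum: "w0 z + (\<Sum>i=1..g. w i z) = 1" by (simp add: w0_def)

lemma w_le_1: "i \<in> {1..g} \<Longrightarrow> w i z \<le> 1"
  using member_le_sum[of i "{1..g}" "\<lambda>i. w i z"] w_nonneg w0_nonneg[of z] by (simp add: w0_def)

lemma measurable_w: "i \<in> {1..g} \<Longrightarrow> w i \<in> borel_measurable borel"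
  unfolding w_def[abs_def] using G(1) s by (intro borel_measurable_continuous_on[of "G i" s]) auto

lemma measurable_w0: "w0 \<in> borel_measurable borel"
  unfolding w0_def[abs_def] using measurable_w by (intro borel_measurable_diff borel_measurable_sum) auto

lemma measurable_cov: "cov \<in> borel_measurable borel"
  unfolding cov_def[abs_def] using measurable_w measurable_w0
  by (intro borel_measurable_add borel_measurable_sum borel_measurable_scaleR) auto

lemma measurable_matrix_vector: "f \<in> borel_measurable M \<Longrightarrow> h \<in> borel_measurable M \<Longrightarrow>
    (\<lambda>x. f x *v h x) \<in> borel_measurable M" for f :: "'x \<Rightarrow> real^'k^'m" and h :: "'x \<Rightarrow> real^'k"
  by (rule borel_measurable_continuous_Pair[where H = "\<lambda>a b. a *v b", OF _ _ bounded_bilinear.continuous_on[OF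
        bounded_bilinear_matrix_vector_mult continuous_on_fst[OF continuous_on_id] continuous_on_snd[OF continuous_on_id]]])

lemma measurable_mean: "mean \<in> borel_measurable borel"
  unfolding mean_def[abs_def] using measurable_w measurable_block
  by (intro borel_measurable_add borel_measurable_sum borel_measurable_scaleR borel_measurable_const measurable_matrix_vector) auto

text \<open>Bounds on quadratic forms and on operator norms pass to convex combinations. The least
  lower constant and the sum of the upper ones therefore serve for every \<open>z\<close>, and this
  uniformity is what the matrix root and the minorization require.\<close>

lemma cov_bounds:
  obtains a b where "0 < a" "\<And>z. transpose (cov z) = cov z" "\<And>z x. a * (norm x)\<^sup>2 \<le> x \<bullet> (cov z *v x)"
    "\<And>z. op_bound (cov z) b"
proof -
  have "\<forall>i\<in>{0..g}. \<exists>a>0. \<forall>x. a * (norm x)\<^sup>2 \<le> x \<bullet> (\<Omega> i *v x)"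
  proof
    fix i assume "i \<in> {0..g}"
    from pos_def_bounds[OF \<Omega>[OF this]] show "\<exists>a>0. \<forall>x. a * (norm x)\<^sup>2 \<le> x \<bullet> (\<Omega> i *v x)" by blast
  qed
  from bchoice[OF this] obtain al where al: "\<And>i. i \<in> {0..g} \<Longrightarrow> al i > 0"
    "\<And>i x. i \<in> {0..g} \<Longrightarrow> al i * (norm x)\<^sup>2 \<le> x \<bullet> (\<Omega> i *v x)" by blast
  have "\<forall>i. \<exists>b. op_bound (\<Omega> i) b" using op_bound_exists by blast
  from choice[OF this] obtain be where be: "\<And>i. op_bound (\<Omega> i) (be i)" by blast
  define a where "a = Min (al ` {0..g})"
  have a: "0 < a" "\<And>i. i \<in> {0..g} \<Longrightarrow> a \<le> al i"
    unfolding a_def using al(1) by (auto simp: Min_gr_iff)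
  define b where "b = (\<Sum>i=0..g. be i)"
  have be0: "0 \<le> be i" for i by (rule op_bound_nonneg[OF be])
  have beb: "be i \<le> b" if "i \<in> {0..g}" for i unfolding b_def using be0 that by (intro member_le_sum) auto
  have quad: "x \<bullet> (cov z *v x) = w0 z * (x \<bullet> (\<Omega> 0 *v x)) + (\<Sum>i=1..g. w i z * (x \<bullet> (\<Omega> i *v x)))" for z x
    by (simp add: cov_def matrix_vector_mult_add_rdistrib scaleR_matrix_vector_assoc[symmetric] inner_add_right
        linear_sum[OF bilinear_matrix_vector_mult[unfolded bilinear_def, THEN conjunct2, rule_format]] inner_sum_right)
  have sym: "transpose (cov z) = cov z" for z
  proof -
    have t: "transpose (\<Sum>i\<in>I. f i) = (\<Sum>i\<in>I. transpose (f i))" for I and f :: "nat \<Rightarrow> real^'n^'n"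
      by (simp add: transpose_def vec_eq_iff)
    have "transpose (cov z) = w0 z *\<^sub>R transpose (\<Omega> 0) + (\<Sum>i=1..g. w i z *\<^sub>R transpose (\<Omega> i))"
      by (simp add: cov_def transpose_add t transpose_scalar)
    also have "\<dots> = cov z" unfolding cov_def using \<Omega> by (intro arg_cong2[where f = "(+)"] sum.cong) (auto simp: pos_def_def)
    finally show ?thesis .
  qed
  have lo: "a * (norm x)\<^sup>2 \<le> x \<bullet> (cov z *v x)" for z x
  proof -
    have "a * (norm x)\<^sup>2 = w0 z * (a * (norm x)\<^sup>2) + (\<Sum>i=1..g. w i z * (a * (norm x)\<^sup>2))"
      unfolding sum_distrib_right[symmetric] distrib_right[symmetric] w_sum by simp
    also have "\<dots> \<le> w0 z * (x \<bullet> (\<Omega> 0 *v x)) + (\<Sum>i=1..g. w i z * (x \<bullet> (\<Omega> i *v x)))"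
    proof -
      have "a * (norm x)\<^sup>2 \<le> x \<bullet> (\<Omega> i *v x)" if "i \<in> {0..g}" for i
        using mult_right_mono[OF a(2)[OF that], of "(norm x)\<^sup>2"] al(2)[OF that, of x] by simp
      then show ?thesis using w0_nonneg w_nonneg by (intro add_mono sum_mono mult_left_mono) auto
    qed
    finally show ?thesis unfolding quad .
  qed
  have up: "op_bound (cov z) b" for z
    unfolding op_bound_def
  proof
    fix x
    have "cov z *v x = w0 z *\<^sub>R (\<Omega> 0 *v x) + (\<Sum>i=1..g. w i z *\<^sub>R (\<Omega> i *v x))"
      by (simp add: cov_def matrix_vector_mult_add_rdistrib scaleR_matrix_vector_assoc[symmetric]
        linear_sum[OF bilinear_matrix_vector_mult[unfolded bilinear_def, THEN conjunct2, rule_format]])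
    then have "norm (cov z *v x) \<le> norm (w0 z *\<^sub>R (\<Omega> 0 *v x)) + (\<Sum>i=1..g. norm (w i z *\<^sub>R (\<Omega> i *v x)))"
      by (simp only:) (intro norm_triangle_le add_mono order_refl norm_sum)
    also have "\<dots> = w0 z * norm (\<Omega> 0 *v x) + (\<Sum>i=1..g. w i z * norm (\<Omega> i *v x))"
      using w0_nonneg w_nonneg by simp
    also have "\<dots> \<le> w0 z * (b * norm x) + (\<Sum>i=1..g. w i z * (b * norm x))"
    proof -
      have "norm (\<Omega> i *v x) \<le> b * norm x" if "i \<in> {0..g}" for i
        using mult_right_mono[OF beb[OF that], of "norm x"] be[of i] by (auto simp: op_bound_def intro: order_trans)
      then show ?thesis using w0_nonneg w_nonneg by (intro add_mono sum_mono mult_left_mono) auto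
    qed
    also have "\<dots> = (w0 z + (\<Sum>i=1..g. w i z)) * (b * norm x)" by (simp only: distrib_right sum_distrib_right)
    finally show "norm (cov z *v x) \<le> b * norm x" unfolding w_sum by simp
  qed
  show ?thesis by (rule that[OF a(1) sym lo up])
qed

lemma measurable_root: "(\<lambda>z. matrix_sqrt (cov z)) \<in> borel_measurable borel"
proof -
  obtain a b where "0 < a" "\<And>z. transpose (cov z) = cov z" "\<And>z x. a * (norm x)\<^sup>2 \<le> x \<bullet> (cov z *v x)"
    "\<And>z. op_bound (cov z) b" using cov_bounds by blast
  then show ?thesis using measurable_cov by (intro measurable_matrix_sqrt[of cov borel a b])
qed

lemma measurable_F: "(\<lambda>(z, e). F z e) \<in> borel \<Otimes>\<^sub>M borel \<rightarrow>\<^sub>M borel"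
proof -
  have "(\<lambda>x. (fst x, mean (fst x) + matrix_sqrt (cov (fst x)) *v snd x)) \<in> borel \<Otimes>\<^sub>M borel \<rightarrow>\<^sub>M borel \<Otimes>\<^sub>M borel"
    by (intro measurable_Pair measurable_fst borel_measurable_add measurable_matrix_vector measurable_snd
        measurable_compose[OF measurable_fst measurable_mean] measurable_compose[OF measurable_fst measurable_root])
  from measurable_compose[OF this measurable_push_pair] show ?thesis by (simp add: F_def split_beta')
qed

sublocale random_recursion D F
proof -
  interpret D: prob_space D by (rule prob_D)
  show "random_recursion D F"
    by unfold_locales (rule sets_D, rule measurable_F)
qed

lemma vstar_kernel_eq: "vstar_kernel g \<mu> \<Phi> \<Psi> \<Omega> G s D = kernel"
proof (rule ext)
  fix z
  have "stack (\<lambda>j. if j = 1 then vstar g \<mu> \<Phi> \<Psi> \<Omega> G s (block z) e else block z (j - 1)) = F z e" for e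
    unfolding vstar_eq F_def push_def ..
  then show "vstar_kernel g \<mu> \<Phi> \<Psi> \<Omega> G s D z = kernel z" unfolding vstar_kernel_def kernel_def by simp
qed

end

lemma push_sum: "(\<Sum>i\<in>I. push (f i) (h i)) = push (\<Sum>i\<in>I. f i) (\<Sum>i\<in>I. h i)"
  by (induction I rule: infinite_finite_induct) (simp_all add: push_add, simp_all add: vec_eq_iff push_component)

text \<open>Uniqueness of translation invariant measures, by computing
  \<open>\<integral>\<integral> 1\<^sub>A(x) 1\<^sub>B(x + y) d\<nu>(x) dy\<close> in both orders.\<close>

lemma translation_invariant_lborel:
  fixes \<nu> :: "'a::euclidean_space measure"
  assumes s: "sets \<nu> = sets borel" and sf: "sigma_finite_measure \<nu>"
    and inv: "\<And>t. distr \<nu> borel ((+) t) = \<nu>" and A: "A \<in> sets borel" and B: "B \<in> sets borel"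
  shows "emeasure \<nu> A * emeasure lborel B = emeasure \<nu> B * emeasure lborel A"
proof -
  interpret sigma_finite_measure \<nu> by (rule sf)
  interpret pair_sigma_finite \<nu> "lborel :: 'a measure" ..
  let ?f = "\<lambda>x y. indicator A x * indicator B (x + y) :: ennreal"
  let ?h = "\<lambda>x y. indicator A (x - y) * indicator B x :: ennreal"
  have sp: "sets (\<nu> \<Otimes>\<^sub>M lborel) = sets (borel \<Otimes>\<^sub>M (borel :: 'a measure))"
    by (rule sets_pair_measure_cong) (simp_all add: s)
  have [measurable]: "A \<in> sets borel" "B \<in> sets borel" by fact+
  have f: "(\<lambda>(x, y). ?f x y) \<in> borel_measurable (\<nu> \<Otimes>\<^sub>M lborel)"
    and h: "(\<lambda>(x, y). ?h x y) \<in> borel_measurable (\<nu> \<Otimes>\<^sub>M lborel)"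
    unfolding measurable_cong_sets[OF sp refl] by measurable
  have refl_lborel: "distr lborel borel (\<lambda>y. x - y) = lborel" for x :: 'a
    using lborel_affine[of "-1" x] by (simp add: density_1)
  have "(\<integral>\<^sup>+y. ?f x y \<partial>lborel) = indicator A x * emeasure lborel B" for x
  proof -
    have "(\<integral>\<^sup>+y. indicator B (x + y) \<partial>lborel) = (\<integral>\<^sup>+y. indicator B y \<partial>distr lborel borel ((+) x))"
      by (subst nn_integral_distr) simp_all
    then show ?thesis by (simp add: nn_integral_cmult lborel_distr_plus)
  qed
  then have 1: "(\<integral>\<^sup>+x. \<integral>\<^sup>+y. ?f x y \<partial>lborel \<partial>\<nu>) = emeasure \<nu> A * emeasure lborel B"
    using A s by (simp add: nn_integral_multc)
  have "(\<integral>\<^sup>+y. ?h x y \<partial>lborel) = emeasure lborel A * indicator B x" for x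
  proof -
    have "(\<integral>\<^sup>+y. indicator A (x - y) \<partial>lborel) = (\<integral>\<^sup>+y. indicator A y \<partial>distr lborel borel (\<lambda>y. x - y))"
      by (subst nn_integral_distr) simp_all
    then show ?thesis by (simp add: nn_integral_multc refl_lborel)
  qed
  then have 2: "(\<integral>\<^sup>+x. \<integral>\<^sup>+y. ?h x y \<partial>lborel \<partial>\<nu>) = emeasure lborel A * emeasure \<nu> B"
    using B s by (simp add: nn_integral_cmult)
  have "(\<integral>\<^sup>+x. ?f x y \<partial>\<nu>) = (\<integral>\<^sup>+x. ?h x y \<partial>\<nu>)" for y
  proof -
    have "(\<integral>\<^sup>+x. ?h x y \<partial>\<nu>) = (\<integral>\<^sup>+x. ?h x y \<partial>distr \<nu> borel ((+) y))" by (simp only: inv)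
    also have "\<dots> = (\<integral>\<^sup>+x. ?h (y + x) y \<partial>\<nu>)"
      by (rule nn_integral_distr) (simp_all add: measurable_cong_sets[OF s refl])
    finally show ?thesis by (simp add: add.commute)
  qed
  then have "(\<integral>\<^sup>+y. \<integral>\<^sup>+x. ?f x y \<partial>\<nu> \<partial>lborel) = (\<integral>\<^sup>+y. \<integral>\<^sup>+x. ?h x y \<partial>\<nu> \<partial>lborel)" by (simp only:)
  then show ?thesis using Fubini'[OF f] Fubini'[OF h] 1 2 by (simp add: mult.commute)
qed

text \<open>The image of Lebesgue measure under an invertible affine map is translation invariant,
  hence proportional to Lebesgue measure. The factor is estimated from one ball instead of a
  determinant: the preimage of the ball of radius \<open>b\<close> about \<open>m\<close> contains
  the unit ball.\<close>

lemma affine_image_minorization: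
  fixes M :: "real^'n^'n" and m :: "real^'n" and a b r dl :: real
  assumes lo: "\<And>x. a * norm x \<le> norm (M *v x)" and up: "op_bound M b" and a: "0 < a" "0 < b"
    and m: "norm m \<le> r" and dl: "0 < dl" "\<And>x. x \<in> cball 0 ((1 + r) / a) \<Longrightarrow> dl \<le> d x"
    and D: "D = density lborel (\<lambda>x. ennreal (d x))" "(\<lambda>x. ennreal (d x)) \<in> borel_measurable borel"
    and A: "A \<in> sets borel"
  shows "ennreal (dl * (measure lborel (cball (0::real^'n) 1) / b ^ CARD('n))) *
      emeasure (uniform_measure lborel (cball 0 1)) A \<le> emeasure (distr D borel (\<lambda>e. m + M *v e)) A"
proof -
  define \<Delta> where "\<Delta> = b ^ CARD('n)"
  have \<Delta>: "0 < \<Delta>" using a(2) by (simp add: \<Delta>_def)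
  let ?T = "\<lambda>e. m + M *v e"
  have contT: "continuous_on UNIV ?T" by (intro continuous_intros matrix_vector_mult_linear_continuous_on)
  then have T: "?T \<in> borel \<rightarrow>\<^sub>M borel" by (rule borel_measurable_continuous_onI)
  define A' where "A' = A \<inter> cball 0 1"
  have A': "A' \<in> sets borel" using A by (simp add: A'_def)
  define P where "P = ?T -` A'"
  have P: "P \<in> sets borel" using measurable_sets[OF T A'] by (simp add: P_def)
  \<comment> \<open>Innovations that land in the unit ball stay in a ball whose radius depends only
    on \<open>a\<close> and \<open>r\<close>; there the density is at least
    \<open>dl\<close>.\<close>
  have PK: "P \<subseteq> cball 0 ((1 + r) / a)"
  proof
    fix e assume "e \<in> P"
    then have "norm (m + M *v e) \<le> 1" by (auto simp: P_def A'_def)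
    then have "norm (M *v e) \<le> 1 + r" using norm_triangle_ineq4[of "m + M *v e" m] m by simp
    then have "a * norm e \<le> 1 + r" using lo[of e] by linarith
    then show "e \<in> cball 0 ((1 + r) / a)" using a by (simp add: field_simps)
  qed
  have bP: "bounded P" using PK bounded_cball bounded_subset by blast
  have inj: "inj ((*v) M)"
  proof (rule linear_injective_0[OF matrix_vector_mul_linear, THEN iffD2], intro allI impI)
    fix x assume "M *v x = 0"
    then have "a * norm x \<le> 0" using lo[of x] by simp
    then show "x = 0" using a by (simp add: mult_le_0_iff)
  qed
  have surj: "surj ((*v) M)" by (rule linear_injective_imp_surjective[OF matrix_vector_mul_linear inj]) simp
  let ?\<nu> = "distr lborel borel ?T"
  have T': "?T \<in> lborel \<rightarrow>\<^sub>M borel" using T by simp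
  have em: "emeasure ?\<nu> X = emeasure lborel (?T -` X)" if "X \<in> sets borel" for X
    using that T by (simp add: emeasure_distr)
  have bT: "bounded (?T -` cball 0 R)" for R
  proof (rule boundedI)
    fix e assume "e \<in> ?T -` cball 0 R"
    then have "norm (m + M *v e) \<le> R" by simp
    then have "norm (M *v e) \<le> R + norm m" using norm_triangle_ineq4[of "m + M *v e" m] by simp
    then have "a * norm e \<le> R + norm m" using lo[of e] by linarith
    then show "norm e \<le> (R + norm m) / a" using a by (simp add: field_simps)
  qed
  have "sigma_finite_measure ?\<nu>"
  proof
    show "\<exists>Y. countable Y \<and> Y \<subseteq> sets ?\<nu> \<and> \<Union>Y = space ?\<nu> \<and> (\<forall>y\<in>Y. emeasure ?\<nu> y \<noteq> \<infinity>)"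
    proof (intro exI[of _ "range (\<lambda>k::nat. cball 0 (real k))"] conjI ballI)
      show "\<Union>(range (\<lambda>k::nat. cball 0 (real k))) = space ?\<nu>"
        using real_arch_simple by (auto simp: set_eq_iff)
      show "emeasure ?\<nu> y \<noteq> \<infinity>" if y: "y \<in> range (\<lambda>k::nat. cball 0 (real k))" for y
      proof -
        obtain k where k: "y = cball 0 (real k)" using y by blast
        have "emeasure ?\<nu> y = emeasure lborel (?T -` cball 0 (real k))" unfolding k by (rule em) simp
        also have "\<dots> < \<infinity>" by (rule emeasure_bounded_finite[OF bT])
        finally show ?thesis by simp
      qed
    qed auto
  qed
  moreover have "distr ?\<nu> borel ((+) t) = ?\<nu>" for t
  proof -
    \<comment> \<open>Translating the image by \<open>M u\<close> amounts to translating the source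
      by \<open>u\<close>, which Lebesgue measure ignores.\<close>
    obtain u where u: "t = M *v u" using surj by (auto simp: surj_def)
    have "distr ?\<nu> borel ((+) t) = distr lborel borel (\<lambda>e. ?T (u + e))"
      using T by (subst distr_distr) (simp_all add: o_def u matrix_vector_right_distrib algebra_simps)
    also have "\<dots> = distr (distr lborel borel ((+) u)) borel ?T"
      using T by (subst distr_distr) (simp_all add: o_def)
    finally show ?thesis by (simp add: lborel_distr_plus)
  qed
  ultimately have uniq: "emeasure ?\<nu> A' * emeasure lborel (cball m b) = emeasure ?\<nu> (cball m b) * emeasure lborel A'"
    using A' by (intro translation_invariant_lborel) auto
  have finP: "emeasure lborel P < \<infinity>" by (rule emeasure_bounded_finite[OF bP])
  have finA: "emeasure lborel A' < \<infinity>"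
    by (rule emeasure_bounded_finite) (auto simp: A'_def intro: bounded_subset[OF bounded_cball])
  have ball: "0 < measure lborel (cball (0::real^'n) 1)" "emeasure lborel (cball (0::real^'n) 1) < \<infinity>"
    using content_cball_pos[of 1 "0::real^'n"] emeasure_bounded_finite[OF bounded_cball] by auto
  have balls: "measure lborel (cball m b) = \<Delta> * measure lborel (cball (0::real^'n) 1)"
    using a(2) by (simp add: content_cball \<Delta>_def)
  have leb: "measure lborel A' \<le> \<Delta> * measure lborel P"
  proof -
    have "cball 0 1 \<subseteq> ?T -` cball m b"
    proof
      fix e :: "real^'n" assume "e \<in> cball 0 1"
      then have "norm (M *v e) \<le> b * 1" using up a(2) unfolding op_bound_def
        by (meson mem_cball_0 mult_left_mono order_trans less_imp_le)
      then show "e \<in> ?T -` cball m b" by (simp add: dist_norm)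
    qed
    then have "emeasure lborel (cball (0::real^'n) 1) \<le> emeasure ?\<nu> (cball m b)"
      using measurable_sets[OF T, of "cball m b"] by (subst em) (auto intro!: emeasure_mono)
    then have "emeasure lborel (cball (0::real^'n) 1) * emeasure lborel A' \<le> emeasure lborel P * emeasure lborel (cball m b)"
      using uniq A' by (simp add: em P_def[symmetric] mult_right_mono)
    then have "ennreal (measure lborel (cball (0::real^'n) 1) * measure lborel A') \<le>
        ennreal (measure lborel P * (\<Delta> * measure lborel (cball (0::real^'n) 1)))"
    proof -
      have fin: "emeasure lborel X = ennreal (measure lborel X)" if "emeasure lborel X < \<infinity>" for X :: "(real^'n) set"
        using that by (intro emeasure_eq_ennreal_measure) simp
      assume "emeasure lborel (cball (0::real^'n) 1) * emeasure lborel A' \<le> emeasure lborel P * emeasure lborel (cball m b)"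
      then show ?thesis
        unfolding fin[OF finP] fin[OF finA] fin[OF ball(2)] fin[OF emeasure_bounded_finite[OF bounded_cball, of m b]] balls
        by (simp only: ennreal_mult'[symmetric] measure_nonneg)
    qed
    then show ?thesis using ball(1) \<Delta> by (subst (asm) ennreal_le_iff) (auto simp: mult_ac)
  qed
  have "emeasure (uniform_measure lborel (cball 0 1)) A = emeasure lborel A' / emeasure lborel (cball (0::real^'n) 1)"
    using A by (simp add: A'_def Int_commute)
  also have "\<dots> = ennreal (measure lborel A' / measure lborel (cball (0::real^'n) 1))"
    using finA ball by (simp add: emeasure_eq_ennreal_measure divide_ennreal less_top)
  finally have um: "emeasure (uniform_measure lborel (cball 0 1)) A = ennreal (measure lborel A' / measure lborel (cball (0::real^'n) 1))" .
  have "0 \<le> dl * (measure lborel (cball (0::real^'n) 1) / \<Delta>)" using dl(1) \<Delta> by simp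
  from ennreal_mult'[OF this, of "measure lborel A' / measure lborel (cball (0::real^'n) 1)"]
  have "ennreal (dl * (measure lborel (cball (0::real^'n) 1) / \<Delta>)) * emeasure (uniform_measure lborel (cball 0 1)) A =
      ennreal (dl * (measure lborel (cball (0::real^'n) 1) / \<Delta>) * (measure lborel A' / measure lborel (cball (0::real^'n) 1)))"
    unfolding um by (rule sym)
  also have "\<dots> \<le> ennreal (dl * measure lborel P)"
    using leb dl(1) \<Delta> ball(1) by (intro ennreal_leI) (simp add: field_simps)
  also have "\<dots> = (\<integral>\<^sup>+x. ennreal dl * indicator P x \<partial>lborel)"
    using P finP dl(1) by (simp add: nn_integral_cmult_indicator ennreal_mult' emeasure_eq_ennreal_measure less_top)
  also have "\<dots> \<le> (\<integral>\<^sup>+x. ennreal (d x) * indicator P x \<partial>lborel)"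
    using dl(2) PK by (intro nn_integral_mono) (auto simp: indicator_def intro!: ennreal_leI)
  also have "\<dots> = emeasure D P" unfolding D(1) using D(2) P by (simp add: emeasure_density)
  also have "\<dots> \<le> emeasure D (?T -` A)"
    using measurable_sets[OF T A] by (intro emeasure_mono) (auto simp: P_def A'_def D(1))
  also have "\<dots> = emeasure (distr D borel ?T) A"
    using A T by (subst emeasure_distr) (simp_all add: D(1))
  finally show ?thesis unfolding \<Delta>_def .
qed

section \<open>Drift and minorization for the model\<close>

context vstar_model
begin

definition B0 :: "real^('p \<times> 'n)^('p \<times> 'n)" where "B0 = companion \<Phi>"

definition Bi :: "nat \<Rightarrow> real^('p \<times> 'n)^('p \<times> 'n)" where "Bi i = companion (\<lambda>j. \<Phi> j + \<Psi> i j)"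

text \<open>Since the weights sum to one, \<Phi> can be distributed over all regimes, so that regime
  \<open>i\<close> receives the companion matrix of \<open>\<Phi> + \<Psi> i\<close>. Intercepts and
  noise enter through the first block alone.\<close>

lemma F_decomp: "F z e = (w0 z *\<^sub>R (B0 *v z) + (\<Sum>i=1..g. w i z *\<^sub>R (Bi i *v z))) +
    push 0 (\<mu> 0 + (\<Sum>i=1..g. w i z *\<^sub>R \<mu> i) + matrix_sqrt (cov z) *v e)"
proof -
  let ?base = "\<Sum>j=1..CARD('p). \<Phi> j *v block z j" and ?x = "\<lambda>i. \<Sum>j=1..CARD('p). \<Psi> i j *v block z j"
  have Bi: "Bi i *v z = push z (?base + ?x i)" for i
    unfolding Bi_def companion_mult by (simp add: matrix_vector_mult_add_rdistrib sum.distrib)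
  have "w0 z *\<^sub>R (B0 *v z) + (\<Sum>i=1..g. w i z *\<^sub>R (Bi i *v z)) =
      push (w0 z *\<^sub>R z + (\<Sum>i=1..g. w i z *\<^sub>R z)) (w0 z *\<^sub>R ?base + (\<Sum>i=1..g. w i z *\<^sub>R (?base + ?x i)))"
    unfolding Bi B0_def companion_mult push_scaleR[symmetric] push_sum push_add ..
  also have "w0 z *\<^sub>R z + (\<Sum>i=1..g. w i z *\<^sub>R z) = z"
    using w_sum[of z] by (simp only: scaleR_sum_left[symmetric] scaleR_add_left[symmetric]) simp
  also have "w0 z *\<^sub>R ?base + (\<Sum>i=1..g. w i z *\<^sub>R (?base + ?x i)) = (w0 z + (\<Sum>i=1..g. w i z)) *\<^sub>R ?base + (\<Sum>i=1..g. w i z *\<^sub>R ?x i)"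
    by (simp only: scaleR_add_left scaleR_add_right sum.distrib scaleR_sum_left add.assoc)
  finally have lin: "w0 z *\<^sub>R (B0 *v z) + (\<Sum>i=1..g. w i z *\<^sub>R (Bi i *v z)) = push z (?base + (\<Sum>i=1..g. w i z *\<^sub>R ?x i))"
    unfolding w_sum scaleR_one .
  have "F z e = push (z + 0) ((?base + (\<Sum>i=1..g. w i z *\<^sub>R ?x i)) + (\<mu> 0 + (\<Sum>i=1..g. w i z *\<^sub>R \<mu> i) + matrix_sqrt (cov z) *v e))"
    unfolding F_def mean_def by (simp add: scaleR_add_right sum.distrib algebra_simps)
  then show ?thesis unfolding lin push_add .
qed

lemma lyapunov:
  obtains V :: "real^('p \<times> 'n) \<Rightarrow> real" and lam b c :: real where
    "V \<in> borel_measurable borel" "0 < lam" "lam < 1" "0 \<le> b"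
    "\<And>x. (norm x)\<^sup>2 \<le> V x" "\<And>x. V x \<le> c * (norm x)\<^sup>2"
    "\<And>x. (\<integral>\<^sup>+y. ennreal (V y) \<partial>kernel x) \<le> ennreal (lam * V x + b)"
proof -
  let ?\<A> = "(\<lambda>i. companion (\<lambda>j. \<Phi> j + \<Psi> i j)) ` {1..g} \<union> {companion \<Phi>} :: (real^('p \<times> 'n)^('p \<times> 'n)) set"
  have fin: "finite ?\<A>" by simp
  obtain nrm :: "real^('p \<times> 'n) \<Rightarrow> real" and lam C where lam: "0 < lam" "lam < 1" and C: "0 < C"
    and nrm: "\<And>x. norm x \<le> nrm x" "\<And>x. nrm x \<le> C * norm x" "\<And>x y. nrm (x + y) \<le> nrm x + nrm y"
      "\<And>c x. 0 \<le> c \<Longrightarrow> nrm (c *\<^sub>R x) \<le> c * nrm x" "\<And>B x. B \<in> ?\<A> \<Longrightarrow> nrm (B *v x) \<le> lam * nrm x"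
    by (rule adapted_norm[OF fin jsr], rule that, assumption+)
  have nrm0: "0 \<le> nrm x" for x using nrm(1)[of x] norm_ge_zero[of x] by linarith
  have nsum: "nrm (\<Sum>i\<in>I. f i) \<le> (\<Sum>i\<in>I. nrm (f i))" if "finite I" for I :: "nat set" and f
    using that
  proof (induction I rule: finite_induct)
    case empty
    then show ?case using nrm(2)[of 0] by simp
  next
    case (insert i I)
    then show ?case using nrm(3)[of "f i" "sum f I"] by simp
  qed
  have "C-lipschitz_on UNIV nrm"
  proof (rule lipschitz_onI)
    fix x y
    have "nrm x \<le> nrm (x - y) + nrm y" "nrm y \<le> nrm (y - x) + nrm x"
      using nrm(3)[of "x - y" y] nrm(3)[of "y - x" x] by simp_all
    then show "dist (nrm x) (nrm y) \<le> C * dist x y"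
      using nrm(2)[of "x - y"] nrm(2)[of "y - x"] by (simp add: dist_norm norm_minus_commute abs_le_iff)
  qed (use C in simp)
  then have nm[measurable]: "nrm \<in> borel_measurable borel"
    by (intro borel_measurable_continuous_onI lipschitz_on_continuous_on)
  obtain L where L: "L > 0" "\<And>(z::real^('p \<times> 'n)) u. norm (push z u) \<le> L * (norm z + norm u)"
    using push_bounded by blast
  obtain a0 b0 where ab: "0 < a0" "\<And>z. transpose (cov z) = cov z" "\<And>z x. a0 * (norm x)\<^sup>2 \<le> x \<bullet> (cov z *v x)"
    "\<And>z. op_bound (cov z) b0" using cov_bounds by blast
  define m0 where "m0 = norm (\<mu> 0) + (\<Sum>i=1..g. norm (\<mu> i))"
  have m0: "0 \<le> m0" by (simp add: m0_def sum_nonneg)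
  have b0: "0 < b0" by (rule op_bound_contraction(2)[OF ab(3) ab(4) ab(1)])
  define c0 c1 where "c0 = C * L * m0" and "c1 = C * L * sqrt b0"
  have c01: "0 \<le> c0" "0 \<le> c1" using C L m0 b0 by (simp_all add: c0_def c1_def)
  have step: "nrm (F z e) \<le> lam * nrm z + (c0 + c1 * norm e)" for z e
  proof -
    let ?lin = "w0 z *\<^sub>R (B0 *v z) + (\<Sum>i=1..g. w i z *\<^sub>R (Bi i *v z))"
    let ?rest = "\<mu> 0 + (\<Sum>i=1..g. w i z *\<^sub>R \<mu> i) + matrix_sqrt (cov z) *v e"
    have "nrm ?lin \<le> nrm (w0 z *\<^sub>R (B0 *v z)) + nrm (\<Sum>i=1..g. w i z *\<^sub>R (Bi i *v z))" by (rule nrm(3))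
    also have "\<dots> \<le> nrm (w0 z *\<^sub>R (B0 *v z)) + (\<Sum>i=1..g. nrm (w i z *\<^sub>R (Bi i *v z)))"
      by (intro add_left_mono nsum) simp
    also have "\<dots> \<le> w0 z * (lam * nrm z) + (\<Sum>i=1..g. w i z * (lam * nrm z))"
    proof (intro add_mono sum_mono)
      have "nrm (w0 z *\<^sub>R (B0 *v z)) \<le> w0 z * nrm (B0 *v z)" by (rule nrm(4)[OF w0_nonneg])
      also have "\<dots> \<le> w0 z * (lam * nrm z)" by (intro mult_left_mono nrm(5) w0_nonneg) (simp add: B0_def)
      finally show "nrm (w0 z *\<^sub>R (B0 *v z)) \<le> w0 z * (lam * nrm z)" .
      fix i assume i: "i \<in> {1..g}"
      have "nrm (w i z *\<^sub>R (Bi i *v z)) \<le> w i z * nrm (Bi i *v z)" by (rule nrm(4)[OF w_nonneg[OF i]])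
      also have "\<dots> \<le> w i z * (lam * nrm z)" using i by (intro mult_left_mono nrm(5) w_nonneg) (auto simp: Bi_def)
      finally show "nrm (w i z *\<^sub>R (Bi i *v z)) \<le> w i z * (lam * nrm z)" .
    qed
    also have "\<dots> = (w0 z + (\<Sum>i=1..g. w i z)) * (lam * nrm z)" by (simp only: distrib_right sum_distrib_right)
    finally have 1: "nrm ?lin \<le> lam * nrm z" unfolding w_sum by simp
    have "norm (\<Sum>i=1..g. w i z *\<^sub>R \<mu> i) \<le> (\<Sum>i=1..g. norm (\<mu> i))"
      using w_nonneg w_le_1 by (intro order_trans[OF norm_sum] sum_mono) (simp add: mult_left_le_one_le)
    moreover have "norm (matrix_sqrt (cov z) *v e) \<le> sqrt b0 * norm e"
      by (rule matrix_sqrt_bounds(2)[OF ab(2-4) ab(1)])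
    ultimately have "norm ?rest \<le> m0 + sqrt b0 * norm e"
      using norm_triangle_ineq[of "\<mu> 0 + (\<Sum>i=1..g. w i z *\<^sub>R \<mu> i)" "matrix_sqrt (cov z) *v e"]
        norm_triangle_ineq[of "\<mu> 0" "\<Sum>i=1..g. w i z *\<^sub>R \<mu> i"] unfolding m0_def by linarith
    then have "C * (L * (norm (0::real^('p \<times> 'n)) + norm ?rest)) \<le> C * (L * (m0 + sqrt b0 * norm e))"
      using C L by simp
    moreover have "nrm (push 0 ?rest) \<le> C * (L * (norm (0::real^('p \<times> 'n)) + norm ?rest))"
      using nrm(2)[of "push 0 ?rest"] mult_left_mono[OF L(2)[of 0 ?rest], of C] C by linarith
    ultimately have 2: "nrm (push 0 ?rest) \<le> c0 + c1 * norm e" by (simp add: c0_def c1_def algebra_simps)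
    show ?thesis unfolding F_decomp using nrm(3)[of ?lin "push 0 ?rest"] 1 2 by linarith
  qed
  \<comment> \<open>Collects everything in the squared norm that does not involve the state. Its
    mean is finite by the second moment and becomes the drift constant.\<close>
  define q where "q e = (2 * c0\<^sup>2 + 2 * c1\<^sup>2 * (norm e)\<^sup>2) / (1 - lam)" for e :: "real^'n"
  have q0: "0 \<le> q e" for e using lam by (simp add: q_def)
  have qi: "integrable D q" unfolding q_def using second_moment by (intro integrable_divide Bochner_Integration.integrable_add) auto
  define b where "b = (\<integral>e. q e \<partial>D)"
  have b: "0 \<le> b" unfolding b_def using q0 by (intro Bochner_Integration.integral_nonneg) auto
  have sq: "(nrm (F z e))\<^sup>2 \<le> lam * (nrm z)\<^sup>2 + q e" for z e
  proof -
    define y where "y = c0 + c1 * norm e"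
    have y: "0 \<le> y" using c01 by (simp add: y_def)
    have "(nrm (F z e))\<^sup>2 \<le> (lam * nrm z + y)\<^sup>2"
      using step[of z e] nrm0[of "F z e"] by (intro power_mono) (simp_all add: y_def)
    also have "\<dots> \<le> lam * (nrm z)\<^sup>2 + y\<^sup>2 / (1 - lam)"
    proof -
      \<comment> \<open>Convexity of the square with weights \<open>lam\<close> and
        \<open>1 - lam\<close>, applied to \<open>nrm z\<close> and \<open>y / (1 - lam)\<close>.
        The factor \<open>lam\<close> is kept and the bound holds for each \<open>e\<close> before
        integration.\<close>
      have "0 \<le> lam * ((1 - lam) * nrm z - y)\<^sup>2" using lam by simp
      then have "(lam * nrm z + y)\<^sup>2 * (1 - lam) \<le> (lam * (nrm z)\<^sup>2) * (1 - lam) + y\<^sup>2"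
        by (simp add: power2_eq_square algebra_simps)
      then have "(lam * nrm z + y)\<^sup>2 \<le> ((lam * (nrm z)\<^sup>2) * (1 - lam) + y\<^sup>2) / (1 - lam)"
        using lam by (simp add: pos_le_divide_eq)
      then show ?thesis using lam by (simp add: add_divide_distrib)
    qed
    also have "y\<^sup>2 / (1 - lam) \<le> q e"
      unfolding q_def
    proof (rule divide_right_mono)
      have "0 \<le> (c0 - c1 * norm e)\<^sup>2" by simp
      then show "y\<^sup>2 \<le> 2 * c0\<^sup>2 + 2 * c1\<^sup>2 * (norm e)\<^sup>2"
        unfolding y_def by (simp add: power2_eq_square algebra_simps)
    qed (use lam in simp)
    finally show ?thesis by simp
  qed
  show ?thesis
  proof (rule that[of "\<lambda>x. (nrm x)\<^sup>2" lam b "C\<^sup>2"])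
    show "(\<lambda>x. (nrm x)\<^sup>2) \<in> borel_measurable borel" by measurable
    show "(norm x)\<^sup>2 \<le> (nrm x)\<^sup>2" for x using nrm(1)[of x] by (intro power_mono) auto
    show "(nrm x)\<^sup>2 \<le> C\<^sup>2 * (norm x)\<^sup>2" for x
      using power_mono[OF nrm(2)[of x] nrm0, of 2] by (simp add: power_mult_distrib)
    fix x
    have F1: "F x \<in> D \<rightarrow>\<^sub>M borel"
      using measurable_compose[OF measurable_Pair1'[of x borel D] F_D] by simp
    have "(\<integral>\<^sup>+y. ennreal ((nrm y)\<^sup>2) \<partial>kernel x) = (\<integral>\<^sup>+e. ennreal ((nrm (F x e))\<^sup>2) \<partial>D)"
      unfolding kernel_def by (rule nn_integral_distr[OF F1]) simp
    also have "\<dots> \<le> (\<integral>\<^sup>+e. ennreal (lam * (nrm x)\<^sup>2 + q e) \<partial>D)"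
      by (intro nn_integral_mono ennreal_leI sq)
    also have "\<dots> = ennreal (\<integral>e. lam * (nrm x)\<^sup>2 + q e \<partial>D)"
      using qi q0 lam by (intro nn_integral_eq_integral) auto
    also have "(\<integral>e. lam * (nrm x)\<^sup>2 + q e \<partial>D) = lam * (nrm x)\<^sup>2 + b"
      using qi by (simp add: prob_space.prob_space[OF prob_D] b_def)
    finally show "(\<integral>\<^sup>+y. ennreal ((nrm y)\<^sup>2) \<partial>kernel x) \<le> ennreal (lam * (nrm x)\<^sup>2 + b)" .
  qed (use lam b in auto)
qed

definition UM :: "(real^'n) measure" where "UM = uniform_measure lborel (cball 0 1)"

text \<open>The comparison chain: the new block is uniform on the unit ball whatever the state is,
  so that the start is remembered only through the blocks not yet pushed out.\<close>

definition Q :: "real^('p \<times> 'n) \<Rightarrow> (real^('p \<times> 'n)) measure" where "Q z = distr UM borel (push z)"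

lemma ball_lborel: "emeasure lborel (cball (0::real^'n) 1) \<noteq> 0" "emeasure lborel (cball (0::real^'n) 1) \<noteq> \<infinity>"
  using content_cball_pos[of 1 "0::real^'n"] emeasure_bounded_finite[OF bounded_cball, of "0::real^'n" 1]
  by (auto simp: measure_def)

lemma prob_UM: "prob_space UM"
  unfolding UM_def using ball_lborel by (rule prob_space_uniform_measure)

lemma sets_UM: "sets UM = sets borel"
  by (simp add: UM_def)

lemma measurable_push: "push z \<in> UM \<rightarrow>\<^sub>M borel"
  using measurable_compose[OF measurable_Pair1'[of z borel borel] measurable_push_pair]
  by (simp add: measurable_cong_sets[OF sets_UM refl])

lemma measurable_Q: "Q \<in> borel \<rightarrow>\<^sub>M prob_algebra borel"
proof -
  have "UM \<in> space (prob_algebra UM)" by (simp add: space_prob_algebra prob_UM)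
  then have "(\<lambda>_. UM) \<in> borel \<rightarrow>\<^sub>M prob_algebra UM" by simp
  moreover have "(\<lambda>(z, u). push z u) \<in> borel \<Otimes>\<^sub>M UM \<rightarrow>\<^sub>M borel"
    using measurable_push_pair by (simp add: measurable_cong_sets[OF sets_pair_measure_cong[OF refl sets_UM] refl])
  ultimately show ?thesis unfolding Q_def[abs_def] by (rule measurable_distr_prob_space2)
qed

interpretation Q: markov borel Q
  by unfold_locales (simp add: markov_kernel_def measurable_Q)

lemma nn_integral_Q: "f \<in> borel_measurable borel \<Longrightarrow> (\<integral>\<^sup>+y. f y \<partial>Q z) = (\<integral>\<^sup>+u. f (push z u) \<partial>UM)"
  unfolding Q_def by (rule nn_integral_distr[OF measurable_push]) simp

lemma one_step_minorization:
  "\<exists>c. 0 < c \<and> c \<le> 1 \<and> (\<forall>z. norm z \<le> R \<longrightarrow> (\<forall>f\<in>borel_measurable borel.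
      ennreal c * (\<integral>\<^sup>+y. f y \<partial>Q z) \<le> (\<integral>\<^sup>+y. f y \<partial>kernel z)))"
proof -
  obtain a b where ab: "0 < a" "\<And>z. transpose (cov z) = cov z" "\<And>z x. a * (norm x)\<^sup>2 \<le> x \<bullet> (cov z *v x)"
    "\<And>z. op_bound (cov z) b" using cov_bounds by blast
  have b: "0 < b" by (rule op_bound_contraction(2)[OF ab(3) ab(4) ab(1)])
  \<comment> \<open>A continuous function that dominates the norm of \<open>mean\<close>. The mean
    itself need not be continuous, as the weights depend on the Borel function
    \<open>s\<close>.\<close>
  define bd where "bd z = norm (\<mu> 0) + (\<Sum>j=1..CARD('p). norm (\<Phi> j *v block z j)) +
      (\<Sum>i=1..g. norm (\<mu> i + (\<Sum>j=1..CARD('p). \<Psi> i j *v block z j)))" for z :: "real^('p \<times> 'n)"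
  have cb: "continuous_on UNIV (\<lambda>z::real^('p \<times> 'n). A *v block z j)" for A :: "real^'n^'n" and j
    by (rule linear_continuous_on_compose[OF continuous_on_block matrix_vector_mul_linear])
  have "continuous_on UNIV bd" unfolding bd_def[abs_def]
    by (intro continuous_on_add continuous_on_sum continuous_on_norm continuous_on_const cb)
  then have "continuous_on (cball 0 R) bd" by (rule continuous_on_subset) simp
  then have "bounded (bd ` cball 0 R)"
    by (intro compact_imp_bounded compact_continuous_image compact_cball)
  then obtain r0 where r0': "\<And>x. x \<in> bd ` cball 0 R \<Longrightarrow> norm x \<le> r0" unfolding bounded_iff by blast
  have r0: "bd z \<le> r0" if "norm z \<le> R" for z
    using r0'[of "bd z"] that abs_ge_self[of "bd z"] by simp
  define r where "r = max r0 0"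
  have mean: "norm (mean z) \<le> r" if "norm z \<le> R" for z
  proof -
    have "norm (mean z) \<le> norm (\<mu> 0) + norm (\<Sum>j=1..CARD('p). \<Phi> j *v block z j) +
        norm (\<Sum>i=1..g. w i z *\<^sub>R (\<mu> i + (\<Sum>j=1..CARD('p). \<Psi> i j *v block z j)))"
      unfolding mean_def by (intro norm_triangle_le add_right_mono norm_triangle_ineq)
    also have "\<dots> \<le> bd z"
      unfolding bd_def
    proof (intro add_mono order_refl norm_sum)
      show "norm (\<Sum>i=1..g. w i z *\<^sub>R (\<mu> i + (\<Sum>j=1..CARD('p). \<Psi> i j *v block z j)))
          \<le> (\<Sum>i=1..g. norm (\<mu> i + (\<Sum>j=1..CARD('p). \<Psi> i j *v block z j)))"
        using w_nonneg w_le_1 by (intro order_trans[OF norm_sum] sum_mono) (simp add: mult_left_le_one_le)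
    qed
    finally show ?thesis using r0[OF that] by (simp add: r_def)
  qed
  obtain dl where dl: "dl > 0" "\<And>x. x \<in> cball 0 ((1 + r) / sqrt a) \<Longrightarrow> dl \<le> d x"
    using d_low[OF compact_cball] by blast
  \<comment> \<open>The constant of \<open>affine_image_minorization\<close>; the matrix root of the
    covariance has operator norm at most \<open>sqrt b\<close>.\<close>
  define c where "c = dl * (measure lborel (cball (0::real^'n) 1) / sqrt b ^ CARD('n))"
  have c: "0 < c" using dl(1) b content_cball_pos[of 1 "0::real^'n"] by (simp add: c_def)
  have main: "ennreal (min 1 c) * (\<integral>\<^sup>+y. f y \<partial>Q z) \<le> (\<integral>\<^sup>+y. f y \<partial>kernel z)"
    if z: "norm z \<le> R" and f: "f \<in> borel_measurable borel" for z f
  proof -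
    let ?T = "\<lambda>e. mean z + matrix_sqrt (cov z) *v e"
    let ?m = "distr D borel ?T"
    have T: "?T \<in> D \<rightarrow>\<^sub>M borel"
      by (simp add: measurable_cong_sets[OF sets_D refl] borel_measurable_continuous_onI continuous_intros
          matrix_vector_mult_linear_continuous_on)
    have m: "ennreal (min 1 c) * emeasure UM A \<le> emeasure ?m A" if A: "A \<in> sets ?m" for A
    proof -
      have "ennreal (min 1 c) * emeasure UM A \<le> ennreal c * emeasure UM A"
        by (intro mult_right_mono ennreal_leI) auto
      also have "\<dots> \<le> emeasure ?m A"
        unfolding c_def UM_def
      proof (rule affine_image_minorization)
        show "sqrt a * norm x \<le> norm (matrix_sqrt (cov z) *v x)" for x
          by (rule matrix_sqrt_bounds(1)[OF ab(2-4) ab(1)])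
        show "op_bound (matrix_sqrt (cov z)) (sqrt b)"
          unfolding op_bound_def using matrix_sqrt_bounds(2)[OF ab(2-4) ab(1)] by blast
        show "0 < sqrt a" "0 < sqrt b" using ab(1) b by simp_all
        show "norm (mean z) \<le> r" by (rule mean[OF z])
        show "A \<in> sets borel" using A by simp
      qed (use dl dens in auto)
      finally show ?thesis .
    qed
    have fp: "(\<lambda>u. f (push z u)) \<in> borel_measurable ?m"
      using measurable_compose[OF measurable_push f] by (simp add: measurable_cong_sets[OF sets_UM refl])
    have "ennreal (min 1 c) * (\<integral>\<^sup>+u. f (push z u) \<partial>UM) \<le> (\<integral>\<^sup>+u. f (push z u) \<partial>?m)"
      by (rule nn_integral_minorization[OF _ m fp]) (simp add: sets_UM)
    also have "\<dots> = (\<integral>\<^sup>+e. f (push z (?T e)) \<partial>D)"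
      using fp by (intro nn_integral_distr[OF T]) simp
    also have "\<dots> = (\<integral>\<^sup>+y. f y \<partial>kernel z)"
      unfolding kernel_def using f measurable_compose[OF measurable_Pair1'[of z borel D] F_D]
      by (subst nn_integral_distr) (simp_all add: F_def)
    finally show ?thesis unfolding nn_integral_Q[OF f] .
  qed
  show ?thesis by (rule exI[of _ "min 1 c"]) (use c main in auto)
qed

text \<open>The radius must vary in the induction: one step of \<open>Q\<close> from radius
  \<open>R\<close> leads to radius \<open>L * (R + 1)\<close>, because the inserted block lies in
  the unit ball. The constants of the single steps multiply.\<close>

lemma multi_step_minorization:
  "\<exists>c. 0 < c \<and> c \<le> 1 \<and> (\<forall>z. norm z \<le> R \<longrightarrow> (\<forall>f\<in>borel_measurable borel.
      ennreal c * (\<integral>\<^sup>+y. f y \<partial>kernel_pow borel Q k z) \<le> (\<integral>\<^sup>+y. f y \<partial>kernel_pow borel kernel k z)))"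
proof (induction k arbitrary: R)
  case 0
  show ?case by (rule exI[of _ 1]) simp
next
  case (Suc k)
  obtain L where L: "L > 0" "\<And>(z::real^('p \<times> 'n)) u. norm (push z u) \<le> L * (norm z + norm u)"
    using push_bounded by blast
  obtain c1 where c1: "0 < c1" "c1 \<le> 1" "\<And>z f. norm z \<le> R \<Longrightarrow> f \<in> borel_measurable borel \<Longrightarrow>
      ennreal c1 * (\<integral>\<^sup>+y. f y \<partial>Q z) \<le> (\<integral>\<^sup>+y. f y \<partial>kernel z)"
    using one_step_minorization[of R] by blast
  obtain c2 where c2: "0 < c2" "c2 \<le> 1" "\<And>z f. norm z \<le> L * (R + 1) \<Longrightarrow> f \<in> borel_measurable borel \<Longrightarrow>
      ennreal c2 * (\<integral>\<^sup>+y. f y \<partial>kernel_pow borel Q k z) \<le> (\<integral>\<^sup>+y. f y \<partial>kernel_pow borel kernel k z)"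
    using Suc[of "L * (R + 1)"] by blast
  have "ennreal (c1 * c2) * (\<integral>\<^sup>+y. f y \<partial>kernel_pow borel Q (Suc k) z) \<le> (\<integral>\<^sup>+y. f y \<partial>kernel_pow borel kernel (Suc k) z)"
    if z: "norm z \<le> R" and f: "f \<in> borel_measurable borel" for z f
  proof -
    let ?q = "\<lambda>y. \<integral>\<^sup>+x. f x \<partial>kernel_pow borel Q k y" and ?k = "\<lambda>y. \<integral>\<^sup>+x. f x \<partial>kernel_pow borel kernel k y"
    have mq: "?q \<in> borel_measurable borel" by (rule measurable_nn_integral_kernel[OF Q.kernel_pow_measurable f])
    have mk: "?k \<in> borel_measurable borel" by (rule measurable_nn_integral_kernel[OF kernel_pow_measurable f])
    have "(\<integral>\<^sup>+y. f y \<partial>kernel_pow borel Q (Suc k) z) = (\<integral>\<^sup>+y. ?q y \<partial>Q z)"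
      using Q.nn_integral_kernel_pow_add[of z f "Suc 0" k] Q.kernel_pow_1[of z] f by (simp del: kernel_pow.simps)
    then have "ennreal (c1 * c2) * (\<integral>\<^sup>+y. f y \<partial>kernel_pow borel Q (Suc k) z) = ennreal c1 * (\<integral>\<^sup>+u. ennreal c2 * ?q (push z u) \<partial>UM)"
      using c1(1) c2(1) measurable_compose[OF measurable_push mq]
      by (simp add: nn_integral_Q[OF mq] ennreal_mult nn_integral_cmult mult.assoc del: kernel_pow.simps)
    also have "\<dots> \<le> ennreal c1 * (\<integral>\<^sup>+u. ?k (push z u) \<partial>UM)"
    proof (intro mult_left_mono nn_integral_mono_AE zero_le)
      have "AE u in UM. u \<in> cball 0 1" unfolding UM_def by (rule AE_uniform_measureI) auto
      then show "AE u in UM. ennreal c2 * ?q (push z u) \<le> ?k (push z u)"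
      proof (rule eventually_mono)
        fix u :: "real^'n" assume "u \<in> cball 0 1"
        then have "L * (norm z + norm u) \<le> L * (R + 1)" using z L(1) by (intro mult_left_mono add_mono) auto
        then have "norm (push z u) \<le> L * (R + 1)" using L(2)[of z u] by linarith
        then show "ennreal c2 * ?q (push z u) \<le> ?k (push z u)" using c2(3) f by blast
      qed
    qed
    also have "\<dots> = ennreal c1 * (\<integral>\<^sup>+y. ?k y \<partial>Q z)" by (simp only: nn_integral_Q[OF mk])
    also have "\<dots> \<le> (\<integral>\<^sup>+y. ?k y \<partial>kernel z)" by (rule c1(3)[OF z mk])
    also have "\<dots> = (\<integral>\<^sup>+y. f y \<partial>kernel_pow borel kernel (Suc k) z)"
      using nn_integral_kernel_pow_add[of z f "Suc 0" k] kernel_pow_1[of z] f by (simp del: kernel_pow.simps)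
    finally show ?thesis .
  qed
  moreover have "0 < c1 * c2" "c1 * c2 \<le> 1" using c1 c2 by (simp_all add: mult_le_one)
  ultimately show ?case by blast
qed

text \<open>After \<open>k\<close> steps the \<open>k\<close> oldest blocks of the start have been
  pushed out, so only the lags \<open>1..p - k\<close> matter. For \<open>k = p\<close> nothing of
  the start remains.\<close>

lemma Q_forgets:
  assumes f: "f \<in> borel_measurable borel"
  shows "k \<le> CARD('p) \<Longrightarrow> (\<And>j. j \<in> {1..CARD('p) - k} \<Longrightarrow> block z j = block z' j) \<Longrightarrow>
    (\<integral>\<^sup>+y. f y \<partial>kernel_pow borel Q k z) = (\<integral>\<^sup>+y. f y \<partial>kernel_pow borel Q k z')"
proof (induction k arbitrary: z z')
  case 0
  have "z = z'"
  proof (rule vec_eq_iff[THEN iffD2], rule allI)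
    fix q :: "'p \<times> 'n"
    have "block z (lag_of (fst q)) = block z' (lag_of (fst q))" using 0 lag_of_range[of "fst q"] by simp
    then have "block z (lag_of (fst q)) $ snd q = block z' (lag_of (fst q)) $ snd q" by simp
    then show "z $ q = z' $ q" by (simp add: block_def lag_pos_lag_of)
  qed
  then show ?case by simp
next
  case (Suc k)
  have eq: "(\<integral>\<^sup>+y. f y \<partial>kernel_pow borel Q (Suc k) x) = (\<integral>\<^sup>+u. (\<integral>\<^sup>+y. f y \<partial>kernel_pow borel Q k (push x u)) \<partial>UM)" for x
    using Q.nn_integral_kernel_pow_add[of x f "Suc 0" k] Q.kernel_pow_1[of x] f
      nn_integral_Q[OF measurable_nn_integral_kernel[OF Q.kernel_pow_measurable[of k] f], of x]
    by (simp del: kernel_pow.simps)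
  show ?case unfolding eq
  proof (rule nn_integral_cong, rule Suc.IH)
    show "k \<le> CARD('p)" using Suc.prems by simp
    fix u j assume j: "j \<in> {1..CARD('p) - k}"
    then have j': "j \<in> {1..CARD('p)}" by auto
    show "block (push z u) j = block (push z' u) j"
    proof (cases "j = 1")
      case False
      then have "j - 1 \<in> {1..CARD('p) - Suc k}" using j Suc.prems(1) by auto
      then show ?thesis unfolding block_push[OF j'] using Suc.prems(2) False by simp
    next
      case True
      then show ?thesis unfolding block_push[OF j'] by simp
    qed
  qed
qed

lemma harris_chain:
  assumes V: "V \<in> borel_measurable borel" "0 < lam" "lam < 1" "0 \<le> b" "\<And>x. (norm x)\<^sup>2 \<le> V x"
    "\<And>x. (\<integral>\<^sup>+y. ennreal (V y) \<partial>kernel x) \<le> ennreal (lam * V x + b)"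
  shows "harris_chain borel kernel V lam b CARD('p)"
proof
  show "V \<in> borel_measurable borel" by fact
  show "0 \<le> V x" for x using V(5)[of x] zero_le_power2[of "norm x"] by linarith
  show "0 \<le> lam" "lam < 1" "0 \<le> b" using V by auto
  show "(\<integral>\<^sup>+y. ennreal (V y) \<partial>kernel x) \<le> ennreal (lam * V x + b)" for x by (rule V(6))
  show "space (borel :: (real^('p \<times> 'n)) measure) \<noteq> {}" by simp
  show "1 \<le> CARD('p)" by (simp add: Suc_le_eq)
  fix R :: real
  \<comment> \<open>The sublevel set of \<open>V\<close> lies in this ball because \<open>V\<close>
    dominates the squared norm; the maximum covers negative levels.\<close>
  let ?R = "sqrt (max R 0)"
  obtain c where c: "0 < c" "c \<le> 1" "\<And>z f. norm z \<le> ?R \<Longrightarrow> f \<in> borel_measurable borel \<Longrightarrow>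
      ennreal c * (\<integral>\<^sup>+y. f y \<partial>kernel_pow borel Q CARD('p) z) \<le> (\<integral>\<^sup>+y. f y \<partial>kernel_pow borel kernel CARD('p) z)"
    using multi_step_minorization[of ?R "CARD('p)"] by blast
  \<comment> \<open>By \<open>Q_forgets\<close> the \<open>p\<close>-step law of \<open>Q\<close> is
    the same from every start, so the start 0 is as good as any.\<close>
  define \<nu> where "\<nu> = kernel_pow borel Q CARD('p) 0"
  have \<nu>: "\<nu> \<in> space (prob_algebra borel)" unfolding \<nu>_def by (rule Q.kernel_pow_space) simp
  have "ennreal c * emeasure \<nu> A \<le> emeasure (kernel_pow borel kernel CARD('p) x) A"
    if "V x \<le> R" and A: "A \<in> sets borel" for x A
  proof -
    have "norm x \<le> ?R" using V(5)[of x] that(1) by (intro real_le_rsqrt) simp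
    from c(3)[OF this, of "indicator A"] A
    have "ennreal c * (\<integral>\<^sup>+y. indicator A y \<partial>kernel_pow borel Q CARD('p) x) \<le> (\<integral>\<^sup>+y. indicator A y \<partial>kernel_pow borel kernel CARD('p) x)"
      by simp
    also have "(\<integral>\<^sup>+y. indicator A y \<partial>kernel_pow borel Q CARD('p) x) = (\<integral>\<^sup>+y. indicator A y \<partial>kernel_pow borel Q CARD('p) 0)"
      by (rule Q_forgets) (use A in auto)
    finally show ?thesis
      using A Q.kernel_powD(1)[of 0 "CARD('p)"] kernel_powD(1)[of x "CARD('p)"] by (simp add: \<nu>_def)
  qed
  then show "\<exists>\<alpha> \<nu>. 0 < \<alpha> \<and> \<alpha> \<le> 1 \<and> prob_space \<nu> \<and> sets \<nu> = sets borel \<and>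
      (\<forall>x\<in>space borel. V x \<le> R \<longrightarrow> (\<forall>A\<in>sets borel. ennreal \<alpha> * emeasure \<nu> A \<le> emeasure (kernel_pow borel kernel CARD('p) x) A))"
    using c(1,2) space_prob_algebraD(1,2)[OF \<nu>] by (intro exI[of _ c] exI[of _ \<nu>]) simp
qed

end

section \<open>From a given process to a random recursion\<close>

lemma markov_chain_cong:
  assumes "\<And>t \<omega>. \<omega> \<in> space M \<Longrightarrow> Z t \<omega> = Z' t \<omega>" and "markov_chain M S K Z"
  shows "markov_chain M S K Z'"
proof -
  have pre: "Z t -` A \<inter> space M = Z' t -` A \<inter> space M" for t A using assms(1) by auto
  have G: "gen_sigma M S Z I = gen_sigma M S Z' I" for I by (simp add: gen_sigma_def pre)
  show ?thesis
    unfolding markov_chain_def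
  proof (intro conjI allI ballI)
    show "markov_kernel S K" using assms(2) by (simp add: markov_chain_def)
    show "Z' t \<in> M \<rightarrow>\<^sub>M S" for t
      using assms(2) measurable_cong[of M "Z t" "Z' t" S] assms(1) by (simp add: markov_chain_def)
    fix t A assume "A \<in> sets S"
    then have "AE \<omega> in M. real_cond_exp M (gen_sigma M S Z {..t}) (indicator (Z (Suc t) -` A \<inter> space M)) \<omega>
        = measure (K (Z t \<omega>)) A" using assms(2) by (simp add: markov_chain_def)
    then show "AE \<omega> in M. real_cond_exp M (gen_sigma M S Z' {..t}) (indicator (Z' (Suc t) -` A \<inter> space M)) \<omega>
        = measure (K (Z' t \<omega>)) A"
      unfolding G pre by (rule AE_mp) (rule AE_I2, simp add: assms(1))
  qed
qed

text \<open>Independence of the initial values from the noise and independence within the noise are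
  both stated through sigma-algebras. They are merged here into one product law for the initial
  state and the reindexed noise sequence.\<close>

lemma (in prob_space) joint_law:
  fixes Z0 :: "'a \<Rightarrow> 's::topological_space" and \<epsilon> :: "nat \<Rightarrow> 'a \<Rightarrow> 'e::topological_space"
  assumes sub: "subalgebra M G0" and Z0: "Z0 \<in> G0 \<rightarrow>\<^sub>M borel"
    and ind: "indep_set (sets G0) (sets (gen_sigma M borel \<epsilon> {1..}))"
    and iv: "indep_vars (\<lambda>_. borel) \<epsilon> {1..}" and D: "\<And>t. t \<ge> 1 \<Longrightarrow> distr M borel (\<epsilon> t) = D"
  shows "(\<lambda>\<omega>. (Z0 \<omega>, \<lambda>i. \<epsilon> (Suc i) \<omega>)) \<in> M \<rightarrow>\<^sub>M borel \<Otimes>\<^sub>M PiM UNIV (\<lambda>_::nat. D)" (is "?m")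
    and "distr M (borel \<Otimes>\<^sub>M PiM UNIV (\<lambda>_::nat. D)) (\<lambda>\<omega>. (Z0 \<omega>, \<lambda>i. \<epsilon> (Suc i) \<omega>)) =
      distr M borel Z0 \<Otimes>\<^sub>M PiM UNIV (\<lambda>_::nat. D)" (is "?d")
proof -
  let ?G1 = "gen_sigma M borel \<epsilon> {1..}" and ?P = "PiM UNIV (\<lambda>_::nat. borel :: 'e measure)"
  define \<eta> where "\<eta> \<omega> i = \<epsilon> (Suc i) \<omega>" for \<omega> i
  have rv: "\<epsilon> t \<in> M \<rightarrow>\<^sub>M borel" if "t \<ge> 1" for t using iv that by (auto simp: indep_vars_def)
  have Z0M: "Z0 \<in> M \<rightarrow>\<^sub>M borel" by (rule measurable_from_subalg[OF sub Z0])
  have \<eta>G: "\<eta> \<in> ?G1 \<rightarrow>\<^sub>M ?P"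
  proof (rule measurable_PiM_single')
    show "(\<lambda>\<omega>. \<eta> \<omega> i) \<in> ?G1 \<rightarrow>\<^sub>M borel" for i
      using measurable_gen_sigma[of "Suc i" "{1..}" \<epsilon> M borel] by (simp add: \<eta>_def)
  qed (auto simp: PiE_def extensional_def)
  have sub1: "subalgebra M ?G1" by (rule subalgebra_gen_sigma) (use rv in auto)
  have \<eta>M: "\<eta> \<in> M \<rightarrow>\<^sub>M ?P" by (rule measurable_from_subalg[OF sub1 \<eta>G])
  have pair: "distr M borel Z0 \<Otimes>\<^sub>M distr M ?P \<eta> = distr M (borel \<Otimes>\<^sub>M ?P) (\<lambda>\<omega>. (Z0 \<omega>, \<eta> \<omega>))"
  proof (rule pair_measure_eqI)
    interpret a: prob_space "distr M borel Z0" by (rule prob_space_distr[OF Z0M])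
    interpret b: prob_space "distr M ?P \<eta>" by (rule prob_space_distr[OF \<eta>M])
    show "sigma_finite_measure (distr M borel Z0)" "sigma_finite_measure (distr M ?P \<eta>)" by unfold_locales
    show "sets (distr M borel Z0 \<Otimes>\<^sub>M distr M ?P \<eta>) = sets (distr M (borel \<Otimes>\<^sub>M ?P) (\<lambda>\<omega>. (Z0 \<omega>, \<eta> \<omega>)))"
      by simp
    fix A B assume "A \<in> sets (distr M borel Z0)" "B \<in> sets (distr M ?P \<eta>)"
    then have A: "A \<in> sets borel" and B: "B \<in> sets ?P" by auto
    have "prob ((Z0 -` A \<inter> space M) \<inter> (\<eta> -` B \<inter> space M)) = prob (Z0 -` A \<inter> space M) * prob (\<eta> -` B \<inter> space M)"
      using measurable_sets[OF Z0 A] measurable_sets[OF \<eta>G B] sub sub1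
      by (intro indep_setD[OF ind]) (simp_all add: subalgebra_def)
    moreover have "(\<lambda>\<omega>. (Z0 \<omega>, \<eta> \<omega>)) -` (A \<times> B) \<inter> space M = (Z0 -` A \<inter> space M) \<inter> (\<eta> -` B \<inter> space M)" by auto
    ultimately show "emeasure (distr M borel Z0) A * emeasure (distr M ?P \<eta>) B =
        emeasure (distr M (borel \<Otimes>\<^sub>M ?P) (\<lambda>\<omega>. (Z0 \<omega>, \<eta> \<omega>))) (A \<times> B)"
      using A B Z0M \<eta>M measurable_Pair[OF Z0M \<eta>M]
      by (simp add: emeasure_distr emeasure_eq_measure ennreal_mult)
  qed
  have sD: "sets D = sets borel" using D[of 1] by auto
  have sP: "sets (PiM UNIV (\<lambda>_::nat. D)) = sets ?P" by (rule sets_PiM_cong) (simp_all add: sD)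
  \<comment> \<open>The innovations are indexed from 1, the sequence space from 0.\<close>
  have "indep_vars (\<lambda>_. borel) (\<lambda>i. \<epsilon> (Suc i)) UNIV"
    unfolding indep_vars_def2
  proof (intro conjI ballI indep_setsI)
    show "\<epsilon> (Suc i) \<in> M \<rightarrow>\<^sub>M borel" for i using rv by simp
    then show "{\<epsilon> (Suc i) -` A \<inter> space M | A. A \<in> sets borel} \<subseteq> events" for i by (auto intro: measurable_sets)
    fix A :: "nat \<Rightarrow> 'a set" and J
    assume J: "J \<noteq> {}" "finite J" and A: "\<forall>j\<in>J. A j \<in> {\<epsilon> (Suc j) -` A \<inter> space M | A. A \<in> sets borel}"
    have "indep_sets (\<lambda>i. {\<epsilon> i -` A \<inter> space M | A. A \<in> sets borel}) {1..}" using iv unfolding indep_vars_def2 by blast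
    from indep_setsD[OF this, of "Suc ` J" "\<lambda>k. A (k - 1)"]
    have "prob (\<Inter>k\<in>Suc ` J. A (k - 1)) = (\<Prod>k\<in>Suc ` J. prob (A (k - 1)))" using J A by auto
    then show "prob (\<Inter>j\<in>J. A j) = (\<Prod>j\<in>J. prob (A j))" by (simp add: prod.reindex)
  qed
  then have "distr M ?P (\<lambda>\<omega>. \<lambda>i\<in>UNIV. \<epsilon> (Suc i) \<omega>) = PiM UNIV (\<lambda>i. distr M borel (\<epsilon> (Suc i)))"
    using rv by (subst (asm) indep_vars_iff_distr_eq_PiM) auto
  then have \<eta>D: "distr M ?P \<eta> = PiM UNIV (\<lambda>_. D)" by (simp add: D \<eta>_def[abs_def] restrict_def)
  have sets: "sets (borel \<Otimes>\<^sub>M PiM UNIV (\<lambda>_::nat. D)) = sets ((borel :: 's measure) \<Otimes>\<^sub>M ?P)"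
    by (rule sets_pair_measure_cong[OF refl sP])
  have "(\<lambda>\<omega>. (Z0 \<omega>, \<eta> \<omega>)) \<in> M \<rightarrow>\<^sub>M borel \<Otimes>\<^sub>M ?P" using Z0M \<eta>M by (rule measurable_Pair)
  then show ?m unfolding measurable_cong_sets[OF refl sets] \<eta>_def[abs_def] .
  have "distr M (borel \<Otimes>\<^sub>M PiM UNIV (\<lambda>_::nat. D)) (\<lambda>\<omega>. (Z0 \<omega>, \<eta> \<omega>)) = distr M (borel \<Otimes>\<^sub>M ?P) (\<lambda>\<omega>. (Z0 \<omega>, \<eta> \<omega>))"
    by (rule distr_cong[OF refl sets refl])
  then show ?d unfolding pair[symmetric] \<eta>D unfolding \<eta>_def .
qed

lemma strictly_stationary_integral_eq:
  fixes X :: "int \<Rightarrow> 'a \<Rightarrow> 's" and f :: "'s \<times> 's \<Rightarrow> 'b::{banach, second_countable_topology}"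
  assumes st: "strictly_stationary M S a X" and f: "f \<in> borel_measurable (S \<Otimes>\<^sub>M S)" and t: "t \<ge> a" "u \<ge> a" "h \<ge> 0"
  shows "(\<integral>\<omega>. f (X (t + h) \<omega>, X (u + h) \<omega>) \<partial>M) = (\<integral>\<omega>. f (X t \<omega>, X u \<omega>) \<partial>M)"
proof -
  let ?J = "{t, u}" and ?P = "PiM {t, u} (\<lambda>_. S)"
  have X: "X v \<in> M \<rightarrow>\<^sub>M S" if "v \<ge> a" for v using st that by (simp add: strictly_stationary_def)
  have m: "(\<lambda>\<omega>. \<lambda>v\<in>?J. X (v + k) \<omega>) \<in> M \<rightarrow>\<^sub>M ?P" if "k \<ge> 0" for k
    by (rule measurable_restrict) (use X t that in auto)
  have "(\<lambda>x. (x t, x u)) \<in> ?P \<rightarrow>\<^sub>M S \<Otimes>\<^sub>M S"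
    by (intro measurable_Pair measurable_component_singleton) auto
  then have fP: "(\<lambda>x. f (x t, x u)) \<in> borel_measurable ?P" by (rule measurable_compose[OF _ f])
  have eq: "(\<integral>\<omega>. f (X (t + k) \<omega>, X (u + k) \<omega>) \<partial>M) = (\<integral>x. f (x t, x u) \<partial>distr M ?P (\<lambda>\<omega>. \<lambda>v\<in>?J. X (v + k) \<omega>))" if "k \<ge> 0" for k
    by (subst integral_distr[OF m[OF that] fP]) simp
  have "finite ?J \<and> ?J \<subseteq> {a..} \<and> 0 \<le> h" using t by auto
  then have "distr M ?P (\<lambda>\<omega>. \<lambda>v\<in>?J. X (v + h) \<omega>) = distr M ?P (\<lambda>\<omega>. \<lambda>v\<in>?J. X (v + 0) \<omega>)"
    using st unfolding strictly_stationary_def by simp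
  then show ?thesis using eq[OF t(3)] eq[of 0] by simp
qed

lemma strictly_stationary_imp_second_order:
  fixes X :: "int \<Rightarrow> 'a \<Rightarrow> real^'n"
  assumes st: "strictly_stationary M borel a X" and sq: "\<And>t. t \<ge> a \<Longrightarrow> integrable M (\<lambda>\<omega>. (norm (X t \<omega>))\<^sup>2)"
  shows "second_order_stationary M a X"
proof -
  have mean: "(\<integral>\<omega>. X (t + h) \<omega> \<partial>M) = (\<integral>\<omega>. X t \<omega> \<partial>M)" if "t \<ge> a" "h \<ge> 0" for t h
    using strictly_stationary_integral_eq[OF st, of fst t t h] that by simp
  have "cross_cov M (X (t + h)) (X (u + h)) = cross_cov M (X t) (X u)" if t: "t \<ge> a" "u \<ge> a" "h \<ge> 0" for t u h
  proof -
    have "(\<integral>\<omega>. (X (t + h) \<omega> - m) $ k * (X (u + h) \<omega> - m') $ l \<partial>M) = (\<integral>\<omega>. (X t \<omega> - m) $ k * (X u \<omega> - m') $ l \<partial>M)" for m m' k l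
    proof -
      have "(\<lambda>x. (fst x - m) $ k * (snd x - m') $ l) \<in> borel_measurable (borel \<Otimes>\<^sub>M borel)"
        unfolding borel_measurable_pair_iff by (intro borel_measurable_continuous_onI continuous_intros)
      from strictly_stationary_integral_eq[OF st this t] show ?thesis by simp
    qed
    then show ?thesis unfolding cross_cov_def mean[OF t(1,3)] mean[OF t(2,3)] by simp
  qed
  then show ?thesis
    unfolding second_order_stationary_def using st sq mean by (auto simp: strictly_stationary_def)
qed

text \<open>The output at \<open>t + m\<close> applies one functional \<open>\<Theta> t\<close> to
  the shifted state and noise. The output starts at \<open>a \<le> 0\<close>, since the state
  carries lagged values; causality says that up to time \<open>m\<close> only the first
  \<open>m\<close> innovations enter.\<close>

locale stationary_output = stationary_process D F N \<mu> Z0 \<eta>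
  for D :: "'e::topological_space measure" and F :: "'s::topological_space \<Rightarrow> 'e \<Rightarrow> 's" and N :: "'w measure"
    and \<mu> Z0 \<eta> +
  fixes T :: "'v measure" and a :: int and \<Theta> :: "int \<Rightarrow> 's \<Rightarrow> (nat \<Rightarrow> 'e) \<Rightarrow> 'v" and y :: "int \<Rightarrow> 'w \<Rightarrow> 'v"
  assumes a: "a \<le> 0"
    and \<Theta>_measurable: "\<And>t. t \<ge> a \<Longrightarrow> (\<lambda>x. \<Theta> t (fst x) (snd x)) \<in> borel \<Otimes>\<^sub>M S \<rightarrow>\<^sub>M T"
    and causal: "\<And>t m z e e'. t \<ge> a \<Longrightarrow> t \<le> int m \<Longrightarrow> \<Theta> t z (comb_seq m e e') = \<Theta> t z e"
    and y: "\<And>t m \<omega>. t \<ge> a \<Longrightarrow> y (t + int m) \<omega> = \<Theta> t (Z m \<omega>) (\<lambda>i. \<eta> \<omega> (m + i))"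
begin

lemma measurable_shifted_state: "(\<lambda>\<omega>. (Z m \<omega>, \<lambda>i. \<eta> \<omega> (m + i))) \<in> N \<rightarrow>\<^sub>M borel \<Otimes>\<^sub>M S"
  using measurable_compose[OF joint_measurable measurable_shifted[of m]] unfolding Z_def[abs_def] by simp

lemma y_0: "t \<ge> a \<Longrightarrow> y t \<omega> = \<Theta> t (Z0 \<omega>) (\<eta> \<omega>)"
  using y[of t 0 \<omega>] by (simp add: Z_def)

lemma measurable_y: "t \<ge> a \<Longrightarrow> y t \<in> N \<rightarrow>\<^sub>M T"
proof -
  assume t: "t \<ge> a"
  have "y t = (\<lambda>\<omega>. \<Theta> t (Z0 \<omega>) (\<eta> \<omega>))" by (rule ext) (rule y_0[OF t])
  then show ?thesis using measurable_compose[OF joint_measurable \<Theta>_measurable[OF t]] by simp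
qed

lemma distr_Z: "distr N borel (Z m) = \<mu>"
proof (rule measure_eqI)
  show "sets (distr N borel (Z m)) = sets \<mu>" by (simp add: sets_mu)
  fix A assume "A \<in> sets (distr N borel (Z m))"
  then have A: "A \<in> sets borel" by simp
  have c: "A \<times> UNIV \<in> sets (borel \<Otimes>\<^sub>M S)" using A sets.top[of S] by (intro pair_measureI) (auto simp: space_Seq)
  have "emeasure S (Pair x -` (A \<times> UNIV)) = indicator A x" for x
    using P.emeasure_space_1 by (auto simp: space_Seq indicator_def)
  with emeasure_future[OF c, of m] have "emeasure N {\<omega> \<in> space N. Z m \<omega> \<in> A} = (\<integral>\<^sup>+x. indicator A x \<partial>\<mu>)" by simp
  also have "\<dots> = emeasure \<mu> A" using A by (intro nn_integral_indicator) (simp add: sets_mu)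
  finally show "emeasure (distr N borel (Z m)) A = emeasure \<mu> A"
    using A by (simp add: emeasure_distr[OF measurable_Z] vimage_def Int_def conj_commute)
qed

lemma strictly_stationary: "strictly_stationary N T a y"
  unfolding strictly_stationary_def
proof (intro conjI allI impI)
  show "y t \<in> N \<rightarrow>\<^sub>M T" if "a \<le> t" for t using that by (rule measurable_y)
  fix J :: "int set" and h :: int
  assume J: "finite J \<and> J \<subseteq> {a..} \<and> 0 \<le> h"
  let ?P = "PiM J (\<lambda>_. T)" and ?\<Psi> = "\<lambda>x. \<lambda>t\<in>J. \<Theta> t (fst x) (snd x)"
  have \<Psi>: "?\<Psi> \<in> borel \<Otimes>\<^sub>M S \<rightarrow>\<^sub>M ?P"
    by (rule measurable_restrict) (use J \<Theta>_measurable in auto)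
  have *: "distr N ?P (\<lambda>\<omega>. \<lambda>t\<in>J. y (t + int m) \<omega>) = distr (\<mu> \<Otimes>\<^sub>M S) ?P ?\<Psi>" for m
  proof -
    have "(\<lambda>\<omega>. \<lambda>t\<in>J. y (t + int m) \<omega>) = (\<lambda>\<omega>. ?\<Psi> (Z m \<omega>, \<lambda>i. \<eta> \<omega> (m + i)))"
      using J y by (intro ext) (auto simp: restrict_def)
    then have "distr N ?P (\<lambda>\<omega>. \<lambda>t\<in>J. y (t + int m) \<omega>) = distr (distr N (borel \<Otimes>\<^sub>M S) (\<lambda>\<omega>. (Z m \<omega>, \<lambda>i. \<eta> \<omega> (m + i)))) ?P ?\<Psi>"
      using distr_distr[OF \<Psi> measurable_shifted_state[of m]] by (simp add: comp_def)
    then show ?thesis by (simp only: distr_shift)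
  qed
  from *[of "nat h"] *[of 0] J
  show "distr N ?P (\<lambda>\<omega>. \<lambda>t\<in>J. y (t + h) \<omega>) = distr N ?P (\<lambda>\<omega>. \<lambda>t\<in>J. y t \<omega>)" by simp
qed

lemma geometric_beta_mixing:
  fixes V :: "'s \<Rightarrow> real" and C \<rho> :: real
  assumes V: "integrable \<mu> V" "\<And>x. 0 \<le> V x" and C: "0 \<le> C" and \<rho>: "0 < \<rho>" "\<rho> < 1"
    and decay: "\<And>h x n. h \<in> borel_measurable borel \<Longrightarrow> (\<And>y. \<bar>h y\<bar> \<le> 1) \<Longrightarrow>
      \<bar>(\<integral>y. h y \<partial>kernel_pow borel kernel n x) - (\<integral>y. h y \<partial>\<mu>)\<bar> \<le> C * \<rho> ^ n * (1 + V x)"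
  shows "geometric_beta_mixing N T a y"
proof -
  interpret mu: prob_space \<mu> using space_prob_algebraD(2)[OF \<mu>] .
  let ?I = "\<integral>x. V x \<partial>\<mu>"
  have I0: "0 \<le> ?I" using V(2) by (intro Bochner_Integration.integral_nonneg) auto
  have Vm: "V \<in> borel_measurable borel"
    using borel_measurable_integrable[OF V(1)] by (simp add: measurable_cong_sets[OF sets_mu refl])
  have VZ: "integrable N (\<lambda>\<omega>. V (Z m \<omega>))" "(\<integral>\<omega>. V (Z m \<omega>) \<partial>N) = ?I" for m
  proof -
    have "integrable (distr N borel (Z m)) V" using V(1) by (simp add: distr_Z)
    then show "integrable N (\<lambda>\<omega>. V (Z m \<omega>))" by (rule integrable_distr[OF measurable_Z])
    have "(\<integral>x. V x \<partial>distr N borel (Z m)) = (\<integral>\<omega>. V (Z m \<omega>) \<partial>N)" by (rule integral_distr[OF measurable_Z Vm])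
    then show "(\<integral>\<omega>. V (Z m \<omega>) \<partial>N) = ?I" by (simp add: distr_Z)
  qed
  have beta: "(\<integral>\<^sup>+\<omega>. ess_sup N
        ((\<lambda>A \<omega>. ennreal \<bar>real_cond_exp N (gen_sigma N T y {a..t}) (indicator A) \<omega> - N.prob A\<bar>)
          ` sets (gen_sigma N T y {t + int k..})) \<omega> \<partial>N) \<le> ennreal (C * (1 + ?I) * \<rho> ^ k)" if t: "t \<ge> a" for t k
  proof -
    \<comment> \<open>For negative \<open>t\<close> the initial state already determines the
      observed past, hence the maximum with 0.\<close>
    define m where "m = nat (max t 0)"
    \<comment> \<open>The outputs from \<open>t + k\<close> on are those from \<open>u + a\<close>
      on, and all of these are functions of the state at \<open>u\<close> and the later noise. As
      \<open>a \<le> 0\<close>, the gap \<open>u - m\<close> is still at least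
      \<open>k\<close>.\<close>
    define u where "u = nat (t + int k - a)"
    have mu: "m \<le> u" "k \<le> u - m" using t a by (auto simp: m_def u_def)
    have past: "sets (gen_sigma N T y {a..t}) \<subseteq> past m"
    proof (rule gen_sigma_sets_subset[OF past_sigma_algebra])
      fix v A assume v: "v \<in> {a..t}" and A: "A \<in> sets T"
      have "{\<omega> \<in> space N. \<Theta> v (Z0 \<omega>) (\<eta> \<omega>) \<in> A} \<in> past m"
      proof (rule pastI[OF \<Theta>_measurable A])
        show "a \<le> v" using v by simp
        show "\<Theta> v z (comb_seq m e e') = \<Theta> v z e" for z e e' using v by (intro causal) (auto simp: m_def)
      qed
      then show "{\<omega> \<in> space N. y v \<omega> \<in> A} \<in> past m" using v by (simp add: y_0)
    qed
    have fut: "sets (gen_sigma N T y {t + int k..}) \<subseteq> future u"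
    proof (rule gen_sigma_sets_subset[OF future_sigma_algebra])
      fix v A assume v: "v \<in> {t + int k..}" and A: "A \<in> sets T"
      have v': "a \<le> v - int u" using v t a by (auto simp: u_def)
      have "{\<omega> \<in> space N. \<Theta> (v - int u) (Z u \<omega>) (\<lambda>i. \<eta> \<omega> (u + i)) \<in> A} \<in> future u"
        by (rule futureI[OF \<Theta>_measurable[OF v'] A])
      then show "{\<omega> \<in> space N. y v \<omega> \<in> A} \<in> future u" using y[OF v', of u] by simp
    qed
    let ?W = "\<lambda>\<omega>. C * \<rho> ^ (u - m) * (1 + V (Z m \<omega>))"
    have W: "integrable N ?W" using VZ(1) by simp
    have sub: "subalgebra N (gen_sigma N T y {a..t})" by (rule subalgebra_gen_sigma) (auto intro: measurable_y)
    have sub': "subalgebra N (gen_sigma N T y {t + int k..})" by (rule subalgebra_gen_sigma) (use t in \<open>auto intro: measurable_y\<close>)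
    have "(\<integral>\<^sup>+\<omega>. ess_sup N
        ((\<lambda>A \<omega>. ennreal \<bar>real_cond_exp N (gen_sigma N T y {a..t}) (indicator A) \<omega> - N.prob A\<bar>)
          ` sets (gen_sigma N T y {t + int k..})) \<omega> \<partial>N) \<le> ennreal (\<integral>\<omega>. ?W \<omega> \<partial>N)"
    proof (rule N.nn_integral_beta_le[OF sub _ _ W])
      show "sets (gen_sigma N T y {t + int k..}) \<noteq> {}" using sets.top by blast
      show "sets (gen_sigma N T y {t + int k..}) \<subseteq> sets N" using sub' by (simp add: subalgebra_def)
      show "0 \<le> ?W \<omega>" for \<omega> using C \<rho> V(2) by simp
      fix A B assume A: "A \<in> sets (gen_sigma N T y {t + int k..})" and B: "B \<in> sets (gen_sigma N T y {a..t})"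
      show "\<bar>N.prob (B \<inter> A) - N.prob B * N.prob A\<bar> \<le> (\<integral>\<omega>. indicator B \<omega> * ?W \<omega> \<partial>N)"
        by (rule mixing_bound[where V = "\<lambda>x. C * \<rho> ^ (u - m) * (1 + V x)", OF subsetD[OF past B] subsetD[OF fut A] mu(1) decay W])
    qed
    also have "\<dots> \<le> ennreal (C * (1 + ?I) * \<rho> ^ k)"
    proof (rule ennreal_leI)
      have "(\<integral>\<omega>. ?W \<omega> \<partial>N) = C * \<rho> ^ (u - m) * (1 + ?I)" using VZ by (simp add: N.prob_space)
      also have "\<dots> \<le> C * \<rho> ^ k * (1 + ?I)"
        using C \<rho> I0 mu(2) by (intro mult_right_mono mult_left_mono power_decreasing) auto
      finally show "(\<integral>\<omega>. ?W \<omega> \<partial>N) \<le> C * (1 + ?I) * \<rho> ^ k" by (simp add: mult_ac)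
    qed
    finally show ?thesis .
  qed
  show ?thesis
    unfolding geometric_beta_mixing_def beta_coeff_def
  proof (rule conjI[OF _ exI[of _ "C * (1 + ?I)", OF conjI[OF _ exI[of _ \<rho>]]]], intro allI impI)
    show "y t \<in> N \<rightarrow>\<^sub>M T" if "a \<le> t" for t using that by (rule measurable_y)
    show "0 \<le> C * (1 + ?I)" using C I0 by simp
    show "0 < \<rho> \<and> \<rho> < 1 \<and> (\<forall>k\<ge>1. (SUP t\<in>{a..}. \<integral>\<^sup>+\<omega>. ess_sup N
        ((\<lambda>A \<omega>. ennreal \<bar>real_cond_exp N (gen_sigma N T y {a..t}) (indicator A) \<omega> - N.prob A\<bar>)
          ` sets (gen_sigma N T y {t + int k..})) \<omega> \<partial>N) \<le> ennreal (C * (1 + ?I) * \<rho> ^ k))"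
      using \<rho> by (intro conjI allI impI SUP_least beta) auto
  qed
qed

end

section \<open>The stationary solution on an enlarged probability space\<close>

lemma stack_cong:
  assumes "\<And>j. j \<in> {1..CARD('p)} \<Longrightarrow> v j = v' j"
  shows "(stack v :: real^('p::{finite,linorder} \<times> 'n::finite)) = stack v'"
  unfolding stack_def assms[OF lag_of_range] ..

lemma vstar_cong:
  fixes s :: "real^('p::{finite,linorder} \<times> 'n::finite) \<Rightarrow> real"
  assumes "\<And>j. j \<in> {1..CARD('p)} \<Longrightarrow> v j = v' j"
  shows "vstar g \<mu> \<Phi> \<Psi> \<Omega> G s v e = vstar g \<mu> \<Phi> \<Psi> \<Omega> G s v' e"
proof -
  have "(stack v :: real^('p \<times> 'n)) = stack v'" using assms by (rule stack_cong)
  moreover have "(\<Sum>j=1..CARD('p). A j *v v j) = (\<Sum>j=1..CARD('p). A j *v v' j)" for A :: "nat \<Rightarrow> real^'n^'n"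
    by (rule sum.cong) (simp_all add: assms)
  ultimately show ?thesis unfolding vstar_def by simp
qed

lemma measurable_stack:
  fixes X :: "nat \<Rightarrow> 'a \<Rightarrow> real^'n::finite"
  assumes "\<And>j. j \<in> {1..CARD('p)} \<Longrightarrow> X j \<in> borel_measurable M"
  shows "(\<lambda>\<omega>. stack (\<lambda>j. X j \<omega>) :: real^('p::{finite,linorder} \<times> 'n)) \<in> borel_measurable M"
proof (rule borel_measurable_euclidean_space[THEN iffD2], rule ballI)
  fix b :: "real^('p \<times> 'n)" assume "b \<in> Basis"
  then obtain i k where b: "b = axis (i, k) 1" by (auto simp: Basis_vec_def)
  have "(\<lambda>\<omega>. X (lag_of i) \<omega> \<bullet> axis k 1) \<in> borel_measurable M"
    using assms[OF lag_of_range[of i]] by (intro borel_measurable_inner) auto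
  then show "(\<lambda>\<omega>. stack (\<lambda>j. X j \<omega>) \<bullet> b) \<in> borel_measurable M"
    unfolding b by (simp add: inner_axis stack_def)
qed

text \<open>Independence of a family depends only on its joint law, and composing with a measure
  preserving map keeps that law. This lifts the innovations to the enlarged space.\<close>

lemma (in prob_space) indep_vars_distr:
  assumes f: "f \<in> L \<rightarrow>\<^sub>M M" "prob_space L" "distr L M f = M" and iv: "indep_vars M' X I" and I: "I \<noteq> {}"
  shows "prob_space.indep_vars L M' (\<lambda>i \<omega>. X i (f \<omega>)) I"
proof -
  interpret L: prob_space L by fact
  have rv: "X i \<in> M \<rightarrow>\<^sub>M M' i" if "i \<in> I" for i using iv that by (auto simp: indep_vars_def)
  have rvL: "(\<lambda>\<omega>. X i (f \<omega>)) \<in> L \<rightarrow>\<^sub>M M' i" if "i \<in> I" for i using measurable_compose[OF f(1) rv[OF that]] .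
  have "distr L (PiM I M') (\<lambda>\<omega>. \<lambda>i\<in>I. X i (f \<omega>)) = distr (distr L M f) (PiM I M') (\<lambda>\<omega>. \<lambda>i\<in>I. X i \<omega>)"
    using rv f(1) by (subst distr_distr) (auto intro!: measurable_restrict simp: comp_def)
  also have "\<dots> = PiM I (\<lambda>i. distr M (M' i) (X i))"
    unfolding f(3) using iv rv I by (subst (asm) indep_vars_iff_distr_eq_PiM') auto
  also have "\<dots> = PiM I (\<lambda>i. distr L (M' i) (\<lambda>\<omega>. X i (f \<omega>)))"
  proof (rule PiM_cong[OF refl])
    fix i assume "i \<in> I"
    then show "distr M (M' i) (X i) = distr L (M' i) (\<lambda>\<omega>. X i (f \<omega>))"
      using distr_distr[OF rv f(1)] unfolding f(3) by (simp add: comp_def)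
  qed
  finally show ?thesis using rvL I by (subst L.indep_vars_iff_distr_eq_PiM') auto
qed

lemma distr_pair_snd:
  assumes "prob_space M1" "prob_space M2" shows "distr (M1 \<Otimes>\<^sub>M M2) M2 snd = M2"
proof -
  interpret M1: prob_space M1 by fact
  interpret M2: prob_space M2 by fact
  interpret pair_prob_space M1 M2 ..
  show ?thesis
  proof (rule measure_eqI)
    fix A assume "A \<in> sets (distr (M1 \<Otimes>\<^sub>M M2) M2 snd)"
    then have A: "A \<in> sets M2" by simp
    have "snd -` A \<inter> space (M1 \<Otimes>\<^sub>M M2) = space M1 \<times> A"
      using sets.sets_into_space[OF A] by (auto simp: space_pair_measure)
    then show "emeasure (distr (M1 \<Otimes>\<^sub>M M2) M2 snd) A = emeasure M2 A"
      using A by (simp add: emeasure_distr M2.emeasure_pair_measure_Times M1.emeasure_space_1)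
  qed simp
qed

lemma indep_set_coordinates:
  assumes "prob_space M1" "prob_space M2"
  shows "prob_space.indep_set (M1 \<Otimes>\<^sub>M M2) (sets (vimage_algebra (space (M1 \<Otimes>\<^sub>M M2)) snd M2))
    (sets (vimage_algebra (space (M1 \<Otimes>\<^sub>M M2)) fst M1))"
proof -
  interpret M1: prob_space M1 by fact
  interpret M2: prob_space M2 by fact
  interpret pair_prob_space M1 M2 ..
  let ?N = "M1 \<Otimes>\<^sub>M M2"
  have s: "sets (vimage_algebra (space ?N) snd M2) = {snd -` A \<inter> space ?N | A. A \<in> sets M2}"
    "sets (vimage_algebra (space ?N) fst M1) = {fst -` A \<inter> space ?N | A. A \<in> sets M1}"
    by (rule sets_vimage_algebra2; simp add: space_pair_measure Pi_iff mem_Times_iff)+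
  show ?thesis
    unfolding s
  proof (rule indep_setI)
    show "{snd -` A \<inter> space ?N | A. A \<in> sets M2} \<subseteq> sets ?N" using measurable_sets[OF measurable_snd] by blast
    show "{fst -` A \<inter> space ?N | A. A \<in> sets M1} \<subseteq> sets ?N" using measurable_sets[OF measurable_fst] by blast
    fix a b assume "a \<in> {snd -` A \<inter> space ?N | A. A \<in> sets M2}" "b \<in> {fst -` A \<inter> space ?N | A. A \<in> sets M1}"
    then obtain A B where A: "A \<in> sets M2" "a = snd -` A \<inter> space ?N" and B: "B \<in> sets M1" "b = fst -` B \<inter> space ?N" by blast
    have "a = space M1 \<times> A" "b = B \<times> space M2" "a \<inter> b = B \<times> A"
      using A B sets.sets_into_space[OF A(1)] sets.sets_into_space[OF B(1)] by (auto simp: space_pair_measure)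
    then show "prob (a \<inter> b) = prob a * prob b"
      using A(1) B(1) by (simp add: measure_def M2.emeasure_pair_measure_Times M1.emeasure_space_1 M2.emeasure_space_1 enn2real_mult mult.commute)
  qed
qed

context vstar_model
begin

lemma state_process_rsol:
  assumes "\<And>t. t \<ge> 1 \<Longrightarrow> y (int t) \<omega> = vstar g \<mu> \<Phi> \<Psi> \<Omega> G s (\<lambda>j. y (int t - int j) \<omega>) (\<epsilon> t \<omega>)"
  shows "state_process y t \<omega> = rsol F (state_process y 0 \<omega>) (\<lambda>i. \<epsilon> (Suc i) \<omega>) t"
proof (induction t)
  case (Suc t)
  let ?z = "state_process y t \<omega> :: real^('p \<times> 'n)"
  have b: "block ?z j = y (int t - int j + 1) \<omega>" if "j \<in> {1..CARD('p)}" for j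
    using that unfolding state_process_def by (rule block_stack)
  have "vstar g \<mu> \<Phi> \<Psi> \<Omega> G s (block ?z) (\<epsilon> (Suc t) \<omega>) = vstar g \<mu> \<Phi> \<Psi> \<Omega> G s (\<lambda>j. y (int (Suc t) - int j) \<omega>) (\<epsilon> (Suc t) \<omega>)"
    \<comment> \<open>Agreement is required for the lags \<open>1..p\<close> only;
      \<open>block\<close> is meaningless at other indices.\<close>
    by (rule vstar_cong) (simp add: b algebra_simps)
  also have "\<dots> = y (int (Suc t)) \<omega>" by (rule assms[symmetric]) simp
  finally have "F ?z (\<epsilon> (Suc t) \<omega>) = push ?z (y (int (Suc t)) \<omega>)" unfolding F_def vstar_eq[symmetric] by simp
  also have "\<dots> = state_process y (Suc t) \<omega>"
    unfolding push_def state_process_def[of y "Suc t"]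
  proof (rule stack_cong)
    fix j assume j: "j \<in> {1..CARD('p)}"
    show "(if j = 1 then y (int (Suc t)) \<omega> else block ?z (j - 1)) = y (int (Suc t) - int j + 1) \<omega>"
    proof (cases "j = 1")
      case False
      then have "j - 1 \<in> {1..CARD('p)}" "int t - int (j - 1) + 1 = int (Suc t) - int j + 1" using j by auto
      then show ?thesis using b False by simp
    qed (simp add: add.commute)
  qed
  finally show ?case using Suc by simp
qed simp

lemma recursive_process_vstar:
  assumes "prob_space N" and iv: "prob_space.indep_vars N (\<lambda>_. borel) \<epsilon> {1..}"
    and D: "\<And>t. t \<ge> 1 \<Longrightarrow> distr N borel (\<epsilon> t) = D"
    and y: "vstar_process g \<mu> \<Phi> \<Psi> \<Omega> G s N \<epsilon> y"
  shows "recursive_process D F N (distr N borel (state_process y 0)) (state_process y 0) (\<lambda>\<omega> i. \<epsilon> (Suc i) \<omega>)"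
proof -
  interpret N: prob_space N by fact
  let ?I = "{1 - int CARD('p)..0}"
  let ?G = "gen_sigma N borel y ?I"
  have ym: "y t \<in> borel_measurable N" if "t \<in> ?I" for t using y that by (simp add: vstar_process_def)
  have sub: "subalgebra N ?G" by (rule subalgebra_gen_sigma) (rule ym)
  have Z0: "state_process y 0 \<in> ?G \<rightarrow>\<^sub>M (borel :: (real^('p \<times> 'n)) measure)"
    unfolding state_process_def[abs_def]
    by (rule measurable_stack) (rule measurable_gen_sigma, auto)
  have ind: "N.indep_set (sets ?G) (sets (gen_sigma N borel \<epsilon> {1..}))" using y by (simp add: vstar_process_def)
  have "distr N borel (state_process y 0) \<in> space (prob_algebra (borel :: (real^('p \<times> 'n)) measure))"
    using N.prob_space_distr[OF measurable_from_subalg[OF sub Z0]] by (simp add: space_prob_algebra)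
  then show ?thesis
    using N.joint_law[OF sub Z0 ind iv D] by unfold_locales
qed

text \<open>The solution as a function of initial state and noise. Nonnegative times read the newest
  block of the current state, and a negative time \<open>t\<close> reads lag \<open>1 - t\<close> of
  the initial state.\<close>

definition path :: "int \<Rightarrow> real^('p \<times> 'n) \<Rightarrow> (nat \<Rightarrow> real^'n) \<Rightarrow> real^'n" where
  "path t z e = (if 0 \<le> t then block (rsol F z e (nat t)) 1 else block z (nat (1 - t)))"

lemma block_rsol: "j \<in> {1..CARD('p)} \<Longrightarrow> block (rsol F z e m) j = path (int m - int j + 1) z e"
proof (induction m arbitrary: j)
  case 0
  then show ?case by (cases "j = 1") (auto simp: path_def nat_diff_distrib)
next
  case (Suc m)
  show ?case
  proof (cases "j = 1")
    case False
    then have j: "j - 1 \<in> {1..CARD('p)}" "int m - int (j - 1) + 1 = int (Suc m) - int j + 1" using Suc.prems by auto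
    have "block (rsol F z e (Suc m)) j = block (rsol F z e m) (j - 1)"
      using False block_push[OF Suc.prems] by (simp add: F_def)
    then show ?thesis unfolding Suc.IH[OF j(1)] j(2) .
  qed (simp add: path_def nat_add_distrib del: rsol.simps)
qed

text \<open>The solution can be restarted at time \<open>m\<close>. For negative \<open>t\<close>
  this says that the older blocks of the state at \<open>m\<close> are the earlier path values,
  which is \<open>block_rsol\<close>.\<close>

lemma path_add:
  assumes t: "1 - int CARD('p) \<le> t"
  shows "path (t + int m) z e = path t (rsol F z e m) (\<lambda>i. e (m + i))"
proof (cases "0 \<le> t")
  case True
  then have "nat (t + int m) = m + nat t" by simp
  then show ?thesis using True by (simp add: path_def rsol_add)
next
  case False
  then have "nat (1 - t) \<in> {1..CARD('p)}" using t by auto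
  from block_rsol[OF this, of z e m] show ?thesis using False by (simp add: path_def algebra_simps)
qed

lemma path_recursion: "t \<ge> 1 \<Longrightarrow> path (int t) z e = vstar g \<mu> \<Phi> \<Psi> \<Omega> G s (\<lambda>j. path (int t - int j) z e) (e (t - 1))"
proof -
  assume "t \<ge> 1"
  then obtain u where t: "t = Suc u" by (cases t) auto
  have 1: "1 \<in> {1..CARD('p)}" by (simp add: Suc_le_eq)
  have "path (int t) z e = vstar g \<mu> \<Phi> \<Psi> \<Omega> G s (block (rsol F z e u)) (e u)"
    unfolding vstar_eq using block_push[OF 1] by (simp add: path_def t F_def nat_add_distrib)
  also have "\<dots> = vstar g \<mu> \<Phi> \<Psi> \<Omega> G s (\<lambda>j. path (int t - int j) z e) (e u)"
    by (rule vstar_cong) (simp add: block_rsol t algebra_simps)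
  finally show ?thesis by (simp add: t)
qed

lemma measurable_path: "(\<lambda>x. path t (fst x) (snd x)) \<in> borel \<Otimes>\<^sub>M S \<rightarrow>\<^sub>M borel"
proof (cases "0 \<le> t")
  case True
  then show ?thesis
    using measurable_compose[OF measurable_rsol[of "nat t"] measurable_block[of 1]] by (simp add: path_def split_beta')
next
  case False
  then show ?thesis
    using measurable_compose[OF measurable_fst measurable_block[of "nat (1 - t)"]] by (simp add: path_def)
qed

lemma state_process_path: "state_process (\<lambda>t \<omega>. path t (z \<omega>) (e \<omega>)) 0 = z"
proof
  fix \<omega>
  have "state_process (\<lambda>t \<omega>. path t (z \<omega>) (e \<omega>)) 0 \<omega> = (stack (block (rsol F (z \<omega>) (e \<omega>) 0)) :: real^('p \<times> 'n))"
    unfolding state_process_def by (rule stack_cong) (use block_rsol[of _ "z \<omega>" "e \<omega>" 0] in simp)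
  then show "state_process (\<lambda>t \<omega>. path t (z \<omega>) (e \<omega>)) 0 \<omega> = z \<omega>" by (simp add: stack_block)
qed

text \<open>On the product space the noise reads the first coordinate and the initial values read
  the second, which makes them independent.\<close>

lemma vstar_process_path:
  fixes \<epsilon> :: "nat \<Rightarrow> 'a \<Rightarrow> real^'n"
  assumes M: "prob_space M" and \<epsilon>: "\<And>t. t \<ge> 1 \<Longrightarrow> \<epsilon> t \<in> borel_measurable M"
    and \<pi>: "prob_space \<pi>" "sets \<pi> = sets borel"
  shows "vstar_process g \<mu> \<Phi> \<Psi> \<Omega> G s (M \<Otimes>\<^sub>M \<pi>) (\<lambda>t \<omega>. \<epsilon> t (fst \<omega>))
    (\<lambda>t \<omega>. path t (snd \<omega>) (\<lambda>i. \<epsilon> (Suc i) (fst \<omega>)))"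
proof -
  interpret MM: prob_space M by fact
  interpret \<pi>: prob_space \<pi> by fact
  interpret N: pair_prob_space M \<pi> ..
  let ?N = "M \<Otimes>\<^sub>M \<pi>" and ?y = "\<lambda>t \<omega>. path t (snd \<omega>) (\<lambda>i. \<epsilon> (Suc i) (fst \<omega>))" and ?I = "{1 - int CARD('p)..0}"
  have y: "?y t = (\<lambda>\<omega>. block (snd \<omega>) (nat (1 - t)))" if "t \<in> ?I" for t
    using that by (auto simp: path_def fun_eq_iff)
  have s: "(\<lambda>\<omega>. block (snd \<omega>) j) \<in> borel_measurable ?N" for j
    by (rule measurable_compose[OF _ measurable_block])
      (simp add: measurable_cong_sets[OF refl \<pi>(2)[symmetric]])
  show ?thesis
    unfolding vstar_process_def
  proof (intro conjI ballI allI impI)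
    show "?y t \<in> borel_measurable ?N" if "t \<in> ?I" for t unfolding y[OF that] by (rule s)
    have 1: "sets (gen_sigma ?N borel ?y ?I) \<subseteq> sets (vimage_algebra (space ?N) snd \<pi>)"
    proof (rule gen_sigma_sets_subset)
      show "sigma_algebra (space ?N) (sets (vimage_algebra (space ?N) snd \<pi>))"
        using sets.sigma_algebra_axioms[of "vimage_algebra (space ?N) snd \<pi>"] by simp
      fix t and A :: "(real^'n) set" assume t: "t \<in> ?I" and A: "A \<in> sets borel"
      have "(\<lambda>z. block z (nat (1 - t))) -` A \<inter> space borel \<in> sets (borel :: (real^('p \<times> 'n)) measure)"
        by (rule measurable_sets[OF measurable_block A])
      then have "(\<lambda>z. block z (nat (1 - t))) -` A \<in> sets \<pi>" by (simp add: \<pi>(2))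
      from in_vimage_algebra[OF this, of snd "space ?N"]
      show "{\<omega> \<in> space ?N. ?y t \<omega> \<in> A} \<in> sets (vimage_algebra (space ?N) snd \<pi>)"
        using fun_cong[OF y[OF t]] by (simp add: vimage_def Int_def conj_commute)
    qed
    have 2: "sets (gen_sigma ?N borel (\<lambda>t \<omega>. \<epsilon> t (fst \<omega>)) {1..}) \<subseteq> sets (vimage_algebra (space ?N) fst M)"
    proof (rule gen_sigma_sets_subset)
      show "sigma_algebra (space ?N) (sets (vimage_algebra (space ?N) fst M))"
        using sets.sigma_algebra_axioms[of "vimage_algebra (space ?N) fst M"] by simp
      fix t :: nat and A :: "(real^'n) set" assume t: "t \<in> {1..}" and A: "A \<in> sets borel"
      have "\<epsilon> t -` A \<inter> space M \<in> sets M" using \<epsilon> t A by (intro measurable_sets) auto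
      moreover have "fst -` (\<epsilon> t -` A \<inter> space M) \<inter> space ?N = {\<omega> \<in> space ?N. \<epsilon> t (fst \<omega>) \<in> A}"
        by (rule set_eqI, simp only: space_pair_measure mem_Times_iff Int_iff vimage_eq mem_Collect_eq) blast
      ultimately show "{\<omega> \<in> space ?N. \<epsilon> t (fst \<omega>) \<in> A} \<in> sets (vimage_algebra (space ?N) fst M)"
        using in_vimage_algebra[of "\<epsilon> t -` A \<inter> space M" M fst "space ?N"] by (simp only:)
    qed
    show "N.indep_set (sets (gen_sigma ?N borel ?y ?I)) (sets (gen_sigma ?N borel (\<lambda>t \<omega>. \<epsilon> t (fst \<omega>)) {1..}))"
      unfolding N.indep_set_def
      by (rule N.indep_sets_mono_sets[OF indep_set_coordinates[OF M \<pi>(1), unfolded N.indep_set_def]])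
        (use 1 2 in \<open>auto split: bool.split\<close>)
    fix t :: nat and \<omega> assume "1 \<le> t"
    then show "?y (int t) \<omega> = vstar g \<mu> \<Phi> \<Psi> \<Omega> G s (\<lambda>j. ?y (int t - int j) \<omega>) (\<epsilon> t (fst \<omega>))"
      using path_recursion[of t "snd \<omega>" "\<lambda>i. \<epsilon> (Suc i) (fst \<omega>)"] by simp
  qed
qed

lemma ergodic_and_stationary_version:
  fixes M :: "'a measure"
  assumes M: "prob_space M" and iv: "prob_space.indep_vars M (\<lambda>_. borel) \<epsilon> {1..}"
    and D: "\<And>t. t \<ge> 1 \<Longrightarrow> distr M borel (\<epsilon> t) = D"
  shows "geometrically_ergodic borel kernel (\<lambda>x. 1 + (norm x)\<^sup>2) \<and>
    (\<exists>(N :: ('a \<times> (real^('p \<times> 'n))) measure) y'.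
            prob_space N \<and> fst \<in> N \<rightarrow>\<^sub>M M \<and> distr N M fst = M \<and>
            vstar_process g \<mu> \<Phi> \<Psi> \<Omega> G s N (\<lambda>t \<omega>. \<epsilon> t (fst \<omega>)) y' \<and>
            strictly_stationary N borel (1 - int CARD('p)) y' \<and>
            second_order_stationary N (1 - int CARD('p)) y' \<and>
            geometric_beta_mixing N borel (1 - int CARD('p)) y')"
proof -
  obtain V lam b c where V: "V \<in> borel_measurable borel" "0 < lam" "lam < 1" "0 \<le> b"
    "\<And>x. (norm x)\<^sup>2 \<le> V x" "\<And>x. V x \<le> c * (norm x)\<^sup>2"
    "\<And>x. (\<integral>\<^sup>+y. ennreal (V y) \<partial>kernel x) \<le> ennreal (lam * V x + b)" using lyapunov by blast
  interpret H: harris_chain borel kernel V lam b "CARD('p)" by (rule harris_chain[OF V(1-5,7)])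
  obtain \<pi> C \<rho> where inv: "invariant_prob borel kernel \<pi>" and C: "0 \<le> C" and \<rho>: "0 < \<rho>" "\<rho> < 1"
    and conv: "\<And>\<phi> x t. H.Vbdd \<phi> 1 \<Longrightarrow> x \<in> space borel \<Longrightarrow> integrable \<pi> \<phi> \<and>
      \<bar>(\<integral>z. \<phi> z \<partial>kernel_pow borel kernel t x) - (\<integral>z. \<phi> z \<partial>\<pi>)\<bar> \<le> C * \<rho> ^ t * (1 + V x)"
    by (rule H.geometric_convergence) (rule that, assumption+)
  have norm2: "(\<lambda>x::real^('p \<times> 'n). (norm x)\<^sup>2) \<in> borel_measurable borel" by measurable
  have "geometrically_ergodic borel kernel (\<lambda>x. 1 + (norm x)\<^sup>2)"
    by (rule H.geometrically_ergodic_chain[OF inv C \<rho> conv, of _ 1]) (use V(5) norm2 in auto)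
  moreover
  have \<pi>: "prob_space \<pi>" "sets \<pi> = sets borel" using inv by (auto simp: invariant_prob_def)
  \<comment> \<open>The given space need not carry an initial state with law \<pi> independent of
    the noise, so a second coordinate with that law is adjoined.\<close>
  let ?N = "M \<Otimes>\<^sub>M \<pi>" and ?\<eta> = "\<lambda>\<omega> i. \<epsilon> (Suc i) (fst \<omega>)" and ?a = "1 - int CARD('p)"
  define y where "y t \<omega> = path t (snd \<omega>) (?\<eta> \<omega>)" for t and \<omega> :: "'a \<times> (real^('p \<times> 'n))"
  interpret MM: prob_space M by fact
  interpret \<pi>: prob_space \<pi> by fact
  interpret N: pair_prob_space M \<pi> ..
  have \<epsilon>: "\<epsilon> t \<in> borel_measurable M" if "t \<ge> 1" for t using iv that by (auto simp: MM.indep_vars_def)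
  have fst: "distr ?N M fst = M" by (rule \<pi>.distr_pair_fst)
  have iv': "N.indep_vars (\<lambda>_. borel) (\<lambda>t \<omega>. \<epsilon> t (fst \<omega>)) {1..}"
    by (rule MM.indep_vars_distr[OF measurable_fst N.prob_space_axioms fst iv]) simp
  have D': "distr ?N borel (\<lambda>\<omega>. \<epsilon> t (fst \<omega>)) = D" if t: "t \<ge> 1" for t
    using distr_distr[OF \<epsilon>[OF t], of fst ?N] D[OF t] unfolding fst by (simp add: comp_def)
  have vp: "vstar_process g \<mu> \<Phi> \<Psi> \<Omega> G s ?N (\<lambda>t \<omega>. \<epsilon> t (fst \<omega>)) y"
    unfolding y_def[abs_def] by (rule vstar_process_path[OF M \<epsilon> \<pi>])
  have sp: "state_process y 0 = snd" unfolding y_def[abs_def] by (rule state_process_path)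
  have "distr ?N borel snd = distr ?N \<pi> snd" by (rule distr_cong) (simp_all add: \<pi>(2))
  then have sndpi: "distr ?N borel snd = \<pi>" by (simp add: distr_pair_snd[OF M \<pi>(1)])
  interpret R: recursive_process D F ?N \<pi> snd ?\<eta>
    using recursive_process_vstar[OF N.prob_space_axioms iv' D' vp] unfolding sp sndpi .
  interpret O: stationary_output D F ?N \<pi> snd ?\<eta> borel ?a path y
  proof unfold_locales
    show "invariant_prob borel kernel \<pi>" by (rule inv)
    show "?a \<le> 0" by (simp add: Suc_le_eq)
    show "(\<lambda>x. path t (fst x) (snd x)) \<in> borel \<Otimes>\<^sub>M S \<rightarrow>\<^sub>M borel" for t by (rule measurable_path)
    show "path t z (comb_seq m e e') = path t z e" if "t \<le> int m" for t m z e e'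
      using that by (simp add: path_def rsol_comb_seq_le)
    show "y (t + int m) \<omega> = path t (R.Z m \<omega>) (\<lambda>i. ?\<eta> \<omega> (m + i))" if "?a \<le> t" for t m \<omega>
      unfolding y_def R.Z_def by (rule path_add[OF that])
  qed
  have x0: "(0 :: real^('p \<times> 'n)) \<in> space borel" by simp
  have "H.Vbdd (\<lambda>x. (norm x)\<^sup>2) 1"
    unfolding H.Vbdd_def using norm2 V(5) by (auto simp: add_increasing)
  then have sq: "integrable \<pi> (\<lambda>x. (norm x)\<^sup>2)" using conv x0 by blast
  have "integrable ?N (\<lambda>\<omega>. (norm (y t \<omega>))\<^sup>2)" if t: "?a \<le> t" for t
  proof -
    \<comment> \<open>Each output is a block of some state, and every state has law \<pi>; second
      moments of \<pi> therefore suffice.\<close>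
    obtain m j where y: "\<And>\<omega>. y t \<omega> = block (R.Z m \<omega>) j"
    proof (cases "0 \<le> t")
      case True
      then show ?thesis using that[of "nat t" 1] by (simp add: y_def path_def R.Z_def)
    next
      case False
      then show ?thesis using that[of 0 "nat (1 - t)"] by (simp add: y_def path_def R.Z_def)
    qed
    obtain L where L: "\<And>x::real^('p \<times> 'n). norm (block x j) \<le> L * norm x"
      using linear_bounded[OF linear_block[of j]] by blast
    have "integrable \<pi> (\<lambda>x. (norm (block x j))\<^sup>2)"
    proof (rule Bochner_Integration.integrable_bound)
      show "integrable \<pi> (\<lambda>x. L\<^sup>2 * (norm x)\<^sup>2)" using sq by simp
      have "(\<lambda>x. (norm (block x j))\<^sup>2) \<in> borel_measurable (borel :: (real^('p \<times> 'n)) measure)" by measurable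
      then show "(\<lambda>x. (norm (block x j))\<^sup>2) \<in> borel_measurable \<pi>" by (simp add: measurable_cong_sets[OF \<pi>(2) refl])
      show "AE x in \<pi>. norm ((norm (block x j))\<^sup>2) \<le> norm (L\<^sup>2 * (norm x)\<^sup>2)"
        using power_mono[OF L norm_ge_zero, of _ 2] by (intro AE_I2) (simp add: power_mult_distrib)
    qed
    then have "integrable (distr ?N borel (R.Z m)) (\<lambda>x. (norm (block x j))\<^sup>2)" by (simp add: O.distr_Z)
    from integrable_distr[OF R.measurable_Z this] show ?thesis by (simp add: y)
  qed
  note second = strictly_stationary_imp_second_order[OF O.strictly_stationary this]
  have "integrable \<pi> V" using conv[OF H.Vbdd_V x0] by blast
  then have mix: "geometric_beta_mixing ?N borel ?a y"
  proof (rule O.geometric_beta_mixing[OF _ _ C \<rho>])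
    show V0: "0 \<le> V x" for x using V(5)[of x] zero_le_power2[of "norm x"] by linarith
    fix h :: "real^('p \<times> 'n) \<Rightarrow> real" and x n assume h: "h \<in> borel_measurable borel" "\<And>y. \<bar>h y\<bar> \<le> 1"
    have "\<bar>h y\<bar> \<le> 1 * (1 + V y)" for y using h(2)[of y] V0[of y] by simp
    then have "H.Vbdd h 1" unfolding H.Vbdd_def using h(1) by blast
    from conv[OF this, of x n]
    show "\<bar>(\<integral>y. h y \<partial>kernel_pow borel kernel n x) - (\<integral>y. h y \<partial>\<pi>)\<bar> \<le> C * \<rho> ^ n * (1 + V x)" by simp
  qed
  have "\<exists>(N :: ('a \<times> (real^('p \<times> 'n))) measure) y'.
            prob_space N \<and> fst \<in> N \<rightarrow>\<^sub>M M \<and> distr N M fst = M \<and>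
            vstar_process g \<mu> \<Phi> \<Psi> \<Omega> G s N (\<lambda>t \<omega>. \<epsilon> t (fst \<omega>)) y' \<and>
            strictly_stationary N borel ?a y' \<and> second_order_stationary N ?a y' \<and> geometric_beta_mixing N borel ?a y'"
    using N.prob_space_axioms measurable_fst fst vp O.strictly_stationary second mix by blast
  ultimately show ?thesis by blast
qed

end

theorem theorem1:
  fixes g :: nat
    and \<mu> :: "nat \<Rightarrow> real^'n"
    and \<Phi> :: "nat \<Rightarrow> real^'n^'n"
    and \<Psi> :: "nat \<Rightarrow> nat \<Rightarrow> real^'n^'n"
    and \<Omega> :: "nat \<Rightarrow> real^'n^'n"
    and G :: "nat \<Rightarrow> 'gam \<Rightarrow> 'c \<Rightarrow> real \<Rightarrow> real"
    and \<gamma> :: 'gam and c :: 'c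
    and s :: "real^('p::{finite,linorder} \<times> 'n) \<Rightarrow> real"
    and M :: "'a measure"
    and \<epsilon> :: "nat \<Rightarrow> 'a \<Rightarrow> real^'n"
    and d :: "real^'n \<Rightarrow> real"
    and y :: "int \<Rightarrow> 'a \<Rightarrow> real^'n"
  assumes "g \<ge> 1"
    and "\<forall>i\<in>{0..g}. pos_def (\<Omega> i)"
    and "\<forall>i\<in>{1..g}. continuous_on UNIV (G i \<gamma> c) \<and> (\<forall>u. 0 \<le> G i \<gamma> c u \<and> G i \<gamma> c u \<le> 1)"
    and "\<forall>u. (\<Sum>i=1..g. G i \<gamma> c u) \<le> 1"
    and "s \<in> borel_measurable borel"
    and "prob_space M"
    and "prob_space.indep_vars M (\<lambda>_. borel) \<epsilon> {1..}"
    and "\<forall>t\<ge>1. distr M borel (\<epsilon> t) = distr M borel (\<epsilon> 1)"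
    and "\<forall>t\<ge>1. integrable M (\<lambda>\<omega>. (norm (\<epsilon> t \<omega>))\<^sup>2)"
    and "\<forall>t\<ge>1. (\<integral>\<omega>. \<epsilon> t \<omega> \<partial>M) = 0"
    and "\<forall>t\<ge>1. cross_cov M (\<epsilon> t) (\<epsilon> t) = mat 1"
    and "distributed M lborel (\<epsilon> 1) (\<lambda>x. ennreal (d x))"
    and "\<forall>K. compact K \<longrightarrow> (\<exists>b>0. \<forall>x\<in>K. b \<le> d x)"
    and "vstar_process g \<mu> \<Phi> \<Psi> \<Omega> (\<lambda>i. G i \<gamma> c) s M \<epsilon> y"
    and "joint_spectral_radius
           ((\<lambda>i. companion (\<lambda>j. \<Phi> j + \<Psi> i j)) ` {1..g} \<union> {companion \<Phi>}
             :: (real^('p \<times> 'n)^('p \<times> 'n)) set) < 1"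
  shows "markov_chain M borel
           (vstar_kernel g \<mu> \<Phi> \<Psi> \<Omega> (\<lambda>i. G i \<gamma> c) s (distr M borel (\<epsilon> 1))) (state_process y)
       \<and> geometrically_ergodic borel
           (vstar_kernel g \<mu> \<Phi> \<Psi> \<Omega> (\<lambda>i. G i \<gamma> c) s (distr M borel (\<epsilon> 1))) (\<lambda>x. 1 + (norm x)\<^sup>2)
       \<and> (\<exists>(N :: ('a \<times> (real^('p \<times> 'n))) measure) y'.
            prob_space N \<and> fst \<in> N \<rightarrow>\<^sub>M M \<and> distr N M fst = M \<and>
            vstar_process g \<mu> \<Phi> \<Psi> \<Omega> (\<lambda>i. G i \<gamma> c) s N (\<lambda>t \<omega>. \<epsilon> t (fst \<omega>)) y' \<and>
            strictly_stationary N borel (1 - int CARD('p)) y' \<and>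
            second_order_stationary N (1 - int CARD('p)) y' \<and>
            geometric_beta_mixing N borel (1 - int CARD('p)) y')"
proof -
  let ?D = "distr M borel (\<epsilon> 1)"
  interpret MM: prob_space M by fact
  have \<epsilon>1: "\<epsilon> 1 \<in> borel_measurable M" using assms(7) by (auto simp: MM.indep_vars_def)
  interpret vstar_model g \<mu> \<Phi> \<Psi> \<Omega> "\<lambda>i. G i \<gamma> c" s ?D d
  proof (rule vstar_model.intro)
    show "pos_def (\<Omega> i)" if "i \<in> {0..g}" for i using assms(2) that by blast
    show "continuous_on UNIV (G i \<gamma> c)" "0 \<le> G i \<gamma> c u" if "i \<in> {1..g}" for i u using assms(3) that by auto
    show "(\<Sum>i=1..g. G i \<gamma> c u) \<le> 1" for u using assms(4) by blast
    show "s \<in> borel_measurable borel" by fact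
    show "prob_space ?D" by (rule MM.prob_space_distr[OF \<epsilon>1])
    show "integrable ?D (\<lambda>e. (norm e)\<^sup>2)"
      using assms(9) \<epsilon>1 by (subst integrable_distr_eq) auto
    have "?D = distr M lborel (\<epsilon> 1)" by (rule distr_cong) auto
    also have "\<dots> = density lborel (\<lambda>x. ennreal (d x))" using assms(12) by (rule distributed_distr_eq_density)
    finally show "?D = density lborel (\<lambda>x. ennreal (d x))" .
    show "(\<lambda>x. ennreal (d x)) \<in> borel_measurable borel"
      using distributed_borel_measurable[OF assms(12)] by simp
    show "\<exists>b>0. \<forall>x\<in>K. b \<le> d x" if "compact K" for K using assms(13) that by blast
    show "joint_spectral_radius
           ((\<lambda>i. companion (\<lambda>j. \<Phi> j + \<Psi> i j)) ` {1..g} \<union> {companion \<Phi>}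
             :: (real^('p \<times> 'n)^('p \<times> 'n)) set) < 1" by fact
  qed simp
  have D: "distr M borel (\<epsilon> t) = ?D" if "t \<ge> 1" for t using assms(8) that by blast
  interpret R: recursive_process ?D F M "distr M borel (state_process y 0)" "state_process y 0" "\<lambda>\<omega> i. \<epsilon> (Suc i) \<omega>"
    by (rule recursive_process_vstar[OF assms(6,7) D assms(14)])
  \<comment> \<open>The model equation is available on the space of \<open>M\<close> only, so the
    two processes are identified there and \<open>markov_chain_cong\<close> transfers the Markov
    property.\<close>
  have "R.Z t \<omega> = state_process y t \<omega>" if "\<omega> \<in> space M" for t \<omega>
    unfolding R.Z_def using assms(14) that
    by (intro state_process_rsol[symmetric]) (simp add: vstar_process_def)
  from markov_chain_cong[OF this R.markov_chain_Z] have "markov_chain M borel kernel (state_process y)" .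
  then show ?thesis
    unfolding vstar_kernel_eq using ergodic_and_stationary_version[OF assms(6,7) D] by blast
qed

end
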